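(* Let $h_N$ be the function, holomorphic near $t=0$, defined in the context. For $N=2,3,4$ (when $\Gamma_0(N)$ has exactly three fixed points on $X_0(N)$), near $t=0$: $h_2(t)={}_2F_1(\tfrac14,\tfrac14;1;-t/64)$, $\;h_3(t)={}_2F_1(\tfrac13,\tfrac13;1;-t/27)$, $\;h_4(t)={}_2F_1(\tfrac12,\tfrac12;1;-t/16)$. For $N=5,6,7,8,9$ (when it has exactly four), near $t=0$, in terms of the local Heun function $\mathit{Hl}$: $h_5(t)=\mathit{Hl}\Bigl(\frac{-11\mp2i}{-11\pm2i},-\frac1{50}(-11\mp2i);\frac12,\frac12,1,\frac12;\frac{t}{-11\pm2i}\Bigr)$; $h_6(t)=\mathit{Hl}\bigl(\frac98,\frac34;1,1,1,1;-\frac t8\bigr)=\mathit{Hl}\bigl(\frac89,\frac23;1,1,1,1;-\frac t9\bigr)$; $h_7(t)=\mathit{Hl}\Bigl(\frac{-13\mp3\sqrt{-3}}{-13\pm3\sqrt{-3}},-\frac1{21}\bigl(\frac{-13\mp3\sqrt{-3}}2\bigr);\frac23,\frac23,1,\frac23;t\Big/\bigl[\frac{-13\pm3\sqrt{-3}}2\bigr]\Bigr)$; $h_8(t)=\mathit{Hl}\bigl(2,1;1,1,1,1;-\frac t4\bigr)=\mathit{Hl}\bigl(\frac12,\frac12;1,1,1,1;-\frac t8\bigr)$; $h_9(t)=\mathit{Hl}\Bigl(\frac{-9\mp3\sqrt{-3}}{-9\pm3\sqrt{-3}},-\frac19\bigl(\frac{-9\mp3\sqrt{-3}}2\bigr);1,1,1,1;t\Big/\bigl[\frac{-9\pm3\sqrt{-3}}2\bigr]\Bigr)$,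 where in each formula either the upper signs or the lower signs are taken throughout (both choices are valid).
   Context: $\mathit{Hl}(a,q;\alpha,\beta,\gamma,\delta;s)$ denotes the local Heun function: the unique solution, holomorphic at $s=0$ and equal to $1$ there, of $u''+\bigl[\frac\gamma s+\frac\delta{s-1}+\frac\epsilon{s-a}\bigr]u'+\frac{\alpha\beta s-q}{s(s-1)(s-a)}u=0$, with $\epsilon=\alpha+\beta-\gamma-\delta+1$. $j=q^{-1}+744+\cdots$ (here $q=e^{2\pi i\tau}$) is the elliptic modular invariant, $[m]=\eta(m\tau)$ with $\eta$ the Dedekind eta function. The Hauptmodul $t_N$ of the genus-zero curve $X_0(N)$ is: $t_2=2^{12}[2]^{24}/[1]^{24}$, $t_3=3^6[3]^{12}/[1]^{12}$, $t_4=2^8[4]^8/[1]^8$, $t_5=5^3[5]^6/[1]^6$, $t_6=2^33^2[2][6]^5/([1]^5[3])$, $t_7=7^2[7]^4/[1]^4$, $t_8=2^5[2]^2[8]^4/([1]^4[4]^2)$, $t_9=3^3[9]^3/[1]^3$. Write $j=P_N(t_N)/Q_N(t_N)$ with coprime polynomials $P_N,Q_N$ (so $Q_N(0)=0$). Then $h_N(t)=[P_N(t)/P_N(0)]^{-1/12}\,{}_2F_1\bigl(\tfrac1{12},\tfrac5{12};1;12^3Q_N(t)/P_N(t)\bigr)$ near $t=0$ (power equal to $1$ at $t=0$). *)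

theory Defs
  imports "HOL-Analysis.Analysis" "HOL-Computational_Algebra.Computational_Algebra"
begin

definition hypergeom_2F1 :: "complex \<Rightarrow> complex \<Rightarrow> complex \<Rightarrow> complex \<Rightarrow> complex" where
  "hypergeom_2F1 a b c z = eval_fps (fps_hypergeo [a, b] [c] 1) z"

definition solves_heun_near_0 ::
  "complex \<Rightarrow> complex \<Rightarrow> complex \<Rightarrow> complex \<Rightarrow> complex \<Rightarrow> complex \<Rightarrow> (complex \<Rightarrow> complex) \<Rightarrow> bool" where
  "solves_heun_near_0 a q \<alpha> \<beta> \<gamma> \<delta> u \<longleftrightarrow>
     (let \<epsilon> = \<alpha> + \<beta> - \<gamma> - \<delta> + 1 in
      \<forall>\<^sub>F s in at 0.
        deriv (deriv u) s + (\<gamma> / s + \<delta> / (s - 1) + \<epsilon> / (s - a)) * deriv u s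
          + (\<alpha> * \<beta> * s - q) / (s * (s - 1) * (s - a)) * u s = 0)"

text \<open>
  The local Heun function is the unique solution that is holomorphic at 0 and equal to 1 there.
  Functions holomorphic at 0 are represented by power series of positive radius of convergence,
  so that the germ is uniquely determined (for \<open>a \<noteq> 0, 1\<close> and \<open>\<gamma>\<close> not a nonpositive integer).
  The value is meaningful inside the disk of convergence only.
\<close>

definition local_heun ::
  "complex \<Rightarrow> complex \<Rightarrow> complex \<Rightarrow> complex \<Rightarrow> complex \<Rightarrow> complex \<Rightarrow> complex \<Rightarrow> complex" where
  "local_heun a q \<alpha> \<beta> \<gamma> \<delta> s =
     eval_fps (THE F. fps_conv_radius F > 0 \<and> eval_fps F 0 = 1 \<and>
                      solves_heun_near_0 a q \<alpha> \<beta> \<gamma> \<delta> (eval_fps F)) s"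

text \<open>The modular functions below are meant for \<open>Im \<tau> > 0\<close>.\<close>

definition dedekind_eta :: "complex \<Rightarrow> complex" where
  "dedekind_eta \<tau> =
     exp (2 * of_real pi * \<i> * \<tau> / 24) * (\<Prod>n. 1 - exp (2 * of_real pi * \<i> * \<tau>) ^ Suc n)"

definition eisenstein_G :: "nat \<Rightarrow> complex \<Rightarrow> complex" where
  "eisenstein_G k \<tau> =
     infsum (\<lambda>(m :: int, n :: int). 1 / (of_int m + of_int n * \<tau>) ^ k) (UNIV - {(0, 0)})"

text \<open>
  With \<open>g\<^sub>2 = 60 G\<^sub>4\<close> and \<open>g\<^sub>3 = 140 G\<^sub>6\<close>, the invariant \<open>1728 g\<^sub>2\<^sup>3 / (g\<^sub>2\<^sup>3 - 27 g\<^sub>3\<^sup>2)\<close> has the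
  normalisation \<open>q\<^sup>-\<^sup>1 + 744 + \<dots>\<close> with \<open>q = exp (2 \<pi> \<i> \<tau>)\<close>.
\<close>

definition modular_j :: "complex \<Rightarrow> complex" where
  "modular_j \<tau> =
     (let g2 = 60 * eisenstein_G 4 \<tau>; g3 = 140 * eisenstein_G 6 \<tau>
      in 1728 * g2 ^ 3 / (g2 ^ 3 - 27 * g3 ^ 2))"

definition hauptmodul :: "nat \<Rightarrow> complex \<Rightarrow> complex" where
  "hauptmodul N \<tau> =
     (let e = (\<lambda>m :: nat. dedekind_eta (of_nat m * \<tau>)) in
      if N = 2 then 2 ^ 12 * e 2 ^ 24 / e 1 ^ 24
      else if N = 3 then 3 ^ 6 * e 3 ^ 12 / e 1 ^ 12
      else if N = 4 then 2 ^ 8 * e 4 ^ 8 / e 1 ^ 8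
      else if N = 5 then 5 ^ 3 * e 5 ^ 6 / e 1 ^ 6
      else if N = 6 then 2 ^ 3 * 3 ^ 2 * e 2 * e 6 ^ 5 / (e 1 ^ 5 * e 3)
      else if N = 7 then 7 ^ 2 * e 7 ^ 4 / e 1 ^ 4
      else if N = 8 then 2 ^ 5 * e 2 ^ 2 * e 8 ^ 4 / (e 1 ^ 4 * e 4 ^ 2)
      else if N = 9 then 3 ^ 3 * e 9 ^ 3 / e 1 ^ 3
      else undefined)"

text \<open>
  The expression \<open>j = P(t\<^sub>N) / Q(t\<^sub>N)\<close> in lowest terms; it determines \<open>P\<close> and \<open>Q\<close> up to a common
  nonzero constant factor, which cancels in \<open>h_fun\<close> below.
\<close>

definition j_in_lowest_terms :: "nat \<Rightarrow> complex poly \<Rightarrow> complex poly \<Rightarrow> bool" where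
  "j_in_lowest_terms N P Q \<longleftrightarrow> coprime P Q \<and>
     (\<forall>\<tau>. Im \<tau> > 0 \<longrightarrow> poly Q (hauptmodul N \<tau>) \<noteq> 0 \<and>
        modular_j \<tau> = poly P (hauptmodul N \<tau>) / poly Q (hauptmodul N \<tau>))"

text \<open>
  The base of the power tends to 1 as \<open>t\<close> tends to 0, so the principal branch is, near 0,
  the holomorphic one with value 1 at 0.
\<close>

definition h_fun :: "complex poly \<Rightarrow> complex poly \<Rightarrow> complex \<Rightarrow> complex" where
  "h_fun P Q t = (poly P t / poly P 0) powr (- 1 / 12) *
     hypergeom_2F1 (1 / 12) (5 / 12) 1 (12 ^ 3 * poly Q t / poly P t)"

end

(*
  Expansions at the cusps, taken over coset representatives, together with Liouville's theorem at level 1 bound the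
  degrees of P and Q by the index psi(N) of Gamma_0(N).  Hence the identity E_4^3 Q(t) = Delta P(t) determines P / Q
  from its first 2 psi(N) + 1 coefficients in q, and these are compared with the explicit P_N and Q_N by computation.

  For these P = A^3 B and Q, writing P - 1728 Q = C^2 D, the Wronskian of P and Q factors through C.  Therefore the
  pullback of the hypergeometric equation along 1728 Q / P, twisted by P^(-1/12), has rational coefficients whose only
  finite singular points are the cusps and elliptic points of X_0(N); it is the stated Gauss or Heun equation.  The
  holomorphic solution with value 1 at t = 0 is unique.
*)
theory Submission
  imports Defs "HOL-Complex_Analysis.Complex_Analysis" "HOL-Real_Asymp.Real_Asymp"
begin

section \<open>The Lipschitz formula and lattice sums\<close>

text \<open>The obstacle is the degree bound. \<open>j_in_lowest_terms\<close> says only that j =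
  P(t)/Q(t) on the upper half plane, and eta quotients transform with 24th roots of unity.
  Everything is therefore done with u = t^24, a quotient of values of Delta, for which the law of
  Delta under SL2(Z) suffices; that law rests on the weight 2 Eisenstein series. The conjugates of u
  are the roots of a polynomial whose coefficients are polynomials in j. The price of the 24th power
  is that a fibre of P/Q must be found on which x^24 is injective; the simple zero of Q at 0 makes a
  generic fibre of this kind. Points of the fibre are not known to be values of t. They are reached
  algebraically: the relation between t^24 and j holds at infinitely many values of t, hence
  identically. The number 2 psi(N) + 1 arises because P Q_N - Q P_N has degree at most 2 psi(N),
  while t and Delta have simple zeros at q = 0.\<close>

lemma has_sum_int_split:
  fixes f :: "int \<Rightarrow> 'a :: {topological_comm_monoid_add, t2_space}"
  assumes "((\<lambda>n. f (int n)) has_sum a) UNIV" "((\<lambda>n. f (- 1 - int n)) has_sum b) UNIV"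
  shows "(f has_sum (a + b)) UNIV"
proof -
  have 1: "(f has_sum a) (range int)"
    using assms(1) by (subst has_sum_reindex) (auto simp: o_def inj_def)
  have 2: "(f has_sum b) (range (\<lambda>n. - 1 - int n))"
    using assms(2) by (subst has_sum_reindex) (auto simp: o_def inj_def)
  have disj: "range int \<inter> range (\<lambda>n. - 1 - int n) = {}" by auto
  have "m \<in> range int \<union> range (\<lambda>n. - 1 - int n)" for m
  proof (cases "m \<ge> 0")
    case True thus ?thesis by (metis UnI1 rangeI zero_le_imp_eq_int)
  next
    case False
    hence "m = -1 - int (nat (-1 - m))" by simp
    thus ?thesis by blast
  qed
  hence un: "range int \<union> range (\<lambda>n. - 1 - int n) = UNIV" by blast
  show ?thesis using has_sum_Un_disjoint[OF 1 2 disj] un by simp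
qed

lemma summable_on_int_split:
  fixes f :: "int \<Rightarrow> 'a :: {topological_comm_monoid_add, t2_space}"
  assumes "(\<lambda>n. f (int n)) summable_on UNIV" "(\<lambda>n. f (- 1 - int n)) summable_on UNIV"
  shows "f summable_on UNIV"
  using assms has_sum_int_split[of f] unfolding summable_on_def by blast

section \<open>Bilateral sums of 1/(m + z)^k and derivatives of the cotangent\<close>

lemma summable_norm_inverse_shift_power:
  fixes z :: complex
  assumes "k \<ge> 2"
  shows "summable (\<lambda>n. norm (1 / (of_nat n + z) ^ k))"
proof (rule summable_comparison_test_ev)
  obtain N :: nat where N: "real N > 2 * norm z" using reals_Archimedean2 by blast
  show "eventually (\<lambda>n. norm (norm (1 / (of_nat n + z) ^ k)) \<le> 2 ^ k * inverse (real n ^ k)) sequentially"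
    using eventually_ge_at_top[of "N + 1"]
  proof eventually_elim
    case (elim n)
    have "real n / 2 \<le> real n - norm z" using elim N by simp
    also have "\<dots> \<le> norm (of_nat n + z)" using norm_diff_ineq[of "of_nat n" z] by simp
    finally have "(real n / 2) ^ k \<le> norm (of_nat n + z) ^ k" by (intro power_mono) auto
    moreover have "(real n / 2) ^ k > 0" using elim by simp
    ultimately have "inverse (norm (of_nat n + z) ^ k) \<le> inverse ((real n / 2) ^ k)"
      by (intro le_imp_inverse_le)
    thus ?case by (simp add: norm_divide norm_power inverse_eq_divide power_divide)
  qed
  show "summable (\<lambda>n. 2 ^ k * inverse (real n ^ k))"
    using inverse_power_summable[of k, where 'a=real] assms by (intro summable_mult) simp
qed

text \<open>The n-th derivative of pi cot(pi z), encoded by the reflection formula. For n >= 1 the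
  two terms are, up to the common factor (-1)^n n!, the halves m < 0 and m >= 0 of the bilateral sum
  of 1/(m + z)^(n + 1); for n = 0 they still make sense although that sum does not converge
  absolutely.\<close>

definition cot_deriv :: "nat \<Rightarrow> complex \<Rightarrow> complex" where
  "cot_deriv n z = (-1) ^ n * Polygamma n (1 - z) - Polygamma n z"

lemma Ints_nonpos_aux:
  assumes "(z :: complex) \<notin> \<int>"
  shows "z \<notin> \<int>\<^sub>\<le>\<^sub>0" "1 - z \<notin> \<int>\<^sub>\<le>\<^sub>0"
proof -
  show "z \<notin> \<int>\<^sub>\<le>\<^sub>0" using assms nonpos_Ints_Int by blast
  show "1 - z \<notin> \<int>\<^sub>\<le>\<^sub>0"
  proof
    assume "1 - z \<in> \<int>\<^sub>\<le>\<^sub>0"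
    hence "1 - z \<in> \<int>" using nonpos_Ints_Int by blast
    hence "1 - (1 - z) \<in> \<int>" by (rule Ints_diff[OF Ints_1])
    thus False using assms by simp
  qed
qed

lemma has_sum_inverse_power_nat:
  fixes z :: complex
  assumes "k \<ge> 2"
  shows "((\<lambda>n. 1 / (of_nat n + z) ^ k) has_sum ((-1) ^ k / fact (k - 1) * Polygamma (k - 1) z)) UNIV"
proof -
  have "(\<lambda>n. 1 / (of_nat n + z) ^ k) summable_on UNIV"
    by (intro norm_summable_imp_summable_on summable_norm_inverse_shift_power assms)
  moreover have "(\<Sum>n. 1 / (of_nat n + z) ^ k) = (-1) ^ k / fact (k - 1) * Polygamma (k - 1) z"
    using assms by (simp add: Polygamma_def inverse_eq_divide add.commute)
  ultimately show ?thesis using has_sum_infsum has_sum_imp_sums sums_unique by metis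
qed

text \<open>The halves m >= 0 and m = -1 - n are Polygamma series at z and at 1 - z. The formula
  holds at integers as well: for positive order Polygamma is by definition its series, and 1 / 0 =
  0.\<close>

lemma has_sum_inverse_power_int:
  fixes z :: complex
  assumes "k \<ge> 2"
  shows "((\<lambda>m. 1 / (of_int m + z) ^ k) has_sum ((-1) ^ (k - 1) / fact (k - 1) * cot_deriv (k - 1) z)) UNIV"
proof -
  have 1: "((\<lambda>n. 1 / (of_int (int n) + z) ^ k) has_sum ((-1) ^ k / fact (k - 1) * Polygamma (k - 1) z)) UNIV"
    using has_sum_inverse_power_nat[OF assms, of z] by simp
  have "((\<lambda>n. (-1) ^ k * (1 / (of_nat n + (1 - z)) ^ k)) has_sum
     ((-1) ^ k * ((-1) ^ k / fact (k - 1) * Polygamma (k - 1) (1 - z)))) UNIV"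
    by (intro has_sum_cmult_right has_sum_inverse_power_nat assms)
  also have "(\<lambda>n. (-1) ^ k * (1 / (of_nat n + (1 - z)) ^ k)) = (\<lambda>n. 1 / (of_int (- 1 - int n) + z) ^ k)"
  proof
    fix n :: nat
    have "of_int (- 1 - int n) + z = (-1) * (of_nat n + (1 - z))" by simp
    hence "(of_int (- 1 - int n) + z) ^ k = (-1) ^ k * (of_nat n + (1 - z)) ^ k"
      by (simp only: power_mult_distrib)
    thus "(-1) ^ k * (1 / (of_nat n + (1 - z)) ^ k) = 1 / (of_int (- 1 - int n) + z) ^ k"
      by (cases "even k") auto
  qed
  finally have 2: "((\<lambda>n. 1 / (of_int (- 1 - int n) + z) ^ k) has_sum
     ((-1) ^ k * ((-1) ^ k / fact (k - 1) * Polygamma (k - 1) (1 - z)))) UNIV" .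
  obtain n where k: "k = Suc n" using assms by (cases k) auto
  have "((-1) ^ k / fact (k - 1) * Polygamma (k - 1) z) + ((-1) ^ k * ((-1) ^ k / fact (k - 1) * Polygamma (k - 1) (1 - z)))
     = ((-1) ^ (k - 1) / fact (k - 1) * cot_deriv (k - 1) z)"
    by (cases "even n") (simp_all add: k cot_deriv_def field_simps)
  with has_sum_int_split[OF 1 2] show ?thesis by simp
qed

lemma has_field_derivative_cot_deriv [derivative_intros]:
  assumes "z \<notin> \<int>"
  shows "(cot_deriv n has_field_derivative cot_deriv (Suc n) z) (at z)"
  unfolding cot_deriv_def
  by (rule derivative_eq_intros refl Ints_nonpos_aux assms)+ simp_all

text \<open>Both sides of Gamma z * Gamma (1 - z) = pi / sin(pi z) are differentiated and divided by
  the common value.\<close>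

lemma cot_deriv_0:
  assumes "z \<notin> \<int>"
  shows "cot_deriv 0 z = of_real pi * cot (of_real pi * z)"
proof -
  note nz = Ints_nonpos_aux[OF assms]
  have sn: "sin (of_real pi * z) \<noteq> 0"
  proof
    assume "sin (of_real pi * z) = 0"
    then obtain n where "of_real pi * z = of_real (of_int n * pi)"
      unfolding Complex_Transcendental.sin_eq_0 by blast
    hence "of_real pi * z = of_real pi * of_int n" by simp
    hence "z = of_int n" by (subst (asm) mult_cancel_left) auto
    thus False using assms by simp
  qed
  have "((\<lambda>z. Gamma z * Gamma (1 - z)) has_field_derivative
     Gamma z * Digamma z * Gamma (1 - z) - Gamma z * (Gamma (1 - z) * Digamma (1 - z))) (at z)"
    by (rule derivative_eq_intros refl nz)+ simp_all
  moreover have "((\<lambda>z. of_real pi / sin (of_real pi * z)) has_field_derivative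
     - (of_real pi * (of_real pi * cos (of_real pi * z))) / (sin (of_real pi * z)) ^ 2) (at z)"
    by (rule derivative_eq_intros refl sn)+ (use sn in \<open>simp_all add: field_simps power2_eq_square\<close>)
  ultimately have "Gamma z * Digamma z * Gamma (1 - z) - Gamma z * (Gamma (1 - z) * Digamma (1 - z)) =
    - (of_real pi * (of_real pi * cos (of_real pi * z))) / (sin (of_real pi * z)) ^ 2"
    using DERIV_unique by (metis (no_types, lifting) Gamma_reflection_complex ext)
  hence "(Gamma z * Gamma (1 - z)) * (Digamma z - Digamma (1 - z)) = 
     - (of_real pi * (of_real pi * cos (of_real pi * z))) / (sin (of_real pi * z)) ^ 2"
    by (simp add: algebra_simps)
  also have "\<dots> = (Gamma z * Gamma (1 - z)) * (- of_real pi * cos (of_real pi * z) / sin (of_real pi * z))"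
    unfolding Gamma_reflection_complex using sn by (simp add: power2_eq_square)
  finally have "Digamma z - Digamma (1 - z) = - of_real pi * cos (of_real pi * z) / sin (of_real pi * z)"
    unfolding Gamma_reflection_complex using sn by (subst (asm) mult_cancel_left) auto
  thus ?thesis by (simp add: cot_deriv_def cot_def algebra_simps)
qed

text \<open>The polylogarithm of order -j. The constant term is set to 0 by hand because 0 ^ 0 = 1
  would give a wrong value for j = 0.\<close>

definition powsum_fps :: "nat \<Rightarrow> complex fps" where
  "powsum_fps j = Abs_fps (\<lambda>n. if n = 0 then 0 else of_nat n ^ j)"

lemma powsum_fps_Suc: "powsum_fps (Suc j) = fps_X * fps_deriv (powsum_fps j)"
  by (rule fps_ext) (auto simp: powsum_fps_def)

lemma fps_conv_radius_powsum: "fps_conv_radius (powsum_fps j) \<ge> 1"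
proof (induction j)
  case 0
  have *: "powsum_fps 0 = fps_X * Abs_fps (\<lambda>_. 1)" by (rule fps_ext) (auto simp: powsum_fps_def)
  have "fps_conv_radius (Abs_fps (\<lambda>_. 1 :: complex)) \<ge> 1"
    unfolding fps_conv_radius_def by (intro conv_radius_geI_ex') (simp add: one_ereal_def summable_geometric)
  thus ?case unfolding * using fps_conv_radius_mult[of fps_X "Abs_fps (\<lambda>_. 1 :: complex)"] by (simp add: order.trans)
next
  case (Suc j)
  have "1 \<le> min (fps_conv_radius (fps_X :: complex fps)) (fps_conv_radius (fps_deriv (powsum_fps j)))"
    using Suc fps_conv_radius_deriv[of "powsum_fps j"] by (simp add: order.trans)
  also have "\<dots> \<le> fps_conv_radius (powsum_fps (Suc j))"
    unfolding powsum_fps_Suc by (rule fps_conv_radius_mult)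
  finally show ?case .
qed

lemma norm_less_conv_radius_1:
  assumes "1 \<le> fps_conv_radius F" "norm (z::complex) < 1"
  shows "ereal (norm z) < fps_conv_radius F"
  using assms less_le_trans[of "ereal (norm z)" 1 "fps_conv_radius F"] by (simp add: one_ereal_def)

section \<open>The nome q and the Lipschitz formula\<close>

definition qexp :: "complex \<Rightarrow> complex" where
  "qexp \<tau> = exp (2 * of_real pi * \<i> * \<tau>)"

lemma norm_qexp: "norm (qexp \<tau>) = exp (- 2 * pi * Im \<tau>)"
  by (simp add: qexp_def norm_exp_eq_Re)

lemma norm_qexp_less_1: "Im \<tau> > 0 \<Longrightarrow> norm (qexp \<tau>) < 1"
  by (simp add: norm_qexp)

lemma qexp_nonzero [simp]: "qexp \<tau> \<noteq> 0" by (simp add: qexp_def)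

lemma qexp_of_nat_mult: "qexp (of_nat n * \<tau>) = qexp \<tau> ^ n"
  by (simp add: qexp_def exp_of_nat_mult [symmetric] algebra_simps)

lemma qexp_plus_1 [simp]: "qexp (\<tau> + 1) = qexp \<tau>"
  by (simp add: qexp_def ring_distribs exp_add)

lemma has_field_derivative_qexp [derivative_intros]:
  assumes "(f has_field_derivative f') (at z within A)"
  shows "((\<lambda>z. qexp (f z)) has_field_derivative 2 * of_real pi * \<i> * qexp (f z) * f') (at z within A)"
  unfolding qexp_def by (rule derivative_eq_intros assms refl)+ simp

text \<open>In terms of q the operator d/dz is 2 pi i q d/dq, and q d/dq raises j by one
  (\<open>powsum_fps_Suc\<close>).\<close>

lemma powsum_qexp_deriv:
  assumes "Im z > 0"
  shows "((\<lambda>z. eval_fps (powsum_fps j) (qexp z)) has_field_derivative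
           2 * of_real pi * \<i> * eval_fps (powsum_fps (Suc j)) (qexp z)) (at z)"
proof -
  have r: "ereal (norm (qexp z)) < fps_conv_radius (powsum_fps j)"
    by (intro norm_less_conv_radius_1 fps_conv_radius_powsum norm_qexp_less_1 assms)
  have r': "ereal (norm (qexp z)) < fps_conv_radius (fps_deriv (powsum_fps j))"
    using r fps_conv_radius_deriv less_le_trans by blast
  have 1: "eval_fps (powsum_fps (Suc j)) (qexp z) = qexp z * eval_fps (fps_deriv (powsum_fps j)) (qexp z)"
    unfolding powsum_fps_Suc by (subst eval_fps_mult) (use r' in auto)
  have "((\<lambda>z. eval_fps (powsum_fps j) (qexp z)) has_field_derivative
     eval_fps (fps_deriv (powsum_fps j)) (qexp z) * (2 * of_real pi * \<i> * qexp z * 1)) (at z)"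
    by (rule DERIV_chain2[where f = "eval_fps (powsum_fps j)" and g = qexp, OF has_field_derivative_eval_fps[OF r]])
       (auto intro!: derivative_eq_intros)
  thus ?thesis unfolding 1 by (simp add: mult_ac)
qed

lemma not_Ints_if_Im: "Im z \<noteq> 0 \<Longrightarrow> z \<notin> \<int>"
  by (auto elim!: Ints_cases)

lemma cot_deriv_0_qexp:
  assumes "Im z > 0"
  shows "cot_deriv 0 z = - of_real pi * \<i> - 2 * of_real pi * \<i> * eval_fps (powsum_fps 0) (qexp z)"
proof -
  \<comment> \<open>A square root of q, in which sine and cosine are Laurent polynomials.\<close>
  define w where "w = exp (\<i> * (of_real pi * z))"
  have w0: "w \<noteq> 0" by (simp add: w_def)
  have q: "qexp z = w ^ 2" unfolding w_def qexp_def by (simp add: exp_double[symmetric] mult_ac)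
  have nq: "norm (qexp z) < 1" using assms norm_qexp_less_1 by blast
  hence q1: "1 - w ^ 2 \<noteq> 0" unfolding q by auto
  have "(\<lambda>n. qexp z * qexp z ^ n) sums (qexp z * (1 / (1 - qexp z)))"
    by (intro sums_mult geometric_sums nq)
  hence "(\<lambda>n. (if Suc n = 0 then 0 else of_nat (Suc n) ^ 0) * qexp z ^ Suc n) sums (qexp z * (1 / (1 - qexp z)))"
    by simp
  hence "(\<lambda>n. (if n = 0 then 0 else of_nat n ^ 0) * qexp z ^ n) sums (qexp z * (1 / (1 - qexp z)))"
    by (subst (asm) sums_Suc_iff) simp
  hence "eval_fps (powsum_fps 0) (qexp z) = qexp z * (1 / (1 - qexp z))"
    unfolding eval_fps_def powsum_fps_def by (simp add: sums_iff)
  hence e: "eval_fps (powsum_fps 0) (qexp z) = w\<^sup>2 / (1 - w\<^sup>2)" by (simp add: q)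
  have "exp (- (\<i> * (of_real pi * z))) = inverse w" unfolding w_def by (simp add: exp_minus)
  hence sc: "sin (of_real pi * z) = (w - inverse w) / (2 * \<i>)" "cos (of_real pi * z) = (w + inverse w) / 2"
    by (simp_all add: sin_exp_eq cos_exp_eq w_def)
  have "w * (w - inverse w) = w ^ 2 - 1" using w0 by (simp add: field_simps power2_eq_square)
  hence wn: "w - inverse w \<noteq> 0" using q1 by force
  have "cot_deriv 0 z = of_real pi * cot (of_real pi * z)"
    by (intro cot_deriv_0 not_Ints_if_Im) (use assms in auto)
  also have "cot (of_real pi * z) = \<i> * ((w + inverse w) / (w - inverse w))"
  proof -
    have "(a / 2) / (b / (2 * \<i>)) = \<i> * (a / b)" for a b :: complex
      by (cases "b = 0") (simp_all add: field_simps)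
    thus ?thesis unfolding cot_def sc by blast
  qed
  also have "(w + inverse w) / (w - inverse w) = (w\<^sup>2 + 1) / (w\<^sup>2 - 1)"
    using wn q1 w0 by (auto simp: divide_simps) (auto simp: algebra_simps power2_eq_square)
  also have "of_real pi * (\<i> * ((w\<^sup>2 + 1) / (w\<^sup>2 - 1))) = - of_real pi * \<i> - 2 * of_real pi * \<i> * (w\<^sup>2 / (1 - w\<^sup>2))"
    using q1 by (auto simp: divide_simps) (auto simp: algebra_simps)
  finally show ?thesis unfolding e .
qed

text \<open>The Fourier series of the cotangent is differentiated n times. The induction starts at 1
  because the additive constant -pi i of the case n = 0 disappears only after one
  differentiation.\<close>

lemma cot_deriv_qexp:
  assumes "Im z > 0" "n \<ge> 1"
  shows "cot_deriv n z = - ((2 * of_real pi * \<i>) ^ Suc n) * eval_fps (powsum_fps n) (qexp z)"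
  using assms(2,1)
proof (induction n arbitrary: z rule: nat_induct_at_least)
  case base
  have "(cot_deriv 0 has_field_derivative - (2 * of_real pi * \<i>) * (2 * of_real pi * \<i> * eval_fps (powsum_fps 1) (qexp z))) (at z)"
  proof (rule has_field_derivative_transform_within_open)
    show "((\<lambda>z. - of_real pi * \<i> - 2 * of_real pi * \<i> * eval_fps (powsum_fps 0) (qexp z)) has_field_derivative
       - (2 * of_real pi * \<i>) * (2 * of_real pi * \<i> * eval_fps (powsum_fps 1) (qexp z))) (at z)"
      by (rule derivative_eq_intros powsum_qexp_deriv base refl)+ simp
    show "open {z. Im z > 0}" by (simp add: open_halfspace_Im_gt)
  qed (use base cot_deriv_0_qexp in auto)
  from DERIV_unique[OF this has_field_derivative_cot_deriv[OF not_Ints_if_Im[of z]]] base show ?case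
    by (simp add: mult_ac)
next
  case (Suc n)
  have "(cot_deriv n has_field_derivative - ((2 * of_real pi * \<i>) ^ Suc n) * (2 * of_real pi * \<i> * eval_fps (powsum_fps (Suc n)) (qexp z))) (at z)"
  proof (rule has_field_derivative_transform_within_open)
    show "((\<lambda>z. - ((2 * of_real pi * \<i>) ^ Suc n) * eval_fps (powsum_fps n) (qexp z)) has_field_derivative
       - ((2 * of_real pi * \<i>) ^ Suc n) * (2 * of_real pi * \<i> * eval_fps (powsum_fps (Suc n)) (qexp z))) (at z)"
      by (rule DERIV_cmult powsum_qexp_deriv Suc)+
    show "open {z. Im z > 0}" by (simp add: open_halfspace_Im_gt)
  qed (use Suc in auto)
  from DERIV_unique[OF this has_field_derivative_cot_deriv[OF not_Ints_if_Im[of z]]] Suc.prems show ?case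
    by (simp add: mult_ac)
qed

lemma lipschitz_formula:
  assumes "Im z > 0" "k \<ge> 2"
  shows "((\<lambda>m. 1 / (of_int m + z) ^ k) has_sum
           ((- 2 * of_real pi * \<i>) ^ k / fact (k - 1) * eval_fps (powsum_fps (k - 1)) (qexp z))) UNIV"
proof -
  obtain n where k: "k = Suc n" using assms by (cases k) auto
  have "(-1) ^ (k - 1) / fact (k - 1) * cot_deriv (k - 1) z = 
    (- 2 * of_real pi * \<i>) ^ k / fact (k - 1) * eval_fps (powsum_fps (k - 1)) (qexp z)"
    using cot_deriv_qexp[of z n] assms
    by (cases "even n") (simp_all add: k power_mult_distrib power_minus_odd)
  thus ?thesis using has_sum_inverse_power_int[OF assms(2), of z] by simp
qed

section \<open>Absolute convergence of lattice sums and their q-expansions\<close>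

lemma summable_on_product_nonneg:
  fixes a :: "'a \<Rightarrow> real" and b :: "'b \<Rightarrow> real"
  assumes "a summable_on A" "b summable_on B" "\<And>x. a x \<ge> 0" "\<And>y. b y \<ge> 0"
  shows "(\<lambda>(x, y). a x * b y) summable_on (A \<times> B)"
proof -
  have "(\<lambda>x. norm (case x of (x, y) \<Rightarrow> a x * b y)) summable_on (A \<times> B)"
    by (rule Infinite_Sum.abs_summable_on_Sigma_iff[THEN iffD2])
       (use assms in \<open>auto simp: infsum_cmult_right' abs_mult infsum_nonneg intro!: summable_on_cmult_right summable_on_cmult_left\<close>)
  thus ?thesis by (rule abs_summable_summable)
qed

text \<open>The exponent 3/2 is half of 3: a product of two such series dominates the lattice sum of
  |w|^(-3).\<close>

lemma summable_on_int_powr: "(\<lambda>m::int. (1 + \<bar>real_of_int m\<bar>) powr (- 3 / 2)) summable_on UNIV"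
proof (rule summable_on_int_split)
  have s: "summable (\<lambda>n. real n powr (- 3 / 2))" by (simp add: summable_real_powr_iff)
  have "summable (\<lambda>n. real (Suc n) powr (- 3 / 2))" using s by (subst summable_Suc_iff)
  thus "(\<lambda>n. (1 + \<bar>real_of_int (int n)\<bar>) powr (- 3 / 2)) summable_on UNIV"
    by (intro norm_summable_imp_summable_on) (simp add: add_ac)
  have "summable (\<lambda>n. real (Suc (Suc n)) powr (- 3 / 2))"
    using s by (subst summable_Suc_iff, subst summable_Suc_iff[where f = "\<lambda>n. real n powr (- 3 / 2)"])
  thus "(\<lambda>n. (1 + \<bar>real_of_int (- 1 - int n)\<bar>) powr (- 3 / 2)) summable_on UNIV"
    by (intro norm_summable_imp_summable_on) (simp add: add_ac)
qed

text \<open>The imaginary part of w = m + n \<tau> controls n; then m = w - n \<tau> is controlled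
  as well.\<close>

lemma lattice_norm_bound:
  assumes "Im \<tau> > 0"
  obtains c where "c > 0" "\<And>m n. max \<bar>real_of_int m\<bar> \<bar>real_of_int n\<bar> \<le> c * norm (of_int m + of_int n * \<tau>)"
proof
  define c where "c = 1 + (1 + norm \<tau>) / Im \<tau>"
  show "c > 0" using assms by (auto simp: c_def intro!: add_pos_nonneg)
  fix m n :: int
  define w where "w = of_int m + of_int n * \<tau>"
  have "\<bar>real_of_int n\<bar> * Im \<tau> = \<bar>Im w\<bar>" using assms by (simp add: w_def abs_mult)
  also have "\<dots> \<le> norm w" by (rule abs_Im_le_cmod)
  finally have n: "\<bar>real_of_int n\<bar> \<le> norm w / Im \<tau>" using assms by (simp add: field_simps)
  have "\<bar>real_of_int m\<bar> = norm (w - of_int n * \<tau>)" by (simp add: w_def)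
  also have "\<dots> \<le> norm w + \<bar>real_of_int n\<bar> * norm \<tau>"
    by (rule order.trans[OF norm_triangle_ineq4]) (simp add: norm_mult)
  also have "\<dots> \<le> norm w + norm w / Im \<tau> * norm \<tau>" using n by (intro add_mono mult_right_mono) auto
  finally have m: "\<bar>real_of_int m\<bar> \<le> norm w + norm w * norm \<tau> / Im \<tau>" by simp
  have "c * norm w = norm w + norm w / Im \<tau> + norm w * norm \<tau> / Im \<tau>"
    using assms by (simp add: c_def field_simps)
  moreover have "norm w / Im \<tau> \<ge> 0" "norm w * norm \<tau> / Im \<tau> \<ge> 0" "norm w \<ge> 0" using assms by auto
  ultimately show "max \<bar>real_of_int m\<bar> \<bar>real_of_int n\<bar> \<le> c * norm (of_int m + of_int n * \<tau>)"
    using m n unfolding w_def[symmetric] by linarith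
qed

text \<open>Put M = max |m| |n|. Off the origin M >= 1 and (1 + |m|)(1 + |n|) <= 4 M^2, so its power
  3/2 is at most 8 M^3 <= 8 (c |w|)^k. This is the origin of the factor 8 c^k.\<close>

lemma lattice_sum_summable_norm:
  assumes "Im \<tau> > 0" "k \<ge> 3"
  shows "(\<lambda>(m::int, n::int). 1 / norm (of_int m + of_int n * \<tau>) ^ k) summable_on UNIV"
proof -
  obtain c where c: "c > 0" "\<And>m n. max \<bar>real_of_int m\<bar> \<bar>real_of_int n\<bar> \<le> c * norm (of_int m + of_int n * \<tau>)"
    using lattice_norm_bound[OF assms(1)] by blast
  define a where "a = (\<lambda>m::int. (1 + \<bar>real_of_int m\<bar>) powr (- 3 / 2))"
  have "(\<lambda>(m, n). a m * a n) summable_on (UNIV \<times> UNIV)"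
    by (rule summable_on_product_nonneg) (use summable_on_int_powr in \<open>auto simp: a_def\<close>)
  hence "(\<lambda>x. c ^ k * 8 * (case x of (m, n) \<Rightarrow> a m * a n)) summable_on UNIV"
    by (intro summable_on_cmult_right) simp
  thus ?thesis
  proof (rule summable_on_comparison_test)
    fix x :: "int \<times> int"
    obtain m n where x: "x = (m, n)" by (cases x)
    define w where "w = of_int m + of_int n * \<tau>"
    define M where "M = max \<bar>real_of_int m\<bar> \<bar>real_of_int n\<bar>"
    show "(case x of (m, n) \<Rightarrow> 1 / norm (of_int m + of_int n * \<tau>) ^ k) \<le> c ^ k * 8 * (case x of (m, n) \<Rightarrow> a m * a n)"
    proof (cases "x = (0, 0)")
      \<comment> \<open>The origin contributes 1 / 0 = 0.\<close>
      case True thus ?thesis using c(1) assms by (simp add: a_def power_0_left)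
    next
      case False
      hence M1: "M \<ge> 1" unfolding M_def x by (auto simp: max_def)
      have cw: "M \<le> c * norm w" using c(2)[of m n] by (simp add: M_def w_def)
      have "(1 + \<bar>real_of_int m\<bar>) * (1 + \<bar>real_of_int n\<bar>) \<le> (2 * M) * (2 * M)"
        using M1 unfolding M_def by (intro mult_mono) auto
      also have "\<dots> = (2 * M) powr 2" using M1 by (simp add: power2_eq_square)
      finally have "((1 + \<bar>real_of_int m\<bar>) * (1 + \<bar>real_of_int n\<bar>)) powr (3/2) \<le> ((2 * M) powr 2) powr (3/2)"
        by (intro powr_mono2) auto
      also have "\<dots> = (2 * M) ^ 3" using M1 by (subst powr_powr) simp
      finally have "((1 + \<bar>real_of_int m\<bar>) * (1 + \<bar>real_of_int n\<bar>)) powr (3/2) \<le> 8 * M ^ 3"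
        by (simp add: power_mult_distrib)
      moreover have "M ^ 3 \<le> M ^ k" using M1 assms by (intro power_increasing) auto
      moreover have "M ^ k \<le> (c * norm w) ^ k" using cw M1 by (intro power_mono) auto
      ultimately have le: "((1 + \<bar>real_of_int m\<bar>) * (1 + \<bar>real_of_int n\<bar>)) powr (3/2) \<le> 8 * (c * norm w) ^ k"
        by linarith
      have aa: "a m * a n = inverse (((1 + \<bar>real_of_int m\<bar>) * (1 + \<bar>real_of_int n\<bar>)) powr (3/2))"
      proof -
        have "1 + \<bar>real_of_int m\<bar> \<noteq> 0" "1 + \<bar>real_of_int n\<bar> \<noteq> 0" by linarith+
        thus ?thesis unfolding a_def by (subst powr_mult) (simp_all add: powr_minus)
      qed
      have "(1 + \<bar>real_of_int m\<bar>) * (1 + \<bar>real_of_int n\<bar>) > 0" by (intro mult_pos_pos) linarith+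
      hence pos: "((1 + \<bar>real_of_int m\<bar>) * (1 + \<bar>real_of_int n\<bar>)) powr (3/2) > 0"
        by (subst powr_gt_zero) linarith
      have wp: "norm w > 0" using cw M1 by (cases "w = 0") auto
      have "inverse (8 * (c * norm w) ^ k) \<le> a m * a n"
        unfolding aa using le pos by (intro le_imp_inverse_le)
      hence "c ^ k * 8 * inverse (8 * (c * norm w) ^ k) \<le> c ^ k * 8 * (a m * a n)"
        using c by (intro mult_left_mono) auto
      moreover have "c ^ k * 8 * inverse (8 * (c * norm w) ^ k) = 1 / norm w ^ k"
        using c wp by (simp add: power_mult_distrib field_simps)
      ultimately show ?thesis by (simp add: x w_def)
    qed
  qed auto
qed

lemma lattice_sum_summable:
  assumes "Im \<tau> > 0" "k \<ge> 3"
  shows "(\<lambda>(m::int, n::int). 1 / (of_int m + of_int n * \<tau>) ^ k) summable_on UNIV"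
proof (rule abs_summable_summable)
  show "(\<lambda>x. norm (case x of (m::int, n::int) \<Rightarrow> 1 / (of_int m + of_int n * \<tau>) ^ k)) summable_on UNIV"
    using lattice_sum_summable_norm[OF assms]
    by (simp add: case_prod_unfold norm_divide norm_power)
qed

text \<open>For k > 0 the term at the origin is 1 / 0 = 0.\<close>

lemma eisenstein_G_UNIV:
  assumes "k > 0"
  shows "eisenstein_G k \<tau> = infsum (\<lambda>(m :: int, n :: int). 1 / (of_int m + of_int n * \<tau>) ^ k) UNIV"
  unfolding eisenstein_G_def by (rule infsum_cong_neutral) (use assms in auto)

text \<open>The lattice of -1/\<tau> is that of \<tau> divided by \<tau>. Reindexing an
  \<open>infsum\<close> along a bijection and pulling out a factor are valid without a summability
  argument.\<close>

lemma eisenstein_G_S: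
  assumes "k > 0" "\<tau> \<noteq> 0" "even k"
  shows "eisenstein_G k (- 1 / \<tau>) = \<tau> ^ k * eisenstein_G k \<tau>"
proof -
  have "infsum (\<lambda>(m :: int, n :: int). 1 / (of_int m + of_int n * (- 1 / \<tau>)) ^ k) UNIV =
        infsum (\<lambda>x. \<tau> ^ k * (case x of (m :: int, n :: int) \<Rightarrow> 1 / (of_int m + of_int n * \<tau>) ^ k)) UNIV"
  proof (rule infsum_reindex_bij_witness[of _ "\<lambda>(m, n). (n, - m)" "\<lambda>(m, n). (- n, m)"]; clarsimp)
    fix m n :: int
    have "of_int m - of_int n / \<tau> = (of_int m * \<tau> - of_int n) / \<tau>" using assms by (simp add: field_simps)
    thus "\<tau> ^ k / (of_int m * \<tau> - of_int n) ^ k = 1 / (of_int m - of_int n / \<tau>) ^ k"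
      by (simp add: power_divide)
  qed
  thus ?thesis using assms by (simp add: eisenstein_G_UNIV infsum_cmult_right')
qed

lemma eisenstein_G_rows:
  assumes "Im \<tau> > 0" "k \<ge> 3"
  shows "((\<lambda>n. infsum (\<lambda>m. 1 / (of_int m + of_int n * \<tau>) ^ k) UNIV) has_sum eisenstein_G k \<tau>) (UNIV :: int set)"
proof -
  define f where "f = (\<lambda>(m::int) (n::int). 1 / (of_int m + of_int n * \<tau>) ^ k)"
  have "((\<lambda>(m, n). f m n) has_sum eisenstein_G k \<tau>) (UNIV \<times> UNIV)"
    using has_sum_infsum[OF lattice_sum_summable[OF assms]] eisenstein_G_UNIV[of k \<tau>] assms by (simp add: f_def)
  hence *: "((\<lambda>(n, m). f m n) has_sum eisenstein_G k \<tau>) (UNIV \<times> UNIV)"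
    by (subst has_sum_swap) simp
  have "((\<lambda>n. infsum (\<lambda>m. f m n) UNIV) has_sum infsum (\<lambda>n. infsum (\<lambda>m. f m n) UNIV) UNIV) UNIV"
    using has_sum_imp_summable[OF *] by (intro has_sum_infsum summable_on_Sigma_banach)
  also have "infsum (\<lambda>n. infsum (\<lambda>m. f m n) UNIV) UNIV = eisenstein_G k \<tau>"
    by (subst infsum_Sigma'_banach[OF has_sum_imp_summable[OF *]]) (rule infsumI[OF *])
  finally show ?thesis by (simp add: f_def)
qed

lemma row_sum_minus:
  assumes "even k"
  shows "infsum (\<lambda>m::int. 1 / (of_int m + (- z :: complex)) ^ k) UNIV = infsum (\<lambda>m::int. 1 / (of_int m + z) ^ k) UNIV"
proof (rule infsum_reindex_bij_witness[of _ uminus uminus])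
  fix m :: int
  have "(- of_int m + z) ^ k = (- (of_int m + (- z))) ^ k" by simp
  also have "\<dots> = (of_int m + (- z)) ^ k" using assms by (rule power_minus_even)
  finally show "1 / (of_int (- m) + z) ^ k = 1 / (of_int m + - z) ^ k" by simp
qed auto

lemma has_sum_even_int:
  fixes f :: "int \<Rightarrow> complex"
  assumes "(f has_sum s) UNIV" "\<And>n. f (- n) = f n"
  shows "((\<lambda>n. 2 * f (int n)) has_sum (s - f 0)) {1..}"
proof -
  have un: "UNIV = {0} \<union> (({1..} :: int set) \<union> {..-1})" by auto
  have sm: "f summable_on A" for A using summable_on_subset_banach[OF has_sum_imp_summable[OF assms(1)], of A] by simp
  have neg: "infsum f {..-1} = infsum f {1..}"
    by (rule infsum_reindex_bij_witness[of _ uminus uminus]) (auto simp: assms(2))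
  have "s = infsum f UNIV" using assms(1) infsumI by metis
  also have "\<dots> = infsum f ({0} \<union> (({1..} :: int set) \<union> {..-1}))" using un by simp
  also have "\<dots> = f 0 + (infsum f {1..} + infsum f {..-1})"
    by (subst infsum_Un_disjoint, (simp_all add: sm)[3], subst infsum_Un_disjoint) (auto simp: sm)
  finally have "2 * infsum f {1..} = s - f 0" by (simp add: neg)
  moreover have "((\<lambda>n. 2 * f n) has_sum (2 * infsum f {1..})) {1..}"
    by (intro has_sum_cmult_right has_sum_infsum sm)
  ultimately have "((\<lambda>n. 2 * f n) has_sum (s - f 0)) {1..}" by simp
  thus ?thesis
    by (subst (asm) has_sum_reindex_bij_witness[of "{1..}" int nat "{1..}" "\<lambda>n. 2 * f (int n)"]) auto
qed

text \<open>The double sum of d^j q^(n d) over n, d >= 1. It is iterated with n outside because row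
  n of an Eisenstein series yields, by the Lipschitz formula, the inner sum at q^n.\<close>

definition lambert :: "nat \<Rightarrow> complex \<Rightarrow> complex" where
  "lambert j q = infsum (\<lambda>n. eval_fps (powsum_fps j) (q ^ n)) {1..}"

text \<open>Row 0 gives the constant term 2 zeta(k). Rows n and -n agree because k is even, and each
  is a Lipschitz sum at n \<tau>.\<close>

lemma eisenstein_G_lambert:
  assumes "Im \<tau> > 0" "k \<ge> 3" "even k"
  shows "eisenstein_G k \<tau> = infsum (\<lambda>m. 1 / (of_int m) ^ k) UNIV +
     2 * (- 2 * of_real pi * \<i>) ^ k / fact (k - 1) * lambert (k - 1) (qexp \<tau>)"
proof -
  define r where "r = (\<lambda>n::int. infsum (\<lambda>m. 1 / (of_int m + of_int n * \<tau>) ^ k) UNIV)"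
  have "(r has_sum eisenstein_G k \<tau>) UNIV" unfolding r_def by (rule eisenstein_G_rows assms)+
  moreover have "r (- n) = r n" for n
    using row_sum_minus[OF assms(3), of "of_int n * \<tau>"] by (simp add: r_def)
  ultimately have "((\<lambda>n. 2 * r (int n)) has_sum (eisenstein_G k \<tau> - r 0)) {1..}" by (rule has_sum_even_int)
  also have "?this \<longleftrightarrow> ((\<lambda>n. 2 * (- 2 * of_real pi * \<i>) ^ k / fact (k - 1) * 
      eval_fps (powsum_fps (k - 1)) (qexp \<tau> ^ n)) has_sum (eisenstein_G k \<tau> - r 0)) {1..}"
  proof (rule has_sum_cong)
    fix n :: nat assume n: "n \<in> {1..}"
    have "r (int n) = (- 2 * of_real pi * \<i>) ^ k / fact (k - 1) * eval_fps (powsum_fps (k - 1)) (qexp (of_nat n * \<tau>))"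
      unfolding r_def using lipschitz_formula[of "of_nat n * \<tau>" k] assms n by (intro infsumI) simp
    thus "2 * r (int n) = 2 * (- 2 * of_real pi * \<i>) ^ k / fact (k - 1) * eval_fps (powsum_fps (k - 1)) (qexp \<tau> ^ n)"
      by (simp add: qexp_of_nat_mult)
  qed
  finally have "eisenstein_G k \<tau> - r 0 = infsum (\<lambda>n. 2 * (- 2 * of_real pi * \<i>) ^ k / fact (k - 1) * 
      eval_fps (powsum_fps (k - 1)) (qexp \<tau> ^ n)) {1..}" by (rule infsumI[symmetric])
  also have "\<dots> = 2 * (- 2 * of_real pi * \<i>) ^ k / fact (k - 1) * lambert (k - 1) (qexp \<tau>)"
    unfolding lambert_def by (rule infsum_cmult_right')
  finally show ?thesis by (simp add: r_def algebra_simps)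
qed

text \<open>At n = 0 the divisors form an infinite set, over which \<open>sum\<close> is 0 by
  convention; so the constant term vanishes, as it should.\<close>

definition sigma_fps :: "nat \<Rightarrow> complex fps" where
  "sigma_fps j = Abs_fps (\<lambda>n. \<Sum>d | d dvd n. of_nat d ^ j)"

lemma powsum_abs_summable:
  assumes "0 \<le> x" "x < (1::real)"
  shows "(\<lambda>d. real d ^ j * x ^ d) summable_on A"
proof -
  have r: "ereal (norm (of_real x :: complex)) < fps_conv_radius (powsum_fps j)"
    by (intro norm_less_conv_radius_1 fps_conv_radius_powsum) (use assms in simp)
  have "summable (\<lambda>n. norm (fps_nth (powsum_fps j) n * of_real x ^ n))" by (rule norm_summable_fps[OF r])
  hence "summable (\<lambda>n. norm (real n ^ j * x ^ n))"
  proof (rule summable_comparison_test_ev[rotated])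
    show "\<forall>\<^sub>F n in sequentially. norm (norm (real n ^ j * x ^ n)) \<le> norm (fps_nth (powsum_fps j) n * of_real x ^ n)"
      using eventually_gt_at_top[of 0]
      by eventually_elim (use assms in \<open>auto simp: powsum_fps_def norm_mult norm_power\<close>)
  qed
  hence "(\<lambda>d. real d ^ j * x ^ d) summable_on UNIV" by (rule norm_summable_imp_summable_on)
  thus ?thesis using summable_on_subset_banach by blast
qed

lemma lambert_double_summable:
  assumes "norm (q::complex) < 1"
  shows "(\<lambda>(n, d). of_nat d ^ j * q ^ (n * d)) summable_on ({1..} \<times> {1..})"
proof (rule abs_summable_summable)
  \<comment> \<open>For n, d >= 1 one has n + d <= 2 n d, hence |q|^(n d) <= x^n x^d, and a product
    of two single series dominates.\<close>
  define x where "x = sqrt (norm q)"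
  have x: "0 \<le> x" "x < 1" "norm q = x ^ 2" using assms by (auto simp: x_def)
  have "(\<lambda>n. x ^ n) summable_on {1..}" using powsum_abs_summable[OF x(1,2), of 0] by simp
  hence "(\<lambda>(n, d). x ^ n * (real d ^ j * x ^ d)) summable_on ({1..} \<times> {1..})"
    using x by (intro summable_on_product_nonneg powsum_abs_summable) auto
  thus "(\<lambda>x. norm (case x of (n, d) \<Rightarrow> of_nat d ^ j * q ^ (n * d))) summable_on ({1..} \<times> {1..})"
  proof (rule summable_on_comparison_test; clarsimp)
    fix n d :: nat assume "Suc 0 \<le> n" "Suc 0 \<le> d"
    hence "n + d \<le> 2 * (n * d)"
      by (metis One_nat_def add_mono mult.right_neutral mult_2 mult_le_mono nat_mult_1 order_refl)
    hence "x ^ (2 * (n * d)) \<le> x ^ (n + d)" using x by (intro power_decreasing) auto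
    hence "real d ^ j * x ^ (2 * (n * d)) \<le> real d ^ j * x ^ (n + d)" by (intro mult_left_mono) auto
    thus "norm (of_nat d ^ j * q ^ (n * d)) \<le> x ^ n * (real d ^ j * x ^ d)"
      by (simp add: norm_mult norm_power x(3) power_mult [symmetric] power_add mult_ac)
  qed
qed

lemma powsum_has_sum:
  assumes "norm (q::complex) < 1"
  shows "((\<lambda>d. of_nat d ^ j * q ^ d) has_sum eval_fps (powsum_fps j) q) {1..}"
proof -
  have r: "ereal (norm q) < fps_conv_radius (powsum_fps j)"
    by (intro norm_less_conv_radius_1 fps_conv_radius_powsum assms)
  have "((\<lambda>n. fps_nth (powsum_fps j) n * q ^ n) has_sum eval_fps (powsum_fps j) q) UNIV"
    by (rule norm_summable_imp_has_sum[OF norm_summable_fps[OF r] sums_eval_fps[OF r]])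
  thus ?thesis
    by (subst has_sum_cong_neutral[where T = UNIV and g = "\<lambda>n. fps_nth (powsum_fps j) n * q ^ n"]) (auto simp: powsum_fps_def)
qed

lemma lambert_has_sum:
  assumes "norm (q::complex) < 1"
  shows "((\<lambda>(n, d). of_nat d ^ j * q ^ (n * d)) has_sum lambert j q) ({1..} \<times> {1..})"
proof -
  note s = lambert_double_summable[OF assms, of j]
  have "infsum (\<lambda>(n, d). of_nat d ^ j * q ^ (n * d)) ({1..} \<times> {1..}) =
     infsum (\<lambda>n. infsum (\<lambda>d. of_nat d ^ j * q ^ (n * d)) {1..}) {1..}"
    using infsum_Sigma'_banach[OF s] by simp
  also have "\<dots> = lambert j q" unfolding lambert_def
  proof (rule infsum_cong)
    fix n :: nat assume "n \<in> {1..}"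
    hence "norm (q ^ n) < 1" using assms by (auto simp: norm_power intro!: power_less_one_iff[THEN iffD2])
    from powsum_has_sum[OF this, of j] show "infsum (\<lambda>d. of_nat d ^ j * q ^ (n * d)) {1..} = eval_fps (powsum_fps j) (q ^ n)"
      by (intro infsumI) (simp add: power_mult)
  qed
  finally show ?thesis using has_sum_infsum[OF s] by simp
qed

text \<open>The double series is regrouped by the product N = n d.\<close>

lemma sigma_has_sum:
  assumes "norm (q::complex) < 1"
  shows "((\<lambda>n. fps_nth (sigma_fps j) n * q ^ n) has_sum lambert j q) UNIV"
proof -
  have "((\<lambda>(N, d). of_nat d ^ j * q ^ N) has_sum lambert j q) (Sigma {1..} (\<lambda>N. {d. d dvd N}))"
    using lambert_has_sum[OF assms, of j]
    by (subst has_sum_reindex_bij_witness[of _ "\<lambda>(n, d). (n * d, d)" "\<lambda>(N, d). (N div d, d)" "{1..} \<times> {1..}" "\<lambda>(n, d). of_nat d ^ j * q ^ (n * d)"])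
       (auto simp: Suc_le_eq mult.commute elim!: dvdE)
  hence "((\<lambda>N. \<Sum>d | d dvd N. of_nat d ^ j * q ^ N) has_sum lambert j q) {1..}"
    by (rule has_sum_SigmaD) (auto intro!: has_sum_finite)
  hence "((\<lambda>n. fps_nth (sigma_fps j) n * q ^ n) has_sum lambert j q) {1..}"
    by (simp add: sigma_fps_def sum_distrib_right)
  thus ?thesis
    by (subst has_sum_cong_neutral[where T = "{1..}" and g = "\<lambda>n. fps_nth (sigma_fps j) n * q ^ n"])
       (auto simp: sigma_fps_def Suc_le_eq)
qed

lemma fps_conv_radius_sigma: "fps_conv_radius (sigma_fps j) \<ge> 1"
  unfolding fps_conv_radius_def
proof (rule conv_radius_geI_ex')
  fix r :: real assume "0 < r" "ereal r < 1"
  hence "norm (of_real r :: complex) < 1" by (simp add: one_ereal_def)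
  from sigma_has_sum[OF this, of j] show "summable (\<lambda>n. fps_nth (sigma_fps j) n * of_real r ^ n)"
    using has_sum_imp_sums sums_summable by blast
qed

lemma lambert_eval_fps:
  assumes "norm (q::complex) < 1"
  shows "lambert j q = eval_fps (sigma_fps j) q"
  unfolding eval_fps_def using has_sum_imp_sums[OF sigma_has_sum[OF assms]] sums_unique by blast

section \<open>The values zeta(2), zeta(4), zeta(6) from the cotangent\<close>

lemma cot_deriv_1:
  assumes "z \<notin> \<int>"
  shows "cot_deriv 1 z = - (of_real pi ^ 2 * (1 + cot (of_real pi * z) ^ 2))"
proof -
  have sn: "sin (of_real pi * z) \<noteq> 0" using assms by (auto simp: Complex_Transcendental.sin_eq_0)
  have "(cot_deriv 0 has_field_derivative - (of_real pi ^ 2 * (1 + cot (of_real pi * z) ^ 2))) (at z)"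
  proof (rule has_field_derivative_transform_within_open)
    show "((\<lambda>z. of_real pi * cot (of_real pi * z)) has_field_derivative - (of_real pi ^ 2 * (1 + cot (of_real pi * z) ^ 2))) (at z)"
    proof -
      let ?s = "sin (of_real pi * z)" and ?c = "cos (of_real pi * z)"
      have "((\<lambda>z. of_real pi * (cos (of_real pi * z) / sin (of_real pi * z))) has_field_derivative
        of_real pi * ((- ?s * of_real pi * ?s - ?c * (?c * of_real pi)) / (?s * ?s))) (at z)"
        by (intro DERIV_cmult) (use sn in \<open>auto intro!: derivative_eq_intros\<close>)
      moreover have "of_real pi * ((- ?s * of_real pi * ?s - ?c * (?c * of_real pi)) / (?s * ?s)) =
        - (of_real pi ^ 2 * (1 + (?c / ?s) ^ 2))"
      proof -
        have "p * ((- s * p * s - c * (c * p)) / (s * s)) = - (p ^ 2 * (1 + (c / s) ^ 2))" if "s \<noteq> 0" for p s c :: complex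
          using that by (simp add: field_simps power2_eq_square)
        thus ?thesis using sn by blast
      qed
      ultimately show ?thesis by (simp add: cot_def)
    qed
    show "open (- \<int> :: complex set)" by (simp add: open_Compl closed_Ints)
  qed (use assms cot_deriv_0 in auto)
  from DERIV_unique[OF has_field_derivative_cot_deriv[OF assms] this] show ?thesis by simp
qed

lemma cot_has_field_derivative:
  fixes z :: complex
  assumes "z \<notin> \<int>"
  shows "((\<lambda>z. cot (of_real pi * z)) has_field_derivative - (of_real pi * (1 + cot (of_real pi * z) ^ 2))) (at z)"
proof -
  have "((\<lambda>z. 1 / of_real pi * cot_deriv 0 z) has_field_derivative 1 / of_real pi * cot_deriv 1 z) (at z)"
    using has_field_derivative_cot_deriv[OF assms, of 0] by (intro DERIV_cmult) simp
  hence "((\<lambda>z. 1 / of_real pi * cot_deriv 0 z) has_field_derivative - (of_real pi * (1 + cot (of_real pi * z) ^ 2))) (at z)"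
    unfolding cot_deriv_1[OF assms] by (simp add: power2_eq_square)
  thus ?thesis
    by (rule has_field_derivative_transform_within_open[where S = "- \<int>"])
       (use assms cot_deriv_0 in \<open>auto simp: open_Compl closed_Ints\<close>)
qed

text \<open>All derivatives stay polynomials in the cotangent. This turns the values of Polygamma at
  1 into limits of elementary functions, which \<open>real_asymp\<close> computes.\<close>

lemma cot_deriv_step:
  assumes "\<And>z. z \<notin> \<int> \<Longrightarrow> cot_deriv n z = poly p (cot (of_real pi * z))" "z \<notin> \<int>"
  shows "cot_deriv (Suc n) z = poly (- smult (of_real pi) (pderiv p * [:1, 0, 1:])) (cot (of_real pi * z))"
proof -
  have "((\<lambda>z. poly p (cot (of_real pi * z))) has_field_derivative
       poly (pderiv p) (cot (of_real pi * z)) * (- (of_real pi * (1 + cot (of_real pi * z) ^ 2)))) (at z)"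
    by (rule DERIV_chain2[where f = "poly p", OF poly_DERIV cot_has_field_derivative[OF assms(2)]])
  hence "(cot_deriv n has_field_derivative
       poly (pderiv p) (cot (of_real pi * z)) * (- (of_real pi * (1 + cot (of_real pi * z) ^ 2)))) (at z)"
    by (rule has_field_derivative_transform_within_open[where S = "- \<int>"])
       (use assms in \<open>auto simp: open_Compl closed_Ints\<close>)
  from DERIV_unique[OF has_field_derivative_cot_deriv[OF assms(2)] this] show ?thesis
    by (simp add: power2_eq_square algebra_simps)
qed

lemma cot_deriv_3:
  assumes "z \<notin> \<int>"
  shows "cot_deriv 3 z = poly (smult (- 2 * of_real pi ^ 4) [:1, 0, 4, 0, 3:]) (cot (of_real pi * z))"
proof -
  have 1: "cot_deriv 1 z = poly (smult (- (of_real pi ^ 2)) [:1, 0, 1:]) (cot (of_real pi * z))" if "z \<notin> \<int>" for z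
    using cot_deriv_1[OF that] by (simp add: power2_eq_square algebra_simps)
  have "cot_deriv (Suc (Suc 1)) z = poly (smult (- 2 * of_real pi ^ 4) [:1, 0, 4, 0, 3:]) (cot (of_real pi * z))"
    by (subst cot_deriv_step[OF cot_deriv_step[OF 1] assms])
       (simp_all add: pderiv_smult pderiv_pCons pderiv_mult pderiv_minus algebra_simps power4_eq_xxxx power2_eq_square)
  thus ?thesis by (simp add: numeral_3_eq_3)
qed

lemma cot_deriv_5:
  assumes "z \<notin> \<int>"
  shows "cot_deriv 5 z = poly (smult (- 8 * of_real pi ^ 6) [:2, 0, 17, 0, 30, 0, 15:]) (cot (of_real pi * z))"
proof -
  have "cot_deriv (Suc (Suc 3)) z = poly (smult (- 8 * of_real pi ^ 6) [:2, 0, 17, 0, 30, 0, 15:]) (cot (of_real pi * z))"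
    by (subst cot_deriv_step[OF cot_deriv_step[OF cot_deriv_3] assms])
       (simp_all add: pderiv_smult pderiv_pCons pderiv_mult pderiv_minus algebra_simps power4_eq_xxxx power2_eq_square numeral_eq_Suc)
  thus ?thesis by (simp add: eval_nat_numeral)
qed

text \<open>The recurrence for Polygamma n splits off its pole at 0 and leaves -Polygamma n (1 - x)
  - Polygamma n (1 + x), which is continuous at 0. For odd n the two limits add up instead of
  cancelling.\<close>

lemma tendsto_cot_deriv_0:
  assumes "odd n"
  shows "((\<lambda>x::real. cot_deriv n (of_real x) + fact n / of_real x ^ Suc n) \<longlongrightarrow> - 2 * Polygamma n 1) (at_right 0)"
proof -
  have "((\<lambda>x::real. - Polygamma n (1 - of_real x :: complex) - Polygamma n (of_real x + 1)) \<longlongrightarrow> 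
     - Polygamma n (1 - of_real 0) - Polygamma n (of_real 0 + 1)) (at_right 0)"
    by (intro tendsto_intros) auto
  moreover have "eventually (\<lambda>x::real. cot_deriv n (of_real x) + fact n / of_real x ^ Suc n = 
      - Polygamma n (1 - of_real x :: complex) - Polygamma n (of_real x + 1)) (at_right 0)"
    using eventually_at_right_less[of 0]
  proof eventually_elim
    case (elim x)
    hence "Polygamma n (of_real x + 1 :: complex) = Polygamma n (of_real x) + (-1) ^ n * fact n / of_real x ^ Suc n"
      by (intro Polygamma_plus1) auto
    thus ?case using assms by (simp add: cot_deriv_def)
  qed
  ultimately show ?thesis by (simp add: filterlim_cong)
qed

text \<open>f(cot x) is the n-th derivative of cot at x, and L is the constant term of its Laurent
  expansion at 0. Since Polygamma n 1 = n! zeta(n + 1) for odd n, this evaluates zeta at an even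
  integer.\<close>

lemma Polygamma_1_eqI:
  assumes "odd n" "\<And>z. z \<notin> \<int> \<Longrightarrow> cot_deriv n z = g (cot (of_real pi * z))"
    and "\<And>x. g (of_real x) = of_real (pi ^ Suc n * f x)"
    and "((\<lambda>x::real. f (cot x) + fact n / x ^ Suc n) \<longlongrightarrow> L) (at_right 0)"
  shows "Polygamma n (1::complex) = - (of_real pi ^ Suc n * of_real L / 2)"
proof -
  have "filterlim (\<lambda>x::real. pi * x) (at_right 0) (at_right 0)" by real_asymp
  with assms(4) have "((\<lambda>x::real. f (cot (pi * x)) + fact n / (pi * x) ^ Suc n) \<longlongrightarrow> L) (at_right 0)"
    by (rule filterlim_compose)
  hence "((\<lambda>x::real. complex_of_real (pi ^ Suc n * (f (cot (pi * x)) + fact n / (pi * x) ^ Suc n))) \<longlongrightarrow> 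
    of_real (pi ^ Suc n * L)) (at_right 0)"
    by (intro tendsto_of_real tendsto_mult_left)
  moreover have "eventually (\<lambda>x::real. complex_of_real (pi ^ Suc n * (f (cot (pi * x)) + fact n / (pi * x) ^ Suc n)) = 
      cot_deriv n (of_real x) + fact n / of_real x ^ Suc n) (at_right 0)"
    using eventually_at_right_real[OF zero_less_one]
  proof eventually_elim
    case (elim x)
    have "x \<notin> \<int>" using elim by (auto elim!: Ints_cases)
    hence "complex_of_real x \<notin> \<int>" using of_real_in_Ints_iff by blast
    moreover have "cot (complex_of_real (pi * x)) = complex_of_real (cot (pi * x))"
      by (simp add: cot_def flip: sin_of_real cos_of_real of_real_mult)
    hence "cot (of_real pi * complex_of_real x) = complex_of_real (cot (pi * x))" by simp
    moreover have "pi ^ Suc n * (f (cot (pi * x)) + fact n / (pi * x) ^ Suc n) = 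
       pi ^ Suc n * f (cot (pi * x)) + fact n / x ^ Suc n"
      by (simp add: power_mult_distrib field_simps)
    ultimately show ?case by (simp add: assms(2,3) del: power_Suc)
  qed
  ultimately have "((\<lambda>x::real. cot_deriv n (of_real x) + fact n / of_real x ^ Suc n) \<longlongrightarrow> of_real (pi ^ Suc n * L)) (at_right 0)"
    by (rule Lim_transform_eventually)
  hence "of_real (pi ^ Suc n * L) = - 2 * Polygamma n (1::complex)"
    using tendsto_unique[OF _ _ tendsto_cot_deriv_0[OF assms(1)]] by simp
  thus ?thesis by simp
qed

lemma Polygamma_1_at_1: "Polygamma 1 (1::complex) = of_real pi ^ 2 / 6"
proof -
  have "((\<lambda>x::real. - (1 + cot x ^ 2) + fact 1 / x ^ Suc 1) \<longlongrightarrow> - 1 / 3) (at_right 0)"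
    unfolding cot_def by real_asymp
  hence "Polygamma 1 (1::complex) = - (of_real pi ^ Suc 1 * of_real (- 1 / 3) / 2)"
    by (intro Polygamma_1_eqI[where f = "\<lambda>c. - (1 + c ^ 2)", OF _ cot_deriv_1]) (auto simp: power2_eq_square algebra_simps)
  thus ?thesis by (simp add: power2_eq_square)
qed

lemma Polygamma_3_at_1: "Polygamma 3 (1::complex) = of_real pi ^ 4 / 15"
proof -
  have "((\<lambda>x::real. - 2 * (1 + 4 * cot x ^ 2 + 3 * cot x ^ 4) + 6 / x ^ 4) \<longlongrightarrow> - 2 / 15) (at_right 0)"
    unfolding cot_def by real_asymp
  hence "Polygamma 3 (1::complex) = - (of_real pi ^ Suc 3 * of_real (- 2 / 15) / 2)"
    by (intro Polygamma_1_eqI[where f = "\<lambda>c. - 2 * (1 + 4 * c ^ 2 + 3 * c ^ 4)", OF _ cot_deriv_3])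
       (auto simp: power2_eq_square power4_eq_xxxx algebra_simps fact_numeral)
  thus ?thesis by simp
qed

lemma Polygamma_5_at_1: "Polygamma 5 (1::complex) = 8 * of_real pi ^ 6 / 63"
proof -
  have "((\<lambda>x::real. - 8 * (2 + 17 * cot x ^ 2 + 30 * cot x ^ 4 + 15 * cot x ^ 6) + 120 / x ^ 6) \<longlongrightarrow> - 16 / 63) (at_right 0)"
    unfolding cot_def by real_asymp
  hence "Polygamma 5 (1::complex) = - (of_real pi ^ Suc 5 * of_real (- 16 / 63) / 2)"
    by (intro Polygamma_1_eqI[where f = "\<lambda>c. - 8 * (2 + 17 * c ^ 2 + 30 * c ^ 4 + 15 * c ^ 6)", OF _ cot_deriv_5])
       (auto simp: power_numeral_reduce algebra_simps fact_numeral)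
  thus ?thesis by simp
qed

lemma row_sum_0:
  assumes "even k" "k \<ge> 2"
  shows "((\<lambda>m::int. 1 / of_int m ^ k) has_sum (2 / fact (k - 1) * Polygamma (k - 1) (1::complex))) UNIV"
proof -
  have 1: "((\<lambda>n. 1 / (of_nat n + 1) ^ k) has_sum (Polygamma (k - 1) (1::complex) / fact (k - 1))) UNIV"
    using has_sum_inverse_power_nat[OF assms(2), of 1] assms by simp
  have "((\<lambda>n. 1 / of_nat n ^ k) has_sum (Polygamma (k - 1) (1::complex) / fact (k - 1))) (range Suc)"
    using 1 by (subst has_sum_reindex) (auto simp: o_def add.commute)
  hence "((\<lambda>n. 1 / of_nat n ^ k) has_sum (Polygamma (k - 1) (1::complex) / fact (k - 1))) UNIV"
    by (rule has_sum_cong_neutral[THEN iffD1, rotated -1])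
       (use assms not0_implies_Suc in \<open>fastforce simp: image_def power_0_left\<close>)+
  moreover have "(\<lambda>n. 1 / (of_int (- 1 - int n)) ^ k) = (\<lambda>n. 1 / (of_nat n + 1 :: complex) ^ k)"
  proof
    fix n
    have "(of_int (- 1 - int n) :: complex) = - (of_nat n + 1)" by simp
    hence "(of_int (- 1 - int n) :: complex) ^ k = (of_nat n + 1) ^ k" using assms by (metis power_minus_even)
    thus "1 / (of_int (- 1 - int n)) ^ k = 1 / (of_nat n + 1 :: complex) ^ k" by simp
  qed
  ultimately have "((\<lambda>m::int. 1 / of_int m ^ k) has_sum
     (Polygamma (k - 1) (1::complex) / fact (k - 1) + Polygamma (k - 1) (1::complex) / fact (k - 1))) UNIV"
    by (intro has_sum_int_split) (use 1 in simp_all)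
  thus ?thesis by simp
qed

lemma eisenstein_G_4:
  assumes "Im \<tau> > 0"
  shows "60 * eisenstein_G 4 \<tau> = 4 * of_real pi ^ 4 / 3 * (1 + 240 * eval_fps (sigma_fps 3) (qexp \<tau>))"
  using row_sum_0[of 4, THEN infsumI] lambert_eval_fps[OF norm_qexp_less_1[OF assms], of 3]
  by (simp add: eisenstein_G_lambert[OF assms, of 4] Polygamma_3_at_1 fact_numeral power_mult_distrib field_simps)

lemma eisenstein_G_6:
  assumes "Im \<tau> > 0"
  shows "140 * eisenstein_G 6 \<tau> = 8 * of_real pi ^ 6 / 27 * (1 - 504 * eval_fps (sigma_fps 5) (qexp \<tau>))"
proof -
  have "(- 2 * complex_of_real pi * \<i>) ^ 6 = 64 * of_real pi ^ 6 * (\<i> ^ 2) ^ 3"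
    by (simp only: power_mult_distrib power_mult [symmetric]) simp
  thus ?thesis
    using row_sum_0[of 6, THEN infsumI] lambert_eval_fps[OF norm_qexp_less_1[OF assms], of 5]
    by (simp add: eisenstein_G_lambert[OF assms, of 6] Polygamma_5_at_1 fact_numeral field_simps)
qed

text \<open>The weight-2 Eisenstein series is only conditionally convergent; its transformation law is obtained by
  exchanging the order of summation in an absolutely convergent double series that differs from it by a
  telescoping one.\<close>

definition lattice_corr :: "complex \<Rightarrow> int \<Rightarrow> int \<Rightarrow> complex" where
  "lattice_corr \<tau> m n = (if n = 0 then 0 else 1 / (of_int m + of_int n * \<tau>) ^ 2
      - (1 / (of_int m + of_int n * \<tau>) - 1 / (of_int m + 1 + of_int n * \<tau>)))"

text \<open>With w = m + n \<tau> the term equals 1 / (w^2 (w + 1)) and so has order |w|^(-3): the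
  telescoping part is subtracted precisely to gain this power.\<close>

lemma lattice_corr_summable:
  assumes "Im \<tau> > 0"
  shows "(\<lambda>(m, n). lattice_corr \<tau> m n) summable_on (UNIV \<times> UNIV)"
proof (rule abs_summable_summable)
  define y where "y = Im \<tau>"
  have "(\<lambda>x. (1 + 1 / y) * (case x of (m::int, n::int) \<Rightarrow> 1 / norm (of_int m + of_int n * \<tau>) ^ 3)) summable_on (UNIV \<times> UNIV)"
    using lattice_sum_summable_norm[OF assms, of 3] by (intro summable_on_cmult_right) simp
  thus "(\<lambda>x. norm (case x of (m, n) \<Rightarrow> lattice_corr \<tau> m n)) summable_on (UNIV \<times> UNIV)"
  proof (rule summable_on_comparison_test)
    fix x :: "int \<times> int"
    obtain m n where x: "x = (m, n)" by (cases x)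
    define w where "w = of_int m + of_int n * \<tau>"
    have y: "y > 0" using assms by (simp add: y_def)
    show "norm (case x of (m, n) \<Rightarrow> lattice_corr \<tau> m n) \<le>
        (1 + 1 / y) * (case x of (m, n) \<Rightarrow> 1 / norm (of_int m + of_int n * \<tau>) ^ 3)"
    proof (cases "n = 0")
      case True thus ?thesis using y by (simp add: x lattice_corr_def)
    next
      case False
      \<comment> \<open>The distance of w + 1 from 0 is at least y, so |w| <= |w + 1| + 1 is at most
        a constant multiple of |w + 1|.\<close>
      have "1 * y \<le> \<bar>real_of_int n\<bar> * y" using False y by (intro mult_right_mono) auto
      also have "\<dots> = \<bar>Im (w + 1)\<bar>" using y by (simp add: w_def y_def abs_mult)
      also have "\<dots> \<le> norm (w + 1)" by (rule abs_Im_le_cmod)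
      finally have w1: "y \<le> norm (w + 1)" by simp
      have Imw: "Im w \<noteq> 0" using False assms by (simp add: w_def)
      hence w0: "w \<noteq> 0" "w + 1 \<noteq> 0" by (auto simp: complex_eq_iff)
      have "norm w = norm ((w + 1) - 1)" by simp
      also have "\<dots> \<le> norm (w + 1) + norm (1::complex)" by (rule norm_triangle_ineq4)
      also have "\<dots> \<le> norm (w + 1) + 1 / y * norm (w + 1)" using w1 y by (simp add: field_simps)
      finally have ww: "norm w \<le> (1 + 1 / y) * norm (w + 1)" by (simp add: algebra_simps)
      have "lattice_corr \<tau> m n = 1 / w ^ 2 - (1 / w - 1 / (w + 1))"
        using False by (simp add: lattice_corr_def w_def algebra_simps)
      also have "1 / w - 1 / (w + 1) = 1 / (w * (w + 1))" using w0 by (simp add: field_simps)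
      also have "1 / w ^ 2 - 1 / (w * (w + 1)) = 1 / (w ^ 2 * (w + 1))"
        using w0 by (simp add: divide_simps power2_eq_square)
      finally have "norm (lattice_corr \<tau> m n) = 1 / (norm w ^ 2 * norm (w + 1))"
        by (simp add: norm_divide norm_mult norm_power)
      also have "\<dots> \<le> (1 + 1 / y) * (1 / norm w ^ 3)"
        using ww w0 by (simp add: divide_simps power2_eq_square power3_eq_cube mult_left_mono mult_ac)
      finally show ?thesis by (simp add: x w_def)
    qed
  qed auto
qed

text \<open>The intervals are half-open so that a telescoping sum over them leaves exactly f(-M) -
  f(M).\<close>

lemma has_sum_int_imp_tendsto_symmetric:
  fixes f :: "int \<Rightarrow> 'a :: {topological_comm_monoid_add, t2_space}"
  assumes "(f has_sum s) UNIV"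
  shows "(\<lambda>M. \<Sum>m\<in>{- int M..<int M}. f m) \<longlonglongrightarrow> s"
proof -
  have "filterlim (\<lambda>M. {- int M..<int M}) (finite_subsets_at_top UNIV) sequentially"
    unfolding filterlim_finite_subsets_at_top
  proof (intro allI impI)
    fix X :: "int set" assume "finite X \<and> X \<subseteq> UNIV"
    hence fin: "finite X" by simp
    define N where "N = (\<Sum>x\<in>X. nat \<bar>x\<bar>) + 1"
    have N: "\<bar>x\<bar> < int N" if "x \<in> X" for x
    proof -
      have "nat \<bar>x\<bar> \<le> (\<Sum>x\<in>X. nat \<bar>x\<bar>)" by (rule member_le_sum) (use that fin in auto)
      thus ?thesis unfolding N_def by linarith
    qed
    show "\<forall>\<^sub>F M in sequentially. finite {- int M..<int M} \<and> X \<subseteq> {- int M..<int M} \<and> {- int M..<int M} \<subseteq> UNIV"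
      using eventually_ge_at_top[of N]
    proof eventually_elim
      case (elim M)
      show ?case using N elim by fastforce
    qed
  qed
  with assms show ?thesis unfolding has_sum_def by (rule filterlim_compose)
qed

lemma sum_telescope_int:
  fixes f :: "int \<Rightarrow> 'a :: ab_group_add"
  shows "(\<Sum>m\<in>{- int M..<int M}. f m - f (m + 1)) = f (- int M) - f (int M)"
proof (induction M)
  case (Suc M)
  have "{- int (Suc M)..<int (Suc M)} = insert (- int (Suc M)) (insert (int M) {- int M..<int M})" by auto
  thus ?case using Suc by (simp add: add.commute)
qed simp

section \<open>The weight 2 correction and the discriminant\<close>

lemma has_sum_uminusI:
  fixes f :: "'a \<Rightarrow> complex"
  shows "(f has_sum a) A \<Longrightarrow> ((\<lambda>x. - f x) has_sum - a) A"
  by (simp add: has_sum_uminus)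

lemma has_sum_Suc_shift:
  fixes f :: "nat \<Rightarrow> complex"
  assumes "f 0 = 0" "((\<lambda>n. f (Suc n)) has_sum s) UNIV"
  shows "(f has_sum s) UNIV"
proof -
  have "(f has_sum s) (range Suc)" using assms(2) by (subst has_sum_reindex) (auto simp: o_def)
  moreover have "x = 0" if "x \<notin> range Suc" for x using that not0_implies_Suc by blast
  ultimately show ?thesis
    using assms(1) by (subst has_sum_cong_neutral[where T = "range Suc" and g = f]) auto
qed

text \<open>In the limit formula for Digamma the logarithms cancel in the difference. Absolute
  convergence comes from the product 1/((n + z)(n + z')), estimated by the two squares.\<close>

lemma has_sum_digamma_diff:
  fixes z z' :: complex
  assumes "z \<notin> \<int>\<^sub>\<le>\<^sub>0" "z' \<notin> \<int>\<^sub>\<le>\<^sub>0"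
  shows "((\<lambda>n. 1 / (of_nat n + z) - 1 / (of_nat n + z')) has_sum (Digamma z' - Digamma z)) UNIV"
proof (rule norm_summable_imp_has_sum)
  have nz: "of_nat n + z \<noteq> 0" "of_nat n + z' \<noteq> 0" for n
    using assms by (metis add_diff_cancel_left' diff_0 minus_of_nat_in_nonpos_Ints)+
  show "summable (\<lambda>n. norm (1 / (of_nat n + z) - 1 / (of_nat n + z')))"
  proof (rule summable_comparison_test)
    show "summable (\<lambda>n. norm (z' - z) * (norm (1 / (of_nat n + z) ^ 2) + norm (1 / (of_nat n + z') ^ 2)))"
      by (intro summable_mult summable_add summable_norm_inverse_shift_power) auto
    have "norm (norm (1 / (of_nat n + z) - 1 / (of_nat n + z'))) \<le>
        norm (z' - z) * (norm (1 / (of_nat n + z) ^ 2) + norm (1 / (of_nat n + z') ^ 2))" for n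
    proof -
      have "1 / (of_nat n + z) - 1 / (of_nat n + z') = (z' - z) * ((1 / (of_nat n + z)) * (1 / (of_nat n + z')))"
        using nz by (simp add: divide_simps)
      hence "norm (1 / (of_nat n + z) - 1 / (of_nat n + z')) =
          norm (z' - z) * (norm (1 / (of_nat n + z)) * norm (1 / (of_nat n + z')))"
        by (simp only: norm_mult)
      also have "norm (1 / (of_nat n + z)) * norm (1 / (of_nat n + z')) \<le>
          norm (1 / (of_nat n + z)) ^ 2 + norm (1 / (of_nat n + z')) ^ 2"
        using sum_squares_bound[of "norm (1 / (of_nat n + z))" "norm (1 / (of_nat n + z'))"]
          mult_nonneg_nonneg[OF norm_ge_zero norm_ge_zero, of "1 / (of_nat n + z)" "1 / (of_nat n + z')"]
        unfolding mult.assoc by linarith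
      finally show ?thesis by (simp add: mult_left_mono norm_divide norm_power power_divide)
    qed
    thus "\<exists>N. \<forall>n\<ge>N. norm (norm (1 / (of_nat n + z) - 1 / (of_nat n + z'))) \<le>
        norm (z' - z) * (norm (1 / (of_nat n + z) ^ 2) + norm (1 / (of_nat n + z') ^ 2))" by blast
  qed
  have "z \<noteq> 0" "z' \<noteq> 0" using nz[of 0] by auto
  hence "(\<lambda>m. (of_real (ln (real m)) - (\<Sum>n<m. inverse (z' + of_nat n))) - (of_real (ln (real m)) - (\<Sum>n<m. inverse (z + of_nat n))))
       \<longlonglongrightarrow> Digamma z' - Digamma z"
    by (intro tendsto_diff Digamma_LIMSEQ)
  thus "(\<lambda>n. 1 / (of_nat n + z) - 1 / (of_nat n + z')) sums (Digamma z' - Digamma z)"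
    by (simp add: sums_def sum_subtractf inverse_eq_divide add.commute)
qed

text \<open>This is pi cot(pi z) - 1/z in a form that is also meaningful at z = 0, where the columns
  m = 0 and m = -1 of the lattice need it.\<close>

definition cot_reg :: "complex \<Rightarrow> complex" where
  "cot_reg z = Digamma (1 - z) - Digamma (1 + z)"

lemma has_sum_cot_reg_diff:
  assumes "z \<notin> \<int> - {0}" "z' \<notin> \<int> - {0}"
  shows "((\<lambda>n::int. if n = 0 then 0 else 1 / (of_int n + z) - 1 / (of_int n + z')) has_sum (cot_reg z - cot_reg z')) UNIV"
proof -
  have ni: "1 + z \<notin> \<int>\<^sub>\<le>\<^sub>0 \<and> 1 - z \<notin> \<int>\<^sub>\<le>\<^sub>0" if "z \<notin> \<int> - {0}" for z :: complex
  proof (cases "z = 0")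
    case False
    hence zz: "z \<notin> \<int>" using that by auto
    hence "- z \<notin> \<int>" by simp
    from Ints_nonpos_aux(2)[OF this] Ints_nonpos_aux(2)[OF zz] show ?thesis by simp
  qed auto
  define f where "f = (\<lambda>n::int. if n = 0 then 0 else 1 / (of_int n + z) - 1 / (of_int n + z'))"
  have "((\<lambda>n. 1 / (of_nat n + (1 + z)) - 1 / (of_nat n + (1 + z'))) has_sum (Digamma (1 + z') - Digamma (1 + z))) UNIV"
    by (intro has_sum_digamma_diff) (use ni assms in auto)
  moreover have "f (int (Suc n)) = 1 / (of_nat n + (1 + z)) - 1 / (of_nat n + (1 + z'))" for n
  proof -
    have "of_int (int (Suc n)) + w = of_nat n + (1 + w)" for w :: complex by simp
    thus ?thesis by (simp only: f_def) simp
  qed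
  ultimately have "((\<lambda>n. f (int (Suc n))) has_sum (Digamma (1 + z') - Digamma (1 + z))) UNIV" by (simp only:)
  hence 1: "((\<lambda>n. f (int n)) has_sum (Digamma (1 + z') - Digamma (1 + z))) UNIV"
    by (rule has_sum_Suc_shift[where f = "\<lambda>n. f (int n)", rotated]) (simp add: f_def)
  have "((\<lambda>n. - (1 / (of_nat n + (1 - z)) - 1 / (of_nat n + (1 - z')))) has_sum - (Digamma (1 - z') - Digamma (1 - z))) UNIV"
    by (intro has_sum_uminusI has_sum_digamma_diff) (use ni assms in auto)
  also have "(\<lambda>n. - (1 / (of_nat n + (1 - z)) - 1 / (of_nat n + (1 - z')))) = (\<lambda>n. f (- 1 - int n))"
  proof
    fix n
    have neg: "- (1 / w) = 1 / (- w)" for w :: complex by simp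
    have "- (1 / (of_nat n + (1 - z)) - 1 / (of_nat n + (1 - z'))) =
      1 / - (of_nat n + (1 - z)) - 1 / - (of_nat n + (1 - z'))" by (simp only: neg [symmetric]) simp
    also have "\<dots> = f (- 1 - int n)" by (simp add: f_def algebra_simps)
    finally show "- (1 / (of_nat n + (1 - z)) - 1 / (of_nat n + (1 - z'))) = f (- 1 - int n)" .
  qed
  finally have "((\<lambda>n. f (- 1 - int n)) has_sum - (Digamma (1 - z') - Digamma (1 - z))) UNIV" .
  from has_sum_int_split[OF 1 this] show ?thesis by (simp add: f_def cot_reg_def algebra_simps)
qed

lemma cot_reg_minus: "cot_reg (- z) = - cot_reg z"
  by (simp add: cot_reg_def)

lemma cot_reg_eq: "z \<noteq> 0 \<Longrightarrow> cot_reg z = cot_deriv 0 z - 1 / z"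
  using Polygamma_plus1[of z 0] by (simp add: cot_reg_def cot_deriv_def add.commute)

definition row2 :: "complex \<Rightarrow> complex" where
  "row2 z = infsum (\<lambda>m::int. 1 / (of_int m + z) ^ 2) UNIV"

lemma row2_has_sum: "((\<lambda>m::int. 1 / (of_int m + z) ^ 2) has_sum row2 z) UNIV"
  unfolding row2_def using has_sum_inverse_power_int[of 2 z] has_sum_imp_summable has_sum_infsum by blast

lemma row2_minus: "row2 (- z) = row2 z"
  using row_sum_minus[of 2 z] by (simp add: row2_def)

text \<open>Each row n > 0 is a Lipschitz sum of weight 2 with factor (2 pi i)^2 = -4 pi^2; the rows
  -n double it.\<close>

lemma row2_lambert_has_sum:
  assumes "Im \<tau> > 0"
  shows "((\<lambda>n::int. if n = 0 then 0 else row2 (of_int n * \<tau>)) has_sum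
           (- 8 * of_real pi ^ 2 * lambert 1 (qexp \<tau>))) UNIV"
proof -
  define q where "q = qexp \<tau>"
  have q: "norm q < 1" unfolding q_def by (intro norm_qexp_less_1 assms)
  have row: "row2 (of_nat n * \<tau>) = - 4 * of_real pi ^ 2 * eval_fps (powsum_fps 1) (q ^ n)" if "n \<ge> 1" for n
    unfolding row2_def using lipschitz_formula[of "of_nat n * \<tau>" 2] assms that
    by (intro infsumI) (simp add: q_def qexp_of_nat_mult power_mult_distrib)
  have "((\<lambda>n. infsum (\<lambda>d. of_nat d ^ 1 * q ^ (n * d)) {1..}) has_sum lambert 1 q) {1..}"
    using has_sum_infsum[OF summable_on_Sigma_banach[OF lambert_double_summable[OF q, of 1]]]
      infsum_Sigma'_banach[OF lambert_double_summable[OF q, of 1]] infsumI[OF lambert_has_sum[OF q, of 1]] by simp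
  also have "?this \<longleftrightarrow> ((\<lambda>n. eval_fps (powsum_fps 1) (q ^ n)) has_sum lambert 1 q) {1..}"
  proof (rule has_sum_cong)
    fix n :: nat assume "n \<in> {1..}"
    hence "norm (q ^ n) < 1" using q by (auto simp: norm_power intro!: power_less_one_iff[THEN iffD2])
    from powsum_has_sum[OF this, of 1] show "infsum (\<lambda>d. of_nat d ^ 1 * q ^ (n * d)) {1..} = eval_fps (powsum_fps 1) (q ^ n)"
      by (intro infsumI) (simp add: power_mult)
  qed
  finally have "((\<lambda>n. - 4 * of_real pi ^ 2 * eval_fps (powsum_fps 1) (q ^ n)) has_sum (- 4 * of_real pi ^ 2 * lambert 1 q)) {1..}"
    by (rule has_sum_cmult_right)
  also have "?this \<longleftrightarrow> ((\<lambda>n. row2 (of_nat n * \<tau>)) has_sum (- 4 * of_real pi ^ 2 * lambert 1 q)) {1..}"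
    by (rule has_sum_cong) (use row in auto)
  finally have *: "((\<lambda>n. row2 (of_nat n * \<tau>)) has_sum (- 4 * of_real pi ^ 2 * lambert 1 q)) {1..}" .
  define f where "f = (\<lambda>n::int. if n = 0 then 0 else row2 (of_int n * \<tau>))"
  have 1: "((\<lambda>n. f (int n)) has_sum (- 4 * of_real pi ^ 2 * lambert 1 q)) UNIV"
    using * by (rule has_sum_cong_neutral[THEN iffD1, rotated -1]) (auto simp: f_def)
  have "((\<lambda>n. row2 (of_nat (Suc n) * \<tau>)) has_sum (- 4 * of_real pi ^ 2 * lambert 1 q)) UNIV"
    using * by (subst (asm) has_sum_reindex_bij_witness[of "{1..}" Suc "\<lambda>n. n - 1" UNIV "\<lambda>n. row2 (of_nat (Suc n) * \<tau>)"]) auto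
  also have "(\<lambda>n. row2 (of_nat (Suc n) * \<tau>)) = (\<lambda>n. f (- 1 - int n))"
  proof
    fix n
    have "of_int (- 1 - int n) * \<tau> = - (of_nat (Suc n) * \<tau>)" by (simp add: algebra_simps)
    thus "row2 (of_nat (Suc n) * \<tau>) = f (- 1 - int n)" by (simp only: f_def row2_minus) simp
  qed
  finally have "((\<lambda>n. f (- 1 - int n)) has_sum (- 4 * of_real pi ^ 2 * lambert 1 q)) UNIV" .
  from has_sum_int_split[OF 1 this] show ?thesis by (simp add: f_def q_def mult_ac)
qed

text \<open>Along a row the subtracted differences g(m) - g(m + 1) telescope, and g tends to 0 at
  both ends; only the sum of the squares survives.\<close>

lemma lattice_corr_row:
  assumes "Im \<tau> > 0"
  shows "((\<lambda>m. lattice_corr \<tau> m n) has_sum (if n = 0 then 0 else row2 (of_int n * \<tau>))) UNIV"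
proof (cases "n = 0")
  case True thus ?thesis by (simp add: lattice_corr_def)
next
  case False
  define z where "z = of_int n * \<tau>"
  define g where "g = (\<lambda>m::int. 1 / (of_int m + z))"
  have c: "lattice_corr \<tau> m n = 1 / (of_int m + z) ^ 2 - (g m - g (m + 1))" for m
    using False by (simp add: lattice_corr_def g_def z_def add_ac)
  have sg: "(\<lambda>m. lattice_corr \<tau> m n) summable_on UNIV"
  proof -
    have "(\<lambda>(n, m). lattice_corr \<tau> m n) summable_on (UNIV \<times> UNIV)"
      using lattice_corr_summable[OF assms] by (subst summable_on_swap) simp
    from summable_on_SigmaD1[OF this UNIV_I] show ?thesis .
  qed
  hence "(\<lambda>m. 1 / (of_int m + z) ^ 2 - lattice_corr \<tau> m n) summable_on UNIV"
    using summable_on_add[OF has_sum_imp_summable[OF row2_has_sum[of z]] summable_on_uminus[THEN iffD2, OF sg]] by simp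
  hence "(\<lambda>m. g m - g (m + 1)) summable_on UNIV" by (simp add: c)
  then obtain s where s: "((\<lambda>m. g m - g (m + 1)) has_sum s) UNIV" unfolding summable_on_def by blast
  have g0: "(\<lambda>M. g (int M)) \<longlonglongrightarrow> 0" "(\<lambda>M. g (- int M)) \<longlonglongrightarrow> 0"
  proof -
    have l: "(\<lambda>M. 1 / (of_nat M + z)) \<longlonglongrightarrow> 0" for z :: complex
    proof (rule tendsto_divide_0[OF tendsto_const], unfold filterlim_at_infinity_conv_norm_at_top, rule filterlim_at_top_mono)
      show "filterlim (\<lambda>M. real M - norm z) at_top sequentially" by real_asymp
      show "\<forall>\<^sub>F M in sequentially. real M - norm z \<le> norm (of_nat M + z)"
        using norm_diff_ineq[of "of_nat _ :: complex" z] by (intro always_eventually) simp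
    qed
    from l[of z] show "(\<lambda>M. g (int M)) \<longlonglongrightarrow> 0" by (simp add: g_def)
    have "g (- int M) = - (1 / (of_nat M + (- z)))" for M
    proof -
      have "1 / (- of_nat M + z) = 1 / (- (of_nat M + (- z)))" by simp
      thus ?thesis by (simp only: g_def minus_divide_right of_int_minus of_int_of_nat_eq)
    qed
    with tendsto_minus[OF l[of "- z"]] show "(\<lambda>M. g (- int M)) \<longlonglongrightarrow> 0" by (simp only: minus_zero)
  qed
  have "(\<lambda>M. g (- int M) - g (int M)) \<longlonglongrightarrow> s"
    using has_sum_int_imp_tendsto_symmetric[OF s] by (simp only: sum_telescope_int)
  moreover have "(\<lambda>M. g (- int M) - g (int M)) \<longlonglongrightarrow> 0 - 0" by (intro tendsto_diff g0)
  ultimately have "s = 0" using LIMSEQ_unique by force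
  have eq: "lattice_corr \<tau> m n = 1 / (of_int m + z) ^ 2 + - (g m - g (m + 1))" for m by (simp add: c)
  have "((\<lambda>m. lattice_corr \<tau> m n) has_sum (row2 z + - s)) UNIV"
    unfolding eq by (intro has_sum_add row2_has_sum has_sum_uminusI s)
  thus ?thesis using False \<open>s = 0\<close> by (simp add: z_def)
qed

lemma row_sum_0_2: "((\<lambda>m::int. 1 / of_int m ^ 2) has_sum (of_real pi ^ 2 / 3 :: complex)) UNIV"
proof -
  have e: "2 / fact (2 - 1) * Polygamma (2 - 1) (1::complex) = of_real pi ^ 2 / 3"
    using Polygamma_1_at_1 by (simp add: mult.commute)
  show ?thesis by (rule row_sum_0[of 2, unfolded e]) auto
qed

text \<open>Taking out \<tau> turns column m into a sum over n of terms in n + m/\<tau>. The absent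
  term n = 0 is subtracted from \<open>row2\<close>, and the difference of first powers now leaves a
  cotangent difference, which does not vanish.\<close>

lemma lattice_corr_column:
  fixes m :: int
  assumes "Im \<tau> > 0"
  shows "((\<lambda>n. lattice_corr \<tau> m n) has_sum
      ((if m = 0 then of_real pi ^ 2 / 3 else row2 (of_int m / \<tau>) - \<tau> ^ 2 / of_int m ^ 2) / \<tau> ^ 2
         - (cot_reg (of_int m / \<tau>) - cot_reg (of_int (m + 1) / \<tau>)) / \<tau>)) UNIV"
proof -
  have t0: "\<tau> \<noteq> 0" using assms by auto
  have ni: "of_int m / \<tau> \<notin> \<int> - {0}" for m
  proof (cases "m = 0")
    case False
    have "Im (of_int m / \<tau>) = - real_of_int m * Im \<tau> / (norm \<tau>)\<^sup>2"
      by (simp add: Im_divide cmod_power2)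
    also have "\<dots> \<noteq> 0" using False assms t0 by simp
    finally show ?thesis using not_Ints_if_Im by blast
  qed simp
  define z where "z = of_int m / \<tau>"
  define z' where "z' = of_int (m + 1) / \<tau>"
  define a where "a = (if m = 0 then of_real pi ^ 2 / 3 else row2 z - \<tau> ^ 2 / of_int m ^ 2)"
  have 1: "((\<lambda>n::int. if n = 0 then 0 else 1 / (of_int n + z) ^ 2) has_sum a) UNIV"
  proof (cases "m = 0")
    case True
    have "((\<lambda>m::int. 1 / of_int m ^ 2) has_sum (of_real pi ^ 2 / 3 :: complex)) UNIV"
      by (rule row_sum_0_2)
    also have "(\<lambda>n::int. 1 / of_int n ^ 2) = (\<lambda>n::int. if n = 0 then 0 else 1 / (of_int n + z) ^ 2)"
      using True by (auto simp: z_def)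
    finally show ?thesis using True by (simp add: a_def)
  next
    case False
    have "((\<lambda>n::int. if n = 0 then - (1 / z ^ 2) else 0) has_sum (- (1 / z ^ 2))) UNIV"
      by (rule has_sum_finite_neutralI[of "{0}"]) auto
    from has_sum_add[OF row2_has_sum[of z] this]
    have "((\<lambda>n::int. if n = 0 then 0 else 1 / (of_int n + z) ^ 2) has_sum (row2 z + - (1 / z ^ 2))) UNIV"
      by (rule has_sum_cong[THEN iffD1, rotated]) auto
    thus ?thesis using False t0 by (simp add: a_def z_def power_divide)
  qed
  have 2: "((\<lambda>n::int. if n = 0 then 0 else 1 / (of_int n + z) - 1 / (of_int n + z')) has_sum (cot_reg z - cot_reg z')) UNIV"
    unfolding z_def z'_def by (rule has_sum_cot_reg_diff ni)+
  have "((\<lambda>n::int. (1 / \<tau> ^ 2) * (if n = 0 then 0 else 1 / (of_int n + z) ^ 2) +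
      - ((1 / \<tau>) * (if n = 0 then 0 else 1 / (of_int n + z) - 1 / (of_int n + z')))) has_sum
      ((1 / \<tau> ^ 2) * a + - ((1 / \<tau>) * (cot_reg z - cot_reg z')))) UNIV"
    by (intro has_sum_add has_sum_cmult_right 1 2 has_sum_uminusI)
  also have "(\<lambda>n::int. (1 / \<tau> ^ 2) * (if n = 0 then 0 else 1 / (of_int n + z) ^ 2) +
      - ((1 / \<tau>) * (if n = 0 then 0 else 1 / (of_int n + z) - 1 / (of_int n + z')))) = (\<lambda>n. lattice_corr \<tau> m n)"
  proof
    fix n :: int
    have e: "of_int m + of_int n * \<tau> = \<tau> * (of_int n + z)" "of_int m + 1 + of_int n * \<tau> = \<tau> * (of_int n + z')"
      using t0 by (simp_all add: z_def z'_def field_simps)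
    show "(1 / \<tau> ^ 2) * (if n = 0 then 0 else 1 / (of_int n + z) ^ 2) +
      - ((1 / \<tau>) * (if n = 0 then 0 else 1 / (of_int n + z) - 1 / (of_int n + z'))) = lattice_corr \<tau> m n"
      unfolding lattice_corr_def e by (simp add: power_mult_distrib diff_divide_distrib mult_ac)
  qed
  moreover have "(1 / \<tau> ^ 2) * a + - ((1 / \<tau>) * (cot_reg z - cot_reg z')) = a / \<tau> ^ 2 - (cot_reg z - cot_reg z') / \<tau>"
    by simp
  ultimately show ?thesis unfolding a_def z_def z'_def by (simp only:)
qed

text \<open>Along the ray of w the cotangent of pi z tends to -i and 1/z tends to 0.\<close>

lemma cot_reg_limit:
  assumes "Im w > 0"
  shows "(\<lambda>M. cot_reg (of_nat M * w)) \<longlonglongrightarrow> - of_real pi * \<i>"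
proof -
  have w0: "w \<noteq> 0" using assms by auto
  have q: "norm (qexp w) < 1" by (intro norm_qexp_less_1 assms)
  have qM: "(\<lambda>M. qexp w ^ M) \<longlonglongrightarrow> 0" by (rule LIMSEQ_power_zero[OF q])
  have "isCont (eval_fps (powsum_fps 0)) 0"
    by (rule continuous_eval_fps) (use norm_less_conv_radius_1[OF fps_conv_radius_powsum, of 0] in simp)
  hence "(\<lambda>M. eval_fps (powsum_fps 0) (qexp w ^ M)) \<longlonglongrightarrow> eval_fps (powsum_fps 0) 0"
    using qM by (rule isCont_tendsto_compose)
  hence e: "(\<lambda>M. eval_fps (powsum_fps 0) (qexp w ^ M)) \<longlonglongrightarrow> 0"
    by (simp add: eval_fps_at_0 powsum_fps_def)
  have i: "(\<lambda>M. 1 / of_nat M * (1 / w)) \<longlonglongrightarrow> 0 * (1 / w)" by (intro tendsto_mult lim_1_over_n tendsto_const)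
  have "(\<lambda>M. (- of_real pi * \<i> - 2 * of_real pi * \<i> * eval_fps (powsum_fps 0) (qexp w ^ M)) - 1 / of_nat M * (1 / w))
       \<longlonglongrightarrow> (- of_real pi * \<i> - 2 * of_real pi * \<i> * 0) - 0 * (1 / w)"
    by (intro tendsto_intros e i)
  moreover have "\<forall>\<^sub>F M in sequentially. (- of_real pi * \<i> - 2 * of_real pi * \<i> * eval_fps (powsum_fps 0) (qexp w ^ M)) - 1 / of_nat M * (1 / w)
     = cot_reg (of_nat M * w)"
    using eventually_gt_at_top[of 0]
    by eventually_elim (use assms w0 in \<open>simp add: cot_reg_eq cot_deriv_0_qexp qexp_of_nat_mult\<close>)
  ultimately show ?thesis by (simp add: filterlim_cong Lim_transform_eventually)
qed

text \<open>The transformation of E_2. The absolutely convergent sum S is evaluated by rows and by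
  columns. By rows the correction contributes nothing; by columns it telescopes to k(-M) - k(M),
  whose limit -2 pi i produces the anomalous term.\<close>

theorem lambert_1_S:
  assumes "Im \<tau> > 0"
  shows "1 - 24 * lambert 1 (qexp (- 1 / \<tau>)) = \<tau> ^ 2 * (1 - 24 * lambert 1 (qexp \<tau>)) - 6 * \<i> * \<tau> / of_real pi"
proof -
  define w where "w = - 1 / \<tau>"
  have t0: "\<tau> \<noteq> 0" using assms by auto
  have Iw: "Im w > 0" using assms by (simp add: w_def Im_divide sum_power2_gt_zero_iff)
  define S where "S = infsum (\<lambda>(m, n). lattice_corr \<tau> m n) (UNIV \<times> UNIV)"
  define a where "a = (\<lambda>m::int. (if m = 0 then of_real pi ^ 2 / 3 else row2 (of_int m / \<tau>) - \<tau> ^ 2 / of_int m ^ 2) :: complex)"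
  define k where "k = (\<lambda>m::int. cot_reg (of_int m / \<tau>))"
  have sm: "(\<lambda>(m, n). lattice_corr \<tau> m n) summable_on (UNIV \<times> UNIV)" by (rule lattice_corr_summable[OF assms])
  have hs: "((\<lambda>(m, n). lattice_corr \<tau> m n) has_sum S) (UNIV \<times> UNIV)"
    unfolding S_def by (rule has_sum_infsum[OF sm])
  hence hs': "((\<lambda>(n, m). lattice_corr \<tau> m n) has_sum S) (UNIV \<times> UNIV)"
    by (subst has_sum_swap) simp
  have "((\<lambda>n::int. if n = 0 then 0 else row2 (of_int n * \<tau>)) has_sum S) UNIV"
    by (rule has_sum_SigmaD[OF hs']) (use lattice_corr_row[OF assms] in auto)
  with row2_lambert_has_sum[OF assms] have S1: "S = - 8 * of_real pi ^ 2 * lambert 1 (qexp \<tau>)"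
    using has_sum_unique by blast
  have col: "((\<lambda>m. a m / \<tau> ^ 2 - (k m - k (m + 1)) / \<tau>) has_sum S) UNIV"
    unfolding a_def k_def by (rule has_sum_SigmaD[OF hs]) (use lattice_corr_column[OF assms] in auto)
  have asum: "(a has_sum (- 8 * of_real pi ^ 2 * lambert 1 (qexp w) + - (\<tau> ^ 2 * (of_real pi ^ 2 / 3)) + of_real pi ^ 2 / 3)) UNIV"
  proof -
    have 1: "((\<lambda>m::int. 1 / of_int m ^ 2) has_sum (of_real pi ^ 2 / 3 :: complex)) UNIV"
      by (rule row_sum_0_2)
    have 2: "((\<lambda>m::int. if m = 0 then of_real pi ^ 2 / 3 else 0) has_sum (of_real pi ^ 2 / 3 :: complex)) UNIV"
      by (rule has_sum_finite_neutralI[of "{0}"]) auto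
    have "((\<lambda>m::int. (if m = 0 then 0 else row2 (of_int m * w)) + - (\<tau> ^ 2 * (1 / of_int m ^ 2)) + (if m = 0 then of_real pi ^ 2 / 3 else 0)) has_sum
       (- 8 * of_real pi ^ 2 * lambert 1 (qexp w) + - (\<tau> ^ 2 * (of_real pi ^ 2 / 3)) + of_real pi ^ 2 / 3)) UNIV"
      by (intro has_sum_add row2_lambert_has_sum Iw has_sum_uminusI has_sum_cmult_right 1 2)
    moreover have "(\<lambda>m::int. (if m = 0 then 0 else row2 (of_int m * w)) + - (\<tau> ^ 2 * (1 / of_int m ^ 2)) + (if m = 0 then of_real pi ^ 2 / 3 else 0)) = a"
      using row2_minus[of "of_int _ / \<tau>"] by (auto simp: a_def w_def)
    ultimately show ?thesis by simp
  qed
  have lim1: "(\<lambda>M. (\<Sum>m\<in>{- int M..<int M}. a m) / \<tau> ^ 2 - (k (- int M) - k (int M)) / \<tau>) \<longlonglongrightarrow> S"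
    using has_sum_int_imp_tendsto_symmetric[OF col]
    by (simp add: sum_subtractf sum_divide_distrib [symmetric] sum_telescope_int[symmetric])
  have kk: "k (- int M) - k (int M) = 2 * cot_reg (of_nat M * w)" for M
  proof -
    have "of_int (- int M) / \<tau> = of_nat M * w" "of_int (int M) / \<tau> = - (of_nat M * w)" by (simp_all add: w_def)
    thus ?thesis unfolding k_def by (simp only: cot_reg_minus) simp
  qed
  have "(\<lambda>M. (\<Sum>m\<in>{- int M..<int M}. a m) / \<tau> ^ 2 - (2 * cot_reg (of_nat M * w)) / \<tau>) \<longlonglongrightarrow>
     (- 8 * of_real pi ^ 2 * lambert 1 (qexp w) + - (\<tau> ^ 2 * (of_real pi ^ 2 / 3)) + of_real pi ^ 2 / 3) / \<tau> ^ 2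
       - (2 * (- of_real pi * \<i>)) / \<tau>"
    by (intro tendsto_intros has_sum_int_imp_tendsto_symmetric[OF asum] cot_reg_limit Iw) (use t0 in auto)
  with lim1 have "S = (- 8 * of_real pi ^ 2 * lambert 1 (qexp w) + - (\<tau> ^ 2 * (of_real pi ^ 2 / 3)) + of_real pi ^ 2 / 3) / \<tau> ^ 2
       - (2 * (- of_real pi * \<i>)) / \<tau>" unfolding kk using LIMSEQ_unique by blast
  hence "S * \<tau> ^ 2 =
    - 8 * of_real pi ^ 2 * lambert 1 (qexp w) + - (\<tau> ^ 2 * (of_real pi ^ 2 / 3)) + of_real pi ^ 2 / 3 + 2 * of_real pi * \<i> * \<tau>"
    using t0 by (simp add: field_simps power2_eq_square)
  moreover have "1 - 24 * L' = t ^ 2 * (1 - 24 * L) - 6 * \<i> * t / p"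
    if "- 8 * p ^ 2 * L * t ^ 2 = - 8 * p ^ 2 * L' + - (t ^ 2 * (p ^ 2 / 3)) + p ^ 2 / 3 + 2 * p * \<i> * t" "p \<noteq> 0"
    for p L L' t :: complex
  proof -
    have "p ^ 2 * (t ^ 2 * (1 - 24 * L) - 6 * \<i> * t / p) = p ^ 2 * t ^ 2 + 3 * (- 8 * p ^ 2 * L * t ^ 2) - 6 * \<i> * t * p"
      using that(2) by (simp add: field_simps power2_eq_square)
    also have "\<dots> = p ^ 2 * (1 - 24 * L')" unfolding that(1) by (simp add: algebra_simps)
    finally show ?thesis using that(2) by (subst (asm) mult_cancel_left) auto
  qed
  ultimately show ?thesis unfolding S1 w_def by simp
qed

section \<open>The Euler product and the discriminant\<close>

definition euler_phi :: "complex \<Rightarrow> complex" where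
  "euler_phi q = (\<Prod>n. 1 - q ^ Suc n)"

lemma euler_phi_convergent:
  assumes "norm (q::complex) < 1"
  shows "convergent_prod (\<lambda>n. 1 - q ^ Suc n)"
proof (rule abs_convergent_prod_imp_convergent_prod, rule summable_imp_abs_convergent_prod)
  have "summable (\<lambda>n. norm q * norm q ^ n)" using assms by (intro summable_mult summable_geometric) simp
  thus "summable (\<lambda>i. norm (1 - q ^ Suc i - 1))" by (simp add: norm_mult norm_power)
qed

lemma one_minus_power_nonzero: "norm (q::complex) < 1 \<Longrightarrow> 1 - q ^ Suc n \<noteq> 0"
proof
  assume q: "norm q < 1" and "1 - q ^ Suc n = 0"
  hence "norm (q ^ Suc n) = 1" by simp
  moreover have "norm (q ^ Suc n) < 1" unfolding norm_power using q by (intro power_less_one_iff[THEN iffD2]) auto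
  ultimately show False by simp
qed

lemma euler_phi_nonzero: "norm q < 1 \<Longrightarrow> euler_phi q \<noteq> 0"
  unfolding euler_phi_def by (intro prodinf_nonzero euler_phi_convergent one_minus_power_nonzero)

lemma euler_phi_uniform_limit:
  assumes "0 \<le> r" "r < 1"
  shows "uniform_limit (cball 0 r) (\<lambda>n q. \<Prod>k<n. 1 - q ^ Suc k) euler_phi sequentially"
proof -
  have "uniformly_convergent_on (cball 0 r) (\<lambda>n q. \<Prod>k<n. 1 - q ^ Suc k :: complex)"
  proof (rule uniformly_convergent_on_prod')
    show "uniformly_convergent_on (cball 0 r) (\<lambda>N x. \<Sum>n<N. norm (1 - x ^ Suc n - 1 :: complex))"
    proof (rule Weierstrass_m_test')
      show "summable (\<lambda>n. r * r ^ n)" using assms by (intro summable_mult summable_geometric) simp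
      fix n :: nat and x :: complex assume "x \<in> cball 0 r"
      hence "norm x ^ Suc n \<le> r ^ Suc n" by (intro power_mono) auto
      thus "norm (norm (1 - x ^ Suc n - 1)) \<le> r * r ^ n" by (simp add: norm_mult norm_power)
    qed
  qed (auto intro!: continuous_intros)
  hence "uniform_limit (cball 0 r) (\<lambda>n q. \<Prod>k<n. 1 - q ^ Suc k :: complex) (\<lambda>q. lim (\<lambda>n. \<Prod>k<n. 1 - q ^ Suc k)) sequentially"
    by (simp only: uniformly_convergent_uniform_limit_iff)
  also have "?this \<longleftrightarrow> ?thesis"
  proof (rule uniform_limit_cong')
    fix q :: complex assume "q \<in> cball 0 r"
    hence "norm q < 1" using assms by simp
    hence "(\<lambda>n. 1 - q ^ Suc n) has_prod euler_phi q"
      unfolding euler_phi_def by (intro convergent_prod_has_prod euler_phi_convergent)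
    from has_prod_imp_tendsto'[OF this] show "lim (\<lambda>n. \<Prod>k<n. 1 - q ^ Suc k) = euler_phi q" by (rule limI)
  qed auto
  finally show ?thesis .
qed

lemma euler_phi_holomorphic: "euler_phi holomorphic_on ball 0 1"
proof (rule holomorphic_uniform_sequence)
  fix x :: complex assume x: "x \<in> ball 0 1"
  define d where "d = (1 - norm x) / 2"
  have d: "d > 0" "cball x d \<subseteq> cball 0 (norm x + d)" "norm x + d < 1"
  proof -
    show "d > 0" "norm x + d < 1" using x by (auto simp: d_def field_simps)
    show "cball x d \<subseteq> cball 0 (norm x + d)"
    proof
      fix y assume "y \<in> cball x d"
      thus "y \<in> cball 0 (norm x + d)" using norm_triangle_sub[of y x] by (simp add: dist_norm norm_minus_commute)
    qed
  qed
  have "uniform_limit (cball x d) (\<lambda>n q. \<Prod>k<n. 1 - q ^ Suc k) euler_phi sequentially"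
    by (rule uniform_limit_on_subset[OF euler_phi_uniform_limit d(2)]) (use d in auto)
  moreover have "cball x d \<subseteq> ball 0 1" using d by fastforce
  ultimately show "\<exists>d>0. cball x d \<subseteq> ball 0 1 \<and> uniform_limit (cball x d) (\<lambda>n q. \<Prod>k<n. 1 - q ^ Suc k) euler_phi sequentially"
    using d by blast
qed (auto intro!: holomorphic_intros)

lemma euler_phi_0 [simp]: "euler_phi 0 = 1"
  by (simp add: euler_phi_def)

lemma geometric_has_sum:
  assumes "norm (x::complex) < 1"
  shows "((\<lambda>n. x ^ n) has_sum (x / (1 - x))) {1..}"
proof -
  have 1: "((\<lambda>n. x ^ Suc n) has_sum (x / (1 - x))) UNIV"
  proof (rule norm_summable_imp_has_sum)
    show "summable (\<lambda>n. norm (x ^ Suc n))"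
      using summable_mult[OF summable_geometric[of "norm x"], of "norm x"] assms by (simp add: norm_mult norm_power)
    show "(\<lambda>n. x ^ Suc n) sums (x / (1 - x))"
      using sums_mult[OF geometric_sums[OF assms], of x] by simp
  qed
  thus ?thesis
    by (subst (asm) has_sum_reindex_bij_witness[of UNIV "\<lambda>n. n - 1" Suc "{1..}" "\<lambda>n. x ^ n"]) auto
qed

text \<open>Summing the double series over n first gives geometric series. This is the shape in
  which the logarithmic derivative of the Euler product appears.\<close>

lemma lambert_1_sums:
  assumes "norm (q::complex) < 1"
  shows "(\<lambda>k. of_nat (Suc k) * q ^ Suc k / (1 - q ^ Suc k)) sums lambert 1 q"
proof -
  have "((\<lambda>(n, d). of_nat d ^ 1 * q ^ (n * d)) has_sum lambert 1 q) ({1..} \<times> {1..})"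
    by (rule lambert_has_sum[OF assms])
  hence "((\<lambda>(d, n). of_nat d * q ^ (n * d)) has_sum lambert 1 q) ({1..} \<times> {1..})"
    by (subst has_sum_swap) simp
  hence "((\<lambda>d. of_nat d * (q ^ d / (1 - q ^ d))) has_sum lambert 1 q) {1..}"
  proof (rule has_sum_SigmaD)
    fix d :: nat assume "d \<in> {1..}"
    hence "norm (q ^ d) < 1" using assms by (auto simp: norm_power intro!: power_less_one_iff[THEN iffD2])
    from has_sum_cmult_right[OF geometric_has_sum[OF this], of "of_nat d"]
    show "((\<lambda>n. case (d, n) of (d, n) \<Rightarrow> of_nat d * q ^ (n * d)) has_sum of_nat d * (q ^ d / (1 - q ^ d))) {1..}"
      by (simp add: power_mult [symmetric] mult.commute)
  qed
  hence "((\<lambda>k. of_nat (Suc k) * q ^ Suc k / (1 - q ^ Suc k)) has_sum lambert 1 q) UNIV"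
    by (subst (asm) has_sum_reindex_bij_witness[of "{1..}" Suc "\<lambda>n. n - 1" UNIV "\<lambda>k. of_nat (Suc k) * q ^ Suc k / (1 - q ^ Suc k)"]) auto
  thus ?thesis by (rule has_sum_imp_sums)
qed

lemma euler_phi_logderiv:
  assumes "norm q < 1"
  shows "q * deriv euler_phi q = - euler_phi q * lambert 1 q"
proof -
  define r where "r = (norm q + 1) / 2"
  have r: "norm q < r" "r < 1" "0 \<le> r" using assms by (auto simp: r_def)
  have nz: "euler_phi q \<noteq> 0" by (rule euler_phi_nonzero[OF assms])
  have "(\<lambda>k. deriv (\<lambda>q. 1 - q ^ Suc k) q / (1 - q ^ Suc k)) sums (deriv euler_phi q / euler_phi q)"
  proof (rule logderiv_prodinf_complex_uniform_limit)
    show "uniform_limit (ball 0 r) (\<lambda>n x. \<Prod>k<n. 1 - x ^ Suc k) euler_phi sequentially"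
      by (rule uniform_limit_on_subset[OF euler_phi_uniform_limit]) (use r in auto)
  qed (use r nz in \<open>auto intro!: holomorphic_intros\<close>)
  moreover have "deriv (\<lambda>q. 1 - q ^ Suc k) q = - (of_nat (Suc k) * q ^ k)" for k
    by (rule DERIV_imp_deriv) (auto intro!: derivative_eq_intros simp del: power_Suc)
  ultimately have "(\<lambda>k. - (of_nat (Suc k) * q ^ k) / (1 - q ^ Suc k)) sums (deriv euler_phi q / euler_phi q)" by simp
  from sums_mult[OF this, of "- q"]
  have "(\<lambda>k. of_nat (Suc k) * q ^ Suc k / (1 - q ^ Suc k)) sums (- q * (deriv euler_phi q / euler_phi q))"
    by (simp add: mult_ac)
  from sums_unique2[OF lambert_1_sums[OF assms] this] show ?thesis using nz by simp
qed

text \<open>The discriminant without the factor (2 pi)^12, so that its first coefficient is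
  1.\<close>

definition disc_q :: "complex \<Rightarrow> complex" where "disc_q q = q * euler_phi q ^ 24"

definition Delta :: "complex \<Rightarrow> complex" where "Delta \<tau> = disc_q (qexp \<tau>)"

lemma dedekind_eta_altdef: "dedekind_eta \<tau> = exp (2 * of_real pi * \<i> * \<tau> / 24) * euler_phi (qexp \<tau>)"
  by (simp add: dedekind_eta_def euler_phi_def qexp_def)

lemma dedekind_eta_power_24: "dedekind_eta \<tau> ^ 24 = Delta \<tau>"
proof -
  have "exp (2 * of_real pi * \<i> * \<tau> / 24) ^ 24 = qexp \<tau>"
    unfolding exp_of_nat_mult [symmetric] qexp_def by (simp add: mult_ac)
  thus ?thesis by (simp add: dedekind_eta_altdef power_mult_distrib Delta_def disc_q_def)
qed

lemma Delta_nonzero: "Im \<tau> > 0 \<Longrightarrow> Delta \<tau> \<noteq> 0"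
  by (simp add: Delta_def disc_q_def euler_phi_nonzero norm_qexp_less_1)

lemma Delta_plus_1 [simp]: "Delta (\<tau> + 1) = Delta \<tau>"
  by (simp add: Delta_def)

lemma Delta_has_field_derivative:
  assumes "Im \<tau> > 0"
  shows "(Delta has_field_derivative 2 * of_real pi * \<i> * (1 - 24 * lambert 1 (qexp \<tau>)) * Delta \<tau>) (at \<tau>)"
proof -
  define q where "q = qexp \<tau>"
  have q: "norm q < 1" unfolding q_def by (rule norm_qexp_less_1[OF assms])
  have "(euler_phi has_field_derivative deriv euler_phi q) (at q)"
    by (rule holomorphic_derivI[OF euler_phi_holomorphic]) (use q in auto)
  hence "(disc_q has_field_derivative euler_phi q ^ 24 + q * (24 * euler_phi q ^ 23 * deriv euler_phi q)) (at q)"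
    unfolding disc_q_def by (auto intro!: derivative_eq_intros)
  also have "euler_phi q ^ 24 + q * (24 * euler_phi q ^ 23 * deriv euler_phi q) =
    euler_phi q ^ 24 + 24 * euler_phi q ^ 23 * (q * deriv euler_phi q)" by simp
  also have "\<dots> = euler_phi q ^ 24 * (1 - 24 * lambert 1 q)"
    unfolding euler_phi_logderiv[OF q] by (simp add: algebra_simps eval_nat_numeral)
  finally have "(disc_q has_field_derivative euler_phi q ^ 24 * (1 - 24 * lambert 1 q)) (at (qexp \<tau>))"
    by (simp add: q_def)
  from DERIV_chain2[where f = disc_q, OF this has_field_derivative_qexp[OF DERIV_ident]]
  show ?thesis unfolding Delta_def disc_q_def q_def by (simp add: mult_ac)
qed

lemma Im_S_pos: "Im \<tau> > 0 \<Longrightarrow> Im (- 1 / \<tau>) > 0"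
  by (simp add: Im_divide sum_power2_gt_zero_iff)

text \<open>The logarithmic derivative of Delta is 2 pi i E_2, and 2 pi i times the anomaly -6 i
  \<tau> / pi of E_2 is 12 \<tau>, which is what the factor \<tau>^12 requires. So the quotient h is
  constant, and its value is read off at the fixed point i.\<close>

theorem Delta_S:
  assumes "Im \<tau> > 0"
  shows "Delta (- 1 / \<tau>) = \<tau> ^ 12 * Delta \<tau>"
proof -
  define h where "h = (\<lambda>\<tau>. Delta (- 1 / \<tau>) / (\<tau> ^ 12 * Delta \<tau>))"
  have "(h has_field_derivative 0) (at \<tau> within {\<tau>. Im \<tau> > 0})" if "\<tau> \<in> {\<tau>. Im \<tau> > 0}" for \<tau>
  proof -
    have I: "Im \<tau> > 0" and t0: "\<tau> \<noteq> 0" using that by auto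
    define E where "E = 1 - 24 * lambert 1 (qexp \<tau>)"
    define E' where "E' = 1 - 24 * lambert 1 (qexp (- 1 / \<tau>))"
    define D where "D = Delta \<tau>"
    define D' where "D' = Delta (- 1 / \<tau>)"
    define k where "k = 2 * of_real pi * \<i>"
    have D0: "D \<noteq> 0" unfolding D_def by (rule Delta_nonzero[OF I])
    have d1: "((\<lambda>\<tau>. Delta (- 1 / \<tau>)) has_field_derivative k * E' * D' * (1 / \<tau> ^ 2)) (at \<tau>)"
      unfolding k_def E'_def D'_def
      by (rule DERIV_chain2[where f = Delta and g = "\<lambda>\<tau>. - 1 / \<tau>", OF Delta_has_field_derivative[OF Im_S_pos[OF I]]])
         (use t0 in \<open>auto intro!: derivative_eq_intros simp: power2_eq_square\<close>)
    have d2: "(Delta has_field_derivative k * E * D) (at \<tau>)"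
      unfolding k_def E_def D_def by (rule Delta_has_field_derivative[OF I])
    have d3: "((\<lambda>\<tau>. \<tau> ^ 12 * Delta \<tau>) has_field_derivative 12 * \<tau> ^ 11 * D + \<tau> ^ 12 * (k * E * D)) (at \<tau>)"
      by (auto intro!: derivative_eq_intros d2 simp: D_def)
    have "(h has_field_derivative (k * E' * D' * (1 / \<tau> ^ 2) * (\<tau> ^ 12 * D) - D' * (12 * \<tau> ^ 11 * D + \<tau> ^ 12 * (k * E * D)))
        / ((\<tau> ^ 12 * D) * (\<tau> ^ 12 * D))) (at \<tau>)"
      unfolding h_def D_def D'_def by (rule DERIV_divide[OF d1[unfolded D'_def] d3[unfolded D_def]]) (use D0 t0 in \<open>simp add: D_def\<close>)
    also have "k * E' * D' * (1 / \<tau> ^ 2) * (\<tau> ^ 12 * D) - D' * (12 * \<tau> ^ 11 * D + \<tau> ^ 12 * (k * E * D)) = 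
       D' * D * \<tau> ^ 10 * (k * E' - 12 * \<tau> - \<tau> ^ 2 * (k * E))"
      using t0 by (simp add: field_simps eval_nat_numeral)
    also have "k * E' - 12 * \<tau> - \<tau> ^ 2 * (k * E) = 0"
      unfolding E'_def lambert_1_S[OF I] E_def k_def by (simp add: field_simps)
    finally show ?thesis by (simp add: has_field_derivative_at_within)
  qed
  moreover have "convex {\<tau>. Im \<tau> > 0}" by (rule convex_halfspace_Im_gt)
  ultimately obtain c where c: "\<And>\<tau>. Im \<tau> > 0 \<Longrightarrow> h \<tau> = c"
    using has_field_derivative_zero_constant[of "{\<tau>. Im \<tau> > 0}" h] by auto
  have "h \<i> = 1"
  proof -
    have "\<i> ^ 12 = ((\<i> ^ 2) ^ 6 :: complex)" by (simp only: power_mult [symmetric]) simp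
    moreover have "- 1 / \<i> = \<i>" by (simp add: divide_i)
    ultimately show ?thesis using Delta_nonzero[of \<i>] by (simp add: h_def)
  qed
  hence "h \<tau> = 1" using c[of \<i>] c[OF assms] by simp
  thus ?thesis using Delta_nonzero[OF assms] assms by (auto simp: h_def field_simps)
qed

text \<open>A translation makes |Re w| <= 1/2. If then Im w < 1/2, it follows that |w|^2 <= 1/2, so
  -1/w has at least twice the imaginary part. Finitely many such steps reach Im >= 1/2; the
  induction is on the power of 2 needed.\<close>

lemma modular_induct:
  assumes "Im \<tau> > 0"
    and base: "\<And>\<tau>. Im \<tau> \<ge> 1 / 2 \<Longrightarrow> P \<tau>"
    and T: "\<And>\<tau>. Im \<tau> > 0 \<Longrightarrow> P (\<tau> + 1) \<longleftrightarrow> P \<tau>"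
    and S: "\<And>\<tau>. Im \<tau> > 0 \<Longrightarrow> P (- 1 / \<tau>) \<Longrightarrow> P \<tau>"
  shows "P \<tau>"
proof -
  have Tn: "P (\<tau> + of_nat n) \<longleftrightarrow> P \<tau>" if "Im \<tau> > 0" for \<tau> n
  proof (induction n)
    case (Suc n)
    have "P (\<tau> + of_nat (Suc n)) \<longleftrightarrow> P ((\<tau> + of_nat n) + 1)" by (simp add: add_ac)
    also have "\<dots> \<longleftrightarrow> P \<tau>" using T[of "\<tau> + of_nat n"] Suc that by simp
    finally show ?case .
  qed simp
  have Ti: "P (\<tau> - of_int n) \<longleftrightarrow> P \<tau>" if "Im \<tau> > 0" for \<tau> n
  proof (cases "n \<ge> 0")
    case True
    thus ?thesis using Tn[of "\<tau> - of_int n" "nat n"] that by simp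
  next
    case False
    thus ?thesis using Tn[of \<tau> "nat (- n)"] that by simp
  qed
  have "\<forall>\<tau>. Im \<tau> > 0 \<longrightarrow> Im \<tau> \<ge> 1 / 2 ^ Suc n \<longrightarrow> P \<tau>" for n
  proof (induction n)
    case 0 thus ?case using base by simp
  next
    case (Suc n)
    show ?case
    proof (intro allI impI)
      fix \<tau> assume I: "Im \<tau> > 0" and ge: "Im \<tau> \<ge> 1 / 2 ^ Suc (Suc n)"
      show "P \<tau>"
      proof (cases "Im \<tau> \<ge> 1 / 2")
        case True thus ?thesis by (rule base)
      next
        case False
        define w where "w = \<tau> - of_int (round (Re \<tau>))"
        have Iw: "Im w = Im \<tau>" by (simp add: w_def)
        have "\<bar>Re w\<bar> \<le> 1 / 2" using of_int_round_abs_le[of "Re \<tau>"] by (simp add: w_def abs_minus_commute)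
        hence "(Re w)\<^sup>2 \<le> (1 / 2)\<^sup>2" using power_mono[of "\<bar>Re w\<bar>" "1 / 2" 2] by simp
        moreover have "(Im w)\<^sup>2 \<le> (1 / 2)\<^sup>2" using False I Iw by (intro power_mono) auto
        ultimately have n: "(Re w)\<^sup>2 + (Im w)\<^sup>2 \<le> 1 / 2" by (simp add: power2_eq_square)
        have pos: "(Re w)\<^sup>2 + (Im w)\<^sup>2 > 0" using I Iw by (simp add: sum_power2_gt_zero_iff)
        have "2 * Im w * ((Re w)\<^sup>2 + (Im w)\<^sup>2) \<le> 2 * Im w * (1 / 2)" using n I Iw by (intro mult_left_mono) auto
        hence "2 * Im w \<le> Im w / ((Re w)\<^sup>2 + (Im w)\<^sup>2)" using pos by (simp add: field_simps)
        also have "\<dots> = Im (- 1 / w)" by (simp add: Im_divide)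
        finally have "2 * Im w \<le> Im (- 1 / w)" .
        moreover have "1 / 2 ^ Suc n = 2 * (1 / 2 ^ Suc (Suc n) :: real)" by simp
        ultimately have "1 / 2 ^ Suc n \<le> Im (- 1 / w)" using ge Iw by linarith
        moreover have "Im (- 1 / w) > 0" using Im_S_pos[of w] I Iw by simp
        ultimately have "P (- 1 / w)" using Suc by blast
        hence "P w" using S[of w] I Iw by simp
        thus ?thesis using Ti[OF I] by (simp add: w_def)
      qed
    qed
  qed
  moreover obtain n where "1 / 2 ^ n < Im \<tau>" using assms(1) real_arch_pow_inv[of "Im \<tau>" "1/2"] by (auto simp: power_one_over)
  moreover have "1 / 2 ^ Suc n \<le> 1 / (2 ^ n :: real)" by (simp add: field_simps)
  ultimately show ?thesis using assms(1) by (meson le_less_trans less_imp_le)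
qed

lemma qexp_surj:
  assumes "q \<noteq> 0" "norm q < 1"
  obtains \<tau> where "Im \<tau> > 0" "qexp \<tau> = q"
proof
  define \<tau> where "\<tau> = Ln q / (2 * of_real pi * \<i>)"
  show "qexp \<tau> = q" using assms by (simp add: qexp_def \<tau>_def)
  hence "exp (- 2 * pi * Im \<tau>) < 1" using norm_qexp[of \<tau>] assms by simp
  thus "Im \<tau> > 0" by (simp add: zero_less_mult_iff)
qed

text \<open>Every orbit meets Im \<tau> >= 1/2, that is |q| <= exp(-pi). The maximum of |F| on this
  closed disc is therefore its maximum on the whole unit disc, and the maximum modulus principle
  applies. Invariance under \<tau> + 1 is built into the dependence on q.\<close>

theorem liouville_level_1:
  assumes hol: "F holomorphic_on ball 0 1"
    and S: "\<And>\<tau>. Im \<tau> > 0 \<Longrightarrow> F (qexp (- 1 / \<tau>)) = F (qexp \<tau>)"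
    and q: "norm q < 1"
  shows "F q = F 0"
proof -
  define r where "r = exp (- pi)"
  have r: "0 < r" "r < 1" by (auto simp: r_def)
  have sub: "cball (0::complex) r \<subseteq> ball 0 1" using r by auto
  have "continuous_on (cball 0 r) F" using holomorphic_on_imp_continuous_on[OF hol] sub continuous_on_subset by blast
  hence "continuous_on (cball 0 r) (\<lambda>q. norm (F q))" by (intro continuous_intros)
  moreover have "cball (0::complex) r \<noteq> {}" using r by simp
  ultimately obtain q0 where q0: "q0 \<in> cball 0 r" "\<And>q. q \<in> cball 0 r \<Longrightarrow> norm (F q) \<le> norm (F q0)"
    using continuous_attains_sup[of "cball (0::complex) r" "\<lambda>q. norm (F q)"] by auto
  have "norm (F (qexp \<tau>)) \<le> norm (F q0)" if "Im \<tau> > 0" for \<tau>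
  proof (rule modular_induct[OF that])
    fix \<tau> :: complex assume "Im \<tau> \<ge> 1 / 2"
    hence "norm (qexp \<tau>) \<le> r" by (simp add: norm_qexp r_def)
    thus "norm (F (qexp \<tau>)) \<le> norm (F q0)" using q0(2) by simp
  qed (use S in auto)
  hence le: "norm (F q) \<le> norm (F q0)" if q1: "q \<in> ball 0 1" for q
  proof (cases "q = 0")
    case True thus ?thesis using q0(2) r by simp
  next
    case False
    then obtain \<tau> where "Im \<tau> > 0" "qexp \<tau> = q" using q1 by (metis mem_ball_0 qexp_surj)
    thus ?thesis using \<open>\<And>\<tau>. Im \<tau> > 0 \<Longrightarrow> norm (F (qexp \<tau>)) \<le> norm (F q0)\<close> by blast
  qed
  have "F constant_on ball 0 1"
    by (rule maximum_modulus_principle[OF hol, where U = "ball 0 1" and \<xi> = q0]) (use le q0 sub in auto)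
  thus ?thesis using q unfolding constant_on_def by auto
qed

section \<open>Eisenstein series as functions of q, and j = E_4^3 / Delta\<close>

definition E4q :: "complex \<Rightarrow> complex" where "E4q q = 1 + 240 * eval_fps (sigma_fps 3) q"
definition E6q :: "complex \<Rightarrow> complex" where "E6q q = 1 - 504 * eval_fps (sigma_fps 5) q"

lemma eval_sigma_holomorphic: "eval_fps (sigma_fps j) holomorphic_on ball 0 1"
  by (rule holomorphic_on_eval_fps) (use norm_less_conv_radius_1[OF fps_conv_radius_sigma] in auto)

lemma eval_sigma_0 [simp]: "eval_fps (sigma_fps j) 0 = 0"
  by (simp add: eval_fps_at_0 sigma_fps_def)

lemma eval_sigma_deriv: "(eval_fps (sigma_fps j) has_field_derivative 1) (at 0)"
proof -
  have "(eval_fps (sigma_fps j) has_field_derivative eval_fps (fps_deriv (sigma_fps j)) 0) (at 0)"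
    by (rule has_field_derivative_eval_fps) (use norm_less_conv_radius_1[OF fps_conv_radius_sigma, of 0] in simp)
  thus ?thesis by (simp add: eval_fps_at_0 sigma_fps_def)
qed

lemma E4q_S:
  assumes "Im \<tau> > 0"
  shows "E4q (qexp (- 1 / \<tau>)) = \<tau> ^ 4 * E4q (qexp \<tau>)"
proof -
  define c where "c = 4 * complex_of_real pi ^ 4 / 3"
  have "\<tau> \<noteq> 0" using assms by auto
  hence "c * E4q (qexp (- 1 / \<tau>)) = \<tau> ^ 4 * (c * E4q (qexp \<tau>))"
    using eisenstein_G_4[OF assms] eisenstein_G_4[OF Im_S_pos[OF assms]] eisenstein_G_S[of 4 \<tau>]
    unfolding E4q_def c_def by (metis (no_types, lifting) even_numeral mult.left_commute zero_less_numeral)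
  thus ?thesis by (simp add: c_def)
qed

lemma E6q_S:
  assumes "Im \<tau> > 0"
  shows "E6q (qexp (- 1 / \<tau>)) = \<tau> ^ 6 * E6q (qexp \<tau>)"
proof -
  define c where "c = 8 * complex_of_real pi ^ 6 / 27"
  have "\<tau> \<noteq> 0" using assms by auto
  hence "c * E6q (qexp (- 1 / \<tau>)) = \<tau> ^ 6 * (c * E6q (qexp \<tau>))"
    using eisenstein_G_6[OF assms] eisenstein_G_6[OF Im_S_pos[OF assms]] eisenstein_G_S[of 6 \<tau>]
    unfolding E6q_def c_def by (metis (no_types, lifting) even_numeral mult.left_commute zero_less_numeral)
  thus ?thesis by (simp add: c_def)
qed

text \<open>E_4^3 - E_6^2 and Delta have weight 12 and vanish at q = 0. After division of both by q
  their quotient F is holomorphic on the disc, hence constant by \<open>liouville_level_1\<close>.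
  The constant is the derivative of the numerator at 0, namely 3 * 240 + 2 * 504 = 1728.\<close>

theorem E4_E6_Delta:
  assumes "Im \<tau> > 0"
  shows "E4q (qexp \<tau>) ^ 3 - E6q (qexp \<tau>) ^ 2 = 1728 * Delta \<tau>"
proof -
  define N where "N = (\<lambda>q. E4q q ^ 3 - E6q q ^ 2)"
  have holN: "N holomorphic_on ball 0 1"
    unfolding N_def E4q_def E6q_def by (intro holomorphic_intros eval_sigma_holomorphic)
  have N0: "N 0 = 0" by (simp add: N_def E4q_def E6q_def)
  have "(N has_field_derivative 1728) (at 0)"
    proof -
    have "((\<lambda>q. (1 + 240 * s3 q) ^ 3 - (1 - 504 * s5 q) ^ 2) has_field_derivative 1728) (at 0)"
      if "(s3 has_field_derivative 1) (at 0)" "(s5 has_field_derivative 1) (at 0)" "s3 0 = 0" "s5 0 = 0" for s3 s5 :: "complex \<Rightarrow> complex"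
      by (auto intro!: derivative_eq_intros that simp: that)
    from this[OF eval_sigma_deriv eval_sigma_deriv] show ?thesis unfolding N_def E4q_def E6q_def by simp
  qed
  hence dN: "deriv N 0 = 1728" by (rule DERIV_imp_deriv)
  define F where "F = (\<lambda>q. (if q = 0 then deriv N 0 else (N q - N 0) / (q - 0)) / euler_phi q ^ 24)"
  have holF: "F holomorphic_on ball 0 1"
    unfolding F_def by (intro holomorphic_on_divide holomorphic_on_power euler_phi_holomorphic pole_lemma_open[OF holN])
      (auto simp: euler_phi_nonzero)
  have Ft: "F (qexp \<tau>) = N (qexp \<tau>) / Delta \<tau>" if "Im \<tau> > 0" for \<tau>
    using that by (simp add: F_def N0 Delta_def disc_q_def)
  have "F (qexp \<tau>) = F 0"
  proof (rule liouville_level_1[OF holF])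
    fix \<tau> :: complex assume I: "Im \<tau> > 0"
    have "N (qexp (- 1 / \<tau>)) = \<tau> ^ 12 * N (qexp \<tau>)"
      unfolding N_def E4q_S[OF I] E6q_S[OF I] by (simp add: power_mult_distrib right_diff_distrib flip: power_mult)
    thus "F (qexp (- 1 / \<tau>)) = F (qexp \<tau>)"
      unfolding Ft[OF I] Ft[OF Im_S_pos[OF I]] Delta_S[OF I] using I by (auto simp: divide_simps)
  qed (use assms norm_qexp_less_1 in auto)
  also have "F 0 = 1728" by (simp add: F_def dN)
  finally show ?thesis using Ft[OF assms] Delta_nonzero[OF assms] by (simp add: N_def field_simps)
qed

theorem modular_j_eq:
  assumes "Im \<tau> > 0"
  shows "modular_j \<tau> = E4q (qexp \<tau>) ^ 3 / Delta \<tau>"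
proof -
  define a where "a = E4q (qexp \<tau>)"
  define b where "b = E6q (qexp \<tau>)"
  define p where "p = complex_of_real pi"
  have p0: "p \<noteq> 0" by (simp add: p_def)
  have g2: "60 * eisenstein_G 4 \<tau> = 4 * p ^ 4 / 3 * a" unfolding eisenstein_G_4[OF assms] a_def E4q_def p_def ..
  have g3: "140 * eisenstein_G 6 \<tau> = 8 * p ^ 6 / 27 * b" unfolding eisenstein_G_6[OF assms] b_def E6q_def p_def ..
  \<comment> \<open>Both terms carry the same constant, since (4/3)^3 = 27 * (8/27)^2 =
    64/27.\<close>
  have "(4 * p ^ 4 / 3 * a) ^ 3 - 27 * (8 * p ^ 6 / 27 * b) ^ 2 = 64 / 27 * p ^ 12 * (a ^ 3 - b ^ 2)"
    by (simp add: power_mult_distrib power_divide field_simps flip: power_mult)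
  also have "a ^ 3 - b ^ 2 = 1728 * Delta \<tau>" unfolding a_def b_def by (rule E4_E6_Delta[OF assms])
  finally have "modular_j \<tau> = 1728 * (4 * p ^ 4 / 3 * a) ^ 3 / (64 / 27 * p ^ 12 * (1728 * Delta \<tau>))"
    by (simp only: modular_j_def g2 g3 Let_def)
  also have "\<dots> = a ^ 3 / Delta \<tau>"
    using p0 Delta_nonzero[OF assms] by (simp add: power_mult_distrib power_divide field_simps flip: power_mult)
  finally show ?thesis by (simp add: a_def)
qed

section \<open>Modular functions of level 1\<close>

definition moeb :: "int \<Rightarrow> int \<Rightarrow> int \<Rightarrow> int \<Rightarrow> complex \<Rightarrow> complex" where
  "moeb a b c d \<tau> = (of_int a * \<tau> + of_int b) / (of_int c * \<tau> + of_int d)"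

lemma moeb_denom_nonzero:
  assumes "Im \<tau> > 0" "(c, d) \<noteq> (0, 0)"
  shows "of_int c * \<tau> + of_int d \<noteq> 0"
proof
  assume *: "of_int c * \<tau> + of_int d = 0"
  moreover have "Im (of_int c * \<tau> + of_int d) = real_of_int c * Im \<tau>" by simp
  ultimately have "real_of_int c * Im \<tau> = 0" by (simp only: zero_complex.simps)
  thus False using assms * by auto
qed

lemma Im_moeb:
  assumes "Im \<tau> > 0" "(c, d) \<noteq> (0, 0)"
  shows "Im (moeb a b c d \<tau>) = of_int (a * d - b * c) * Im \<tau> / norm (of_int c * \<tau> + of_int d) ^ 2"
  by (simp add: moeb_def Im_divide cmod_power2 algebra_simps)

lemma Im_moeb_pos:
  assumes "Im \<tau> > 0" "a * d - b * c > 0"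
  shows "Im (moeb a b c d \<tau>) > 0"
proof -
  have cd: "(c, d) \<noteq> (0, 0)" using assms(2) by auto
  have "real_of_int (a * d - b * c) > 0" using assms(2) by (simp only: of_int_0_less_iff)
  thus ?thesis
    unfolding Im_moeb[OF assms(1) cd] using assms moeb_denom_nonzero[OF assms(1) cd]
    by (intro divide_pos_pos mult_pos_pos) (auto simp del: of_int_diff of_int_mult)
qed

lemma moeb_compose:
  assumes "Im \<tau> > 0" "(c', d') \<noteq> (0, 0)"
  shows "moeb a b c d (moeb a' b' c' d' \<tau>) = moeb (a * a' + b * c') (a * b' + b * d') (c * a' + d * c') (c * b' + d * d') \<tau>"
proof -
  define D where "D = of_int c' * \<tau> + of_int d'"
  have D: "D \<noteq> 0" unfolding D_def by (rule moeb_denom_nonzero[OF assms])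
  define X where "X = of_int a' * \<tau> + of_int b'"
  have "moeb a b c d (moeb a' b' c' d' \<tau>) = (of_int a * (X / D) + of_int b) / (of_int c * (X / D) + of_int d)"
    by (simp add: moeb_def X_def D_def)
  also have "\<dots> = ((of_int a * (X / D) + of_int b) * D) / ((of_int c * (X / D) + of_int d) * D)" using D by simp
  also have "(of_int a * (X / D) + of_int b) * D = of_int a * X + of_int b * D" using D by (simp add: field_simps)
  also have "(of_int c * (X / D) + of_int d) * D = of_int c * X + of_int d * D" using D by (simp add: field_simps)
  also have "(of_int a * X + of_int b * D) / (of_int c * X + of_int d * D) =
     moeb (a * a' + b * c') (a * b' + b * d') (c * a' + d * c') (c * b' + d * d') \<tau>"
    by (simp add: moeb_def X_def D_def algebra_simps)
  finally show ?thesis .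
qed

lemma Delta_plus_of_nat: "Delta (\<tau> + of_nat n) = Delta \<tau>"
proof (induction n)
  case (Suc n)
  have "\<tau> + of_nat (Suc n) = (\<tau> + of_nat n) + 1" by simp
  thus ?case using Suc by (simp only: Delta_plus_1)
qed simp

lemma Delta_plus_of_int: "Delta (\<tau> + of_int n) = Delta \<tau>"
proof (cases "n \<ge> 0")
  case True thus ?thesis using Delta_plus_of_nat[of \<tau> "nat n"] by simp
next
  case False thus ?thesis using Delta_plus_of_nat[of "\<tau> + of_int n" "nat (- n)"] by simp
qed

text \<open>Euclid's algorithm on the left column (a, c): a translation by a div c replaces a by a
  mod c, and the inversion makes this remainder the new lower left entry. Only the laws for \<tau> +
  1 and -1/\<tau> enter.\<close>

theorem Delta_moeb:
  assumes "Im \<tau> > 0" "a * d - b * c = 1"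
  shows "Delta (moeb a b c d \<tau>) = (of_int c * \<tau> + of_int d) ^ 12 * Delta \<tau>"
  using assms(2)
proof (induction "nat \<bar>c\<bar>" arbitrary: a b c d rule: less_induct)
  case less
  show ?case
  proof (cases "c = 0")
    case True
    hence ad: "a * d = 1" using less.prems by simp
    hence "a = 1 \<and> d = 1 \<or> a = -1 \<and> d = -1" by (simp add: zmult_eq_1_iff)
    thus ?thesis
    proof
      assume "a = 1 \<and> d = 1"
      thus ?thesis using True Delta_plus_of_int[of \<tau> b] by (simp add: moeb_def)
    next
      assume "a = -1 \<and> d = -1"
      thus ?thesis using True Delta_plus_of_int[of \<tau> "- b"] by (simp add: moeb_def)
    qed
  next
    case False
    define k where "k = a div c"
    define a' where "a' = a - k * c"
    define b' where "b' = b - k * d"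
    define w where "w = moeb a b c d \<tau>"
    define v where "v = moeb (- c) (- d) a' b' \<tau>"
    have "a' = a mod c" by (simp add: a'_def k_def minus_div_mult_eq_mod)
    hence lt: "nat \<bar>a'\<bar> < nat \<bar>c\<bar>" using abs_mod_less[OF False, of a] False by simp
    have det: "(- c) * b' - (- d) * a' = 1" using less.prems by (simp add: a'_def b'_def algebra_simps)
    have cd: "(c, d) \<noteq> (0, 0)" "(a', b') \<noteq> (0, 0)" using False det by auto
    have nz: "of_int c * \<tau> + of_int d \<noteq> 0" "of_int a' * \<tau> + of_int b' \<noteq> 0"
      by (rule moeb_denom_nonzero[OF assms(1)], use cd in simp)+
    have Iv: "Im v > 0" unfolding v_def by (rule Im_moeb_pos[OF assms(1)]) (use det in simp)
    have "w + of_int (- k) = (of_int a' * \<tau> + of_int b') / (of_int c * \<tau> + of_int d)"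
      using nz by (simp add: w_def moeb_def a'_def b'_def field_simps)
    also have "\<dots> = - 1 / v"
    proof -
      have "v = - ((of_int c * \<tau> + of_int d) / (of_int a' * \<tau> + of_int b'))"
      proof -
        have "of_int (- c) * \<tau> + of_int (- d) = - (of_int c * \<tau> + of_int d)" by simp
        thus ?thesis unfolding v_def moeb_def by (simp only: minus_divide_left)
      qed
      moreover have "X / Y = - 1 / - (Y / X)" for X Y :: complex by simp
      ultimately show ?thesis by (simp only:)
    qed
    finally have wv: "w + of_int (- k) = - 1 / v" .
    have "Delta w = Delta (- 1 / v)" using Delta_plus_of_int[of w "- k"] unfolding wv by simp
    also have "\<dots> = v ^ 12 * Delta v" by (rule Delta_S[OF Iv])
    also have "Delta v = (of_int a' * \<tau> + of_int b') ^ 12 * Delta \<tau>"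
      unfolding v_def by (rule less.hyps[OF lt det])
    also have "v ^ 12 * ((of_int a' * \<tau> + of_int b') ^ 12 * Delta \<tau>) = (v * (of_int a' * \<tau> + of_int b')) ^ 12 * Delta \<tau>"
      by (simp add: power_mult_distrib)
    also have "v * (of_int a' * \<tau> + of_int b') = - (of_int c * \<tau> + of_int d)"
      using nz(2) by (simp add: v_def moeb_def)
    also have "(- (of_int c * \<tau> + of_int d)) ^ 12 = (of_int c * \<tau> + of_int d) ^ 12" by (rule power_minus_even) simp
    finally show ?thesis by (simp add: w_def)
  qed
qed

text \<open>The Petersson norm of Delta. Its invariance under SL2(Z) turns bounds near the cusp at
  infinity into bounds at every cusp, without any list of cusps.\<close>

definition disc_norm :: "complex \<Rightarrow> real" where "disc_norm \<tau> = norm (Delta \<tau>) * Im \<tau> ^ 6"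

lemma disc_norm_moeb:
  assumes "Im \<tau> > 0" "a * d - b * c = 1"
  shows "disc_norm (moeb a b c d \<tau>) = disc_norm \<tau>"
proof -
  have cd: "(c, d) \<noteq> (0, 0)" using assms(2) by auto
  have nz: "of_int c * \<tau> + of_int d \<noteq> 0" by (rule moeb_denom_nonzero[OF assms(1) cd])
  show ?thesis
    unfolding disc_norm_def Im_moeb[OF assms(1) cd] Delta_moeb[OF assms] assms(2)
    using nz by (simp add: norm_mult norm_power power_divide flip: power_mult)
qed

lemma modular_reduction:
  assumes "Im \<tau> > 0"
  obtains a b c d where "a * d - b * c = 1" "Im (moeb a b c d \<tau>) \<ge> 1 / 2"
proof -
  have "\<exists>a b c d. a * d - b * c = 1 \<and> Im (moeb a b c d \<tau>) \<ge> 1 / 2"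
  proof (rule modular_induct[OF assms])
    fix \<tau> :: complex assume "Im \<tau> \<ge> 1 / 2"
    thus "\<exists>a b c d. a * d - b * c = 1 \<and> Im (moeb a b c d \<tau>) \<ge> 1 / 2"
      by (intro exI[of _ 1] exI[of _ 0] exI[of _ 0] exI[of _ 1]) (simp add: moeb_def)
  next
    fix \<tau> :: complex assume I: "Im \<tau> > 0"
    have 1: "moeb a b c d (\<tau> + 1) = moeb a (a + b) c (c + d) \<tau>" for a b c d
      by (simp add: moeb_def algebra_simps)
    show "(\<exists>a b c d. a * d - b * c = 1 \<and> Im (moeb a b c d (\<tau> + 1)) \<ge> 1 / 2) \<longleftrightarrow>
          (\<exists>a b c d. a * d - b * c = 1 \<and> Im (moeb a b c d \<tau>) \<ge> 1 / 2)" (is "?L \<longleftrightarrow> ?R")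
    proof
      assume ?L
      then obtain a b c d where *: "a * d - b * c = 1" "Im (moeb a b c d (\<tau> + 1)) \<ge> 1 / 2" by blast
      have "a * (c + d) - (a + b) * c = 1" using *(1) by (simp add: algebra_simps)
      thus ?R using *(2) unfolding 1 by blast
    next
      assume ?R
      then obtain a b c d where *: "a * d - b * c = 1" "Im (moeb a b c d \<tau>) \<ge> 1 / 2" by blast
      have "a * (d - c) - (b - a) * c = 1" using *(1) by (simp add: algebra_simps)
      moreover have "Im (moeb a (b - a) c (d - c) (\<tau> + 1)) \<ge> 1 / 2" unfolding 1 using *(2) by simp
      ultimately show ?L by blast
    qed
    assume "\<exists>a b c d. a * d - b * c = 1 \<and> Im (moeb a b c d (- 1 / \<tau>)) \<ge> 1 / 2"
    then obtain a b c d where abcd: "a * d - b * c = 1" "Im (moeb a b c d (- 1 / \<tau>)) \<ge> 1 / 2" by blast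
    have "moeb a b c d (- 1 / \<tau>) = moeb a b c d (moeb 0 (-1) 1 0 \<tau>)" by (simp add: moeb_def)
    also have "\<dots> = moeb b (- a) d (- c) \<tau>" by (subst moeb_compose[OF I]) auto
    finally show "\<exists>a b c d. a * d - b * c = 1 \<and> Im (moeb a b c d \<tau>) \<ge> 1 / 2"
      using abcd by (intro exI[of _ b] exI[of _ "- a"] exI[of _ d] exI[of _ "- c"]) (simp add: algebra_simps)
  qed
  thus ?thesis using that by blast
qed

text \<open>The Euler product is continuous and has no zero on the compact disc |q| <= exp(-pi), so
  |Delta| is comparable with |q| there.\<close>

lemma Delta_cusp_bounds:
  obtains c1 c2 where "c1 > 0" "c2 > 0"
    "\<And>\<tau>. Im \<tau> \<ge> 1 / 2 \<Longrightarrow> c1 * exp (- 2 * pi * Im \<tau>) \<le> norm (Delta \<tau>)"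
    "\<And>\<tau>. Im \<tau> \<ge> 1 / 2 \<Longrightarrow> norm (Delta \<tau>) \<le> c2 * exp (- 2 * pi * Im \<tau>)"
proof -
  define r where "r = exp (- pi)"
  have r: "0 < r" "r < 1" by (auto simp: r_def)
  define f where "f = (\<lambda>q. norm (euler_phi q ^ 24))"
  have cont: "continuous_on (cball 0 r) f" unfolding f_def
    by (intro continuous_intros continuous_on_subset[OF holomorphic_on_imp_continuous_on[OF euler_phi_holomorphic]]) (use r in auto)
  have ne: "cball (0::complex) r \<noteq> {}" "compact (cball (0::complex) r)" using r by auto
  obtain qa where qa: "qa \<in> cball 0 r" "\<And>q. q \<in> cball 0 r \<Longrightarrow> f qa \<le> f q"
    using continuous_attains_inf[OF ne(2,1) cont] by blast
  obtain qb where qb: "qb \<in> cball 0 r" "\<And>q. q \<in> cball 0 r \<Longrightarrow> f q \<le> f qb"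
    using continuous_attains_sup[OF ne(2,1) cont] by blast
  have pos: "f q > 0" if "q \<in> cball 0 r" for q
    using that r euler_phi_nonzero[of q] by (simp add: f_def)
  have "f qa * exp (- 2 * pi * Im \<tau>) \<le> norm (Delta \<tau>) \<and> norm (Delta \<tau>) \<le> f qb * exp (- 2 * pi * Im \<tau>)"
    if "Im \<tau> \<ge> 1 / 2" for \<tau>
  proof -
    have "qexp \<tau> \<in> cball 0 r" using that by (simp add: norm_qexp r_def)
    moreover have "norm (Delta \<tau>) = exp (- 2 * pi * Im \<tau>) * f (qexp \<tau>)"
      by (simp add: Delta_def disc_q_def norm_mult norm_qexp f_def)
    ultimately show ?thesis using qa(2) qb(2) by (simp add: mult.commute)
  qed
  thus ?thesis using that[of "f qa" "f qb"] pos[OF qa(1)] pos[OF qb(1)] by blast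
qed

lemma disc_norm_bounds:
  obtains A B where "A > 0" "B > 0" "\<And>\<tau>. Im \<tau> > 0 \<Longrightarrow> disc_norm \<tau> \<le> B"
    "\<And>\<tau>. Im \<tau> \<ge> 1 / 2 \<Longrightarrow> A * exp (- 2 * pi * Im \<tau>) \<le> disc_norm \<tau>"
proof -
  obtain c1 c2 where c: "c1 > 0" "c2 > 0"
    "\<And>\<tau>. Im \<tau> \<ge> 1 / 2 \<Longrightarrow> c1 * exp (- 2 * pi * Im \<tau>) \<le> norm (Delta \<tau>)"
    "\<And>\<tau>. Im \<tau> \<ge> 1 / 2 \<Longrightarrow> norm (Delta \<tau>) \<le> c2 * exp (- 2 * pi * Im \<tau>)"
    using Delta_cusp_bounds by metis
  have up: "disc_norm \<tau> \<le> c2 * 6 ^ 6" if "Im \<tau> \<ge> 1 / 2" for \<tau>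
  proof -
    define x where "x = Im \<tau>"
    have x: "x \<ge> 1 / 2" using that by (simp add: x_def)
    \<comment> \<open>The constant 6^6 comes from (1 + x/6)^6 <= exp x.\<close>
    have "(x / 6) ^ 6 \<le> (1 + x / 6) ^ 6" using x by (intro power_mono) auto
    also have "\<dots> \<le> exp x" using exp_ge_one_plus_x_over_n_power_n[of 6 x] x by simp
    also have "x \<le> 2 * pi * x" using x pi_ge_two by (simp add: mult_le_cancel_right1)
    hence "exp x \<le> exp (2 * pi * x)" by simp
    finally have "x ^ 6 \<le> 6 ^ 6 * exp (2 * pi * x)" by (simp add: power_divide field_simps)
    hence "exp (- 2 * pi * x) * x ^ 6 \<le> exp (- 2 * pi * x) * (6 ^ 6 * exp (2 * pi * x))" by (intro mult_left_mono) auto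
    also have "\<dots> = 6 ^ 6" by (simp add: exp_minus field_simps)
    finally have *: "exp (- 2 * pi * x) * x ^ 6 \<le> 6 ^ 6" .
    have "disc_norm \<tau> \<le> c2 * exp (- 2 * pi * x) * x ^ 6"
      unfolding disc_norm_def x_def using c(4)[OF that] that by (intro mult_right_mono) auto
    also have "\<dots> \<le> c2 * 6 ^ 6" using * c(2) by simp
    finally show ?thesis .
  qed
  have up': "disc_norm \<tau> \<le> c2 * 6 ^ 6" if I: "Im \<tau> > 0" for \<tau>
  proof -
    obtain a b c d where "a * d - b * c = 1" "Im (moeb a b c d \<tau>) \<ge> 1 / 2" using modular_reduction[OF I] .
    thus ?thesis using up disc_norm_moeb[OF I] by metis
  qed
  have "c1 / 2 ^ 6 * exp (- 2 * pi * Im \<tau>) \<le> disc_norm \<tau>" if "Im \<tau> \<ge> 1 / 2" for \<tau>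
  proof -
    have "(1 / 2) ^ 6 \<le> Im \<tau> ^ 6" using that by (intro power_mono) auto
    hence "c1 * exp (- 2 * pi * Im \<tau>) * (1 / 2) ^ 6 \<le> disc_norm \<tau>"
      unfolding disc_norm_def using c(3)[OF that] c(1) by (intro mult_mono) auto
    thus ?thesis by (simp add: power_one_over field_simps)
  qed
  thus ?thesis using that[of "c1 / 2 ^ 6" "c2 * 6 ^ 6"] c up' by auto
qed

lemma moeb_denom_ge:
  assumes "Im \<tau> \<ge> 1 / 2" "(c, d) \<noteq> (0, 0)"
  shows "norm (of_int c * \<tau> + of_int d) \<ge> 1 / 2"
proof (cases "c = 0")
  case True
  hence "\<bar>real_of_int d\<bar> \<ge> 1" using assms(2) by auto
  thus ?thesis using True by simp
next
  case False
  hence "1 * (1 / 2) \<le> \<bar>real_of_int c\<bar> * Im \<tau>" using assms(1) by (intro mult_mono) auto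
  also have "\<dots> = \<bar>Im (of_int c * \<tau> + of_int d)\<bar>" using assms(1) by (simp add: abs_mult)
  also have "\<dots> \<le> norm (of_int c * \<tau> + of_int d)" by (rule abs_Im_le_cmod)
  finally show ?thesis by simp
qed

text \<open>An element of SL2(Z) moves the point to some w with Im w >= 1/2. The composed matrix
  keeps the determinant, and its denominator at \<tau> has norm at least 1/2, so Im w <= 4 (a d - b
  c) Im \<tau>. Hence the exponent 8 pi = 4 * 2 pi.\<close>

lemma disc_norm_moeb_lower:
  assumes "A > 0" "\<And>\<tau>. Im \<tau> \<ge> 1 / 2 \<Longrightarrow> A * exp (- 2 * pi * Im \<tau>) \<le> disc_norm \<tau>"
    and "Im \<tau> \<ge> 1 / 2" "a * d - b * c > 0"
  shows "A * exp (- 8 * pi * of_int (a * d - b * c) * Im \<tau>) \<le> disc_norm (moeb a b c d \<tau>)"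
proof -
  have I: "Im \<tau> > 0" using assms(3) by simp
  have cd: "(c, d) \<noteq> (0, 0)" using assms(4) by auto
  define z where "z = moeb a b c d \<tau>"
  have Iz: "Im z > 0" unfolding z_def by (rule Im_moeb_pos[OF I assms(4)])
  obtain a' b' c' d' where g: "a' * d' - b' * c' = 1" "Im (moeb a' b' c' d' z) \<ge> 1 / 2" using modular_reduction[OF Iz] .
  define w where "w = moeb a' b' c' d' z"
  define c'' where "c'' = c' * a + d' * c"
  define d'' where "d'' = c' * b + d' * d"
  define a'' where "a'' = a' * a + b' * c"
  define b'' where "b'' = a' * b + b' * d"
  have w: "w = moeb a'' b'' c'' d'' \<tau>"
    unfolding w_def z_def a''_def b''_def c''_def d''_def by (rule moeb_compose[OF I cd])
  have "a'' * d'' - b'' * c'' = (a' * d' - b' * c') * (a * d - b * c)"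
    unfolding a''_def b''_def c''_def d''_def by (simp add: algebra_simps)
  hence det: "a'' * d'' - b'' * c'' = a * d - b * c" using g by simp
  have cd'': "(c'', d'') \<noteq> (0, 0)" using det assms(4) by auto
  have "(1 / 2) ^ 2 \<le> norm (of_int c'' * \<tau> + of_int d'') ^ 2"
    using moeb_denom_ge[OF assms(3) cd''] by (intro power_mono) auto
  hence n: "1 / norm (of_int c'' * \<tau> + of_int d'') ^ 2 \<le> 4" by (simp add: field_simps power2_eq_square)
  have "Im w = of_int (a * d - b * c) * Im \<tau> * (1 / norm (of_int c'' * \<tau> + of_int d'') ^ 2)"
    unfolding w Im_moeb[OF I cd''] det by simp
  also have "\<dots> \<le> of_int (a * d - b * c) * Im \<tau> * 4"
  proof (intro mult_left_mono n mult_nonneg_nonneg)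
    show "0 \<le> real_of_int (a * d - b * c)" using assms(4) by (simp only: of_int_0_le_iff less_imp_le)
  qed (use I in simp)
  finally have "2 * pi * Im w \<le> 2 * pi * (of_int (a * d - b * c) * Im \<tau> * 4)" by (intro mult_left_mono) auto
  hence "exp (- 8 * pi * of_int (a * d - b * c) * Im \<tau>) \<le> exp (- 2 * pi * Im w)" by simp
  hence "A * exp (- 8 * pi * of_int (a * d - b * c) * Im \<tau>) \<le> A * exp (- 2 * pi * Im w)" using assms(1) by simp
  also have "\<dots> \<le> disc_norm w" by (rule assms(2)) (use g w_def in simp)
  also have "disc_norm w = disc_norm z" unfolding w_def by (rule disc_norm_moeb[OF Iz g(1)])
  finally show ?thesis by (simp add: z_def)
qed

text \<open>n bounds the order of the pole at q = 0. Since q j tends to 1 at the cusp, subtracting c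
  j^(n + 1) with c = G 0 lowers a pole of order n + 1, and a function without a pole is
  constant.\<close>

lemma poly_in_j_aux:
  assumes "G holomorphic_on ball 0 1"
    and "\<And>\<tau>. Im \<tau> > 0 \<Longrightarrow> f (- 1 / \<tau>) = f \<tau>"
    and "\<And>\<tau>. Im \<tau> > 0 \<Longrightarrow> G (qexp \<tau>) = qexp \<tau> ^ n * f \<tau>"
  shows "\<exists>p. \<forall>\<tau>. Im \<tau> > 0 \<longrightarrow> f \<tau> = poly p (modular_j \<tau>)"
  using assms
proof (induction n arbitrary: f G)
  case 0
  have "f \<tau> = G 0" if "Im \<tau> > 0" for \<tau>
  proof -
    have "G (qexp \<tau>) = G 0"
      by (rule liouville_level_1[OF 0(1)]) (use 0 that Im_S_pos norm_qexp_less_1 in auto)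
    thus ?thesis using 0(3)[OF that] by simp
  qed
  thus ?case by (intro exI[of _ "[:G 0:]"]) simp
next
  case (Suc n)
  define A where "A = (\<lambda>q. E4q q ^ 3 / euler_phi q ^ 24)"
  have holA: "A holomorphic_on ball 0 1"
    unfolding A_def E4q_def
    by (intro holomorphic_on_divide holomorphic_on_power holomorphic_on_add holomorphic_on_mult holomorphic_on_const
        euler_phi_holomorphic eval_sigma_holomorphic) (auto simp: euler_phi_nonzero)
  have A0: "A 0 = 1" by (simp add: A_def E4q_def)
  have Aj: "A (qexp \<tau>) = qexp \<tau> * modular_j \<tau>" if "Im \<tau> > 0" for \<tau>
    using that by (simp add: A_def modular_j_eq Delta_def disc_q_def)
  have jS: "modular_j (- 1 / \<tau>) = modular_j \<tau>" if I: "Im \<tau> > 0" for \<tau>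
  proof -
    have "\<tau> \<noteq> 0" using I by auto
    thus ?thesis
      unfolding modular_j_eq[OF I] modular_j_eq[OF Im_S_pos[OF I]] Delta_S[OF I] E4q_S[OF I]
      by (simp add: power_mult_distrib flip: power_mult)
  qed
  define c where "c = G 0"
  define G1 where "G1 = (\<lambda>q. G q - c * A q ^ Suc n)"
  define G2 where "G2 = (\<lambda>q. if q = 0 then deriv G1 0 else (G1 q - G1 0) / (q - 0))"
  have holG1: "G1 holomorphic_on ball 0 1" unfolding G1_def by (intro holomorphic_intros holA Suc.prems)
  have "G2 holomorphic_on ball 0 1" unfolding G2_def by (rule pole_lemma_open[OF holG1]) simp
  moreover have "f (- 1 / \<tau>) - c * modular_j (- 1 / \<tau>) ^ Suc n = f \<tau> - c * modular_j \<tau> ^ Suc n" if "Im \<tau> > 0" for \<tau>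
    using Suc.prems(2)[OF that] jS[OF that] by simp
  moreover have "G2 (qexp \<tau>) = qexp \<tau> ^ n * (f \<tau> - c * modular_j \<tau> ^ Suc n)" if "Im \<tau> > 0" for \<tau>
  proof -
    have "G1 0 = 0" by (simp add: G1_def c_def A0)
    hence "G2 (qexp \<tau>) = G1 (qexp \<tau>) / qexp \<tau>" by (simp add: G2_def)
    also have "G1 (qexp \<tau>) = qexp \<tau> ^ Suc n * (f \<tau> - c * modular_j \<tau> ^ Suc n)"
      unfolding G1_def Suc.prems(3)[OF that] Aj[OF that] power_mult_distrib by (simp add: algebra_simps)
    finally show ?thesis by simp
  qed
  ultimately obtain p where p: "\<forall>\<tau>. Im \<tau> > 0 \<longrightarrow> f \<tau> - c * modular_j \<tau> ^ Suc n = poly p (modular_j \<tau>)"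
    using Suc.IH[of G2 "\<lambda>\<tau>. f \<tau> - c * modular_j \<tau> ^ Suc n"] by blast
  hence "\<forall>\<tau>. Im \<tau> > 0 \<longrightarrow> f \<tau> = poly (p + monom c (Suc n)) (modular_j \<tau>)"
    by (auto simp: poly_monom algebra_simps)
  thus ?case by blast
qed

lemma periodic_of_int:
  assumes "\<And>\<tau>. Im \<tau> > 0 \<Longrightarrow> f (\<tau> + 1) = f \<tau>" "Im \<tau> > 0"
  shows "f (\<tau> + of_int n) = f \<tau>"
proof -
  have nat: "f (\<tau> + of_nat n) = f \<tau>" if "Im \<tau> > 0" for n \<tau>
  proof (induction n)
    case (Suc n)
    have "f (\<tau> + of_nat (Suc n)) = f ((\<tau> + of_nat n) + 1)" by (simp add: add_ac)
    thus ?case using assms(1)[of "\<tau> + of_nat n"] Suc that by simp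
  qed simp
  show ?thesis
  proof (cases "n \<ge> 0")
    case True thus ?thesis using nat[OF assms(2), of "nat n"] by simp
  next
    case False thus ?thesis using nat[of "\<tau> + of_int n" "nat (- n)"] assms(2) by simp
  qed
qed

theorem poly_in_j:
  assumes hol: "f holomorphic_on {\<tau>. Im \<tau> > 0}"
    and T: "\<And>\<tau>. Im \<tau> > 0 \<Longrightarrow> f (\<tau> + 1) = f \<tau>"
    and S: "\<And>\<tau>. Im \<tau> > 0 \<Longrightarrow> f (- 1 / \<tau>) = f \<tau>"
    and bd: "\<And>\<tau>. Im \<tau> \<ge> 1 / 2 \<Longrightarrow> norm (f \<tau>) \<le> C * exp (K * Im \<tau>)"
  shows "\<exists>p. \<forall>\<tau>. Im \<tau> > 0 \<longrightarrow> f \<tau> = poly p (modular_j \<tau>)"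
proof -
  \<comment> \<open>\<open>Ln\<close> jumps along the negative axis, but a change of branch shifts
    the argument by an integer, which the periodic f does not notice.\<close>
  define F where "F = (\<lambda>q. f (Ln q / (2 * of_real pi * \<i>)))"
  have Ff: "F (qexp \<tau>) = f \<tau>" if "Im \<tau> > 0" for \<tau>
  proof -
    have "exp (Ln (qexp \<tau>)) = exp (2 * of_real pi * \<i> * \<tau>)" by (simp add: qexp_def)
    then obtain n where n: "Ln (qexp \<tau>) = 2 * of_real pi * \<i> * \<tau> + 2 * of_int n * of_real pi * \<i>"
      unfolding exp_eq by (auto simp: mult_ac)
    have "Ln (qexp \<tau>) / (2 * of_real pi * \<i>) = \<tau> + of_int n" unfolding n by (simp add: field_simps)
    thus ?thesis using periodic_of_int[where f = f, OF T that, of n] by (simp add: F_def)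
  qed
  have "F field_differentiable at q0" if q0: "q0 \<in> ball 0 1 - {0}" for q0
  proof -
    obtain \<tau>0 where t0: "Im \<tau>0 > 0" "qexp \<tau>0 = q0" using q0 qexp_surj[of q0] by auto
    \<comment> \<open>A holomorphic inverse of \<open>qexp\<close> near q0: dividing by q0 keeps the
      argument of \<open>Ln\<close> in the right half plane, away from its cut.\<close>
    define g where "g = (\<lambda>q. \<tau>0 + Ln (q / q0) / (2 * of_real pi * \<i>))"
    define U where "U = ball q0 (norm q0) \<inter> ball 0 1"
    have oU: "open U" "q0 \<in> U" using q0 by (auto simp: U_def)
    have U: "q \<noteq> 0 \<and> norm q < 1 \<and> q / q0 \<notin> \<real>\<^sub>\<le>\<^sub>0" if "q \<in> U" for q
    proof -
      have "norm (q0 - q) < norm q0" using that by (simp add: U_def dist_norm)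
      moreover have "norm (1 - q / q0) * norm q0 = norm (q0 - q)"
        using q0 by (simp add: left_diff_distrib flip: norm_mult)
      ultimately have "norm (1 - q / q0) * norm q0 < 1 * norm q0" by simp
      hence "norm (1 - q / q0) < 1" using q0 by (simp only: mult_less_cancel_right) auto
      hence "\<bar>Re (1 - q / q0)\<bar> < 1" using abs_Re_le_cmod[of "1 - q / q0"] by linarith
      hence "Re (q / q0) > 0" by simp
      hence "q / q0 \<notin> \<real>\<^sub>\<le>\<^sub>0" by (auto simp: complex_nonpos_Reals_iff)
      thus ?thesis using that by (auto simp: U_def dist_norm)
    qed
    have qg: "qexp (g q) = q" if "q \<in> U" for q
    proof -
      have "qexp (g q) = qexp \<tau>0 * exp (Ln (q / q0))"
        by (simp add: g_def qexp_def ring_distribs exp_add)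
      thus ?thesis using U[OF that] t0 q0 by (simp del: exp_Ln add: exp_Ln)
    qed
    have Ig: "Im (g q) > 0" if "q \<in> U" for q
    proof -
      have "exp (- 2 * pi * Im (g q)) < 1" using norm_qexp[of "g q"] qg[OF that] U[OF that] by simp
      thus ?thesis by (simp add: zero_less_mult_iff)
    qed
    have "g holomorphic_on U" unfolding g_def using U q0 by (auto intro!: holomorphic_intros)
    hence "(f \<circ> g) holomorphic_on U"
      by (rule holomorphic_on_compose_gen[OF _ hol]) (use Ig in auto)
    hence "F holomorphic_on U"
      by (rule holomorphic_transform) (use Ff[OF Ig] qg in auto)
    thus ?thesis using oU holomorphic_on_imp_differentiable_at by blast
  qed
  hence holF: "F holomorphic_on ball 0 1 - {0}"
    by (simp add: holomorphic_on_def field_differentiable_at_within)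
  \<comment> \<open>|q^n f| is at most |C| exp((K - 2 pi n) Im \<tau>), so n >= K makes it bounded
    near 0.\<close>
  obtain n :: nat where n: "real n \<ge> K" using real_arch_simple by blast
  have "(\<lambda>q. q ^ n * F q) holomorphic_on ball 0 1 - {0}" by (intro holomorphic_intros holF)
  moreover have "open (ball (0::complex) 1)" "(0::complex) \<in> ball 0 1" by auto
  moreover have "\<forall>\<^sub>F q in at 0. norm (q ^ n * F q) \<le> \<bar>C\<bar>"
  proof -
    have "\<forall>\<^sub>F q in at (0::complex). q \<in> ball 0 (exp (- pi)) - {0}"
      by (intro eventually_at_in_open) auto
    thus ?thesis
    proof eventually_elim
      case (elim q)
      have "norm q < 1" using elim by (simp add: less_trans[of _ "exp (- pi)" 1])
      then obtain \<tau> where t: "Im \<tau> > 0" "qexp \<tau> = q" using elim qexp_surj[of q] by auto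
      have "exp (- 2 * pi * Im \<tau>) < exp (- pi)" using elim t norm_qexp[of \<tau>] by simp
      hence h: "Im \<tau> \<ge> 1 / 2" by simp
      have "norm (q ^ n * F q) = exp (- 2 * pi * Im \<tau>) ^ n * norm (f \<tau>)"
        using Ff[OF t(1)] t(2) norm_qexp[of \<tau>] by (simp add: norm_mult norm_power)
      also have "\<dots> \<le> exp (- 2 * pi * Im \<tau>) ^ n * (\<bar>C\<bar> * exp (K * Im \<tau>))"
        using order.trans[OF bd[OF h], of "\<bar>C\<bar> * exp (K * Im \<tau>)"] by (intro mult_left_mono) (auto intro: mult_right_mono)
      also have "\<dots> = \<bar>C\<bar> * exp ((K - 2 * pi * real n) * Im \<tau>)"
        by (simp add: exp_of_nat_mult [symmetric] exp_add [symmetric] algebra_simps)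
      also have "K - 2 * pi * real n \<le> 0"
      proof -
        have "1 * real n \<le> 2 * pi * real n" using pi_ge_two by (intro mult_right_mono) auto
        thus ?thesis using n by simp
      qed
      hence "exp ((K - 2 * pi * real n) * Im \<tau>) \<le> 1" using t by (simp add: mult_le_0_iff)
      hence "\<bar>C\<bar> * exp ((K - 2 * pi * real n) * Im \<tau>) \<le> \<bar>C\<bar>" by (simp add: mult_left_le)
      finally show ?case .
    qed
  qed
  ultimately obtain G where G: "G holomorphic_on ball 0 1" "\<And>q. q \<in> ball 0 1 - {0} \<Longrightarrow> G q = q ^ n * F q"
    using holomorphic_on_extend_bounded[of "\<lambda>q. q ^ n * F q" "ball 0 1" 0] by auto
  show ?thesis
  proof (rule poly_in_j_aux[where f = f, OF G(1) S])
    fix \<tau> :: complex assume "Im \<tau> > 0"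
    thus "G (qexp \<tau>) = qexp \<tau> ^ n * f \<tau>" using G(2)[of "qexp \<tau>"] norm_qexp_less_1[of \<tau>] Ff by simp
  qed auto
qed

section \<open>Eta quotients\<close>

text \<open>The bound expresses meromorphy at the cusp for a periodic f. C and K are kept
  nonnegative so that sums and products inherit it.\<close>

definition mod_growth :: "(complex \<Rightarrow> complex) \<Rightarrow> bool" where
  "mod_growth f \<longleftrightarrow> f holomorphic_on {\<tau>. Im \<tau> > 0} \<and>
     (\<exists>C K. C \<ge> 0 \<and> K \<ge> 0 \<and> (\<forall>\<tau>. Im \<tau> \<ge> 1 / 2 \<longrightarrow> norm (f \<tau>) \<le> C * exp (K * Im \<tau>)))"

lemma mod_growth_const: "mod_growth (\<lambda>_. c)"
  unfolding mod_growth_def by (intro conjI exI[of _ "norm c"] exI[of _ 0]) auto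

lemma mod_growth_add:
  assumes "mod_growth f" "mod_growth g"
  shows "mod_growth (\<lambda>\<tau>. f \<tau> + g \<tau>)"
proof -
  obtain C K where f: "C \<ge> 0" "K \<ge> 0" "\<And>\<tau>. Im \<tau> \<ge> 1 / 2 \<Longrightarrow> norm (f \<tau>) \<le> C * exp (K * Im \<tau>)"
    using assms(1) unfolding mod_growth_def by blast
  obtain D L where g: "D \<ge> 0" "L \<ge> 0" "\<And>\<tau>. Im \<tau> \<ge> 1 / 2 \<Longrightarrow> norm (g \<tau>) \<le> D * exp (L * Im \<tau>)"
    using assms(2) unfolding mod_growth_def by blast
  have "norm (f \<tau> + g \<tau>) \<le> (C + D) * exp ((K + L) * Im \<tau>)" if I: "Im \<tau> \<ge> 1 / 2" for \<tau>
  proof -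
    have "norm (f \<tau> + g \<tau>) \<le> C * exp (K * Im \<tau>) + D * exp (L * Im \<tau>)"
      using norm_triangle_ineq[of "f \<tau>" "g \<tau>"] f(3)[OF I] g(3)[OF I] by linarith
    also have "\<dots> \<le> C * exp ((K + L) * Im \<tau>) + D * exp ((K + L) * Im \<tau>)"
      using f g I by (intro add_mono mult_left_mono) (auto intro!: mult_right_mono)
    finally show ?thesis by (simp add: algebra_simps)
  qed
  moreover have "(\<lambda>\<tau>. f \<tau> + g \<tau>) holomorphic_on {\<tau>. Im \<tau> > 0}"
    using assms unfolding mod_growth_def by (intro holomorphic_intros) auto
  ultimately show ?thesis using f g unfolding mod_growth_def
    by (intro conjI exI[of _ "C + D"] exI[of _ "K + L"]) auto
qed

lemma mod_growth_mult:
  assumes "mod_growth f" "mod_growth g"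
  shows "mod_growth (\<lambda>\<tau>. f \<tau> * g \<tau>)"
proof -
  obtain C K where f: "C \<ge> 0" "K \<ge> 0" "\<And>\<tau>. Im \<tau> \<ge> 1 / 2 \<Longrightarrow> norm (f \<tau>) \<le> C * exp (K * Im \<tau>)"
    using assms(1) unfolding mod_growth_def by blast
  obtain D L where g: "D \<ge> 0" "L \<ge> 0" "\<And>\<tau>. Im \<tau> \<ge> 1 / 2 \<Longrightarrow> norm (g \<tau>) \<le> D * exp (L * Im \<tau>)"
    using assms(2) unfolding mod_growth_def by blast
  have "norm (f \<tau> * g \<tau>) \<le> (C * D) * exp ((K + L) * Im \<tau>)" if I: "Im \<tau> \<ge> 1 / 2" for \<tau>
  proof -
    have "norm (f \<tau> * g \<tau>) \<le> (C * exp (K * Im \<tau>)) * (D * exp (L * Im \<tau>))"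
      unfolding norm_mult using f(1) f(3)[OF I] g(3)[OF I] by (intro mult_mono) auto
    thus ?thesis by (simp only: distrib_right exp_add) (simp add: mult_ac)
  qed
  moreover have "(\<lambda>\<tau>. f \<tau> * g \<tau>) holomorphic_on {\<tau>. Im \<tau> > 0}"
    using assms unfolding mod_growth_def by (intro holomorphic_intros) auto
  ultimately show ?thesis using f g unfolding mod_growth_def
    by (intro conjI exI[of _ "C * D"] exI[of _ "K + L"]) auto
qed

lemma mod_growth_uminus: "mod_growth f \<Longrightarrow> mod_growth (\<lambda>\<tau>. - f \<tau>)"
  using mod_growth_mult[OF mod_growth_const[of "-1"]] by simp

lemma mod_growth_coeff_prod:
  assumes "finite S" "\<And>g. g \<in> S \<Longrightarrow> mod_growth g"
  shows "mod_growth (\<lambda>\<tau>. coeff (\<Prod>g\<in>S. [:- g \<tau>, 1:]) k)"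
  using assms
proof (induction S arbitrary: k rule: finite_induct)
  case empty
  show ?case by (simp add: mod_growth_const)
next
  case (insert g S)
  have "(\<lambda>\<tau>. coeff (\<Prod>h\<in>insert g S. [:- h \<tau>, 1:]) k) =
     (\<lambda>\<tau>. - g \<tau> * coeff (\<Prod>h\<in>S. [:- h \<tau>, 1:]) k + (if k = 0 then 0 else coeff (\<Prod>h\<in>S. [:- h \<tau>, 1:]) (k - 1)))"
    using insert by (auto simp: coeff_pCons split: nat.split)
  moreover have "mod_growth (\<lambda>\<tau>. if k = 0 then 0 else coeff (\<Prod>h\<in>S. [:- h \<tau>, 1:]) (k - 1))"
    using insert by (cases "k = 0") (simp_all add: mod_growth_const)
  ultimately show ?case using insert
    by (simp only:) (intro mod_growth_add mod_growth_mult mod_growth_uminus; simp)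
qed

lemma prod_power_int_exponent:
  fixes x :: "'b :: field"
  assumes "finite A" "x \<noteq> 0"
  shows "(\<Prod>m\<in>A. x powi f m) = x powi (\<Sum>m\<in>A. f m)"
  using assms(1) by (induction A rule: finite_induct) (use assms(2) in \<open>auto simp: power_int_add\<close>)

text \<open>\<open>r_sum\<close> is weight 0. \<open>r_weight\<close> makes K q the leading term,
  because eta(m \<tau>) begins with q^(m/24). B holds bottom rows of representatives of the cosets
  Gamma_0(N) \<gamma> in SL2(Z): rows (c, d) and (c', d') belong to the same coset exactly if N
  divides c d' - d c'.\<close>

locale eta_quotient =
  fixes N :: nat and r :: "nat \<Rightarrow> int" and K :: complex and B :: "(int \<times> int) set"
  assumes N_pos: "N > 0"
    and r_sum: "(\<Sum>m | m dvd N. r m) = 0"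
    and r_weight: "(\<Sum>m | m dvd N. int m * r m) = 24"
    and K_nonzero: "K \<noteq> 0"
    and fin_B: "finite B"
    and coprime_B: "\<And>c d. (c, d) \<in> B \<Longrightarrow> coprime c d"
    and cosets: "\<And>c d. coprime c d \<Longrightarrow> \<exists>(c', d')\<in>B. int N dvd c * d' - d * c'"
begin

definition t :: "complex \<Rightarrow> complex" where
  "t \<tau> = K * (\<Prod>m | m dvd N. dedekind_eta (of_nat m * \<tau>) powi r m)"

text \<open>The 24th power replaces eta by Delta and so removes the multiplier system of
  eta.\<close>

definition u :: "complex \<Rightarrow> complex" where "u \<tau> = t \<tau> ^ 24"

lemma finite_div: "finite {m. m dvd N}"
  using N_pos by simp

lemma u_eq: "u \<tau> = K ^ 24 * (\<Prod>m | m dvd N. Delta (of_nat m * \<tau>) powi r m)"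
proof -
  have "(dedekind_eta z powi k) ^ 24 = Delta z powi k" for z k
    unfolding dedekind_eta_power_24 [symmetric] by (metis power_int_mult power_int_numeral mult.commute)
  thus ?thesis by (simp add: u_def t_def power_mult_distrib prod_power_distrib)
qed

lemma div_pos: "m dvd N \<Longrightarrow> m > 0"
  using N_pos dvd_pos_nat by blast

text \<open>For m dividing N and hence c, multiplication by m conjugates the matrix into one of
  SL2(Z) with lower left entry c/m. Every factor then acquires the same automorphy factor x, and
  these cancel by \<open>r_sum\<close>.\<close>

lemma u_Gamma0:
  assumes "Im \<tau> > 0" "a * d - b * c = 1" "int N dvd c"
  shows "u (moeb a b c d \<tau>) = u \<tau>"
proof -
  define x where "x = (of_int c * \<tau> + of_int d) ^ 12"
  have cd: "(c, d) \<noteq> (0, 0)" using assms(2) by auto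
  have x0: "x \<noteq> 0" unfolding x_def using moeb_denom_nonzero[OF assms(1) cd] by simp
  have D: "Delta (of_nat m * moeb a b c d \<tau>) = x * Delta (of_nat m * \<tau>)" if "m dvd N" for m
  proof -
    have m: "m > 0" by (rule div_pos[OF that])
    have "int m dvd c" using that assms(3) by (meson dvd_trans of_nat_dvd_iff)
    then obtain c' where c': "c = int m * c'" by (elim dvdE)
    have "of_nat m * moeb a b c d \<tau> = moeb a (b * int m) c' d (of_nat m * \<tau>)"
      by (simp add: moeb_def c' algebra_simps)
    moreover have "Delta (moeb a (b * int m) c' d (of_nat m * \<tau>)) = 
       (of_int c' * (of_nat m * \<tau>) + of_int d) ^ 12 * Delta (of_nat m * \<tau>)"
      by (rule Delta_moeb) (use assms m in \<open>auto simp: c' algebra_simps\<close>)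
    ultimately show ?thesis by (simp add: x_def c' mult_ac)
  qed
  have "(\<Prod>m | m dvd N. Delta (of_nat m * moeb a b c d \<tau>) powi r m) = 
        (\<Prod>m | m dvd N. x powi r m * Delta (of_nat m * \<tau>) powi r m)"
    by (intro prod.cong refl) (simp add: D power_int_mult_distrib)
  also have "\<dots> = (\<Prod>m | m dvd N. Delta (of_nat m * \<tau>) powi r m)"
    by (simp add: prod.distrib prod_power_int_exponent[OF finite_div x0] r_sum)
  finally show ?thesis by (simp add: u_eq)
qed

text \<open>A, B', C, D are the entries of the first matrix times the inverse of the second. The
  lower left entry is c d' - d c', so the product lies in Gamma_0(N).\<close>

lemma u_coset:
  assumes "Im \<tau> > 0" "a * d - b * c = 1" "a' * d' - b' * c' = 1" "int N dvd c * d' - d * c'"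
  shows "u (moeb a b c d \<tau>) = u (moeb a' b' c' d' \<tau>)"
proof -
  define z where "z = moeb a' b' c' d' \<tau>"
  have cd': "(c', d') \<noteq> (0, 0)" using assms(3) by auto
  have Iz: "Im z > 0" unfolding z_def by (rule Im_moeb_pos) (use assms in auto)
  define A where "A = a * d' - b * c'"
  define B' where "B' = b * a' - a * b'"
  define C where "C = c * d' - d * c'"
  define D where "D = d * a' - c * b'"
  have e: "A * a' + B' * c' = a * (a' * d' - b' * c')" "A * b' + B' * d' = b * (a' * d' - b' * c')"
    "C * a' + D * c' = c * (a' * d' - b' * c')" "C * b' + D * d' = d * (a' * d' - b' * c')"
    by (simp_all add: A_def B'_def C_def D_def algebra_simps)
  have "A * D - B' * C = (a * d - b * c) * (a' * d' - b' * c')"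
    by (simp add: A_def B'_def C_def D_def algebra_simps)
  hence "A * D - B' * C = 1" using assms by simp
  hence "u (moeb A B' C D z) = u z" by (rule u_Gamma0[OF Iz]) (use assms in \<open>simp add: C_def\<close>)
  moreover have "moeb A B' C D z = moeb a b c d \<tau>"
    unfolding z_def by (subst moeb_compose[OF assms(1) cd']) (simp add: e assms)
  ultimately show ?thesis by (simp add: z_def)
qed

text \<open>The value 0 off the half plane makes equality of functions the same as equality on the
  half plane; thus \<open>orbit\<close> counts distinct conjugates only.\<close>

definition u_conj :: "int \<Rightarrow> int \<Rightarrow> int \<Rightarrow> int \<Rightarrow> complex \<Rightarrow> complex" where
  "u_conj a b c d = (\<lambda>\<tau>. if Im \<tau> > 0 then u (moeb a b c d \<tau>) else 0)"

definition orbit :: "(complex \<Rightarrow> complex) set" where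
  "orbit = {u_conj a b c d | a b c d. a * d - b * c = 1}"

lemma orbit_finite_card: "finite orbit" "card orbit \<le> card B"
proof -
  have "\<exists>ab. fst ab * snd p - snd ab * fst p = 1" if "p \<in> B" for p
  proof -
    obtain c d where p: "p = (c, d)" by (cases p)
    have "coprime c d" using coprime_B that p by simp
    then obtain x y where "x * c + y * d = 1" using bezout_int[of c d] by auto
    thus ?thesis by (intro exI[of _ "(y, - x)"]) (simp add: p)
  qed
  then obtain f where f: "\<And>p. p \<in> B \<Longrightarrow> fst (f p) * snd p - snd (f p) * fst p = 1" by metis
  define g where "g = (\<lambda>p. u_conj (fst (f p)) (snd (f p)) (fst p) (snd p))"
  have sub: "orbit \<subseteq> g ` B"
  proof
    fix h assume "h \<in> orbit"
    then obtain a b c d where h: "h = u_conj a b c d" "a * d - b * c = 1" unfolding orbit_def by blast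
    have "coprime c d"
    proof (rule coprimeI)
      fix e assume "e dvd c" "e dvd d"
      hence "e dvd a * d - b * c" by (intro dvd_diff dvd_mult)
      thus "is_unit e" using h by simp
    qed
    from cosets[OF this] obtain c' d' where cd: "(c', d') \<in> B" "int N dvd c * d' - d * c'" by auto
    have "h = g (c', d')"
      unfolding h g_def u_conj_def
      using u_coset[OF _ h(2) f[OF cd(1), simplified] cd(2)] by auto
    thus "h \<in> g ` B" using cd by blast
  qed
  show "finite orbit" using sub fin_B finite_surj by blast
  have "card orbit \<le> card (g ` B)" using sub fin_B by (intro card_mono) auto
  also have "\<dots> \<le> card B" by (rule card_image_le[OF fin_B])
  finally show "card orbit \<le> card B" .
qed

lemma u_holomorphic: "u holomorphic_on {\<tau>. Im \<tau> > 0}"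
proof -
  have hD: "Delta holomorphic_on {\<tau>. Im \<tau> > 0}"
    unfolding holomorphic_on_def using Delta_has_field_derivative field_differentiable_at_within
    by (metis (no_types, lifting) field_differentiable_def mem_Collect_eq)
  have "(\<lambda>\<tau>. Delta (of_nat m * \<tau>)) holomorphic_on {\<tau>. Im \<tau> > 0}" if "m dvd N" for m
  proof -
    have "(Delta \<circ> (\<lambda>\<tau>. of_nat m * \<tau>)) holomorphic_on {\<tau>. Im \<tau> > 0}"
      by (rule holomorphic_on_compose_gen[OF _ hD]) (use div_pos[OF that] in \<open>auto intro!: holomorphic_intros\<close>)
    thus ?thesis by (simp add: o_def)
  qed
  thus ?thesis unfolding u_eq
    by (intro holomorphic_intros) (use div_pos in \<open>auto simp: Delta_nonzero\<close>)
qed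

text \<open>|u| at a transformed point is a product of powers of invariant norms. Positive exponents
  use the upper bound of \<open>disc_norm\<close>, negative ones the exponential lower
  bound.\<close>

lemma u_conj_growth:
  assumes "a * d - b * c = 1"
  shows "mod_growth (u_conj a b c d)"
proof -
  obtain A C where AC: "A > 0" "C > 0" "\<And>\<tau>. Im \<tau> > 0 \<Longrightarrow> disc_norm \<tau> \<le> C"
    "\<And>\<tau>. Im \<tau> \<ge> 1 / 2 \<Longrightarrow> A * exp (- 2 * pi * Im \<tau>) \<le> disc_norm \<tau>"
    using disc_norm_bounds by metis
  \<comment> \<open>Division by m^6 turns Im(m z)^6 into Im(z)^6. The power of Im(z) is then the
    same for all m and cancels because the exponents add up to 0.\<close>
  define F where "F = (\<lambda>m \<tau>. disc_norm (of_nat m * moeb a b c d \<tau>) / real m ^ 6)"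
  have cd: "(c, d) \<noteq> (0, 0)" using assms by auto
  have norm_eq: "norm (u_conj a b c d \<tau>) = norm K ^ 24 * (\<Prod>m | m dvd N. F m \<tau> powi r m)" if I: "Im \<tau> \<ge> 1 / 2" for \<tau>
  proof -
    define y where "y = Im (moeb a b c d \<tau>) ^ 6"
    have y0: "y > 0" unfolding y_def using Im_moeb_pos[of \<tau> a d b c] assms I by simp
    have "norm (Delta (of_nat m * moeb a b c d \<tau>)) = F m \<tau> / y" if "m dvd N" for m
      using div_pos[OF that] y0 by (simp add: F_def disc_norm_def y_def power_mult_distrib)
    hence "norm (u_conj a b c d \<tau>) = norm K ^ 24 * (\<Prod>m | m dvd N. (F m \<tau> / y) powi r m)"
      using I by (simp add: u_conj_def u_eq norm_mult norm_power prod_norm [symmetric] norm_power_int)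
    also have "(\<Prod>m | m dvd N. (F m \<tau> / y) powi r m) = (\<Prod>m | m dvd N. F m \<tau> powi r m * inverse y powi r m)"
      by (simp add: divide_inverse power_int_mult_distrib)
    also have "\<dots> = (\<Prod>m | m dvd N. F m \<tau> powi r m)"
      using y0 by (simp add: prod.distrib prod_power_int_exponent[OF finite_div] r_sum)
    finally show ?thesis .
  qed
  have Fb: "\<exists>C' K'. C' \<ge> 0 \<and> K' \<ge> 0 \<and> (\<forall>\<tau>. Im \<tau> \<ge> 1 / 2 \<longrightarrow> 0 \<le> F m \<tau> powi r m \<and> F m \<tau> powi r m \<le> C' * exp (K' * Im \<tau>))"
    if m: "m dvd N" for m
  proof -
    have m0: "m > 0" by (rule div_pos[OF m])
    have z: "of_nat m * moeb a b c d \<tau> = moeb (int m * a) (int m * b) c d \<tau>" for \<tau>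
      by (simp add: moeb_def algebra_simps)
    have det: "int m * a * d - int m * b * c = int m"
    proof -
      have "int m * a * d - int m * b * c = int m * (a * d - b * c)" by (simp add: algebra_simps)
      thus ?thesis using assms by simp
    qed
    have F0: "0 \<le> F m \<tau>" if "Im \<tau> \<ge> 1 / 2" for \<tau>
      unfolding F_def disc_norm_def using Im_moeb_pos[of \<tau> a d b c] assms that by simp
    show ?thesis
    proof (cases "r m \<ge> 0")
      case True
      have "F m \<tau> \<le> C / real m ^ 6" if "Im \<tau> \<ge> 1 / 2" for \<tau>
        unfolding F_def z by (intro divide_right_mono AC(3) Im_moeb_pos) (use that det m0 in auto)
      hence "F m \<tau> ^ nat (r m) \<le> (C / real m ^ 6) ^ nat (r m)" if "Im \<tau> \<ge> 1 / 2" for \<tau>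
        using F0 that by (intro power_mono) auto
      thus ?thesis using True AC(2) F0
        by (intro exI[of _ "(C / real m ^ 6) ^ nat (r m)"] exI[of _ 0]) (auto simp: power_int_def)
    next
      case False
      define k where "k = nat (- r m)"
      have rk: "x powi r m = (inverse x) ^ k" for x :: real using False by (simp add: power_int_def k_def)
      have "inverse (F m \<tau>) \<le> real m ^ 6 / A * exp (8 * pi * real m * Im \<tau>)" if I: "Im \<tau> \<ge> 1 / 2" for \<tau>
      proof -
        have "A * exp (- 8 * pi * of_int (int m * a * d - int m * b * c) * Im \<tau>) \<le> disc_norm (moeb (int m * a) (int m * b) c d \<tau>)"
          by (rule disc_norm_moeb_lower[OF AC(1,4) I]) (use det m0 in auto)
        hence "A * exp (- 8 * pi * real m * Im \<tau>) \<le> disc_norm (moeb (int m * a) (int m * b) c d \<tau>)" by (simp only: det of_int_of_nat_eq)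
        hence "A * exp (- 8 * pi * real m * Im \<tau>) / real m ^ 6 \<le> F m \<tau>"
          unfolding F_def z by (intro divide_right_mono) auto
        hence "inverse (F m \<tau>) \<le> inverse (A * exp (- 8 * pi * real m * Im \<tau>) / real m ^ 6)"
          using AC(1) m0 by (intro le_imp_inverse_le) auto
        also have "\<dots> = real m ^ 6 / A * exp (8 * pi * real m * Im \<tau>)"
          by (simp add: exp_minus field_simps)
        finally show ?thesis .
      qed
      hence "(inverse (F m \<tau>)) ^ k \<le> (real m ^ 6 / A * exp (8 * pi * real m * Im \<tau>)) ^ k" if "Im \<tau> \<ge> 1 / 2" for \<tau>
        by (intro power_mono) (use F0[OF that] that in auto)
      moreover have "(real m ^ 6 / A * exp (8 * pi * real m * Im \<tau>)) ^ k = 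
        (real m ^ 6 / A) ^ k * exp (8 * pi * real m * real k * Im \<tau>)" for \<tau>
        unfolding power_mult_distrib exp_of_nat_mult [symmetric] by (simp add: mult_ac)
      ultimately have "(inverse (F m \<tau>)) ^ k \<le> (real m ^ 6 / A) ^ k * exp (8 * pi * real m * real k * Im \<tau>)"
        if "Im \<tau> \<ge> 1 / 2" for \<tau> using that by metis
      thus ?thesis using AC(1) F0
        by (intro exI[of _ "(real m ^ 6 / A) ^ k"] exI[of _ "8 * pi * real m * real k"]) (auto simp: rk)
    qed
  qed
  have "\<exists>C' K'. C' \<ge> 0 \<and> K' \<ge> 0 \<and> (\<forall>\<tau>. Im \<tau> \<ge> 1 / 2 \<longrightarrow> 0 \<le> (\<Prod>m\<in>S. F m \<tau> powi r m) \<and> (\<Prod>m\<in>S. F m \<tau> powi r m) \<le> C' * exp (K' * Im \<tau>))"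
    if "finite S" "S \<subseteq> {m. m dvd N}" for S
    using that
  proof (induction S rule: finite_induct)
    case empty
    show ?case by (intro exI[of _ 1] exI[of _ 0]) auto
  next
    case (insert m S)
    obtain C1 K1 where 1: "C1 \<ge> 0" "K1 \<ge> 0"
      "\<And>\<tau>. Im \<tau> \<ge> 1 / 2 \<Longrightarrow> 0 \<le> (\<Prod>m\<in>S. F m \<tau> powi r m) \<and> (\<Prod>m\<in>S. F m \<tau> powi r m) \<le> C1 * exp (K1 * Im \<tau>)"
      using insert by auto
    obtain C2 K2 where 2: "C2 \<ge> 0" "K2 \<ge> 0"
      "\<And>\<tau>. Im \<tau> \<ge> 1 / 2 \<Longrightarrow> 0 \<le> F m \<tau> powi r m \<and> F m \<tau> powi r m \<le> C2 * exp (K2 * Im \<tau>)"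
      using Fb[of m] insert by auto
    have "0 \<le> (\<Prod>m\<in>insert m S. F m \<tau> powi r m) \<and> (\<Prod>m\<in>insert m S. F m \<tau> powi r m) \<le> (C2 * C1) * exp ((K2 + K1) * Im \<tau>)"
      if I: "Im \<tau> \<ge> 1 / 2" for \<tau>
    proof -
      have "F m \<tau> powi r m * (\<Prod>m\<in>S. F m \<tau> powi r m) \<le> (C2 * exp (K2 * Im \<tau>)) * (C1 * exp (K1 * Im \<tau>))"
        using 1(3)[OF I] 2(3)[OF I] 2(1) by (intro mult_mono) auto
      also have "\<dots> = (C2 * C1) * exp ((K2 + K1) * Im \<tau>)" by (simp only: distrib_right exp_add) (simp add: mult_ac)
      finally show ?thesis using insert 1(3)[OF I] 2(3)[OF I] by simp
    qed
    thus ?case using 1(1,2) 2(1,2) by (intro exI[of _ "C2 * C1"] exI[of _ "K2 + K1"]) auto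
  qed
  from this[OF finite_div] obtain C' K' where CK: "C' \<ge> 0" "K' \<ge> 0"
    "\<And>\<tau>. Im \<tau> \<ge> 1 / 2 \<Longrightarrow> (\<Prod>m | m dvd N. F m \<tau> powi r m) \<le> C' * exp (K' * Im \<tau>)" by auto
  have "norm (u_conj a b c d \<tau>) \<le> (norm K ^ 24 * C') * exp (K' * Im \<tau>)" if "Im \<tau> \<ge> 1 / 2" for \<tau>
    unfolding norm_eq[OF that] mult.assoc by (intro mult_left_mono CK that) auto
  moreover have "u_conj a b c d holomorphic_on {\<tau>. Im \<tau> > 0}"
  proof -
    have "(u \<circ> moeb a b c d) holomorphic_on {\<tau>. Im \<tau> > 0}"
    proof (rule holomorphic_on_compose_gen[OF _ u_holomorphic])
      show "moeb a b c d holomorphic_on {\<tau>. Im \<tau> > 0}"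
        unfolding moeb_def using moeb_denom_nonzero[OF _ cd] by (intro holomorphic_intros) auto
    qed (use Im_moeb_pos assms in auto)
    thus ?thesis by (rule holomorphic_transform) (auto simp: u_conj_def)
  qed
  ultimately show ?thesis unfolding mod_growth_def using CK
    by (intro conjI exI[of _ "norm K ^ 24 * C'"] exI[of _ K']) auto
qed

text \<open>Composition with either generator maps the orbit injectively into itself, hence permutes
  this finite set and fixes the polynomial with these roots.\<close>

lemma orbit_T_S:
  assumes "Im \<tau> > 0"
  shows "(\<Prod>g\<in>orbit. [:- g (\<tau> + 1), 1:]) = (\<Prod>g\<in>orbit. [:- g \<tau>, 1:])" (is ?T)
    and "(\<Prod>g\<in>orbit. [:- g (- 1 / \<tau>), 1:]) = (\<Prod>g\<in>orbit. [:- g \<tau>, 1:])" (is ?S)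
proof -
  have inv: "bij_betw F orbit orbit" if "F ` orbit \<subseteq> orbit" "inj_on F orbit" for F
    using that orbit_finite_card(1) by (simp add: bij_betw_def endo_inj_surj)
  have zero: "g \<tau> = 0" if "g \<in> orbit" "\<not> Im \<tau> > 0" for g \<tau>
    using that by (auto simp: orbit_def u_conj_def)
  define FT where "FT = (\<lambda>(g :: complex \<Rightarrow> complex) \<tau>. if Im \<tau> > 0 then g (\<tau> + 1) else 0)"
  define FS where "FS = (\<lambda>(g :: complex \<Rightarrow> complex) \<tau>. if Im \<tau> > 0 then g (- 1 / \<tau>) else 0)"
  have T1: "FT (u_conj a b c d) = u_conj a (a + b) c (c + d)" for a b c d
    by (rule ext) (simp add: FT_def u_conj_def moeb_def algebra_simps)
  have T2: "a * (c + d) - (a + b) * c = a * d - b * c" for a b c d :: int by (simp add: algebra_simps)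
  have "FT ` orbit \<subseteq> orbit"
  proof
    fix h assume "h \<in> FT ` orbit"
    then obtain a b c d where h: "h = FT (u_conj a b c d)" "a * d - b * c = 1" unfolding orbit_def by blast
    have "a * (c + d) - (a + b) * c = 1" unfolding T2 by (rule h(2))
    thus "h \<in> orbit" unfolding h(1) T1 orbit_def by blast
  qed
  moreover have "inj_on FT orbit"
  proof (rule inj_onI, rule ext)
    fix g h \<tau> assume gh: "g \<in> orbit" "h \<in> orbit" "FT g = FT h"
    show "g \<tau> = h \<tau>"
    proof (cases "Im \<tau> > 0")
      case True
      thus ?thesis using fun_cong[OF gh(3), of "\<tau> - 1"] by (simp add: FT_def)
    qed (simp add: zero gh)
  qed
  ultimately have "bij_betw FT orbit orbit" by (rule inv)
  from prod.reindex_bij_betw[OF this, of "\<lambda>g. [:- g \<tau>, 1:]"] show ?T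
    using assms by (simp add: FT_def)
  have S1: "FS (u_conj a b c d) = u_conj b (- a) d (- c)" for a b c d
  proof
    fix \<tau> show "FS (u_conj a b c d) \<tau> = u_conj b (- a) d (- c) \<tau>"
    proof (cases "Im \<tau> > 0")
      case True
      have "moeb a b c d (- 1 / \<tau>) = moeb a b c d (moeb 0 (-1) 1 0 \<tau>)" by (simp add: moeb_def)
      also have "\<dots> = moeb b (- a) d (- c) \<tau>" by (subst moeb_compose[OF True]) auto
      finally show ?thesis using True Im_S_pos[OF True] by (simp add: FS_def u_conj_def)
    qed (simp add: FS_def u_conj_def)
  qed
  have S2: "b * (- c) - (- a) * d = a * d - b * c" for a b c d :: int by simp
  have "FS ` orbit \<subseteq> orbit"
  proof
    fix h assume "h \<in> FS ` orbit"
    then obtain a b c d where h: "h = FS (u_conj a b c d)" "a * d - b * c = 1" unfolding orbit_def by blast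
    have "b * (- c) - (- a) * d = 1" unfolding S2 by (rule h(2))
    thus "h \<in> orbit" unfolding h(1) S1 orbit_def by blast
  qed
  moreover have "inj_on FS orbit"
  proof (rule inj_onI, rule ext)
    fix g h \<tau> assume gh: "g \<in> orbit" "h \<in> orbit" "FS g = FS h"
    show "g \<tau> = h \<tau>"
    proof (cases "Im \<tau> > 0")
      case True
      have "- 1 / (- 1 / \<tau>) = \<tau>" by simp
      thus ?thesis using fun_cong[OF gh(3), of "- 1 / \<tau>"] Im_S_pos[OF True] by (simp add: FS_def)
    qed (simp add: zero gh)
  qed
  ultimately have "bij_betw FS orbit orbit" by (rule inv)
  from prod.reindex_bij_betw[OF this, of "\<lambda>g. [:- g \<tau>, 1:]"] show ?S
    using assms by (simp add: FS_def)
qed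

lemma orbit_coeff_poly_in_j:
  "\<exists>p. \<forall>\<tau>. Im \<tau> > 0 \<longrightarrow> coeff (\<Prod>g\<in>orbit. [:- g \<tau>, 1:]) k = poly p (modular_j \<tau>)"
proof -
  define f where "f = (\<lambda>\<tau>. coeff (\<Prod>g\<in>orbit. [:- g \<tau>, 1:]) k)"
  have mg: "mod_growth f" unfolding f_def
    by (rule mod_growth_coeff_prod[OF orbit_finite_card(1)]) (auto simp: orbit_def u_conj_growth)
  then obtain C K where CK: "\<And>\<tau>. Im \<tau> \<ge> 1 / 2 \<Longrightarrow> norm (f \<tau>) \<le> C * exp (K * Im \<tau>)" unfolding mod_growth_def by blast
  have hol: "f holomorphic_on {\<tau>. Im \<tau> > 0}" using mg by (simp add: mod_growth_def)
  have "\<exists>p. \<forall>\<tau>. Im \<tau> > 0 \<longrightarrow> f \<tau> = poly p (modular_j \<tau>)"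
    by (rule poly_in_j[OF hol _ _ CK]) (auto simp: f_def orbit_T_S(1) orbit_T_S(2)[simplified])
  thus ?thesis by (simp add: f_def)
qed

lemma u_in_orbit: "u_conj 1 0 0 1 \<in> orbit"
  unfolding orbit_def by force

end

section \<open>The degree bound for P and Q\<close>

lemma card_roots_rsquarefree:
  fixes p :: "complex poly"
  assumes "rsquarefree p"
  shows "card {z. poly p z = 0} = degree p"
proof -
  have p0: "p \<noteq> 0" using assms by (auto simp: rsquarefree_def)
  have "degree p = degree (smult (lead_coeff p) (\<Prod>z|poly p z = 0. [:-z, 1:]))"
    by (simp only: complex_poly_decompose_rsquarefree[OF assms])
  also have "\<dots> = degree (\<Prod>z|poly p z = 0. [:-z, 1:])" using p0 by simp
  also have "\<dots> = (\<Sum>z|poly p z = 0. degree [:-z, 1:])" by (rule degree_prod_eq_sum_degree) auto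
  also have "\<dots> = card {z. poly p z = 0}" by simp
  finally show ?thesis ..
qed

lemma poly_eq_sum_bounded:
  fixes p :: "'a :: comm_ring_1 poly"
  assumes "degree p \<le> M"
  shows "poly p y = (\<Sum>i\<le>M. coeff p i * y ^ i)"
  unfolding poly_altdef
  by (rule sum.mono_neutral_left) (use assms in \<open>auto simp: coeff_eq_0\<close>)

lemma poly_eq_0_infinite:
  assumes "infinite {x. poly p x = (0 :: 'a :: idom)}"
  shows "p = 0"
  using assms poly_roots_finite by blast

context eta_quotient
begin

text \<open>The fractional powers of q in the eta factors combine to q by \<open>r_weight\<close>,
  so t is a function of q that is holomorphic also at the cusp q = 0.\<close>

definition tq :: "complex \<Rightarrow> complex" where
  "tq q = K * q * (\<Prod>m | m dvd N. euler_phi (q ^ m) powi r m)"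

lemma t_eq_tq: "t \<tau> = tq (qexp \<tau>)"
proof -
  define z where "z = 2 * of_real pi * \<i> * \<tau>"
  have "(\<Prod>m | m dvd N. dedekind_eta (of_nat m * \<tau>) powi r m) =
    (\<Prod>m | m dvd N. exp (of_int (int m * r m) * (z / 24)) * euler_phi (qexp \<tau> ^ m) powi r m)"
  proof (intro prod.cong refl)
    fix m
    have "dedekind_eta (of_nat m * \<tau>) powi r m =
      exp (of_int (r m) * (2 * of_real pi * \<i> * (of_nat m * \<tau>) / 24)) * euler_phi (qexp \<tau> ^ m) powi r m"
      by (simp only: dedekind_eta_altdef power_int_mult_distrib exp_power_int qexp_of_nat_mult)
    also have "of_int (r m) * (2 * of_real pi * \<i> * (of_nat m * \<tau>) / 24) = of_int (int m * r m) * (z / 24)"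
      by (simp add: z_def)
    finally show "dedekind_eta (of_nat m * \<tau>) powi r m =
      exp (of_int (int m * r m) * (z / 24)) * euler_phi (qexp \<tau> ^ m) powi r m" .
  qed
  also have "\<dots> = exp (\<Sum>m | m dvd N. of_int (int m * r m) * (z / 24)) * (\<Prod>m | m dvd N. euler_phi (qexp \<tau> ^ m) powi r m)"
    by (simp add: prod.distrib exp_sum[OF finite_div])
  also have "(\<Sum>m | m dvd N. of_int (int m * r m) * (z / 24)) = of_int (\<Sum>m | m dvd N. int m * r m) * (z / 24)"
    by (simp only: of_int_sum sum_distrib_right)
  also have "\<dots> = z" by (simp add: r_weight)
  also have "exp z = qexp \<tau>" by (simp add: z_def qexp_def)
  finally show ?thesis by (simp add: t_def tq_def)
qed

lemma euler_phi_power_holomorphic: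
  assumes "m > 0"
  shows "(\<lambda>q. euler_phi (q ^ m)) holomorphic_on ball 0 1"
proof -
  have "(euler_phi \<circ> (\<lambda>q. q ^ m)) holomorphic_on ball 0 1"
    by (rule holomorphic_on_compose_gen[OF _ euler_phi_holomorphic])
       (use assms in \<open>auto intro!: holomorphic_intros simp: norm_power power_less_one_iff\<close>)
  thus ?thesis by (simp add: o_def)
qed

lemma euler_phi_power_nonzero: "norm q < 1 \<Longrightarrow> m > 0 \<Longrightarrow> euler_phi (q ^ m) \<noteq> 0"
  by (rule euler_phi_nonzero) (simp add: norm_power power_less_one_iff)

lemma tq_holomorphic: "tq holomorphic_on ball 0 1"
  unfolding tq_def
  by (intro holomorphic_intros euler_phi_power_holomorphic) (use div_pos euler_phi_power_nonzero in auto)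

lemma tq_0 [simp]: "tq 0 = 0" by (simp add: tq_def)

lemma tq_deriv_0: "(tq has_field_derivative K) (at 0)"
proof -
  define g where "g = (\<lambda>q. K * (\<Prod>m | m dvd N. euler_phi (q ^ m) powi r m))"
  have "g holomorphic_on ball 0 1" unfolding g_def
    by (intro holomorphic_intros euler_phi_power_holomorphic) (use div_pos euler_phi_power_nonzero in auto)
  hence dg: "(g has_field_derivative deriv g 0) (at 0)" by (rule holomorphic_derivI) auto
  have "(\<Prod>m | m dvd N. euler_phi (0 ^ m) powi r m) = (\<Prod>m | m dvd N. 1)"
    by (intro prod.cong refl) (use div_pos in \<open>auto simp: power_0_left\<close>)
  hence g0: "g 0 = K" by (simp add: g_def)
  have "((\<lambda>q. q * g q) has_field_derivative 1 * g 0 + deriv g 0 * 0) (at 0)"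
    by (rule DERIV_mult'[OF DERIV_ident dg, THEN DERIV_cong]) simp
  moreover have "tq = (\<lambda>q. q * g q)" by (auto simp: tq_def g_def)
  ultimately show ?thesis by (simp add: g0)
qed

lemma tq_nonzero: "norm q < 1 \<Longrightarrow> q \<noteq> 0 \<Longrightarrow> tq q \<noteq> 0"
  unfolding tq_def using K_nonzero finite_div div_pos euler_phi_power_nonzero by auto

text \<open>tq tends to 0 at the cusp without taking the value 0 elsewhere; finitely many values
  would keep it away from 0.\<close>

lemma t_infinite: "infinite (t ` {\<tau>. Im \<tau> > 0})"
proof
  assume fin: "finite (t ` {\<tau>. Im \<tau> > 0})"
  have "tq \<midarrow>0\<rightarrow> tq 0" using tq_deriv_0 DERIV_isCont isContD by blast
  hence lim: "tq \<midarrow>0\<rightarrow> 0" by simp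
  have "open (- (t ` {\<tau>. Im \<tau> > 0}))" using finite_imp_closed[OF fin] by (simp add: open_Compl)
  moreover have "0 \<notin> t ` {\<tau>. Im \<tau> > 0}"
    using tq_nonzero norm_qexp_less_1 by (auto simp: t_eq_tq)
  ultimately have "\<forall>\<^sub>F q in at 0. tq q \<in> - (t ` {\<tau>. Im \<tau> > 0})"
    by (intro topological_tendstoD[OF lim] ComplI) auto
  moreover have "\<forall>\<^sub>F q in at (0::complex). q \<in> ball 0 1 - {0}" by (intro eventually_at_in_open) auto
  ultimately have "\<forall>\<^sub>F q in at (0::complex). False"
  proof eventually_elim
    case (elim q)
    then obtain \<tau> where "Im \<tau> > 0" "qexp \<tau> = q" using qexp_surj[of q] by auto
    thus ?case using elim t_eq_tq by auto
  qed
  thus False by simp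
qed

end

locale eta_quotient_j = eta_quotient +
  fixes P Q :: "complex poly"
  assumes coprime_PQ: "coprime P Q"
    and Q_t_nonzero: "\<And>\<tau>. Im \<tau> > 0 \<Longrightarrow> poly Q (t \<tau>) \<noteq> 0"
    and j_eq: "\<And>\<tau>. Im \<tau> > 0 \<Longrightarrow> modular_j \<tau> = poly P (t \<tau>) / poly Q (t \<tau>)"
begin

text \<open>Without denominators, the two expressions for j agree also at q = 0, by continuity.
  There the identity shows Q(0) = 0, and coprimality then gives P(0) different from 0.\<close>

lemma q_identity:
  assumes "norm q < 1"
  shows "E4q q ^ 3 * poly Q (tq q) = disc_q q * poly P (tq q)"
proof (cases "q = 0")
  case False
  then obtain \<tau> where t: "Im \<tau> > 0" "qexp \<tau> = q" using assms qexp_surj[of q] by auto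
  have "E4q q ^ 3 / disc_q q = poly P (tq q) / poly Q (tq q)"
    using j_eq[OF t(1)] modular_j_eq[OF t(1)] by (simp add: t_eq_tq t Delta_def)
  moreover have "disc_q q \<noteq> 0" using Delta_nonzero[OF t(1)] by (simp add: Delta_def t)
  moreover have "poly Q (tq q) \<noteq> 0" using Q_t_nonzero[OF t(1)] by (simp add: t_eq_tq t)
  ultimately show ?thesis by (simp add: field_simps)
next
  case True
  define f where "f = (\<lambda>q. E4q q ^ 3 * poly Q (tq q) - disc_q q * poly P (tq q))"
  have "f holomorphic_on ball 0 1" unfolding f_def E4q_def disc_q_def
    by (intro holomorphic_intros eval_sigma_holomorphic tq_holomorphic euler_phi_holomorphic)
  hence "isCont f 0"
    by (rule continuous_on_interior[OF holomorphic_on_imp_continuous_on]) simp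
  hence "f \<midarrow>0\<rightarrow> f 0" by (simp add: isCont_def)
  moreover have "f \<midarrow>0\<rightarrow> 0"
  proof (rule tendsto_eventually)
    have "\<forall>\<^sub>F q in at (0::complex). q \<in> ball 0 1 - {0}" by (intro eventually_at_in_open) auto
    thus "\<forall>\<^sub>F q in at 0. f q = 0"
    proof eventually_elim
      case (elim q)
      then obtain \<tau> where t: "Im \<tau> > 0" "qexp \<tau> = q" using qexp_surj[of q] by auto
      have "E4q q ^ 3 / disc_q q = poly P (tq q) / poly Q (tq q)"
        using j_eq[OF t(1)] modular_j_eq[OF t(1)] by (simp add: t_eq_tq t Delta_def)
      moreover have "disc_q q \<noteq> 0" using Delta_nonzero[OF t(1)] by (simp add: Delta_def t)
      moreover have "poly Q (tq q) \<noteq> 0" using Q_t_nonzero[OF t(1)] by (simp add: t_eq_tq t)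
      ultimately show ?case by (simp add: field_simps f_def)
    qed
  qed
  ultimately have "f 0 = 0" using LIM_unique by blast
  thus ?thesis using True by (simp add: f_def)
qed

lemma Q_0: "poly Q 0 = 0"
  using q_identity[of 0] by (simp add: E4q_def disc_q_def)

lemma P_0: "poly P 0 \<noteq> 0"
  using coprime_poly_0[OF coprime_PQ, of 0] Q_0 by simp

text \<open>The derivatives of both sides of \<open>q_identity\<close> at q = 0 are Q'(0) K and
  P(0). So Q has a simple zero at 0, which later excludes that P/Q is constant or invariant under x
  -> \<zeta> x for a root of unity \<zeta> other than 1.\<close>

lemma Q_1: "coeff Q 1 \<noteq> 0"
proof
  assume "coeff Q 1 = 0"
  hence "poly (pderiv Q) 0 = 0" by (simp add: poly_0_coeff_0 coeff_pderiv)
  moreover define L where "L = (\<lambda>q. E4q q ^ 3 * poly Q (tq q))"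
  have Qd: "((\<lambda>q. poly Q (tq q)) has_field_derivative poly (pderiv Q) (tq 0) * K) (at 0)"
    by (rule DERIV_chain2[where f = "poly Q", OF poly_DERIV tq_deriv_0])
  have Pd: "((\<lambda>q. poly P (tq q)) has_field_derivative poly (pderiv P) (tq 0) * K) (at 0)"
    by (rule DERIV_chain2[where f = "poly P", OF poly_DERIV tq_deriv_0])
  have "E4q holomorphic_on ball 0 1" unfolding E4q_def
    by (intro holomorphic_intros eval_sigma_holomorphic)
  hence Ed: "(E4q has_field_derivative deriv E4q 0) (at 0)" by (rule holomorphic_derivI) auto
  have hd: "disc_q holomorphic_on ball 0 1" unfolding disc_q_def
    by (intro holomorphic_intros euler_phi_holomorphic)
  have phd: "(euler_phi has_field_derivative deriv euler_phi 0) (at 0)"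
    by (rule holomorphic_derivI[OF euler_phi_holomorphic]) auto
  have Dd: "(disc_q has_field_derivative 1) (at 0)" unfolding disc_q_def
    by (auto intro!: derivative_eq_intros phd)
  have "(L has_field_derivative poly (pderiv Q) 0 * K) (at 0)" unfolding L_def
  proof -
    have "((\<lambda>q. a q ^ 3 * b q) has_field_derivative b') (at 0)"
      if "(a has_field_derivative a') (at 0)" "(b has_field_derivative b') (at 0)" "a 0 = 1" "b 0 = 0" for a b a' b'
      by (auto intro!: derivative_eq_intros that(1,2) simp: that(3,4))
    from this[OF Ed Qd] show "((\<lambda>q. E4q q ^ 3 * poly Q (tq q)) has_field_derivative poly (pderiv Q) 0 * K) (at 0)"
      by (simp add: Q_0 E4q_def)
  qed
  moreover have "((\<lambda>q. disc_q q * poly P (tq q)) has_field_derivative poly P 0) (at 0)"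
    using DERIV_mult[OF Dd Pd] by (simp add: disc_q_def)
  hence "(L has_field_derivative poly P 0) (at 0)"
    by (rule has_field_derivative_transform_within_open[where S = "ball 0 1"]) (auto simp: L_def q_identity)
  ultimately have "poly P 0 = 0" using DERIV_unique by fastforce
  thus False using P_0 by simp
qed

lemma const_fibre_finite: "finite {x. poly P x = w * poly Q x}"
proof -
  have "P - smult w Q \<noteq> 0"
  proof
    assume "P - smult w Q = 0"
    hence "poly (P - smult w Q) 0 = 0" by simp
    thus False using P_0 Q_0 by simp
  qed
  from poly_roots_finite[OF this] show ?thesis by (simp add: algebra_simps)
qed

lemma j_infinite: "infinite (modular_j ` {\<tau>. Im \<tau> > 0})"
proof
  define R where "R = (\<lambda>x. poly P x / poly Q x)"
  assume "finite (modular_j ` {\<tau>. Im \<tau> > 0})"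
  moreover have "R ` t ` {\<tau>. Im \<tau> > 0} = modular_j ` {\<tau>. Im \<tau> > 0}"
    unfolding image_image by (rule image_cong) (auto simp: R_def j_eq)
  ultimately have "finite (R ` t ` {\<tau>. Im \<tau> > 0})" by simp
  from pigeonhole_infinite[OF t_infinite this] obtain x0 where
    inf: "infinite {x \<in> t ` {\<tau>. Im \<tau> > 0}. R x = R x0}" by blast
  have "{x \<in> t ` {\<tau>. Im \<tau> > 0}. R x = R x0} \<subseteq> {x. poly P x = R x0 * poly Q x}"
    using Q_t_nonzero by (auto simp: R_def field_simps)
  thus False using inf const_fibre_finite finite_subset by blast
qed

text \<open>The point x need not be a value of t. The orbit polynomial relates t^24 to j; after
  clearing denominators this is a polynomial RR that vanishes at the infinitely many values of t, so
  RR = 0 and the relation holds at every x with Q(x) nonzero.\<close>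

lemma fibre_in_orbit:
  assumes "poly Q x \<noteq> 0" "Im \<tau>0 > 0" "poly P x / poly Q x = modular_j \<tau>0"
  shows "x ^ 24 \<in> (\<lambda>g. g \<tau>0) ` orbit"
proof -
  define n where "n = card orbit"
  obtain p where p: "\<And>k \<tau>. Im \<tau> > 0 \<Longrightarrow> coeff (\<Prod>g\<in>orbit. [:- g \<tau>, 1:]) k = poly (p k) (modular_j \<tau>)"
    using orbit_coeff_poly_in_j by metis
  have deg: "degree (\<Prod>g\<in>orbit. [:- g \<tau>, 1:]) \<le> n" for \<tau>
    by (rule order.trans[OF degree_prod_sum_le[OF orbit_finite_card(1)]]) (simp add: n_def)
  have Phi: "poly (\<Prod>g\<in>orbit. [:- g \<tau>, 1:]) y = (\<Sum>k\<le>n. poly (p k) (modular_j \<tau>) * y ^ k)" if "Im \<tau> > 0" for \<tau> y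
    using poly_eq_sum_bounded[OF deg, of \<tau> y] p[OF that] by simp
  define M where "M = Max ((\<lambda>k. degree (p k)) ` {..n})"
  have M: "degree (p k) \<le> M" if "k \<le> n" for k unfolding M_def using that by (intro Max_ge) auto
  \<comment> \<open>P^i Q^(M - i) is Q^M (P/Q)^i; M bounds the degrees of all coefficient
    polynomials p k.\<close>
  define RR where "RR = (\<Sum>k\<le>n. (\<Sum>i\<le>M. smult (coeff (p k) i) (P ^ i * Q ^ (M - i))) * monom 1 (24 * k))"
  have RR: "poly RR x = poly Q x ^ M * (\<Sum>k\<le>n. poly (p k) (poly P x / poly Q x) * (x ^ 24) ^ k)" if "poly Q x \<noteq> 0" for x
  proof -
    have "poly Q x ^ M * poly (p k) (poly P x / poly Q x) = (\<Sum>i\<le>M. coeff (p k) i * (poly P x ^ i * poly Q x ^ (M - i)))"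
      if k: "k \<le> n" for k
    proof -
      have e: "poly Q x ^ M * (coeff (p k) i * (poly P x / poly Q x) ^ i) = coeff (p k) i * (poly P x ^ i * poly Q x ^ (M - i))"
        if "i \<le> M" for i
        using that \<open>poly Q x \<noteq> 0\<close> by (simp add: power_divide power_diff)
      thus ?thesis unfolding poly_eq_sum_bounded[OF M[OF k]] sum_distrib_left
        by (intro sum.cong refl e) simp
    qed
    thus ?thesis
      by (simp add: RR_def poly_sum poly_monom sum_distrib_left power_mult flip: mult.assoc)
  qed
  have "poly RR (t \<tau>) = 0" if I: "Im \<tau> > 0" for \<tau>
  proof -
    have "(\<Sum>k\<le>n. poly (p k) (poly P (t \<tau>) / poly Q (t \<tau>)) * (t \<tau> ^ 24) ^ k) = poly (\<Prod>g\<in>orbit. [:- g \<tau>, 1:]) (t \<tau> ^ 24)"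
      unfolding Phi[OF I] j_eq[OF I] ..
    also have "\<dots> = (\<Prod>g\<in>orbit. t \<tau> ^ 24 - g \<tau>)" by (simp add: poly_prod)
    also have "\<dots> = 0"
      by (rule prod_zero[OF orbit_finite_card(1)], rule bexI[OF _ u_in_orbit])
         (use I in \<open>simp add: u_conj_def u_def moeb_def\<close>)
    finally show ?thesis unfolding RR[OF Q_t_nonzero[OF I]] by simp
  qed
  hence "t ` {\<tau>. Im \<tau> > 0} \<subseteq> {x. poly RR x = 0}" by auto
  hence "RR = 0" using t_infinite poly_eq_0_infinite finite_subset by blast
  hence "(\<Sum>k\<le>n. poly (p k) (modular_j \<tau>0) * (x ^ 24) ^ k) = 0" using RR[OF assms(1)] assms by simp
  hence "poly (\<Prod>g\<in>orbit. [:- g \<tau>0, 1:]) (x ^ 24) = 0" unfolding Phi[OF assms(2)] .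
  hence "(\<Prod>g\<in>orbit. x ^ 24 - g \<tau>0) = 0" by (simp add: poly_prod)
  thus ?thesis using orbit_finite_card(1) by auto
qed

text \<open>For a generic value w of j the fibre P = w Q consists of max (degree P) (degree Q)
  distinct points with distinct 24th powers. By \<open>fibre_in_orbit\<close> these powers are
  values of conjugates of u, of which there are at most card B.\<close>

theorem degree_le: "degree P \<le> card B" "degree Q \<le> card B"
proof -
  define Z where "Z = {\<zeta>::complex. \<zeta> ^ 24 = 1 \<and> \<zeta> \<noteq> 1}"
  have finZ: "finite Z"
  proof -
    have "finite {\<zeta>::complex. poly (monom 1 24 - 1) \<zeta> = 0}"
    proof (rule poly_roots_finite)
      have "coeff (monom 1 24 - 1 :: complex poly) 24 = 1" by simp
      thus "(monom 1 24 - 1 :: complex poly) \<noteq> 0" by (metis coeff_0 zero_neq_one)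
    qed
    thus ?thesis by (rule finite_subset[rotated]) (auto simp: Z_def poly_monom)
  qed
  \<comment> \<open>Wz \<zeta> vanishes at x when x and \<zeta> x lie in the same fibre of P/Q, and
    V vanishes at the multiple points of fibres. Nonvanishing of both is what generic means.\<close>
  define Wz where "Wz = (\<lambda>\<zeta>. pcompose P [:0, \<zeta>:] * Q - P * pcompose Q [:0, \<zeta>:])"
  define V where "V = pderiv P * Q - P * pderiv Q"
  define W where "W = V * (\<Prod>\<zeta>\<in>Z. Wz \<zeta>)"
  have q1: "poly (pderiv Q) 0 = coeff Q 1" by (simp add: poly_0_coeff_0 coeff_pderiv)
  have V0: "V \<noteq> 0"
  proof
    assume "V = 0"
    hence "poly V 0 = 0" by simp
    thus False using P_0 Q_0 Q_1 q1 by (simp add: V_def)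
  qed
  have "Wz \<zeta> \<noteq> 0" if z: "\<zeta> \<in> Z" for \<zeta>
  proof
    assume "Wz \<zeta> = 0"
    \<comment> \<open>The value at 0 gives nothing because Q(0) = 0; the derivative there is P(0)
      Q'(0) (1 - \<zeta>).\<close>
    hence "poly (pderiv (Wz \<zeta>)) 0 = 0" by simp
    hence "poly P 0 * coeff Q 1 = poly P 0 * (\<zeta> * coeff Q 1)"
      by (simp add: Wz_def pderiv_diff pderiv_mult pderiv_pcompose poly_pcompose Q_0 q1 pderiv_pCons mult_ac)
    thus False using P_0 Q_1 z by (auto simp: Z_def)
  qed
  hence W0: "W \<noteq> 0" using V0 finZ by (simp add: W_def)
  define d where "d = max (degree P) (degree Q)"
  \<comment> \<open>Excluded are the images of the zeros of W and the value of w for which the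
    leading terms of P and w Q cancel.\<close>
  define bad where "bad = insert (coeff P d / coeff Q d) ((\<lambda>x. poly P x / poly Q x) ` {x. poly W x = 0})"
  have "finite bad" unfolding bad_def using poly_roots_finite[OF W0] by simp
  then obtain w where "w \<in> modular_j ` {\<tau>. Im \<tau> > 0} - bad"
    using j_infinite by (metis Diff_infinite_finite finite.emptyI all_not_in_conv)
  then obtain \<tau>0 where t0: "Im \<tau>0 > 0" "w = modular_j \<tau>0" and wb: "w \<notin> bad" by auto
  define p where "p = P - smult w Q"
  have root: "poly Q x \<noteq> 0 \<and> poly P x = w * poly Q x" if "poly p x = 0" for x
    using that coprime_poly_0[OF coprime_PQ, of x] by (auto simp: p_def)
  have notbad: "poly W x \<noteq> 0" if "poly p x = 0" for x
  proof
    assume "poly W x = 0"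
    hence "poly P x / poly Q x \<in> bad" by (auto simp: bad_def)
    thus False using wb root[OF that] by simp
  qed
  have degp: "degree p = d"
  proof (rule antisym)
    show "degree p \<le> d" unfolding p_def d_def
      by (rule degree_diff_le) (auto intro: order.trans[OF degree_smult_le])
    have "coeff p d \<noteq> 0"
    proof
      assume 0: "coeff p d = 0"
      hence e: "coeff P d = w * coeff Q d" by (simp add: p_def)
      show False
      proof (cases "coeff Q d = 0")
        case False
        hence "w = coeff P d / coeff Q d" using e by simp
        thus False using wb by (simp add: bad_def)
      next
        case True
        hence "coeff P d = 0" using e by simp
        have PQ: "P \<noteq> 0" "Q \<noteq> 0" using P_0 Q_1 by auto
        have "d = degree P \<or> d = degree Q" by (auto simp: d_def max_def)
        thus False using True \<open>coeff P d = 0\<close> PQ by auto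
      qed
    qed
    thus "d \<le> degree p" by (rule le_degree)
  qed
  have "rsquarefree p"
    unfolding rsquarefree_roots
  proof (intro allI notI)
    fix a assume a: "poly p a = 0 \<and> poly (pderiv p) a = 0"
    hence "poly P a = w * poly Q a" "poly (pderiv P) a = w * poly (pderiv Q) a"
      by (auto simp: p_def pderiv_diff pderiv_smult)
    hence "poly V a = 0" by (simp add: V_def)
    hence "poly W a = 0" by (simp add: W_def)
    thus False using notbad a by blast
  qed
  hence cd: "card {x. poly p x = 0} = d" using card_roots_rsquarefree degp by simp
  have "inj_on (\<lambda>x. x ^ 24) {x. poly p x = 0}"
  proof (rule inj_onI, rule ccontr)
    fix x y assume xy: "x \<in> {x. poly p x = 0}" "y \<in> {x. poly p x = 0}" "x ^ 24 = y ^ 24" "x \<noteq> y"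
    have nz: "x \<noteq> 0" using xy P_0 Q_0 by (auto simp: p_def)
    define \<zeta> where "\<zeta> = y / x"
    have y: "y = \<zeta> * x" using nz by (simp add: \<zeta>_def)
    have "\<zeta> \<in> Z" using nz xy by (auto simp: Z_def \<zeta>_def power_divide)
    have "poly (Wz \<zeta>) x = poly P y * poly Q x - poly P x * poly Q y"
      by (simp add: Wz_def poly_pcompose y mult.commute)
    also have "\<dots> = 0" using root[of x] root[of y] xy by simp
    finally have "poly (\<Prod>\<zeta>\<in>Z. Wz \<zeta>) x = 0" using \<open>\<zeta> \<in> Z\<close> finZ by (auto simp: poly_prod)
    hence "poly W x = 0" by (simp add: W_def)
    thus False using notbad xy by blast
  qed
  hence "d = card ((\<lambda>x. x ^ 24) ` {x. poly p x = 0})" using cd by (simp add: card_image)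
  also have "\<dots> \<le> card ((\<lambda>g. g \<tau>0) ` orbit)"
  proof (rule card_mono)
    show "(\<lambda>x. x ^ 24) ` {x. poly p x = 0} \<subseteq> (\<lambda>g. g \<tau>0) ` orbit"
      using fibre_in_orbit[OF _ t0(1)] root t0(2) by auto
  qed (use orbit_finite_card in auto)
  also have "\<dots> \<le> card orbit" by (rule card_image_le[OF orbit_finite_card(1)])
  also have "\<dots> \<le> card B" by (rule orbit_finite_card(2))
  finally show "degree P \<le> card B" "degree Q \<le> card B" by (auto simp: d_def)
qed

end

section \<open>Identification of P and Q from q-coefficients\<close>

text \<open>The substitution q -> q^m.\<close>

definition dilate :: "nat \<Rightarrow> complex fps \<Rightarrow> complex fps" where
  "dilate m F = Abs_fps (\<lambda>k. if m dvd k then fps_nth F (k div m) else 0)"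

lemma lambert_dilate:
  assumes "m > 0"
  shows "(\<lambda>q. lambert j (q ^ m)) has_fps_expansion dilate m (sigma_fps j)"
proof -
  have hs: "((\<lambda>k. fps_nth (dilate m (sigma_fps j)) k * q ^ k) has_sum lambert j (q ^ m)) UNIV" if "norm q < 1" for q
  proof -
    have "norm (q ^ m) < 1" using that assms by (simp add: norm_power power_less_one_iff)
    from sigma_has_sum[OF this, of j]
    have "((\<lambda>k. fps_nth (dilate m (sigma_fps j)) k * q ^ k) has_sum lambert j (q ^ m)) (range (\<lambda>n. m * n))"
      using assms by (subst has_sum_reindex) (auto simp: inj_on_def o_def dilate_def power_mult)
    thus ?thesis
      by (subst has_sum_cong_neutral[where T = "range (\<lambda>n. m * n)" and g = "\<lambda>k. fps_nth (dilate m (sigma_fps j)) k * q ^ k"])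
         (auto simp: dilate_def)
  qed
  have cr: "fps_conv_radius (dilate m (sigma_fps j)) \<ge> 1"
    unfolding fps_conv_radius_def
  proof (rule conv_radius_geI_ex')
    fix r :: real assume "0 < r" "ereal r < 1"
    hence "norm (of_real r :: complex) < 1" by (simp add: one_ereal_def)
    from hs[OF this] show "summable (\<lambda>n. fps_nth (dilate m (sigma_fps j)) n * of_real r ^ n)"
      using has_sum_imp_sums sums_summable by blast
  qed
  have "\<forall>\<^sub>F q in nhds (0::complex). q \<in> ball 0 1" by (intro eventually_nhds_in_open) auto
  hence "\<forall>\<^sub>F q in nhds 0. eval_fps (dilate m (sigma_fps j)) q = lambert j (q ^ m)"
  proof eventually_elim
    case (elim q)
    thus ?case using has_sum_imp_sums[OF hs[of q]] by (simp add: eval_fps_def sums_iff)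
  qed
  moreover have "fps_conv_radius (dilate m (sigma_fps j)) > 0" using cr by (rule less_le_trans[rotated]) simp
  ultimately show ?thesis by (simp add: has_fps_expansion_def)
qed

lemma coprime_poly_bezout:
  fixes p q :: "'a :: field poly"
  assumes "coprime p q"
  shows "\<exists>u v. u * p + v * q = 1"
  using assms
proof (induction "euclidean_size q" arbitrary: p q rule: less_induct)
  case less
  show ?case
  proof (cases "q = 0")
    case True
    hence "p dvd 1" using less.prems by simp
    then obtain u where "1 = p * u" by (elim dvdE)
    hence "u * p + 0 * q = 1" by (simp add: mult.commute)
    thus ?thesis by blast
  next
    case False
    have "coprime q (p mod q)"
    proof (rule coprimeI)
      fix c assume c: "c dvd q" "c dvd p mod q"
      hence "c dvd p" using dvd_mod_imp_dvd by blast
      thus "is_unit c" using less.prems c(1) coprime_common_divisor by blast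
    qed
    from less.hyps[OF mod_size_less[OF False] this] obtain u v where uv: "u * q + v * (p mod q) = 1" by blast
    have "p mod q = p - p div q * q" by (rule minus_div_mult_eq_mod[symmetric])
    hence "v * p + (u - v * (p div q)) * q = u * q + v * (p mod q)"
      by (simp only: left_diff_distrib right_diff_distrib mult.assoc) simp
    thus ?thesis using uv by auto
  qed
qed

lemma E4q_expansion: "E4q has_fps_expansion 1 + fps_const 240 * sigma_fps 3"
proof -
  have "fps_conv_radius (sigma_fps 3) > 0" using fps_conv_radius_sigma by (rule less_le_trans[rotated]) simp
  thus ?thesis unfolding E4q_def
    by (intro fps_expansion_intros eval_fps_has_fps_expansion)
qed

lemma disc_q_holomorphic: "disc_q holomorphic_on ball 0 1"
  unfolding disc_q_def by (intro holomorphic_intros euler_phi_holomorphic)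

lemma disc_q_expansion: "disc_q has_fps_expansion fps_expansion disc_q 0"
  by (rule has_fps_expansion_fps_expansion[OF _ _ disc_q_holomorphic]) auto

lemma poly_compose_expansion:
  fixes f :: "complex \<Rightarrow> complex"
  assumes "f has_fps_expansion F" "fps_nth F 0 = 0"
  shows "(\<lambda>q. poly p (f q)) has_fps_expansion (fps_of_poly p oo F)"
proof -
  have "poly p has_fps_expansion fps_of_poly p" by (simp add: has_fps_expansion_def)
  from has_fps_expansion_compose[OF this assms] show ?thesis by (simp add: o_def)
qed

lemma has_fps_expansion_eq:
  fixes f g :: "complex \<Rightarrow> complex"
  assumes f: "f has_fps_expansion F" and g: "g has_fps_expansion G" and eq: "\<And>q. norm q < 1 \<Longrightarrow> f q = g q"
  shows "F = G"
proof -
  have "\<forall>\<^sub>F q in nhds (0::complex). q \<in> ball 0 1" by (intro eventually_nhds_in_open) auto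
  hence "\<forall>\<^sub>F q in nhds 0. f q = g q" by eventually_elim (use eq in auto)
  from f[unfolded has_fps_expansion_cong[OF this refl]] show ?thesis by (rule fps_expansion_unique_complex[OF _ g])
qed

text \<open>Delta and t enter through the equation q f' = f l, where the coefficients of l are
  divisor sums; infinite products are never expanded.\<close>

lemma logderiv_expansion:
  assumes f: "f holomorphic_on ball 0 1" and L: "l has_fps_expansion L"
    and eq: "\<And>q. norm q < 1 \<Longrightarrow> q * deriv f q = f q * l q"
  shows "fps_X * fps_deriv (fps_expansion f 0) = fps_expansion f 0 * L"
proof -
  have F: "f has_fps_expansion fps_expansion f 0"
    by (rule has_fps_expansion_fps_expansion[OF _ _ f]) auto
  have "(\<lambda>q. q * deriv f q) has_fps_expansion fps_X * fps_deriv (fps_expansion f 0)"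
    by (intro fps_expansion_intros F)
  moreover have "(\<lambda>q. f q * l q) has_fps_expansion fps_expansion f 0 * L" by (intro fps_expansion_intros F L)
  ultimately show ?thesis by (rule has_fps_expansion_eq) (rule eq)
qed

lemma disc_q_logderiv:
  "fps_X * fps_deriv (fps_expansion disc_q 0) = fps_expansion disc_q 0 * (1 - fps_const 24 * sigma_fps 1)"
proof (rule logderiv_expansion[OF disc_q_holomorphic])
  have "dilate 1 (sigma_fps 1) = sigma_fps 1" by (simp add: dilate_def fps_eq_iff)
  with lambert_dilate[of 1 1] have "lambert 1 has_fps_expansion sigma_fps 1" by simp
  thus "(\<lambda>q. 1 - 24 * lambert 1 q) has_fps_expansion 1 - fps_const 24 * sigma_fps 1"
    by (intro fps_expansion_intros)
  fix q :: complex assume q: "norm q < 1"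
  have "(euler_phi has_field_derivative deriv euler_phi q) (at q)"
    by (rule holomorphic_derivI[OF euler_phi_holomorphic]) (use q in auto)
  hence "(disc_q has_field_derivative euler_phi q ^ 24 + q * (24 * euler_phi q ^ 23 * deriv euler_phi q)) (at q)"
    unfolding disc_q_def by (auto intro!: derivative_eq_intros)
  hence "q * deriv disc_q q = q * (euler_phi q ^ 24 + 24 * euler_phi q ^ 23 * (q * deriv euler_phi q))"
    by (simp add: DERIV_imp_deriv)
  also have "\<dots> = disc_q q * (1 - 24 * lambert 1 q)"
    unfolding euler_phi_logderiv[OF q] by (simp add: disc_q_def algebra_simps eval_nat_numeral)
  finally show "q * deriv disc_q q = disc_q q * (1 - 24 * lambert 1 q)" .
qed

lemma disc_q_nth: "fps_nth (fps_expansion disc_q 0) 0 = 0" "fps_nth (fps_expansion disc_q 0) 1 = 1"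
proof -
  have "(euler_phi has_field_derivative deriv euler_phi 0) (at 0)"
    by (rule holomorphic_derivI[OF euler_phi_holomorphic]) auto
  hence "(disc_q has_field_derivative 1) (at 0)" unfolding disc_q_def by (auto intro!: derivative_eq_intros)
  thus "fps_nth (fps_expansion disc_q 0) 0 = 0" "fps_nth (fps_expansion disc_q 0) 1 = 1"
    by (simp_all add: fps_expansion_def DERIV_imp_deriv disc_q_def)
qed

section \<open>Power series truncated to lists of integers\<close>

primrec series_mult :: "int list \<Rightarrow> int list \<Rightarrow> int list" where
  "series_mult [] ys = map (\<lambda>_. 0) ys"
| "series_mult (x # xs) ys = map2 (+) (map ((*) x) ys) (0 # series_mult xs ys)"

primrec series_add_const :: "int \<Rightarrow> int list \<Rightarrow> int list" where
  "series_add_const a [] = []"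
| "series_add_const a (x # xs) = (a + x) # xs"

primrec series_poly :: "int list \<Rightarrow> int list \<Rightarrow> int list" where
  "series_poly [] ts = map (\<lambda>_. 0) ts"
| "series_poly (a # as) ts = series_add_const a (series_mult (series_poly as ts) ts)"

definition series_cube :: "int list \<Rightarrow> int list" where
  "series_cube xs = series_mult xs (series_mult xs xs)"

definition agrees :: "nat \<Rightarrow> complex fps \<Rightarrow> int list \<Rightarrow> bool" where
  "agrees M F xs \<longleftrightarrow> length xs = M \<and> (\<forall>k<M. fps_nth F k = of_int (xs ! k))"

lemma length_series_mult [simp]: "length (series_mult xs ys) = length ys"
  by (induction xs) auto

text \<open>\<open>map2\<close> stops with the shorter list, so the product is cut to the length of
  ys; below that length nothing is lost.\<close>

lemma series_mult_nth:
  "k < length ys \<Longrightarrow> series_mult xs ys ! k = (\<Sum>i\<le>k. (if i < length xs then xs ! i else 0) * ys ! (k - i))"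
proof (induction xs arbitrary: k)
  case (Cons x xs)
  show ?case
  proof (cases k)
    case 0 thus ?thesis using Cons.prems by simp
  next
    case (Suc k')
    thus ?thesis using Cons.prems Cons.IH[of k']
      by (simp add: sum.atMost_Suc_shift del: sum.atMost_Suc cong: if_cong)
  qed
qed simp

lemma agrees_mult:
  assumes "agrees M F xs" "agrees M G ys"
  shows "agrees M (F * G) (series_mult xs ys)"
  unfolding agrees_def
proof (intro conjI allI impI)
  fix k assume k: "k < M"
  have "fps_nth (F * G) k = (\<Sum>i\<le>k. fps_nth F i * fps_nth G (k - i))" by (simp add: fps_mult_nth atLeast0AtMost)
  also have "\<dots> = (\<Sum>i\<le>k. of_int ((if i < length xs then xs ! i else 0) * ys ! (k - i)))"
    by (intro sum.cong refl) (use assms k in \<open>auto simp: agrees_def\<close>)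
  also have "\<dots> = of_int (series_mult xs ys ! k)"
    using assms k by (subst series_mult_nth) (auto simp: agrees_def)
  finally show "fps_nth (F * G) k = of_int (series_mult xs ys ! k)" .
qed (use assms in \<open>simp add: agrees_def\<close>)

lemma agrees_cube: "agrees M F xs \<Longrightarrow> agrees M (F ^ 3) (series_cube xs)"
  unfolding series_cube_def power3_eq_cube mult.assoc by (intro agrees_mult)

lemma agrees_add_const:
  assumes "agrees M F xs"
  shows "agrees M (fps_const (of_int a) + F) (series_add_const a xs)"
  using assms by (cases xs) (auto simp: agrees_def nth_Cons split: nat.split)

definition int_poly :: "int list \<Rightarrow> complex poly" where "int_poly as = Poly (map of_int as)"

lemma poly_int_poly_Cons [simp]:
  "poly (int_poly []) x = 0" "poly (int_poly (a # as)) x = of_int a + x * poly (int_poly as) x"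
  by (simp_all add: int_poly_def)

lemma degree_int_poly: "degree (int_poly as) \<le> length as - 1"
proof (induction as)
  case (Cons a as)
  have "degree (int_poly (a # as)) \<le> Suc (degree (int_poly as))" by (simp add: int_poly_def degree_pCons_le)
  thus ?case using Cons by (cases as) (auto simp: int_poly_def)
qed (simp add: int_poly_def)

lemma agrees_poly:
  assumes "agrees M F ts" "fps_nth F 0 = 0"
  shows "agrees M (fps_of_poly (int_poly as) oo F) (series_poly as ts)"
proof (induction as)
  case Nil
  show ?case using assms by (auto simp: agrees_def int_poly_def)
next
  case (Cons a as)
  have "fps_of_poly (int_poly (a # as)) oo F = fps_const (of_int a) + (fps_of_poly (int_poly as) oo F) * F"
    using assms(2) by (simp add: int_poly_def fps_of_poly_pCons fps_compose_add_distrib fps_compose_mult_distrib fps_const_compose)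
  thus ?case using agrees_add_const[OF agrees_mult[OF Cons assms(1)], of a] by simp
qed

text \<open>Since L has constant term 1, coefficient k of the equation expresses (k - 1) F_k through
  the F_i with i < k. The factor k - 1 vanishes at k = 1, so the coefficients 0 and 1 are given and
  all others are forced. A proposed list xs is thus verified against the recursion rather than
  computed.\<close>

lemma agrees_logderiv:
  assumes eq: "fps_X * fps_deriv F = F * L" and L0: "fps_nth L 0 = 1" and L: "agrees M L ls"
    and F: "fps_nth F 0 = 0" "fps_nth F 1 = of_int c"
    and xs: "length xs = M" "M \<ge> 2" "xs ! 0 = 0" "xs ! 1 = c"
    and check: "map2 (*) (map int [0..<M]) xs = series_mult xs ls"
  shows "agrees M F xs"
proof -
  have "fps_nth F k = of_int (xs ! k)" if "k < M" for k
    using that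
  proof (induction k rule: less_induct)
    case (less k)
    show ?case
    proof (cases "k < 2")
      case True
      hence "k = 0 \<or> k = 1" by auto
      thus ?thesis using F xs by auto
    next
      case False
      have ls0: "ls ! 0 = 1"
      proof -
        have "of_int (ls ! 0) = (1::complex)" using L L0 xs by (simp add: agrees_def)
        thus ?thesis by simp
      qed
      have split: "(\<Sum>i\<le>k. g i) = (\<Sum>i<k. g i) + g k" for g :: "nat \<Rightarrow> 'a :: comm_monoid_add"
        by (cases k) (simp_all add: lessThan_Suc_atMost)
      have "of_nat k * fps_nth F k = fps_nth (fps_X * fps_deriv F) k" using False by simp
      also have "\<dots> = (\<Sum>i\<le>k. fps_nth F i * fps_nth L (k - i))"
        unfolding eq by (simp add: fps_mult_nth atLeast0AtMost)
      also have "\<dots> = (\<Sum>i<k. fps_nth F i * fps_nth L (k - i)) + fps_nth F k" by (simp add: split L0)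
      also have "(\<Sum>i<k. fps_nth F i * fps_nth L (k - i)) = (\<Sum>i<k. of_int (xs ! i * ls ! (k - i)))"
        by (intro sum.cong refl) (use less L in \<open>auto simp: agrees_def\<close>)
      finally have 1: "of_nat k * fps_nth F k = of_int (\<Sum>i<k. xs ! i * ls ! (k - i)) + fps_nth F k" by simp
      have lsM: "length ls = M" using L by (simp add: agrees_def)
      have "int k * xs ! k = map2 (*) (map int [0..<M]) xs ! k" using less.prems xs by simp
      also have "\<dots> = (\<Sum>i\<le>k. (if i < length xs then xs ! i else 0) * ls ! (k - i))"
        unfolding check by (rule series_mult_nth) (use lsM less.prems in simp)
      also have "\<dots> = (\<Sum>i\<le>k. xs ! i * ls ! (k - i))"
        by (intro sum.cong refl) (use xs less.prems in auto)
      also have "\<dots> = (\<Sum>i<k. xs ! i * ls ! (k - i)) + xs ! k" by (simp add: split ls0)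
      finally have 2: "(\<Sum>i<k. xs ! i * ls ! (k - i)) = int k * xs ! k - xs ! k" by simp
      have "(of_nat k - 1) * fps_nth F k = (of_nat k - 1) * of_int (xs ! k)"
        using 1 unfolding 2 by (simp add: algebra_simps)
      moreover have "of_nat k - 1 \<noteq> (0::complex)" using False by (auto simp: eq_iff_diff_eq_0[symmetric])
      ultimately show ?thesis by simp
    qed
  qed
  thus ?thesis using xs by (simp add: agrees_def)
qed

section \<open>Divisor sums and the logarithmic derivative of an eta quotient\<close>

definition divisor_list :: "nat \<Rightarrow> nat list" where "divisor_list n = filter (\<lambda>d. d dvd n) [1..<Suc n]"

definition sigma_list :: "nat \<Rightarrow> nat \<Rightarrow> int" where "sigma_list j n = (\<Sum>d\<leftarrow>divisor_list n. int d ^ j)"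

lemma set_divisor_list: "n > 0 \<Longrightarrow> set (divisor_list n) = {d. d dvd n}"
  by (auto simp: divisor_list_def dest: dvd_imp_le intro: Suc_leI dvd_pos_nat)

lemma distinct_divisor_list: "distinct (divisor_list n)"
  by (simp add: divisor_list_def)

lemma sum_divisors: "n > 0 \<Longrightarrow> (\<Sum>d | d dvd n. f d) = (\<Sum>d\<leftarrow>divisor_list n. f d)"
  by (simp add: sum_list_distinct_conv_sum_set distinct_divisor_list set_divisor_list)

lemma of_int_sum_list: "of_int (sum_list xs) = (sum_list (map of_int xs) :: complex)"
  by (induction xs) auto

lemma sigma_fps_nth: "fps_nth (sigma_fps j) n = of_int (sigma_list j n)"
proof (cases "n = 0")
  case True
  thus ?thesis by (simp add: sigma_fps_def sigma_list_def divisor_list_def)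
next
  case False
  thus ?thesis by (simp add: sigma_fps_def sum_divisors sigma_list_def of_int_sum_list o_def)
qed

text \<open>Coefficient k of q t'/t. The factor q of \<open>tq\<close> contributes the constant 1,
  and the Euler product at q^m contributes -m r_m times the divisor sum of k/m.\<close>

definition log_coeff :: "nat \<Rightarrow> (nat \<Rightarrow> int) \<Rightarrow> nat \<Rightarrow> int" where
  "log_coeff N r k = (if k = 0 then 1 else 0) - (\<Sum>m\<leftarrow>divisor_list N. r m * int m * (if m dvd k then sigma_list 1 (k div m) else 0))"

context eta_quotient
begin

lemma tq_logderiv_q:
  assumes q: "norm q < 1"
  shows "q * deriv tq q = tq q * (1 - (\<Sum>m | m dvd N. of_int (r m * int m) * lambert 1 (q ^ m)))"
proof (cases "q = 0")
  case False
  have "((\<lambda>q. \<Prod>m\<in>S. euler_phi (q ^ m) powi r m) has_field_derivative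
          (\<Prod>m\<in>S. euler_phi (q ^ m) powi r m) * (- (\<Sum>m\<in>S. of_int (r m * int m) * lambert 1 (q ^ m)) / q)) (at q)"
    if "finite S" "S \<subseteq> {m. m dvd N}" for S
    using that
  proof (induction S rule: finite_induct)
    case (insert m S)
    have m: "m > 0" using insert div_pos by simp
    have qm: "norm (q ^ m) < 1" using q m by (simp add: norm_power power_less_one_iff)
    define A where "A = euler_phi (q ^ m)"
    define l where "l = lambert 1 (q ^ m)"
    have A0: "A \<noteq> 0" unfolding A_def by (rule euler_phi_nonzero[OF qm])
    have "(euler_phi has_field_derivative deriv euler_phi (q ^ m)) (at (q ^ m))"
      by (rule holomorphic_derivI[OF euler_phi_holomorphic]) (use qm in auto)
    hence "((\<lambda>q. euler_phi (q ^ m)) has_field_derivative deriv euler_phi (q ^ m) * (of_nat m * q ^ (m - 1))) (at q)"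
      by (rule DERIV_chain2) (auto intro!: derivative_eq_intros)
    also have "deriv euler_phi (q ^ m) * (of_nat m * q ^ (m - 1)) = of_nat m * (q ^ m * deriv euler_phi (q ^ m)) / q"
      using False m by (cases m) (auto simp: field_simps)
    also have "\<dots> = A * (- of_nat m * l / q)"
      unfolding euler_phi_logderiv[OF qm] A_def l_def by simp
    finally have d1: "((\<lambda>q. euler_phi (q ^ m)) has_field_derivative A * (- of_nat m * l / q)) (at q)" .
    have d2: "((\<lambda>q. euler_phi (q ^ m) powi r m) has_field_derivative of_int (r m) * A powi (r m - 1) * (A * (- of_nat m * l / q))) (at q)"
      using DERIV_power_int[OF d1, of "r m"] A0 by (simp add: A_def mult_ac)
    have "A powi (r m - 1) * A = A powi r m" using A0 by (simp add: power_int_diff)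
    hence e: "of_int (r m) * A powi (r m - 1) * (A * (- of_nat m * l / q)) = A powi r m * (- (of_int (r m * int m) * l) / q)"
      by (simp add: mult_ac)
    show ?case
      using DERIV_mult[OF d2[unfolded e] insert.IH] insert
      by (simp add: A_def l_def) (simp add: algebra_simps add_divide_distrib diff_divide_distrib)
  qed simp
  from this[OF finite_div] have d: "((\<lambda>q. \<Prod>m | m dvd N. euler_phi (q ^ m) powi r m) has_field_derivative
          (\<Prod>m | m dvd N. euler_phi (q ^ m) powi r m) * (- (\<Sum>m | m dvd N. of_int (r m * int m) * lambert 1 (q ^ m)) / q)) (at q)" by simp
  have "(tq has_field_derivative K * (\<Prod>m | m dvd N. euler_phi (q ^ m) powi r m) + K * q *
      ((\<Prod>m | m dvd N. euler_phi (q ^ m) powi r m) * (- (\<Sum>m | m dvd N. of_int (r m * int m) * lambert 1 (q ^ m)) / q))) (at q)"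
    unfolding tq_def by (rule derivative_eq_intros d refl | simp)+
  hence "deriv tq q = K * (\<Prod>m | m dvd N. euler_phi (q ^ m) powi r m) + K * q *
      ((\<Prod>m | m dvd N. euler_phi (q ^ m) powi r m) * (- (\<Sum>m | m dvd N. of_int (r m * int m) * lambert 1 (q ^ m)) / q))"
    by (rule DERIV_imp_deriv)
  moreover have "q * (k * p + k * q * (p * (- s / q))) = k * q * p * (1 - s)" for k p s :: complex
    using False by (simp add: field_simps)
  ultimately show ?thesis by (simp only: tq_def)
qed simp

lemma tq_expansion: "tq has_fps_expansion fps_expansion tq 0"
  by (rule has_fps_expansion_fps_expansion[OF _ _ tq_holomorphic]) auto

lemma tq_nth: "fps_nth (fps_expansion tq 0) 0 = 0" "fps_nth (fps_expansion tq 0) 1 = K"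
  using DERIV_imp_deriv[OF tq_deriv_0] by (simp_all add: fps_expansion_def)

lemma tq_agrees:
  assumes "K = of_int c" "length xs = M" "M \<ge> 2" "xs ! 0 = 0" "xs ! 1 = c"
    and "map2 (*) (map int [0..<M]) xs = series_mult xs (map (log_coeff N r) [0..<M])"
  shows "agrees M (fps_expansion tq 0) xs"
proof -
  define L where "L = 1 - (\<Sum>m | m dvd N. fps_const (of_int (r m * int m)) * dilate m (sigma_fps 1))"
  have Lk: "fps_nth L k = of_int (log_coeff N r k)" for k
  proof -
    have "fps_nth L k = (if k = 0 then 1 else 0) - (\<Sum>m | m dvd N. of_int (r m * int m * (if m dvd k then sigma_list 1 (k div m) else 0)))"
      by (simp add: L_def fps_sum_nth dilate_def sigma_fps_nth if_distrib cong: if_cong)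
    also have "\<dots> = of_int (log_coeff N r k)"
      unfolding sum_divisors[OF N_pos] by (simp add: log_coeff_def of_int_sum_list o_def)
    finally show ?thesis .
  qed
  show ?thesis
  proof (rule agrees_logderiv)
    show "fps_X * fps_deriv (fps_expansion tq 0) = fps_expansion tq 0 * L"
    proof (rule logderiv_expansion[OF tq_holomorphic])
      show "(\<lambda>q. 1 - (\<Sum>m | m dvd N. of_int (r m * int m) * lambert 1 (q ^ m))) has_fps_expansion L"
        unfolding L_def by (intro fps_expansion_intros lambert_dilate) (use div_pos in auto)
    qed (rule tq_logderiv_q)
    show "fps_nth L 0 = 1" unfolding Lk by (simp add: log_coeff_def sigma_list_def divisor_list_def)
    show "agrees M L (map (log_coeff N r) [0..<M])" by (simp add: agrees_def Lk)
  qed (use assms tq_nth in auto)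
qed

end

context eta_quotient_j
begin

text \<open>H = P QN - Q PN has degree at most 2 card B. Along t, the identity for P and Q gives
  Delta H(t) = Q(t) (E_4^3 QN(t) - Delta PN(t)). By the checked coefficients the right side vanishes
  at q = 0 to a higher order than the left side can unless H = 0. Coprimality of P and Q and the
  absence of common zeros of PN and QN then leave only a constant factor.\<close>

theorem identify:
  assumes M: "M = 2 * card B + 1"
    and T: "agrees M (fps_expansion tq 0) ts"
    and E: "agrees M ((1 + fps_const 240 * sigma_fps 3) ^ 3) es"
    and D: "agrees M (fps_expansion disc_q 0) ds"
    and PN: "PN = int_poly as ^ 3 * int_poly bs" and QN: "QN = int_poly cs"
    and deg: "3 * (length as - 1) + (length bs - 1) \<le> card B" "length cs - 1 \<le> card B"
    and check: "series_mult (series_poly cs ts) es = series_mult (series_mult (series_cube (series_poly as ts)) (series_poly bs ts)) ds"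
    and no_common: "\<And>x. poly QN x = 0 \<Longrightarrow> poly PN x \<noteq> 0"
  obtains c where "c \<noteq> 0" "P = smult c PN" "Q = smult c QN"
proof -
  define TF where "TF = fps_expansion tq 0"
  define EF where "EF = (1 + fps_const 240 * sigma_fps 3) ^ 3"
  define DF where "DF = fps_expansion disc_q 0"
  have T0: "fps_nth TF 0 = 0" "fps_nth TF 1 = K" using tq_nth by (simp_all add: TF_def)
  have id: "EF * (fps_of_poly Q oo TF) = DF * (fps_of_poly P oo TF)"
  proof -
    have "(\<lambda>q. E4q q ^ 3 * poly Q (tq q)) has_fps_expansion EF * (fps_of_poly Q oo TF)"
      unfolding EF_def TF_def
      by (intro fps_expansion_intros has_fps_expansion_power E4q_expansion poly_compose_expansion tq_expansion tq_nth)
    moreover have "(\<lambda>q. disc_q q * poly P (tq q)) has_fps_expansion DF * (fps_of_poly P oo TF)"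
      unfolding DF_def TF_def
      by (intro fps_expansion_intros disc_q_expansion poly_compose_expansion tq_expansion tq_nth)
    ultimately show ?thesis by (rule has_fps_expansion_eq) (rule q_identity)
  qed
  have a1: "agrees M ((fps_of_poly QN oo TF) * EF) (series_mult (series_poly cs ts) es)"
    unfolding QN TF_def EF_def by (intro agrees_mult agrees_poly T E tq_nth)
  have PNc: "fps_of_poly PN oo TF = (fps_of_poly (int_poly as) oo TF) ^ 3 * (fps_of_poly (int_poly bs) oo TF)"
    unfolding PN by (simp add: fps_of_poly_mult fps_of_poly_power fps_compose_mult_distrib[OF T0(1)] fps_compose_power[OF T0(1)])
  have a2: "agrees M ((fps_of_poly PN oo TF) * DF)
     (series_mult (series_mult (series_cube (series_poly as ts)) (series_poly bs ts)) ds)"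
    unfolding PNc unfolding TF_def DF_def by (intro agrees_mult agrees_cube agrees_poly T D tq_nth)
  have cong: "fps_nth (EF * (fps_of_poly QN oo TF)) k = fps_nth (DF * (fps_of_poly PN oo TF)) k" if "k < M" for k
    using a1 a2 that unfolding check agrees_def by (simp add: mult.commute)
  define H where "H = P * QN - Q * PN"
  have degPN: "degree PN \<le> card B"
  proof -
    have "degree PN \<le> degree (int_poly as ^ 3) + degree (int_poly bs)" unfolding PN by (rule degree_mult_le)
    also have "degree (int_poly as ^ 3) \<le> degree (int_poly as) * 3" by (rule degree_power_le)
    finally show ?thesis using degree_int_poly[of as] degree_int_poly[of bs] deg(1) by linarith
  qed
  have degQN: "degree QN \<le> card B" using degree_int_poly[of cs] deg(2) by (simp add: QN)
  have "degree (P * QN) \<le> card B + card B"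
    by (rule order.trans[OF degree_mult_le]) (use degree_le degQN in linarith)
  moreover have "degree (Q * PN) \<le> card B + card B"
    by (rule order.trans[OF degree_mult_le]) (use degree_le degPN in linarith)
  ultimately have degH: "degree H \<le> 2 * card B" unfolding H_def by (intro degree_diff_le) auto
  have "H = 0"
  proof (rule ccontr)
    assume H0: "H \<noteq> 0"
    \<comment> \<open>Since t = K q + ... and Delta has a simple zero, Delta H(t) vanishes at q = 0
      to order exactly h + 1, and h + 1 <= 2 card B + 1 = M.\<close>
    define h where "h = order 0 H"
    obtain H' where H': "H = [:- 0, 1:] ^ h * H'" "\<not> [:- 0, 1:] dvd H'"
      using order_decomp[OF H0, of 0] unfolding h_def by blast
    have hle: "h \<le> 2 * card B" using order_degree[OF H0, of 0] degH by (simp add: h_def)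
    have H'0: "coeff H' 0 \<noteq> 0" using H'(2) poly_eq_0_iff_dvd[of H' 0] by (simp add: poly_0_coeff_0)
    define DF1 where "DF1 = fps_shift 1 DF"
    define TF1 where "TF1 = fps_shift 1 TF"
    have DF1: "DF = fps_X * DF1" "fps_nth DF1 0 = 1"
      using disc_q_nth by (auto simp: DF1_def DF_def fps_eq_iff)
    have TF1: "TF = fps_X * TF1" "fps_nth TF1 0 = K"
      using T0 by (auto simp: TF1_def fps_eq_iff)
    have "fps_of_poly H oo TF = TF ^ h * (fps_of_poly H' oo TF)"
      unfolding H'(1) by (simp add: fps_of_poly_mult fps_of_poly_power fps_compose_mult_distrib[OF T0(1)]
          fps_X_power_compose[OF T0(1)] fps_of_poly_pCons)
    hence "DF * (fps_of_poly H oo TF) = fps_X ^ (h + 1) * (DF1 * TF1 ^ h * (fps_of_poly H' oo TF))"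
      by (simp add: DF1(1) TF1(1) power_mult_distrib mult_ac)
    hence "fps_nth (DF * (fps_of_poly H oo TF)) (h + 1) = fps_nth (DF1 * TF1 ^ h * (fps_of_poly H' oo TF)) 0"
      by (simp only: fps_X_power_mult_nth less_irrefl if_False diff_self_eq_0)
    hence n1: "fps_nth (DF * (fps_of_poly H oo TF)) (h + 1) = K ^ h * coeff H' 0"
      by (simp add: DF1 TF1 fps_power_zeroth)
    define R where "R = EF * (fps_of_poly QN oo TF) - DF * (fps_of_poly PN oo TF)"
    define G where "G = fps_of_poly Q oo TF"
    have "DF * (fps_of_poly H oo TF) = (DF * (fps_of_poly P oo TF)) * (fps_of_poly QN oo TF) - DF * (fps_of_poly Q oo TF) * (fps_of_poly PN oo TF)"
      unfolding H_def by (simp add: fps_of_poly_diff fps_of_poly_mult fps_compose_sub_distrib fps_compose_mult_distrib[OF T0(1)] algebra_simps)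
    also have "\<dots> = G * R" unfolding id[symmetric] R_def G_def by (simp add: algebra_simps)
    finally have "fps_nth (DF * (fps_of_poly H oo TF)) (h + 1) = (\<Sum>i=0..h + 1. fps_nth G i * fps_nth R (h + 1 - i))"
      by (simp only: fps_mult_nth)
    also have "\<dots> = 0"
    proof (rule sum.neutral, rule ballI)
      fix i assume "i \<in> {0..h + 1}"
      \<comment> \<open>For i = 0 the coefficient h + 1 of R may lie beyond the M checked ones; that
        term vanishes because Q(0) = 0.\<close>
      show "fps_nth G i * fps_nth R (h + 1 - i) = 0"
      proof (cases "i = 0")
        case True
        thus ?thesis using Q_0 by (simp add: G_def poly_0_coeff_0)
      next
        case False
        hence "fps_nth R (h + 1 - i) = 0" unfolding R_def using cong[of "h + 1 - i"] hle M by simp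
        thus ?thesis by simp
      qed
    qed
    finally show False using n1 K_nonzero H'0 by simp
  qed
  hence eq: "P * QN = Q * PN" by (simp add: H_def)
  hence dvd: "P dvd Q * PN" by (metis dvd_triv_left)
  obtain u v where uv: "u * P + v * Q = 1" using coprime_poly_bezout[OF coprime_PQ] by blast
  \<comment> \<open>Bezout turns the divisibility of Q PN by P into that of PN by P.\<close>
  have "PN = (u * P + v * Q) * PN" by (simp add: uv)
  also have "\<dots> = P * (u * PN) + v * (Q * PN)" by (simp add: algebra_simps)
  finally have PN': "PN = P * (u * PN) + v * (Q * PN)" .
  have "P dvd P * (u * PN) + v * (Q * PN)" by (intro dvd_add dvd_triv_left dvd_mult dvd)
  hence "P dvd PN" using PN' by simp
  then obtain k where k: "PN = P * k" by (elim dvdE)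
  have P0: "P \<noteq> 0" using P_0 by auto
  have "P * QN = P * (Q * k)" using eq k by (simp add: mult_ac)
  hence k': "QN = Q * k" using P0 by simp
  \<comment> \<open>A zero of k would be a common zero of PN = P k and QN = Q k.\<close>
  have "constant (poly k)"
  proof (rule ccontr)
    assume "\<not> constant (poly k)"
    from Fundamental_Theorem_Algebra.fundamental_theorem_of_algebra[OF this] obtain x where "poly k x = 0" by auto
    thus False using no_common[of x] k k' by simp
  qed
  hence "degree k = 0" by (simp add: constant_degree)
  then obtain a where a: "k = [:a:]" by (rule degree_eq_zeroE)
  have a0: "a \<noteq> 0"
  proof
    assume "a = 0"
    thus False using no_common[of 0] k k' a by simp
  qed
  have "P = smult (1 / a) PN" "Q = smult (1 / a) QN" using k k' a a0 by simp_all
  thus ?thesis using that[of "1 / a"] a0 by simp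
qed

end

section \<open>Local solutions of the Gauss and Heun equations\<close>

lemma fps_mult_nth_lowest:
  fixes A B :: "complex fps"
  assumes "\<And>i. i < m \<Longrightarrow> fps_nth A i = 0"
  shows "fps_nth (B * A) m = fps_nth B 0 * fps_nth A m"
proof -
  have "fps_nth (B * A) m = (\<Sum>i=0..m. fps_nth B i * fps_nth A (m - i))" by (rule fps_mult_nth)
  also have "\<dots> = (\<Sum>i\<in>{0}. fps_nth B i * fps_nth A (m - i))"
    by (rule sum.mono_neutral_right) (use assms in auto)
  finally show ?thesis by simp
qed

text \<open>Because U and V have the same constant term, 0 is a double root of the indicial
  equation: coefficient m of the equation determines V(0) (m + 1)^2 H_(m + 1) from lower
  coefficients. This is the case \<gamma> = 1.\<close>

lemma fps_ode_unique:
  fixes F G U V W :: "complex fps"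
  assumes F: "fps_X * U * fps_deriv (fps_deriv F) + V * fps_deriv F + W * F = 0"
    and G: "fps_X * U * fps_deriv (fps_deriv G) + V * fps_deriv G + W * G = 0"
    and UV: "fps_nth U 0 = fps_nth V 0" "fps_nth V 0 \<noteq> 0" and init: "fps_nth F 0 = fps_nth G 0"
  shows "F = G"
proof -
  define H where "H = F - G"
  have H: "fps_X * U * fps_deriv (fps_deriv H) + V * fps_deriv H + W * H = 0"
  proof -
    have "fps_X * U * fps_deriv (fps_deriv H) + V * fps_deriv H + W * H =
      (fps_X * U * fps_deriv (fps_deriv F) + V * fps_deriv F + W * F) -
      (fps_X * U * fps_deriv (fps_deriv G) + V * fps_deriv G + W * G)"
      by (simp add: H_def algebra_simps)
    thus ?thesis by (simp only: F G diff_self)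
  qed
  have "fps_nth H n = 0" for n
  proof (induction n rule: less_induct)
    case (less n)
    show ?case
    proof (cases n)
      case 0 thus ?thesis using init by (simp add: H_def)
    next
      case (Suc m)
      have 1: "fps_nth (W * H) m = 0"
        using less Suc by (subst fps_mult_nth_lowest) auto
      have 2: "fps_nth (V * fps_deriv H) m = fps_nth V 0 * (of_nat (Suc m) * fps_nth H (Suc m))"
        using less Suc by (subst fps_mult_nth_lowest) auto
      have 3: "fps_nth (fps_X * U * fps_deriv (fps_deriv H)) m = fps_nth V 0 * (of_nat m * (of_nat (Suc m) * fps_nth H (Suc m)))"
      proof (cases m)
        case (Suc l)
        have "fps_nth (fps_X * U * fps_deriv (fps_deriv H)) m = fps_nth (U * fps_deriv (fps_deriv H)) l"
          by (simp add: Suc mult.assoc)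
        also have "\<dots> = fps_nth U 0 * fps_nth (fps_deriv (fps_deriv H)) l"
          by (rule fps_mult_nth_lowest) (use less \<open>n = Suc m\<close> Suc in auto)
        finally show ?thesis using Suc UV by simp
      qed (simp add: mult.assoc)
      have "fps_nth (fps_X * U * fps_deriv (fps_deriv H) + V * fps_deriv H + W * H) m = 0" by (simp only: H fps_zero_nth)
      hence "fps_nth V 0 * (of_nat (Suc m) * of_nat (Suc m) * fps_nth H (Suc m)) = 0"
        unfolding fps_add_nth 1 2 3 by (simp add: algebra_simps)
      thus ?thesis using UV(2) Suc by (simp del: of_nat_Suc)
    qed
  qed
  hence "H = 0" by (simp add: fps_eq_iff)
  thus ?thesis by (simp add: H_def)
qed

lemma eventually_poly_nonzero:
  fixes p :: "complex poly"
  assumes "p \<noteq> 0"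
  shows "\<forall>\<^sub>F t in at 0. poly p t \<noteq> 0"
proof -
  have fin: "finite ({t. poly p t = 0} - {0})" using poly_roots_finite[OF assms] by simp
  have "open (- ({t. poly p t = 0} - {0}))" by (intro open_Compl finite_imp_closed fin)
  hence "\<forall>\<^sub>F t in at 0. t \<in> - ({t. poly p t = 0} - {0}) - {0}" by (intro eventually_at_in_open) auto
  thus ?thesis by eventually_elim auto
qed

definition gauss_fps :: "complex \<Rightarrow> complex \<Rightarrow> complex fps" where
  "gauss_fps a b = fps_hypergeo [a, b] [1] 1"

lemma gauss_fps_rec:
  "of_nat (Suc n) * of_nat (Suc n) * fps_nth (gauss_fps a b) (Suc n) = (a + of_nat n) * (b + of_nat n) * fps_nth (gauss_fps a b) n"
proof -
  have "of_nat (Suc n) \<noteq> (0::complex)" by (simp del: of_nat_Suc)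
  moreover have "fps_nth (gauss_fps a b) (Suc n) =
      (1 * (a + of_nat n) * (b + of_nat n)) / (of_nat (Suc n) * (1 + of_nat n)) * fps_nth (gauss_fps a b) n"
    using fps_hypergeo_rec[of "[a, b]" "[1]" 1 n] unfolding gauss_fps_def by (simp only: foldl.simps)
  moreover have "1 + of_nat n \<noteq> (0::complex)"
    using \<open>of_nat (Suc n) \<noteq> (0::complex)\<close> by simp
  ultimately show ?thesis by (simp add: mult_ac)
qed

lemma gauss_fps_0 [simp]: "fps_nth (gauss_fps a b) 0 = 1"
  by (simp add: gauss_fps_def)

lemma gauss_fps_conv_radius: "fps_conv_radius (gauss_fps a b) > 0"
proof -
  \<comment> \<open>The recurrence yields the crude bound C^n for coefficient n; only a positive
    radius is aimed at.\<close>
  define C where "C = (1 + norm a) * (1 + norm b)"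
  have C: "C \<ge> 1" unfolding C_def using mult_mono[of 1 "1 + norm a" 1 "1 + norm b"] by simp
  have bd: "norm (fps_nth (gauss_fps a b) n) \<le> C ^ n" for n
  proof (induction n)
    case (Suc n)
    have k: "norm (x + of_nat n) \<le> (1 + norm x) * real (Suc n)" for x :: complex
    proof -
      have "norm (x + of_nat n) \<le> norm x + real n" using norm_triangle_ineq[of x "of_nat n"] by simp
      also have "\<dots> \<le> (1 + norm x) * real (Suc n)" by (simp add: algebra_simps)
      finally show ?thesis .
    qed
    have "real (Suc n) * real (Suc n) * norm (fps_nth (gauss_fps a b) (Suc n)) =
      norm (of_nat (Suc n) * of_nat (Suc n) * fps_nth (gauss_fps a b) (Suc n))"
      by (simp add: norm_mult del: of_nat_Suc)
    also have "\<dots> = norm (a + of_nat n) * norm (b + of_nat n) * norm (fps_nth (gauss_fps a b) n)"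
      unfolding gauss_fps_rec by (simp add: norm_mult)
    also have "\<dots> \<le> ((1 + norm a) * real (Suc n)) * ((1 + norm b) * real (Suc n)) * C ^ n"
      using Suc k[of a] k[of b] by (intro mult_mono) auto
    also have "\<dots> = real (Suc n) * real (Suc n) * C ^ Suc n" by (simp add: C_def mult_ac)
    finally have le: "real (Suc n) * real (Suc n) * norm (fps_nth (gauss_fps a b) (Suc n)) \<le> real (Suc n) * real (Suc n) * C ^ Suc n" .
    have "real (Suc n) * real (Suc n) > 0" by simp
    with le show ?case by (rule mult_left_le_imp_le)
  qed simp
  define y where "y = 1 / (2 * C)"
  have y: "y > 0" "C * y = 1 / 2" using C by (simp_all add: y_def)
  have "conv_radius (fps_nth (gauss_fps a b)) \<ge> norm (of_real y :: complex)"
  proof (rule conv_radius_geI)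
    show "summable (\<lambda>n. fps_nth (gauss_fps a b) n * of_real y ^ n)"
    proof (rule summable_comparison_test)
      show "summable (\<lambda>n. (1 / 2) ^ n :: real)" by (intro summable_geometric) auto
      have "norm (fps_nth (gauss_fps a b) n * of_real y ^ n) \<le> (1 / 2) ^ n" for n
      proof -
        have "norm (fps_nth (gauss_fps a b) n * of_real y ^ n) \<le> C ^ n * y ^ n"
          unfolding norm_mult norm_power using bd[of n] C y by (intro mult_mono) auto
        also have "\<dots> = (1 / 2) ^ n" by (simp only: y(2) flip: power_mult_distrib)
        finally show ?thesis .
      qed
      thus "\<exists>N. \<forall>n\<ge>N. norm (fps_nth (gauss_fps a b) n * of_real y ^ n) \<le> (1 / 2) ^ n" by blast
    qed
  qed
  moreover have "ereal (norm (of_real y :: complex)) > 0" using y by simp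
  ultimately show ?thesis unfolding fps_conv_radius_def by (rule less_le_trans[rotated])
qed

lemma gauss_fps_ode:
  "fps_X * (1 - fps_X) * fps_deriv (fps_deriv (gauss_fps a b)) + (1 - fps_const (a + b + 1) * fps_X) * fps_deriv (gauss_fps a b)
     + fps_const (- a * b) * gauss_fps a b = 0" (is "?L = 0")
proof (rule fps_ext)
  fix n
  define F where "F = gauss_fps a b"
  have "?L = fps_X * fps_deriv (fps_deriv F) - fps_X * (fps_X * fps_deriv (fps_deriv F)) + fps_deriv F
     - fps_const (a + b + 1) * (fps_X * fps_deriv F) + fps_const (- a * b) * F"
    by (simp add: F_def algebra_simps)
  moreover have "fps_nth (fps_X * fps_deriv F) n = of_nat n * fps_nth F n" by (cases n) auto
  moreover have "fps_nth (fps_X * fps_deriv (fps_deriv F)) n = of_nat n * (of_nat (Suc n) * fps_nth F (Suc n))" by (cases n) auto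
  moreover have "fps_nth (fps_X * (fps_X * fps_deriv (fps_deriv F))) n = of_nat n * (of_nat n - 1) * fps_nth F n"
    by (cases n; cases "n - 1") (auto simp: algebra_simps)
  ultimately have "fps_nth ?L n = of_nat n * (of_nat (Suc n) * fps_nth F (Suc n)) - of_nat n * (of_nat n - 1) * fps_nth F n
     + of_nat (Suc n) * fps_nth F (Suc n) - (a + b + 1) * (of_nat n * fps_nth F n) - a * b * fps_nth F n"
    by (simp add: fps_mult_left_const_nth)
  also have "\<dots> = of_nat (Suc n) * of_nat (Suc n) * fps_nth F (Suc n) - (a + of_nat n) * (b + of_nat n) * fps_nth F n"
    by (simp add: algebra_simps)
  also have "\<dots> = 0" using gauss_fps_rec[of n a b] by (simp add: F_def)
  finally show "fps_nth ?L n = fps_nth 0 n" by simp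
qed

lemma gauss_derivs:
  assumes "ereal (norm x) < fps_conv_radius (gauss_fps a b)"
  defines "F \<equiv> gauss_fps a b"
  shows "(eval_fps F has_field_derivative eval_fps (fps_deriv F) x) (at x)"
    "(eval_fps (fps_deriv F) has_field_derivative eval_fps (fps_deriv (fps_deriv F)) x) (at x)"
    "x * (1 - x) * eval_fps (fps_deriv (fps_deriv F)) x + (1 - (a + b + 1) * x) * eval_fps (fps_deriv F) x - a * b * eval_fps F x = 0"
proof -
  have r: "ereal (norm x) < fps_conv_radius F" using assms by simp
  have r1: "ereal (norm x) < fps_conv_radius (fps_deriv F)" using r fps_conv_radius_deriv less_le_trans by blast
  have r2: "ereal (norm x) < fps_conv_radius (fps_deriv (fps_deriv F))" using r1 fps_conv_radius_deriv less_le_trans by blast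
  show "(eval_fps F has_field_derivative eval_fps (fps_deriv F) x) (at x)" by (rule has_field_derivative_eval_fps[OF r])
  show "(eval_fps (fps_deriv F) has_field_derivative eval_fps (fps_deriv (fps_deriv F)) x) (at x)"
    by (rule has_field_derivative_eval_fps[OF r1])
  define p1 where "p1 = fps_of_poly [:0, 1, -1 :: complex:]"
  define p2 where "p2 = fps_of_poly [:1, - (a + b + 1):]"
  have "fps_X * (1 - fps_X) = p1" "1 - fps_const (a + b + 1) * fps_X = p2"
    by (simp_all add: p1_def p2_def fps_of_poly_pCons algebra_simps flip: fps_const_neg)
  hence ode: "p1 * fps_deriv (fps_deriv F) + p2 * fps_deriv F + fps_const (- a * b) * F = 0"
    using gauss_fps_ode[of a b] by (simp add: F_def)
  have m: "ereal (norm x) < fps_conv_radius (A * B)" if "ereal (norm x) < fps_conv_radius A" "ereal (norm x) < fps_conv_radius B" for A B :: "complex fps"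
    using that fps_conv_radius_mult[of A B] by (meson less_le_trans min_less_iff_conj)
  have ad: "ereal (norm x) < fps_conv_radius (A + B)" if "ereal (norm x) < fps_conv_radius A" "ereal (norm x) < fps_conv_radius B" for A B :: "complex fps"
    using that fps_conv_radius_add[of A B] by (meson less_le_trans min_less_iff_conj)
  have c: "ereal (norm x) < fps_conv_radius p1" "ereal (norm x) < fps_conv_radius p2" "ereal (norm x) < fps_conv_radius (fps_const (- a * b))"
    by (simp_all add: p1_def p2_def)
  have "eval_fps (p1 * fps_deriv (fps_deriv F) + p2 * fps_deriv F + fps_const (- a * b) * F) x = 0" unfolding ode by simp
  hence "poly [:0, 1, -1:] x * eval_fps (fps_deriv (fps_deriv F)) x + poly [:1, - (a + b + 1):] x * eval_fps (fps_deriv F) x + (- a * b) * eval_fps F x = 0"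
    by (simp only: eval_fps_add eval_fps_mult m ad c r r1 r2 p1_def[symmetric] p2_def[symmetric])
       (simp add: p1_def p2_def eval_fps_const)
  thus "x * (1 - x) * eval_fps (fps_deriv (fps_deriv F)) x + (1 - (a + b + 1) * x) * eval_fps (fps_deriv F) x - a * b * eval_fps F x = 0"
    by (simp add: algebra_simps)
qed

text \<open>The left side is analytic at 0 and vanishes near 0 off the point itself; continuity adds
  the point, and then its expansion is 0.\<close>

lemma ode_imp_fps_ode:
  fixes u :: "complex \<Rightarrow> complex"
  assumes u: "u has_fps_expansion F"
    and ode: "\<forall>\<^sub>F s in at 0. poly U s * deriv (deriv u) s + poly V s * deriv u s + poly W s * u s = 0"
  shows "fps_of_poly U * fps_deriv (fps_deriv F) + fps_of_poly V * fps_deriv F + fps_of_poly W * F = 0"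
proof -
  define g where "g = (\<lambda>s. poly U s * deriv (deriv u) s + poly V s * deriv u s + poly W s * u s)"
  have p: "poly p has_fps_expansion fps_of_poly p" for p :: "complex poly" by (simp add: has_fps_expansion_def)
  have g: "g has_fps_expansion fps_of_poly U * fps_deriv (fps_deriv F) + fps_of_poly V * fps_deriv F + fps_of_poly W * F"
    unfolding g_def by (intro fps_expansion_intros p u)
  have "isCont g 0" using has_fps_expansion_imp_continuous[OF g] .
  hence "g \<midarrow>0\<rightarrow> g 0" by (simp add: isCont_def)
  moreover have "g \<midarrow>0\<rightarrow> 0" using ode by (intro tendsto_eventually) (simp add: g_def)
  ultimately have "g 0 = 0" using LIM_unique by blast
  hence "\<forall>\<^sub>F s in nhds 0. g s = 0" using ode by (auto simp: eventually_nhds_conv_at g_def)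
  hence "g has_fps_expansion 0 \<longleftrightarrow> (\<lambda>_. 0 :: complex) has_fps_expansion 0" by (intro has_fps_expansion_cong) auto
  hence "g has_fps_expansion 0" by simp
  thus ?thesis using fps_expansion_unique_complex[OF g] by blast
qed

lemma deriv_eq_of_eventually_eq:
  fixes u v :: "complex \<Rightarrow> complex"
  assumes "\<forall>\<^sub>F s in nhds 0. u s = v s"
  shows "\<forall>\<^sub>F s in nhds 0. u s = v s \<and> deriv u s = deriv v s \<and> deriv (deriv u) s = deriv (deriv v) s"
proof -
  obtain S where S: "open S" "0 \<in> S" "\<And>s. s \<in> S \<Longrightarrow> u s = v s" using assms unfolding eventually_nhds by blast
  have d: "deriv u s = deriv v s" if "s \<in> S" for s
    by (rule deriv_cong_ev) (use S that in \<open>auto simp: eventually_nhds\<close>)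
  have "deriv (deriv u) s = deriv (deriv v) s" if "s \<in> S" for s
    by (rule deriv_cong_ev) (use S d that in \<open>auto simp: eventually_nhds\<close>)
  thus ?thesis using S d unfolding eventually_nhds by blast
qed

text \<open>These arise when the Heun equation with \<gamma> = 1 is multiplied by s (s - 1) (s - a).
  The factor s of the leading coefficient is kept apart to match
  \<open>fps_ode_unique\<close>.\<close>

definition heun_U :: "complex \<Rightarrow> complex poly" where "heun_U a = [:- 1, 1:] * [:- a, 1:]"
definition heun_V :: "complex \<Rightarrow> complex \<Rightarrow> complex \<Rightarrow> complex poly" where
  "heun_V a \<delta> \<epsilon> = [:- 1, 1:] * [:- a, 1:] + smult \<delta> ([:0, 1:] * [:- a, 1:]) + smult \<epsilon> ([:0, 1:] * [:- 1, 1:])"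

lemma solves_heun_iff_poly:
  assumes "a \<noteq> 0"
  shows "solves_heun_near_0 a q \<alpha> \<beta> 1 \<delta> u \<longleftrightarrow>
    (\<forall>\<^sub>F s in at 0. poly ([:0, 1:] * heun_U a) s * deriv (deriv u) s + poly (heun_V a \<delta> (\<alpha> + \<beta> - \<delta>)) s * deriv u s
        + poly [:- q, \<alpha> * \<beta>:] s * u s = 0)"
  unfolding solves_heun_near_0_def Let_def
proof (rule eventually_cong)
  have "open (- {1, a})" by (intro open_Compl finite_imp_closed) auto
  thus "\<forall>\<^sub>F s in at 0. s \<in> - {1, a} - {0}" by (intro eventually_at_in_open) (use assms in auto)
  fix s assume "s \<in> - {1, a} - {0}"
  hence s: "s \<noteq> 0" "s - 1 \<noteq> 0" "s - a \<noteq> 0" by auto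
  define D where "D = s * (s - 1) * (s - a)"
  have D0: "D \<noteq> 0" using s by (simp add: D_def)
  define u2 where "u2 = deriv (deriv u) s"
  define u1 where "u1 = deriv u s"
  have "poly ([:0, 1:] * heun_U a) s * u2 + poly (heun_V a \<delta> (\<alpha> + \<beta> - \<delta>)) s * u1 + poly [:- q, \<alpha> * \<beta>:] s * u s =
    D * (u2 + (1 / s + \<delta> / (s - 1) + (\<alpha> + \<beta> - \<delta>) / (s - a)) * u1 + (\<alpha> * \<beta> * s - q) / D * u s)"
  proof -
    have "D * (1 / s) = (s - 1) * (s - a)" "D * (\<delta> / (s - 1)) = \<delta> * (s * (s - a))"
      "D * ((\<alpha> + \<beta> - \<delta>) / (s - a)) = (\<alpha> + \<beta> - \<delta>) * (s * (s - 1))" "D * ((\<alpha> * \<beta> * s - q) / D) = \<alpha> * \<beta> * s - q"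
      using s D0 by (simp_all add: D_def)
    hence "D * (u2 + (1 / s + \<delta> / (s - 1) + (\<alpha> + \<beta> - \<delta>) / (s - a)) * u1 + (\<alpha> * \<beta> * s - q) / D * u s) =
       D * u2 + ((s - 1) * (s - a) + \<delta> * (s * (s - a)) + (\<alpha> + \<beta> - \<delta>) * (s * (s - 1))) * u1 + (\<alpha> * \<beta> * s - q) * u s"
      by (simp only: distrib_left distrib_right mult.assoc[symmetric])
    moreover have "poly ([:0, 1:] * heun_U a) s = D" by (simp add: heun_U_def D_def algebra_simps)
    moreover have "poly (heun_V a \<delta> (\<alpha> + \<beta> - \<delta>)) s = (s - 1) * (s - a) + \<delta> * (s * (s - a)) + (\<alpha> + \<beta> - \<delta>) * (s * (s - 1))"
      by (simp add: heun_V_def algebra_simps)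
    moreover have "poly [:- q, \<alpha> * \<beta>:] s = \<alpha> * \<beta> * s - q" by (simp add: algebra_simps)
    ultimately show ?thesis by (simp only:)
  qed
  hence "(poly ([:0, 1:] * heun_U a) s * u2 + poly (heun_V a \<delta> (\<alpha> + \<beta> - \<delta>)) s * u1 + poly [:- q, \<alpha> * \<beta>:] s * u s = 0) \<longleftrightarrow>
     u2 + (1 / s + \<delta> / (s - 1) + (\<alpha> + \<beta> - \<delta>) / (s - a)) * u1 + (\<alpha> * \<beta> * s - q) / D * u s = 0"
    using D0 by (simp only: mult_eq_0_iff simp_thms)
  moreover have "\<alpha> + \<beta> - 1 - \<delta> + 1 = \<alpha> + \<beta> - \<delta>" by simp
  ultimately show "(deriv (deriv u) s + (1 / s + \<delta> / (s - 1) + (\<alpha> + \<beta> - 1 - \<delta> + 1) / (s - a)) * deriv u s +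
      (\<alpha> * \<beta> * s - q) / (s * (s - 1) * (s - a)) * u s = 0) \<longleftrightarrow>
     (poly ([:0, 1:] * heun_U a) s * deriv (deriv u) s + poly (heun_V a \<delta> (\<alpha> + \<beta> - \<delta>)) s * deriv u s
        + poly [:- q, \<alpha> * \<beta>:] s * u s = 0)"
    unfolding u1_def u2_def D_def by (simp only:)
qed

text \<open>\<open>local_heun\<close> is a definite description over power series: the expansion of
  u has the described property, and \<open>fps_ode_unique\<close> shows that nothing else has
  it.\<close>

theorem local_heun_eqI:
  assumes a: "a \<noteq> 0" and u: "u has_fps_expansion F" "u 0 = 1" and sol: "solves_heun_near_0 a q \<alpha> \<beta> 1 \<delta> u"
  shows "\<forall>\<^sub>F s in nhds 0. local_heun a q \<alpha> \<beta> 1 \<delta> s = u s"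
proof -
  define S where "S = (\<lambda>F. fps_conv_radius F > 0 \<and> eval_fps F 0 = 1 \<and> solves_heun_near_0 a q \<alpha> \<beta> 1 \<delta> (eval_fps F))"
  have rad: "fps_conv_radius F > 0" and ev: "\<forall>\<^sub>F s in nhds 0. eval_fps F s = u s"
    using u(1) by (auto simp: has_fps_expansion_def)
  have "\<forall>\<^sub>F s in at 0. eval_fps F s = u s \<and> deriv (eval_fps F) s = deriv u s \<and> deriv (deriv (eval_fps F)) s = deriv (deriv u) s"
    using deriv_eq_of_eventually_eq[OF ev] by (simp add: eventually_nhds_conv_at)
  hence "solves_heun_near_0 a q \<alpha> \<beta> 1 \<delta> (eval_fps F)"
    using sol unfolding solves_heun_near_0_def Let_def by eventually_elim simp
  moreover have "eval_fps F 0 = 1" using eventually_nhds_x_imp_x[OF ev] u(2) by simp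
  ultimately have SF: "S F" using rad by (simp add: S_def)
  have uniq: "G = F" if "S G" for G
  proof -
    have ode: "fps_X * fps_of_poly (heun_U a) * fps_deriv (fps_deriv H) + fps_of_poly (heun_V a \<delta> (\<alpha> + \<beta> - \<delta>)) * fps_deriv H
        + fps_of_poly [:- q, \<alpha> * \<beta>:] * H = 0" if "S H" for H
    proof -
      have "eval_fps H has_fps_expansion H" using that by (intro eval_fps_has_fps_expansion) (simp add: S_def)
      from ode_imp_fps_ode[OF this solves_heun_iff_poly[OF a, THEN iffD1]] that
      have "fps_of_poly ([:0, 1:] * heun_U a) * fps_deriv (fps_deriv H) + fps_of_poly (heun_V a \<delta> (\<alpha> + \<beta> - \<delta>)) * fps_deriv H
        + fps_of_poly [:- q, \<alpha> * \<beta>:] * H = 0" by (simp add: S_def)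
      moreover have "fps_of_poly [:0, 1 :: complex:] = fps_X" by (simp add: fps_of_poly_pCons)
      ultimately show ?thesis by (simp only: fps_of_poly_mult)
    qed
    show "G = F"
    proof (rule fps_ode_unique[OF ode[OF that] ode[OF SF]])
      show "fps_nth (fps_of_poly (heun_U a)) 0 = fps_nth (fps_of_poly (heun_V a \<delta> (\<alpha> + \<beta> - \<delta>))) 0"
        by (simp add: heun_U_def heun_V_def)
      show "fps_nth (fps_of_poly (heun_V a \<delta> (\<alpha> + \<beta> - \<delta>))) 0 \<noteq> 0" using a by (simp add: heun_V_def)
      show "fps_nth G 0 = fps_nth F 0" using that SF by (simp add: S_def eval_fps_at_0)
    qed
  qed
  have "(THE F. S F) = F" using SF uniq by (rule the_equality)
  hence "local_heun a q \<alpha> \<beta> 1 \<delta> s = eval_fps F s" for s unfolding local_heun_def S_def by simp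
  thus ?thesis using ev by simp
qed

theorem gauss_eqI:
  assumes u: "u has_fps_expansion F" "u 0 = 1"
    and ode: "\<forall>\<^sub>F s in at 0. s * (1 - s) * deriv (deriv u) s + (1 - (a + b + 1) * s) * deriv u s - a * b * u s = 0"
  shows "\<forall>\<^sub>F s in nhds 0. hypergeom_2F1 a b 1 s = u s"
proof -
  have "\<forall>\<^sub>F s in at 0. poly ([:0, 1:] * [:1, -1:]) s * deriv (deriv u) s + poly [:1, - (a + b + 1):] s * deriv u s + poly [:- a * b:] s * u s = 0"
    using ode by eventually_elim (simp add: algebra_simps)
  note fode = ode_imp_fps_ode[OF u(1) this]
  have 1: "fps_X * (1 - fps_X) * fps_deriv (fps_deriv F) + (1 - fps_const (a + b + 1) * fps_X) * fps_deriv F + fps_const (- a * b) * F = 0"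
  proof -
    have "fps_of_poly ([:0, 1:] * [:1, -1 :: complex:]) = fps_X * (1 - fps_X)"
      "fps_of_poly [:1, - (a + b + 1):] = 1 - fps_const (a + b + 1) * fps_X"
      "fps_of_poly [:- a * b:] = fps_const (- a * b)"
      by (simp_all add: fps_of_poly_pCons fps_of_poly_mult algebra_simps flip: fps_const_neg)
    thus ?thesis using fode by (simp only:)
  qed
  have rad: "fps_conv_radius F > 0" and ev: "\<forall>\<^sub>F s in nhds 0. eval_fps F s = u s"
    using u(1) by (auto simp: has_fps_expansion_def)
  have "fps_nth F 0 = 1" using eventually_nhds_x_imp_x[OF ev] u(2) by (simp add: eval_fps_at_0)
  hence "F = gauss_fps a b" by (intro fps_ode_unique[OF 1 gauss_fps_ode]) auto
  thus ?thesis using ev by (simp add: hypergeom_2F1_def gauss_fps_def)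
qed

section \<open>Pullback of the hypergeometric equation\<close>

text \<open>Pointwise algebra behind the pullback. Capital letters are values of the polynomials,
  with 1 and 2 for derivatives; f0, f1, f2 belong to the hypergeometric function at x, and L is the
  logarithmic derivative of the twist (A^3 B)^(-1/12). The conclusion is the equation for the
  twisted pullback divided by the twist; p and r are the choices that cancel f1 and f0.\<close>

lemma pullback_ode_point:
  fixes A A1 A2 B B1 B2 C C1 D D1 S S1 Q Q1 k f0 f1 f2 x x1 x2 L L1 p r :: complex
  assumes nz: "A \<noteq> 0" "B \<noteq> 0" "C \<noteq> 0" "D \<noteq> 0" "S \<noteq> 0" "Q \<noteq> 0"
    and h1: "A ^ 3 * B - 1728 * Q = C ^ 2 * D"
    and h1': "3 * A ^ 2 * A1 * B + A ^ 3 * B1 - 1728 * Q1 = 2 * C * C1 * D + C ^ 2 * D1"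
    and h2: "Q1 * A * B - 3 * Q * A1 * B - Q * A * B1 = k * C * S"
    and ode: "x * (1 - x) * f2 + (1 - 3 / 2 * x) * f1 - 5 / 144 * f0 = 0"
    and x_def: "x = 1728 * Q / (A ^ 3 * B)"
    and x1_def: "x1 = 1728 * k * C * S / (A ^ 4 * B ^ 2)"
    and x2_def: "x2 = x1 * (C1 / C + S1 / S - 4 * A1 / A - 2 * B1 / B)"
    and L_def: "L = - (A1 / A) / 4 - (B1 / B) / 12"
    and L1_def: "L1 = - (A2 / A - (A1 / A) ^ 2) / 4 - (B2 / B - (B1 / B) ^ 2) / 12"
    and p_def: "p = Q1 / Q + D1 / (2 * D) - S1 / S + 2 * B1 / (3 * B)"
    and r_def: "r = - L1 - L ^ 2 - p * L - 60 * k ^ 2 * S ^ 2 / (A ^ 2 * B ^ 2 * Q * D)"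
  shows "L * (L * f0 + f1 * x1) + (L1 * f0 + L * f1 * x1 + f2 * x1 ^ 2 + f1 * x2) + p * (L * f0 + f1 * x1) + r * f0 = 0"
proof -
  define a where "a = A1 / A"
  define b where "b = B1 / B"
  define c where "c = C1 / C"
  define d where "d = D1 / D"
  define s where "s = S1 / S"
  define e where "e = Q1 / Q"
  have A1: "A1 = a * A" and B1: "B1 = b * B" and C1: "C1 = c * C" and D1: "D1 = d * D" and S1: "S1 = s * S" and Q1: "Q1 = e * Q"
    using nz by (simp_all add: a_def b_def c_def d_def s_def e_def)
  \<comment> \<open>\<alpha> and \<beta> are the logarithmic derivatives of x and 1 - x. Hence x1 =
    x \<alpha> = -(1 - x) \<beta>, so x1^2 = -\<alpha> \<beta> x (1 - x), and the hypergeometric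
    equation eliminates f2.\<close>
  define \<alpha> where "\<alpha> = e - 3 * a - b"
  define \<beta> where "\<beta> = 2 * c + d - 3 * a - b"
  have kCS: "k * C * S = Q * A * B * \<alpha>" unfolding h2[symmetric] A1 B1 Q1 \<alpha>_def by (simp add: algebra_simps)
  have CD: "C ^ 2 * D * \<beta> = - 1728 * Q * \<alpha>"
  proof -
    have "C ^ 2 * D * \<beta> = (2 * C * C1 * D + C ^ 2 * D1) - (C ^ 2 * D) * (3 * a + b)"
      by (simp add: \<beta>_def C1 D1 algebra_simps power2_eq_square)
    also have "\<dots> = - 1728 * Q * \<alpha>"
      unfolding h1'[symmetric] h1[symmetric] by (simp add: \<alpha>_def A1 B1 Q1 algebra_simps power2_eq_square power3_eq_cube)
    finally show ?thesis .
  qed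
  have x1: "x1 = x * \<alpha>"
  proof -
    have "x1 = 1728 * (Q * A * B * \<alpha>) / (A ^ 4 * B ^ 2)" unfolding x1_def kCS[symmetric] by (simp add: mult_ac)
    thus ?thesis using nz by (simp add: x_def eval_nat_numeral mult_ac)
  qed
  have y: "1 - x = C ^ 2 * D / (A ^ 3 * B)"
    unfolding h1[symmetric] x_def using nz by (simp add: field_simps)
  have x1': "x1 = - (1 - x) * \<beta>"
  proof -
    have "- (1 - x) * \<beta> = - (C ^ 2 * D * \<beta>) / (A ^ 3 * B)" by (simp add: y)
    also have "\<dots> = x * \<alpha>" unfolding CD by (simp add: x_def)
    finally show ?thesis by (simp add: x1)
  qed
  \<comment> \<open>60 = 1728 * 5/144, where 5/144 = (1/12) (5/12) is the product of the
    hypergeometric parameters.\<close>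
  have ab: "5 / 144 * (\<alpha> * \<beta>) = - (60 * k ^ 2 * S ^ 2 / (A ^ 2 * B ^ 2 * Q * D))"
  proof -
    have "k ^ 2 * S ^ 2 * (C ^ 2) = (Q * A * B * \<alpha>) ^ 2" unfolding kCS[symmetric] by (simp add: power_mult_distrib)
    also have "\<dots> = Q * A ^ 2 * B ^ 2 * \<alpha> * (Q * \<alpha>)" by (simp add: power2_eq_square mult_ac)
    also have "Q * \<alpha> = - (C ^ 2 * D * \<beta>) / 1728" unfolding CD by simp
    finally have "k ^ 2 * S ^ 2 * (C ^ 2) = (- (Q * A ^ 2 * B ^ 2 * \<alpha> * D * \<beta>) / 1728) * C ^ 2" by (simp add: mult_ac)
    hence "k ^ 2 * S ^ 2 = - (Q * A ^ 2 * B ^ 2 * \<alpha> * D * \<beta>) / 1728"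
      by (rule iffD1[OF mult_right_cancel, rotated]) (use nz in simp)
    hence "60 * k ^ 2 * S ^ 2 / (A ^ 2 * B ^ 2 * Q * D) = 60 * (- (Q * A ^ 2 * B ^ 2 * \<alpha> * D * \<beta>) / 1728) / (A ^ 2 * B ^ 2 * Q * D)"
      by (simp only: mult.assoc)
    also have "\<dots> = - (5 / 144 * (\<alpha> * \<beta>))" using nz by (simp add: field_simps)
    finally show ?thesis by simp
  qed
  have f2: "f2 * x1 ^ 2 = - x1 * (\<alpha> + \<beta> / 2) * f1 - 5 / 144 * (\<alpha> * \<beta>) * f0"
  proof -
    have "f2 * x1 ^ 2 = f2 * ((x * \<alpha>) * (- (1 - x) * \<beta>))"
      using x1 x1' by (simp only: power2_eq_square)
    also have "\<dots> = - (\<alpha> * \<beta>) * (x * (1 - x) * f2)" by (simp add: algebra_simps)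
    also have "x * (1 - x) * f2 = 5 / 144 * f0 - (1 - 3 / 2 * x) * f1" using ode by (simp add: algebra_simps)
    also have "- (\<alpha> * \<beta>) * (5 / 144 * f0 - (1 - 3 / 2 * x) * f1) =
       (\<alpha> * ((1 - x) * \<beta>) - (x * \<alpha>) * \<beta> / 2) * f1 - 5 / 144 * (\<alpha> * \<beta>) * f0"
      by (simp add: field_simps)
    also have "(1 - x) * \<beta> = - x1" unfolding x1' by (simp add: algebra_simps)
    also have "x * \<alpha> = x1" using x1 by simp
    finally show ?thesis by (simp add: algebra_simps)
  qed
  have L: "L = - a / 4 - b / 12" by (simp add: L_def a_def b_def)
  have p: "p = e + d / 2 - s + 2 / 3 * b" by (simp add: p_def e_def d_def s_def b_def)
  have x2: "x2 = x1 * (c + s - 4 * a - 2 * b)" by (simp add: x2_def a_def b_def c_def s_def)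
  have r: "r = - L1 - L ^ 2 - p * L + 5 / 144 * (\<alpha> * \<beta>)" unfolding r_def ab by simp
  have "L * (L * f0 + f1 * x1) + (L1 * f0 + L * f1 * x1 + f2 * x1 ^ 2 + f1 * x2) + p * (L * f0 + f1 * x1) + r * f0
     = f1 * x1 * (2 * L + (c + s - 4 * a - 2 * b) - (\<alpha> + \<beta> / 2) + p)"
    unfolding f2 x2 r by (simp add: algebra_simps power2_eq_square)
  also have "2 * L + (c + s - 4 * a - 2 * b) - (\<alpha> + \<beta> / 2) + p = 0"
  proof -
    have half: "\<beta> / 2 = c + d / 2 - 3 / 2 * a - b / 2" by (simp add: \<beta>_def add_divide_distrib diff_divide_distrib)
    have "2 * (- a / 4 - b / 12) + (c + s - 4 * a - 2 * b) - (e - 3 * a - b + (c + d / 2 - 3 / 2 * a - b / 2)) + (e + d / 2 - s + 2 / 3 * b)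
      = (2 * (- 1 / 4) - 4 + 3 + 3 / 2) * a + (2 * (- 1 / 12) - 2 + 1 + 1 / 2 + 2 / 3) * b"
      by (simp only: ring_distribs divide_inverse mult_ac) simp
    thus ?thesis unfolding half L p \<alpha>_def by simp
  qed
  finally show ?thesis by simp
qed

text \<open>The factors record the ramification of j = A^3 B / Q. Over j = 0, A has the points of
  index 3 and B the elliptic points; over j = 1728, C has the points of index 2 and D the elliptic
  points. h2 is the Wronskian divided by A^2; in the instances S carries the surplus multiplicities
  of the zeros of Q, which are cusps. The constant c is the one left open by
  \<open>j_in_lowest_terms\<close>.\<close>

locale hauptmodul_pullback =
  fixes A B C D S Q :: "complex poly" and k c :: complex
  assumes c: "c \<noteq> 0" and A0: "poly A 0 \<noteq> 0" and B0: "poly B 0 \<noteq> 0" and Q0: "poly Q 0 = 0"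
    and nz: "C \<noteq> 0" "D \<noteq> 0" "S \<noteq> 0" "Q \<noteq> 0"
    and h1: "A ^ 3 * B - smult 1728 Q = C ^ 2 * D"
    and h2: "pderiv Q * A * B - smult 3 (Q * pderiv A * B) - Q * A * pderiv B = smult k (C * S)"
begin

definition h :: "complex \<Rightarrow> complex" where "h = h_fun (smult c (A ^ 3 * B)) (smult c Q)"

definition p_coeff :: "complex \<Rightarrow> complex" where
  "p_coeff t = poly (pderiv Q) t / poly Q t + poly (pderiv D) t / (2 * poly D t) - poly (pderiv S) t / poly S t
     + 2 * poly (pderiv B) t / (3 * poly B t)"

definition L_coeff :: "complex \<Rightarrow> complex" where
  "L_coeff t = - (poly (pderiv A) t / poly A t) / 4 - (poly (pderiv B) t / poly B t) / 12"

definition L'_coeff :: "complex \<Rightarrow> complex" where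
  "L'_coeff t = - (poly (pderiv (pderiv A)) t / poly A t - (poly (pderiv A) t / poly A t) ^ 2) / 4
     - (poly (pderiv (pderiv B)) t / poly B t - (poly (pderiv B) t / poly B t) ^ 2) / 12"

definition r_coeff :: "complex \<Rightarrow> complex" where
  "r_coeff t = - L'_coeff t - L_coeff t ^ 2 - p_coeff t * L_coeff t
     - 60 * k ^ 2 * poly S t ^ 2 / (poly A t ^ 2 * poly B t ^ 2 * poly Q t * poly D t)"

definition x :: "complex \<Rightarrow> complex" where "x t = 1728 * poly Q t / (poly A t ^ 3 * poly B t)"

definition x' :: "complex \<Rightarrow> complex" where
  "x' t = 1728 * k * poly C t * poly S t / (poly A t ^ 4 * poly B t ^ 2)"

definition amp :: "complex \<Rightarrow> complex" where
  "amp t = ((poly A t ^ 3 * poly B t) / (poly A 0 ^ 3 * poly B 0)) powr (- 1 / 12)"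

abbreviation F where "F \<equiv> gauss_fps (1 / 12) (5 / 12)"

lemma h_eq: "h t = amp t * eval_fps F (x t)"
  using c by (simp add: h_def h_fun_def hypergeom_2F1_def gauss_fps_def amp_def x_def mult_ac)

lemma h_0: "h 0 = 1"
  using A0 B0 Q0 by (simp add: h_eq amp_def x_def eval_fps_at_0)

definition good :: "complex \<Rightarrow> bool" where
  "good t \<longleftrightarrow> poly A t \<noteq> 0 \<and> poly B t \<noteq> 0 \<and> (poly A t ^ 3 * poly B t) / (poly A 0 ^ 3 * poly B 0) \<notin> \<real>\<^sub>\<le>\<^sub>0
     \<and> ereal (norm (x t)) < fps_conv_radius F"

text \<open>At t = 0 the base of the power is 1 and x is 0, well inside the slit plane and the disc
  of convergence.\<close>

lemma good_near_0: "\<forall>\<^sub>F t in nhds 0. good t"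
proof -
  have cont: "isCont (poly q) 0" for q :: "complex poly" by (rule poly_isCont)
  have e1: "\<forall>\<^sub>F t in nhds 0. poly A t \<in> - {0}"
    by (rule topological_tendstoD) (use A0 cont[of A] in \<open>auto simp: isCont_def tendsto_at_iff_tendsto_nhds\<close>)
  have e2: "\<forall>\<^sub>F t in nhds 0. poly B t \<in> - {0}"
    by (rule topological_tendstoD) (use B0 cont[of B] in \<open>auto simp: isCont_def tendsto_at_iff_tendsto_nhds\<close>)
  define g where "g = (\<lambda>t. (poly A t ^ 3 * poly B t) / (poly A 0 ^ 3 * poly B 0))"
  have "isCont g 0" unfolding g_def using A0 B0 by (intro continuous_intros cont) auto
  hence "(g \<longlongrightarrow> g 0) (nhds 0)" by (simp add: isCont_def tendsto_at_iff_tendsto_nhds)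
  moreover have "g 0 = 1" using A0 B0 by (simp add: g_def)
  ultimately have "(g \<longlongrightarrow> 1) (nhds 0)" by simp
  from topological_tendstoD[OF this, of "- \<real>\<^sub>\<le>\<^sub>0"]
  have e3: "\<forall>\<^sub>F t in nhds 0. g t \<in> - \<real>\<^sub>\<le>\<^sub>0"
    by (auto simp: open_Compl closed_nonpos_Reals_complex complex_nonpos_Reals_iff)
  obtain \<rho> where \<rho>: "\<rho> > 0" "ereal \<rho> < fps_conv_radius F"
    using gauss_fps_conv_radius[of "1/12" "5/12"] ereal_dense2[of 0 "fps_conv_radius F"] by (auto simp: zero_ereal_def)
  have "isCont x 0" unfolding x_def using A0 B0 by (intro continuous_intros cont) auto
  hence "(x \<longlongrightarrow> x 0) (nhds 0)" by (simp add: isCont_def tendsto_at_iff_tendsto_nhds)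
  hence "(x \<longlongrightarrow> 0) (nhds 0)" using Q0 by (simp add: x_def)
  from topological_tendstoD[OF this, of "ball 0 \<rho>"] have e4: "\<forall>\<^sub>F t in nhds 0. x t \<in> ball 0 \<rho>" using \<rho> by simp
  from e1 e2 e3 e4 show ?thesis
  proof eventually_elim
    case (elim t)
    have "ereal (norm (x t)) < ereal \<rho>" using elim by simp
    thus ?case using elim less_trans[OF _ \<rho>(2)] by (auto simp: good_def g_def)
  qed
qed

lemma h2_poly: "poly (pderiv Q) t * poly A t * poly B t - 3 * poly Q t * poly (pderiv A) t * poly B t
    - poly Q t * poly A t * poly (pderiv B) t = k * poly C t * poly S t"
  using arg_cong[OF h2, of "\<lambda>p. poly p t"] by (simp add: mult_ac)

lemma h1_poly: "poly A t ^ 3 * poly B t - 1728 * poly Q t = poly C t ^ 2 * poly D t"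
  using arg_cong[OF h1, of "\<lambda>p. poly p t"] by simp

lemma h1'_poly: "3 * poly A t ^ 2 * poly (pderiv A) t * poly B t + poly A t ^ 3 * poly (pderiv B) t - 1728 * poly (pderiv Q) t =
    2 * poly C t * poly (pderiv C) t * poly D t + poly C t ^ 2 * poly (pderiv D) t"
  using arg_cong[OF h1, of "\<lambda>p. poly (pderiv p) t"]
  by (simp add: pderiv_diff pderiv_smult pderiv_mult power3_eq_cube power2_eq_square algebra_simps)

lemma x_deriv:
  assumes "poly A t \<noteq> 0" "poly B t \<noteq> 0"
  shows "(x has_field_derivative x' t) (at t)"
proof -
  define a where "a = poly A t"
  define b where "b = poly B t"
  have ab: "a \<noteq> 0" "b \<noteq> 0" using assms by (auto simp: a_def b_def)
  have "(x has_field_derivative (1728 * poly (pderiv Q) t * (a ^ 3 * b) - 1728 * poly Q t * (3 * a ^ 2 * poly (pderiv A) t * b + a ^ 3 * poly (pderiv B) t))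
      / ((a ^ 3 * b) * (a ^ 3 * b))) (at t)"
    unfolding x_def a_def b_def
    by (rule derivative_eq_intros poly_DERIV refl | use assms in \<open>simp add: mult_ac\<close>)+
  also have "(1728 * poly (pderiv Q) t * (a ^ 3 * b) - 1728 * poly Q t * (3 * a ^ 2 * poly (pderiv A) t * b + a ^ 3 * poly (pderiv B) t))
      = 1728 * a ^ 2 * (poly (pderiv Q) t * a * b - 3 * poly Q t * poly (pderiv A) t * b - poly Q t * a * poly (pderiv B) t)"
    by (simp add: algebra_simps power2_eq_square power3_eq_cube)
  also have "(poly (pderiv Q) t * a * b - 3 * poly Q t * poly (pderiv A) t * b - poly Q t * a * poly (pderiv B) t) = k * poly C t * poly S t"
    unfolding a_def b_def by (rule h2_poly)
  also have "1728 * a ^ 2 * (k * poly C t * poly S t) / ((a ^ 3 * b) * (a ^ 3 * b)) = x' t"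
    using ab by (simp add: x'_def a_def[symmetric] b_def[symmetric] eval_nat_numeral mult_ac)
  finally show ?thesis .
qed

lemma x'_deriv:
  assumes "poly A t \<noteq> 0" "poly B t \<noteq> 0" "poly C t \<noteq> 0" "poly S t \<noteq> 0"
  shows "(x' has_field_derivative x' t * (poly (pderiv C) t / poly C t + poly (pderiv S) t / poly S t
     - 4 * poly (pderiv A) t / poly A t - 2 * poly (pderiv B) t / poly B t)) (at t)"
proof -
  have d: "((\<lambda>t. 1728 * k * poly C t * poly S t / (poly A t ^ 4 * poly B t ^ 2)) has_field_derivative
     ((1728 * k * poly (pderiv C) t * poly S t + 1728 * k * poly C t * poly (pderiv S) t) * (poly A t ^ 4 * poly B t ^ 2)
      - (1728 * k * poly C t * poly S t) * (4 * poly A t ^ 3 * poly (pderiv A) t * poly B t ^ 2 + poly A t ^ 4 * (2 * poly B t * poly (pderiv B) t)))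
      / ((poly A t ^ 4 * poly B t ^ 2) * (poly A t ^ 4 * poly B t ^ 2))) (at t)"
    by (rule derivative_eq_intros poly_DERIV refl | use assms in \<open>simp add: mult_ac\<close>)+
  have gen: "((k * c1 * s + k * cc * s1) * (a ^ 4 * b ^ 2) - (k * cc * s) * (4 * a ^ 3 * a1 * b ^ 2 + a ^ 4 * (2 * b * b1)))
      / ((a ^ 4 * b ^ 2) * (a ^ 4 * b ^ 2)) = k * cc * s / (a ^ 4 * b ^ 2) * (c1 / cc + s1 / s - 4 * a1 / a - 2 * b1 / b)"
    if "a \<noteq> 0" "b \<noteq> 0" "cc \<noteq> 0" "s \<noteq> 0" for k a a1 b b1 cc c1 s s1 :: complex
  proof -
    define u v w z where "u = c1 / cc" "v = s1 / s" "w = a1 / a" "z = b1 / b"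
    hence eqs: "c1 = u * cc" "s1 = v * s" "a1 = w * a" "b1 = z * b" using that by simp_all
    have "(k * c1 * s + k * cc * s1) * (a ^ 4 * b ^ 2) - (k * cc * s) * (4 * a ^ 3 * a1 * b ^ 2 + a ^ 4 * (2 * b * b1))
        = (k * cc * s * (u + v - 4 * w - 2 * z)) * (a ^ 4 * b ^ 2)"
      unfolding eqs by (simp add: algebra_simps eval_nat_numeral)
    moreover have "u + v - 4 * w - 2 * z = c1 / cc + s1 / s - 4 * a1 / a - 2 * b1 / b"
      using that by (simp add: eqs)
    ultimately show ?thesis using that by simp
  qed
  show ?thesis unfolding x'_def by (rule DERIV_cong[OF d gen[OF assms]])
qed

lemma amp_deriv:
  assumes "good t"
  shows "(amp has_field_derivative amp t * L_coeff t) (at t)"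
proof -
  define g where "g = (\<lambda>t. (poly A t ^ 3 * poly B t) / (poly A 0 ^ 3 * poly B 0))"
  define K where "K = poly A 0 ^ 3 * poly B 0"
  have nz: "poly A t \<noteq> 0" "poly B t \<noteq> 0" "g t \<notin> \<real>\<^sub>\<le>\<^sub>0" using assms by (auto simp: good_def g_def)
  have K0: "K \<noteq> 0" using A0 B0 by (simp add: K_def)
  have g0: "g t \<noteq> 0" using nz K0 by (simp add: g_def K_def)
  define g1 where "g1 = (3 * poly A t ^ 2 * poly (pderiv A) t * poly B t + poly A t ^ 3 * poly (pderiv B) t) / K"
  have gd: "(g has_field_derivative g1) (at t)"
    unfolding g_def K_def[symmetric] g1_def
    by (rule derivative_eq_intros poly_DERIV refl | use K0 in \<open>simp add: mult_ac\<close>)+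
  have "(amp has_field_derivative (- 1 / 12) * g t powr (- 1 / 12 - 1) * g1) (at t)"
    unfolding amp_def g_def by (rule DERIV_chain2[where f = "\<lambda>z. z powr (- 1 / 12)" and g = g, OF has_field_derivative_powr[OF nz(3)] gd, unfolded g_def])
  also have "g t powr (- 1 / 12 - 1) = amp t / g t"
    unfolding powr_diff by (simp add: amp_def g_def)
  also have "(- 1 / 12) * (amp t / g t) * g1 = amp t * ((- 1 / 12) * (g1 / g t))" by simp
  also have "g1 / g t = 3 * (poly (pderiv A) t / poly A t) + poly (pderiv B) t / poly B t"
  proof -
    have "g1 / g t = (3 * poly A t ^ 2 * poly (pderiv A) t * poly B t + poly A t ^ 3 * poly (pderiv B) t) / (poly A t ^ 3 * poly B t)"
      using K0 by (simp add: g1_def g_def K_def[symmetric])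
    thus ?thesis using nz by (simp add: add_divide_distrib power2_eq_square power3_eq_cube)
  qed
  also have "(- 1 / 12) * (3 * (poly (pderiv A) t / poly A t) + poly (pderiv B) t / poly B t) = L_coeff t"
    by (simp add: L_coeff_def distrib_left mult.commute)
  finally show ?thesis .
qed

lemma L_deriv:
  assumes "poly A t \<noteq> 0" "poly B t \<noteq> 0"
  shows "(L_coeff has_field_derivative L'_coeff t) (at t)"
  unfolding L_coeff_def L'_coeff_def
  by (rule derivative_eq_intros poly_DERIV refl | use assms in \<open>simp add: field_simps power2_eq_square\<close>)+

lemma good_open: obtains U where "open U" "0 \<in> U" "\<And>t. t \<in> U \<Longrightarrow> good t"
  using good_near_0 unfolding eventually_nhds by blast

lemma h_deriv:
  assumes "good t"
  shows "(h has_field_derivative amp t * (L_coeff t * eval_fps F (x t) + eval_fps (fps_deriv F) (x t) * x' t)) (at t)"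
proof -
  have g: "poly A t \<noteq> 0" "poly B t \<noteq> 0" "ereal (norm (x t)) < fps_conv_radius F" using assms by (auto simp: good_def)
  have "((\<lambda>t. eval_fps F (x t)) has_field_derivative eval_fps (fps_deriv F) (x t) * x' t) (at t)"
    by (rule DERIV_chain2[where f = "eval_fps F" and g = x, OF gauss_derivs(1)[OF g(3)] x_deriv[OF g(1,2)]])
  from DERIV_mult[OF amp_deriv[OF assms] this] show ?thesis
    unfolding h_eq by (simp add: algebra_simps)
qed

lemma h_expansion: "h has_fps_expansion fps_expansion h 0"
proof -
  obtain U where U: "open U" "0 \<in> U" "\<And>t. t \<in> U \<Longrightarrow> good t" using good_open by blast
  have "h holomorphic_on U"
    unfolding holomorphic_on_def field_differentiable_def
    using h_deriv[OF U(3)] has_field_derivative_at_within by blast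
  thus ?thesis using U by blast
qed

text \<open>The coefficients have poles at zeros of Q, D and S, and Q does vanish at 0; hence the
  punctured neighbourhood.\<close>

theorem h_ode: "\<forall>\<^sub>F t in at 0. deriv (deriv h) t + p_coeff t * deriv h t + r_coeff t * h t = 0"
proof -
  obtain U where U: "open U" "0 \<in> U" "\<And>t. t \<in> U \<Longrightarrow> good t" using good_open by blast
  have "\<forall>\<^sub>F t in at 0. t \<in> U - {0}" by (intro eventually_at_in_open U)
  moreover note eventually_poly_nonzero[OF nz(1)] eventually_poly_nonzero[OF nz(2)]
    eventually_poly_nonzero[OF nz(3)] eventually_poly_nonzero[OF nz(4)]
  ultimately show ?thesis
  proof eventually_elim
    case (elim t)
    have gt: "good t" using U elim by simp
    have g: "poly A t \<noteq> 0" "poly B t \<noteq> 0" "ereal (norm (x t)) < fps_conv_radius F" using gt by (auto simp: good_def)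
    define f0 where "f0 = eval_fps F (x t)"
    define f1 where "f1 = eval_fps (fps_deriv F) (x t)"
    define f2 where "f2 = eval_fps (fps_deriv (fps_deriv F)) (x t)"
    define x2 where "x2 = x' t * (poly (pderiv C) t / poly C t + poly (pderiv S) t / poly S t
     - 4 * poly (pderiv A) t / poly A t - 2 * poly (pderiv B) t / poly B t)"
    have d1: "deriv h t = amp t * (L_coeff t * f0 + f1 * x' t)" for t'
      unfolding f0_def f1_def by (rule DERIV_imp_deriv[OF h_deriv[OF gt]])
    have da: "((\<lambda>t. eval_fps F (x t)) has_field_derivative f1 * x' t) (at t)"
      unfolding f1_def by (rule DERIV_chain2[where f = "eval_fps F" and g = x, OF gauss_derivs(1)[OF g(3)] x_deriv[OF g(1,2)]])
    have db: "((\<lambda>t. eval_fps (fps_deriv F) (x t)) has_field_derivative f2 * x' t) (at t)"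
      unfolding f2_def by (rule DERIV_chain2[where f = "eval_fps (fps_deriv F)" and g = x, OF gauss_derivs(2)[OF g(3)] x_deriv[OF g(1,2)]])
    have dc: "(x' has_field_derivative x2) (at t)" unfolding x2_def by (rule x'_deriv) (use g elim in auto)
    have "((\<lambda>t. L_coeff t * eval_fps F (x t) + eval_fps (fps_deriv F) (x t) * x' t) has_field_derivative
        (L'_coeff t * f0 + f1 * x' t * L_coeff t) + (f2 * x' t * x' t + x2 * f1)) (at t)"
      unfolding f0_def f1_def
      by (intro DERIV_add DERIV_mult L_deriv[OF g(1,2)] da[unfolded f1_def] db dc)
    from DERIV_mult[OF amp_deriv[OF gt] this]
    have d2: "((\<lambda>t. amp t * (L_coeff t * eval_fps F (x t) + eval_fps (fps_deriv F) (x t) * x' t)) has_field_derivative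
        amp t * (L_coeff t * (L_coeff t * f0 + f1 * x' t) + (L'_coeff t * f0 + L_coeff t * f1 * x' t + f2 * x' t ^ 2 + f1 * x2))) (at t)"
      unfolding f0_def[symmetric] f1_def[symmetric] by (rule DERIV_cong) (simp add: algebra_simps power2_eq_square)
    have "(deriv h has_field_derivative
        amp t * (L_coeff t * (L_coeff t * f0 + f1 * x' t) + (L'_coeff t * f0 + L_coeff t * f1 * x' t + f2 * x' t ^ 2 + f1 * x2))) (at t)"
      by (rule has_field_derivative_transform_within_open[OF d2 U(1)])
         (use elim U(3) DERIV_imp_deriv[OF h_deriv] in auto)
    hence dd: "deriv (deriv h) t = amp t * (L_coeff t * (L_coeff t * f0 + f1 * x' t) + (L'_coeff t * f0 + L_coeff t * f1 * x' t + f2 * x' t ^ 2 + f1 * x2))"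
      by (rule DERIV_imp_deriv)
    have ode: "x t * (1 - x t) * f2 + (1 - 3 / 2 * x t) * f1 - 5 / 144 * f0 = 0"
      using gauss_derivs(3)[OF g(3)] by (simp add: f0_def f1_def f2_def)
    have "L_coeff t * (L_coeff t * f0 + f1 * x' t) + (L'_coeff t * f0 + L_coeff t * f1 * x' t + f2 * x' t ^ 2 + f1 * x2)
       + p_coeff t * (L_coeff t * f0 + f1 * x' t) + r_coeff t * f0 = 0"
      by (rule pullback_ode_point[OF g(1,2) _ _ _ _ h1_poly h1'_poly h2_poly ode x_def x'_def x2_def
            L_coeff_def L'_coeff_def p_coeff_def r_coeff_def]) (use elim in auto)
    hence "amp t * (L_coeff t * (L_coeff t * f0 + f1 * x' t) + (L'_coeff t * f0 + L_coeff t * f1 * x' t + f2 * x' t ^ 2 + f1 * x2)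
       + p_coeff t * (L_coeff t * f0 + f1 * x' t) + r_coeff t * f0) = 0" by simp
    thus ?case unfolding dd d1 h_eq f0_def[symmetric] by (simp add: algebra_simps)
  qed
qed

text \<open>The hypothesis id is the conclusion multiplied by 144 pd A^2 B^2, with p and S^2/(Q D)
  brought to the common denominator pd. It is an identity between polynomials and can be decided for
  each level.\<close>

lemma r_coeff_eq:
  assumes "poly A t \<noteq> 0" "poly B t \<noteq> 0" "pd \<noteq> 0"
    and p: "p_coeff t = pn / pd" and s: "poly S t ^ 2 / (poly Q t * poly D t) = sn / pd"
    and id: "pd * (36 * (poly (pderiv (pderiv A)) t * poly A t - poly (pderiv A) t ^ 2) * poly B t ^ 2
        + 12 * (poly (pderiv (pderiv B)) t * poly B t - poly (pderiv B) t ^ 2) * poly A t ^ 2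
        - (3 * poly (pderiv A) t * poly B t + poly (pderiv B) t * poly A t) ^ 2)
      + 12 * pn * (3 * poly (pderiv A) t * poly B t + poly (pderiv B) t * poly A t) * poly A t * poly B t - 8640 * k ^ 2 * sn
      = 144 * m * poly A t ^ 2 * poly B t ^ 2"
  shows "r_coeff t = m / pd"
proof -
  have s': "60 * k ^ 2 * poly S t ^ 2 / (poly A t ^ 2 * poly B t ^ 2 * poly Q t * poly D t) = 
     60 * k ^ 2 * (poly S t ^ 2 / (poly Q t * poly D t)) / (poly A t ^ 2 * poly B t ^ 2)" by simp
  have gen: "- (- (a2 / a - (a1 / a) ^ 2) / 4 - (b2 / b - (b1 / b) ^ 2) / 12) - (- (a1 / a) / 4 - (b1 / b) / 12) ^ 2
      - pn / pd * (- (a1 / a) / 4 - (b1 / b) / 12) - 60 * k ^ 2 * (sn / pd) / (a ^ 2 * b ^ 2) = 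
     (pd * (36 * (a2 * a - a1 ^ 2) * b ^ 2 + 12 * (b2 * b - b1 ^ 2) * a ^ 2 - (3 * a1 * b + b1 * a) ^ 2)
      + 12 * pn * (3 * a1 * b + b1 * a) * a * b - 8640 * k ^ 2 * sn) / (144 * pd * a ^ 2 * b ^ 2)"
    if "a \<noteq> 0" "b \<noteq> 0" for a a1 a2 b b1 b2
  proof -
    \<comment> \<open>The divisors absorb the fractions 1/4 and 1/12 of the twist, whose logarithmic
      derivative becomes -(3 u + v).\<close>
    define u v w z where "u = a1 / a / 12" "v = b1 / b / 12" "w = a2 / a / 4" "z = b2 / b / 12"
    hence u: "a1 / a = 12 * u" "b1 / b = 12 * v" "a2 / a = 4 * w" "b2 / b = 12 * z"
      and eqs: "a1 = 12 * u * a" "b1 = 12 * v * b" "a2 = 4 * w * a" "b2 = 12 * z * b"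
      using that by simp_all
    define e where "e = pn / pd"
    define Y where "Y = w - 36 * u ^ 2 + z - 12 * v ^ 2 - (3 * u + v) ^ 2"
    have "- (- (a2 / a - (a1 / a) ^ 2) / 4 - (b2 / b - (b1 / b) ^ 2) / 12) - (- (a1 / a) / 4 - (b1 / b) / 12) ^ 2
      - pn / pd * (- (a1 / a) / 4 - (b1 / b) / 12) - 60 * k ^ 2 * (sn / pd) / (a ^ 2 * b ^ 2)
      = Y + pn / pd * (3 * u + v) - 60 * k ^ 2 * (sn / pd) / (a ^ 2 * b ^ 2)"
      unfolding u Y_def e_def[symmetric] by (simp add: diff_divide_distrib add_divide_distrib power_mult_distrib) (simp add: algebra_simps power2_eq_square)
    also have "\<dots> = (144 * pd * a ^ 2 * b ^ 2 * Y + 144 * a ^ 2 * b ^ 2 * pn * (3 * u + v) - 8640 * k ^ 2 * sn) / (144 * pd * a ^ 2 * b ^ 2)"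
      using that assms(3) by (simp add: add_divide_distrib diff_divide_distrib)
    also have "144 * pd * a ^ 2 * b ^ 2 * Y + 144 * a ^ 2 * b ^ 2 * pn * (3 * u + v) - 8640 * k ^ 2 * sn =
      pd * (36 * (a2 * a - a1 ^ 2) * b ^ 2 + 12 * (b2 * b - b1 ^ 2) * a ^ 2 - (3 * a1 * b + b1 * a) ^ 2)
      + 12 * pn * (3 * a1 * b + b1 * a) * a * b - 8640 * k ^ 2 * sn"
      unfolding eqs Y_def by (simp add: algebra_simps power2_eq_square)
    finally show ?thesis .
  qed
  show ?thesis
    unfolding r_coeff_def L'_coeff_def s' s p unfolding L_coeff_def gen[OF assms(1,2)] id using assms(1-3) by simp
qed

end

section \<open>Rescaling to the normal forms of the Gauss and Heun equations\<close>

lemma deriv_scale: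
  fixes h :: "complex \<Rightarrow> complex"
  assumes h: "h has_fps_expansion H" and k: "k \<noteq> 0"
  shows "\<exists>G. (\<lambda>s. h (k * s)) has_fps_expansion G"
    "\<forall>\<^sub>F s in nhds 0. deriv (\<lambda>s. h (k * s)) s = k * deriv h (k * s) \<and>
       deriv (deriv (\<lambda>s. h (k * s))) s = k ^ 2 * deriv (deriv h) (k * s)"
proof -
  have "(h \<circ> (\<lambda>s. k * s)) has_fps_expansion (H oo (fps_const k * fps_X))"
    by (intro has_fps_expansion_compose h fps_expansion_intros) simp
  thus "\<exists>G. (\<lambda>s. h (k * s)) has_fps_expansion G" by (auto simp: o_def)
  obtain U where U: "open U" "0 \<in> U" "h holomorphic_on U" using has_fps_expansion_imp_holomorphic[OF h] by blast
  define V where "V = (\<lambda>s. k * s) -` U"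
  have V: "open V" "0 \<in> V" using U by (auto simp: V_def intro!: open_vimage continuous_intros)
  have d1: "((\<lambda>s. h (k * s)) has_field_derivative k * deriv h (k * s)) (at s)" if "s \<in> V" for s
  proof -
    have "(h has_field_derivative deriv h (k * s)) (at (k * s))"
      by (rule holomorphic_derivI[OF U(3,1)]) (use that in \<open>simp add: V_def\<close>)
    hence "((\<lambda>s. h (k * s)) has_field_derivative deriv h (k * s) * k) (at s)"
      by (rule DERIV_chain2) (auto intro!: derivative_eq_intros)
    thus ?thesis by (simp add: mult.commute)
  qed
  have d2: "(deriv (\<lambda>s. h (k * s)) has_field_derivative k ^ 2 * deriv (deriv h) (k * s)) (at s)" if "s \<in> V" for s
  proof -
    have "deriv h holomorphic_on U" by (rule holomorphic_deriv[OF U(3,1)])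
    hence "(deriv h has_field_derivative deriv (deriv h) (k * s)) (at (k * s))"
      by (rule holomorphic_derivI[OF _ U(1)]) (use that in \<open>simp add: V_def\<close>)
    hence "((\<lambda>s. deriv h (k * s)) has_field_derivative deriv (deriv h) (k * s) * k) (at s)"
      by (rule DERIV_chain2) (auto intro!: derivative_eq_intros)
    hence "((\<lambda>s. k * deriv h (k * s)) has_field_derivative k * (deriv (deriv h) (k * s) * k)) (at s)" by (rule DERIV_cmult)
    hence "(deriv (\<lambda>s. h (k * s)) has_field_derivative k * (deriv (deriv h) (k * s) * k)) (at s)"
      by (rule has_field_derivative_transform_within_open[OF _ V(1) that]) (use DERIV_imp_deriv[OF d1] in auto)
    thus ?thesis by (simp add: power2_eq_square mult_ac)
  qed
  show "\<forall>\<^sub>F s in nhds 0. deriv (\<lambda>s. h (k * s)) s = k * deriv h (k * s) \<and>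
       deriv (deriv (\<lambda>s. h (k * s))) s = k ^ 2 * deriv (deriv h) (k * s)"
    unfolding eventually_nhds using V DERIV_imp_deriv[OF d1] DERIV_imp_deriv[OF d2] by blast
qed

lemma eventually_scale_at_0:
  fixes k :: complex
  assumes "k \<noteq> 0" "\<forall>\<^sub>F t in at 0. R t"
  shows "\<forall>\<^sub>F s in at 0. R (k * s)"
proof -
  have "filterlim (\<lambda>s. k * s) (at 0) (at 0)"
    by (rule filterlim_atI) (use assms(1) in \<open>auto intro!: tendsto_eq_intros eventually_neq_at_within\<close>)
  thus ?thesis using assms(2) by (rule eventually_compose_filterlim[rotated])
qed

lemma eventually_scale_nhds_0:
  fixes k :: complex
  assumes "\<forall>\<^sub>F t in nhds 0. R t"
  shows "\<forall>\<^sub>F s in nhds 0. R (k * s)"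
proof -
  have "((\<lambda>s. k * s) \<longlongrightarrow> k * 0) (nhds 0)" by (intro tendsto_intros) (rule filterlim_ident)
  hence "filterlim (\<lambda>s. k * s) (nhds 0) (nhds 0)" by simp
  thus ?thesis using assms by (rule eventually_compose_filterlim[rotated])
qed

text \<open>The substitution t = k s moves the singular points 0, k, k a to 0, 1, a.\<close>

lemma heun_from_ode:
  fixes h :: "complex \<Rightarrow> complex"
  assumes h: "h has_fps_expansion H" "h 0 = 1" and k: "k \<noteq> 0" and a: "a \<noteq> 0"
    and ode: "\<forall>\<^sub>F t in at 0. deriv (deriv h) t + (1 / t + \<delta> / (t - k) + (\<alpha> + \<beta> - \<delta>) / (t - k * a)) * deriv h t
        + (\<alpha> * \<beta> * t - q * k) / (t * (t - k) * (t - k * a)) * h t = 0"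
  shows "\<forall>\<^sub>F t in nhds 0. h t = local_heun a q \<alpha> \<beta> 1 \<delta> (t / k)"
proof -
  obtain G where G: "(\<lambda>s. h (k * s)) has_fps_expansion G" using deriv_scale(1)[OF h(1) k] by blast
  have "\<forall>\<^sub>F s in at 0. deriv (\<lambda>s. h (k * s)) s = k * deriv h (k * s) \<and>
       deriv (deriv (\<lambda>s. h (k * s))) s = k ^ 2 * deriv (deriv h) (k * s)"
    using deriv_scale(2)[OF h(1) k] by (simp add: eventually_nhds_conv_at)
  moreover note eventually_scale_at_0[OF k ode]
  moreover have "open (- {1, a})" by (intro open_Compl finite_imp_closed) auto
  hence "\<forall>\<^sub>F s in at 0. s \<in> - {1, a} - {0}" by (intro eventually_at_in_open) (use a in auto)
  ultimately have "\<forall>\<^sub>F s in at 0. deriv (deriv (\<lambda>s. h (k * s))) s + (1 / s + \<delta> / (s - 1) + (\<alpha> + \<beta> - 1 - \<delta> + 1) / (s - a)) * deriv (\<lambda>s. h (k * s)) s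
          + (\<alpha> * \<beta> * s - q) / (s * (s - 1) * (s - a)) * h (k * s) = 0"
  proof eventually_elim
    case (elim s)
    define h2 where "h2 = deriv (deriv h) (k * s)"
    define h1 where "h1 = deriv h (k * s)"
    have e: "1 / (k * s) = 1 / s / k" "\<delta> / (k * s - k) = \<delta> / (s - 1) / k" "(\<alpha> + \<beta> - \<delta>) / (k * s - k * a) = (\<alpha> + \<beta> - \<delta>) / (s - a) / k"
      using k elim by (simp_all add: field_simps)
    have e2: "(\<alpha> * \<beta> * (k * s) - q * k) / ((k * s) * (k * s - k) * (k * s - k * a)) = (\<alpha> * \<beta> * s - q) / (s * (s - 1) * (s - a)) / k ^ 2"
    proof -
      have "(k * s) * (k * s - k) * (k * s - k * a) = k * k ^ 2 * (s * (s - 1) * (s - a))" by (simp add: algebra_simps power2_eq_square)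
      moreover have "\<alpha> * \<beta> * (k * s) - q * k = k * (\<alpha> * \<beta> * s - q)" by (simp add: algebra_simps)
      ultimately show ?thesis using k by (simp only: mult.assoc) (simp add: divide_simps)
    qed
    have "h2 + (1 / s / k + \<delta> / (s - 1) / k + (\<alpha> + \<beta> - \<delta>) / (s - a) / k) * h1 + (\<alpha> * \<beta> * s - q) / (s * (s - 1) * (s - a)) / k ^ 2 * h (k * s) = 0"
      using elim(2) unfolding e e2 h1_def h2_def .
    hence "k ^ 2 * (h2 + (1 / s / k + \<delta> / (s - 1) / k + (\<alpha> + \<beta> - \<delta>) / (s - a) / k) * h1 + (\<alpha> * \<beta> * s - q) / (s * (s - 1) * (s - a)) / k ^ 2 * h (k * s)) = 0"
      by simp
    moreover have "k ^ 2 * (h2 + (X / k + Y / k + Z / k) * h1 + W / k ^ 2 * v) = k ^ 2 * h2 + (X + Y + Z) * (k * h1) + W * v" for X Y Z W v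
      using k by (simp add: field_simps power2_eq_square)
    ultimately have "k ^ 2 * h2 + (1 / s + \<delta> / (s - 1) + (\<alpha> + \<beta> - \<delta>) / (s - a)) * (k * h1) + (\<alpha> * \<beta> * s - q) / (s * (s - 1) * (s - a)) * h (k * s) = 0"
      by (simp only:)
    moreover have "\<alpha> + \<beta> - 1 - \<delta> + 1 = \<alpha> + \<beta> - \<delta>" by simp
    ultimately show ?case using elim(1) unfolding h1_def h2_def by (simp only:)
  qed
  hence "solves_heun_near_0 a q \<alpha> \<beta> 1 \<delta> (\<lambda>s. h (k * s))" by (simp add: solves_heun_near_0_def Let_def)
  from local_heun_eqI[OF a G _ this] have "\<forall>\<^sub>F s in nhds 0. local_heun a q \<alpha> \<beta> 1 \<delta> s = h (k * s)" using h(2) by simp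
  from eventually_scale_nhds_0[OF this, of "1 / k"] show ?thesis
    by eventually_elim (use k in simp)
qed

lemma gauss_from_ode:
  fixes h :: "complex \<Rightarrow> complex"
  assumes h: "h has_fps_expansion H" "h 0 = 1" and k: "k \<noteq> 0"
    and ode: "\<forall>\<^sub>F t in at 0. deriv (deriv h) t + ((a + b + 1) * t - k) / (t * (t - k)) * deriv h t + a * b / (t * (t - k)) * h t = 0"
  shows "\<forall>\<^sub>F t in nhds 0. h t = hypergeom_2F1 a b 1 (t / k)"
proof -
  obtain G where G: "(\<lambda>s. h (k * s)) has_fps_expansion G" using deriv_scale(1)[OF h(1) k] by blast
  have "\<forall>\<^sub>F s in at 0. deriv (\<lambda>s. h (k * s)) s = k * deriv h (k * s) \<and>
       deriv (deriv (\<lambda>s. h (k * s))) s = k ^ 2 * deriv (deriv h) (k * s)"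
    using deriv_scale(2)[OF h(1) k] by (simp add: eventually_nhds_conv_at)
  moreover note eventually_scale_at_0[OF k ode]
  moreover have "open (- {1 :: complex})" by (intro open_Compl finite_imp_closed) auto
  hence "\<forall>\<^sub>F s in at (0::complex). s \<in> - {1} - {0}" by (intro eventually_at_in_open) auto
  ultimately have "\<forall>\<^sub>F s in at 0. s * (1 - s) * deriv (deriv (\<lambda>s. h (k * s))) s + (1 - (a + b + 1) * s) * deriv (\<lambda>s. h (k * s)) s - a * b * h (k * s) = 0"
  proof eventually_elim
    case (elim s)
    define h2 where "h2 = deriv (deriv h) (k * s)"
    define h1 where "h1 = deriv h (k * s)"
    define D where "D = (k * s) * (k * s - k)"
    have s: "s \<noteq> 0" "s \<noteq> 1" using elim by auto
    have D: "D = - (k ^ 2 * (s * (1 - s)))" by (simp add: D_def power2_eq_square algebra_simps)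
    have D0: "D \<noteq> 0" using k s by (simp add: D)
    have "h2 + ((a + b + 1) * (k * s) - k) / D * h1 + a * b / D * h (k * s) = 0"
      using elim(2) unfolding h1_def h2_def D_def .
    hence "- D * (h2 + ((a + b + 1) * (k * s) - k) / D * h1 + a * b / D * h (k * s)) = 0" by simp
    moreover have "- D * (h2 + X / D * h1 + Y / D * v) = - D * h2 - X * h1 - Y * v" for X Y v
      using D0 by (simp add: distrib_left)
    ultimately have "- D * h2 - ((a + b + 1) * (k * s) - k) * h1 - a * b * h (k * s) = 0" by (simp only:)
    thus ?case using elim(1) unfolding D h1_def h2_def by (simp add: algebra_simps)
  qed
  from gauss_eqI[OF G _ this] have "\<forall>\<^sub>F s in nhds 0. hypergeom_2F1 a b 1 s = h (k * s)" using h(2) by simp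
  from eventually_scale_nhds_0[OF this, of "1 / k"] show ?thesis
    by eventually_elim (use k in simp)
qed

context hauptmodul_pullback
begin

text \<open>The equation for h without denominators: p = pn/pd, S^2/(Q D) = sn/pd, and the identity
  of \<open>r_coeff_eq\<close>. Each level is left with identities between explicit polynomials; sn
  is the numerator that S^2/(Q D) receives over pd.\<close>

definition ode_certificate :: "(complex \<Rightarrow> complex) \<Rightarrow> (complex \<Rightarrow> complex) \<Rightarrow> (complex \<Rightarrow> complex) \<Rightarrow> (complex \<Rightarrow> complex) \<Rightarrow> bool" where
  "ode_certificate pd pn m sn \<longleftrightarrow> (\<forall>t.
     (6 * poly D t * poly S t * poly B t * poly (pderiv Q) t + 3 * poly (pderiv D) t * poly Q t * poly S t * poly B t
       - 6 * poly (pderiv S) t * poly Q t * poly D t * poly B t + 4 * poly (pderiv B) t * poly Q t * poly D t * poly S t) * pd t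
       = pn t * (6 * poly Q t * poly D t * poly S t * poly B t) \<and>
     poly S t ^ 2 * pd t = sn t * (poly Q t * poly D t) \<and>
     pd t * (36 * (poly (pderiv (pderiv A)) t * poly A t - poly (pderiv A) t ^ 2) * poly B t ^ 2
        + 12 * (poly (pderiv (pderiv B)) t * poly B t - poly (pderiv B) t ^ 2) * poly A t ^ 2
        - (3 * poly (pderiv A) t * poly B t + poly (pderiv B) t * poly A t) ^ 2)
      + 12 * pn t * (3 * poly (pderiv A) t * poly B t + poly (pderiv B) t * poly A t) * poly A t * poly B t - 8640 * k ^ 2 * sn t
      = 144 * m t * poly A t ^ 2 * poly B t ^ 2)"

lemma ode_of_certificate:
  assumes "ode_certificate pd pn m sn" and pd: "\<forall>\<^sub>F t in at 0. pd t \<noteq> 0"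
  shows "\<forall>\<^sub>F t in at 0. deriv (deriv h) t + pn t / pd t * deriv h t + m t / pd t * h t = 0"
proof -
  have "A \<noteq> 0" "B \<noteq> 0" using A0 B0 by auto
  note nz' = this[THEN eventually_poly_nonzero] nz[THEN eventually_poly_nonzero]
  show ?thesis using pd nz' h_ode
  proof eventually_elim
    case (elim t)
    note id = assms(1)[unfolded ode_certificate_def, rule_format, of t]
    have "x / q + d / (2 * d') - s / s' + 2 * b / (3 * b') = pn t / pd t"
      if "(6 * d' * s' * b' * x + 3 * d * q * s' * b' - 6 * s * q * d' * b' + 4 * b * q * d' * s') * pd t = pn t * (6 * q * d' * s' * b')"
        "q \<noteq> 0" "d' \<noteq> 0" "s' \<noteq> 0" "b' \<noteq> 0" for x q d d' s s' b b'
    proof -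
      have "x / q + d / (2 * d') - s / s' + 2 * b / (3 * b') =
        (6 * d' * s' * b' * x + 3 * d * q * s' * b' - 6 * s * q * d' * b' + 4 * b * q * d' * s') / (6 * q * d' * s' * b')"
        using that by (simp add: add_divide_distrib diff_divide_distrib)
      thus ?thesis using that elim(1) by (simp add: frac_eq_eq)
    qed
    from this[OF conjunct1[OF id]] have p: "p_coeff t = pn t / pd t" using elim unfolding p_coeff_def by simp
    have s: "poly S t ^ 2 / (poly Q t * poly D t) = sn t / pd t"
      using conjunct1[OF conjunct2[OF id]] elim by (simp add: frac_eq_eq)
    have "r_coeff t = m t / pd t"
      by (rule r_coeff_eq[OF _ _ _ p s conjunct2[OF conjunct2[OF id]]]) (use elim in auto)
    thus ?case using elim p by simp
  qed
qed

text \<open>e1 and e2 are the elementary symmetric functions of the singular points k' and k' a.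
  Since the certificate contains only e1, ..., e4, it can have rational coefficients even when the
  singular points are irrational.\<close>

lemma eq_local_heun:
  assumes k': "k' \<noteq> 0" "a \<noteq> 0"
    and e: "k' + k' * a = e1" "k' * (k' * a) = e2" "\<delta> * (k' * a) + (\<alpha> + \<beta> - \<delta>) * k' = e3" "q * k' = e4"
    and cert: "ode_certificate (\<lambda>t. t * (t ^ 2 - e1 * t + e2)) (\<lambda>t. t ^ 2 - e1 * t + e2 + t * ((\<alpha> + \<beta>) * t - e3))
      (\<lambda>t. \<alpha> * \<beta> * t - e4) sn"
  shows "\<forall>\<^sub>F t in nhds 0. h t = local_heun a q \<alpha> \<beta> 1 \<delta> (t / k')"
proof (rule heun_from_ode[OF h_expansion h_0 k'])
  have pd: "t ^ 2 - e1 * t + e2 = (t - k') * (t - k' * a)" for t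
    unfolding e[symmetric] by (simp add: algebra_simps power2_eq_square)
  have "open (- {k', k' * a})" by (intro open_Compl finite_imp_closed) auto
  hence ev: "\<forall>\<^sub>F t in at 0. t \<in> - {k', k' * a} - {0}" by (intro eventually_at_in_open) (use k' in auto)
  hence "\<forall>\<^sub>F t in at 0. t * (t ^ 2 - e1 * t + e2) \<noteq> 0" by eventually_elim (simp add: pd)
  from ode_of_certificate[OF cert this] ev
  show "\<forall>\<^sub>F t in at 0. deriv (deriv h) t + (1 / t + \<delta> / (t - k') + (\<alpha> + \<beta> - \<delta>) / (t - k' * a)) * deriv h t
        + (\<alpha> * \<beta> * t - q * k') / (t * (t - k') * (t - k' * a)) * h t = 0"
  proof eventually_elim
    case (elim t)
    have "t ^ 2 - e1 * t + e2 + t * ((\<alpha> + \<beta>) * t - e3) = (t - k') * (t - k' * a) + \<delta> * (t * (t - k' * a)) + (\<alpha> + \<beta> - \<delta>) * (t * (t - k'))"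
      unfolding pd e(3)[symmetric] by (simp add: algebra_simps)
    hence "(t ^ 2 - e1 * t + e2 + t * ((\<alpha> + \<beta>) * t - e3)) / (t * (t ^ 2 - e1 * t + e2)) =
       1 / t + \<delta> / (t - k') + (\<alpha> + \<beta> - \<delta>) / (t - k' * a)"
      using elim(2) by (simp add: pd add_divide_distrib)
    thus ?case using elim(1) by (simp add: pd e(4) mult.assoc)
  qed
qed

text \<open>With \<delta> = \<epsilon> = \<alpha> the equation is symmetric in the singular points
  k' and k''. One certificate therefore serves both orders, that is, both choices of signs.\<close>

lemma eq_local_heun_conj:
  assumes k': "k' * k'' = e2" "e2 \<noteq> 0" "k' + k'' = e1" and a: "a = k'' / k'" and q: "q = e4 / e2 * k''"
    and cert: "ode_certificate (\<lambda>t. t * (t ^ 2 - e1 * t + e2)) (\<lambda>t. t ^ 2 - e1 * t + e2 + t * ((\<alpha> + \<alpha>) * t - \<alpha> * e1))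
      (\<lambda>t. \<alpha> * \<alpha> * t - e4) sn"
  shows "\<forall>\<^sub>F t in nhds 0. h t = local_heun a q \<alpha> \<alpha> 1 \<alpha> (t / k')"
proof (rule eq_local_heun[OF _ _ _ _ _ _ cert])
  have nz: "k' \<noteq> 0" "k'' \<noteq> 0" using k' by auto
  hence a': "k' * a = k''" by (simp add: a)
  show "k' \<noteq> 0" "a \<noteq> 0" using nz by (simp_all add: a)
  show "k' + k' * a = e1" "k' * (k' * a) = e2" unfolding a' by fact+
  show "\<alpha> * (k' * a) + (\<alpha> + \<alpha> - \<alpha>) * k' = \<alpha> * e1" unfolding a' k'(3)[symmetric] by (simp add: algebra_simps)
  have "q * k' = e4 / e2 * (k' * k'')" by (simp add: q)
  thus "q * k' = e4" using k' by simp
qed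

lemma eq_hypergeom:
  assumes k': "k' \<noteq> 0"
    and cert: "ode_certificate (\<lambda>t. t * (t - k')) (\<lambda>t. (a + b + 1) * t - k') (\<lambda>t. a * b) sn"
  shows "\<forall>\<^sub>F t in nhds 0. h t = hypergeom_2F1 a b 1 (t / k')"
proof (rule gauss_from_ode[OF h_expansion h_0 k'])
  have "\<forall>\<^sub>F t in at 0. t \<in> - {k'} - {0}" by (intro eventually_at_in_open open_Compl finite_imp_closed) (use k' in auto)
  hence "\<forall>\<^sub>F t in at 0. t * (t - k') \<noteq> 0" by eventually_elim simp
  from ode_of_certificate[OF cert this]
  show "\<forall>\<^sub>F t in at 0. deriv (deriv h) t + ((a + b + 1) * t - k') / (t * (t - k')) * deriv h t + a * b / (t * (t - k')) * h t = 0" .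
qed

end

section \<open>Data and finite checks shared by all levels\<close>

lemma agrees_take: "agrees M F xs \<Longrightarrow> m \<le> M \<Longrightarrow> agrees m F (take m xs)"
  by (auto simp: agrees_def)

text \<open>There are 25 = 2 * 12 + 1 entries because 12 is the largest index psi(N), attained at N
  = 6, 8, 9.\<close>

definition E4_cube_list :: "int list" where
  "E4_cube_list = [1, 720, 179280, 16954560, 396974160, 4632858720, 34413301440, 187477879680, 814940600400, 2975469665040, 9486467837280,
     27053330840640, 70485969919680, 169930679355360, 384163875688320, 820167497170560, 1668890801059920,
     3249626139960480, 6096884624994960, 11045508493118400, 19428434736248160, 33213183182000640, 55431582035319360,
     90344577991916160, 144355754667499200]"

text \<open>Values of Ramanujan's tau function.\<close>

definition disc_list :: "int list" where
  "disc_list = [0, 1, -24, 252, -1472, 4830, -6048, -16744, 84480, -113643, -115920, 534612, -370944, -577738, 401856, 1217160, 987136,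
     -6905934, 2727432, 10661420, -7109760, -4219488, -12830688, 18643272, 21288960]"

lemma agrees_E4_cube: "agrees 25 ((1 + fps_const 240 * sigma_fps 3) ^ 3) E4_cube_list"
proof -
  have "agrees 25 (1 + fps_const 240 * sigma_fps 3) (map (\<lambda>n. (if n = 0 then 1 else 0) + 240 * sigma_list 3 n) [0..<25])"
    by (auto simp: agrees_def sigma_fps_nth)
  moreover have "series_cube (map (\<lambda>n. (if n = 0 then 1 else 0) + 240 * sigma_list 3 n) [0..<25]) = E4_cube_list"
    by code_simp
  ultimately show ?thesis using agrees_cube by metis
qed

lemma agrees_disc: "agrees 25 (fps_expansion disc_q 0) disc_list"
proof (rule agrees_logderiv[OF disc_q_logderiv])
  show "agrees 25 (1 - fps_const 24 * sigma_fps 1) (map (\<lambda>n. (if n = 0 then 1 else 0) - 24 * sigma_list 1 n) [0..<25])"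
    by (auto simp: agrees_def sigma_fps_nth)
  show "map2 (*) (map int [0..<25]) disc_list = series_mult disc_list (map (\<lambda>n. (if n = 0 then 1 else 0) - 24 * sigma_list 1 n) [0..<25])"
    by code_simp
qed (simp_all add: disc_q_nth disc_q_nth[unfolded One_nat_def] sigma_fps_nth sigma_list_def divisor_list_def disc_list_def)

text \<open>Only residues modulo N are enumerated. Reduction may destroy the coprimality of c and d
  but preserves that c, d and N have no common divisor, so the check runs over the pairs with this
  property.\<close>

definition coset_check :: "int \<Rightarrow> (int \<times> int) list \<Rightarrow> bool" where
  "coset_check N Bl \<longleftrightarrow> distinct Bl \<and> (\<forall>(c, d)\<in>set Bl. gcd c d = 1) \<and>
     (\<forall>c\<in>set [0..N - 1]. \<forall>d\<in>set [0..N - 1]. gcd (gcd c d) N = 1 \<longrightarrow> (\<exists>(c', d')\<in>set Bl. (c * d' - d * c') mod N = 0))"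

lemma coset_check_imp:
  assumes check: "coset_check (int N) Bl" and N: "N > 0" and cd: "coprime c d"
  shows "\<exists>(c', d')\<in>set Bl. int N dvd c * d' - d * c'"
proof -
  define g where "g = gcd (gcd (c mod int N) (d mod int N)) (int N)"
  have g: "g dvd c mod int N" "g dvd d mod int N" "g dvd int N" by (simp_all add: g_def gcd_dvdI1)
  hence "g dvd c" "g dvd d" by (simp_all add: dvd_mod_iff)
  hence "is_unit g" using cd coprime_common_divisor by blast
  hence gcd1: "gcd (gcd (c mod int N) (d mod int N)) (int N) = 1" unfolding g_def by simp
  have memb: "x mod int N \<in> set [0..int N - 1]" for x using N by simp
  have all: "\<forall>c\<in>set [0..int N - 1]. \<forall>d\<in>set [0..int N - 1]. gcd (gcd c d) (int N) = 1 \<longrightarrow>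
      (\<exists>(c', d')\<in>set Bl. (c * d' - d * c') mod int N = 0)"
    by (rule check[unfolded coset_check_def, THEN conjunct2, THEN conjunct2])
  have "\<exists>(c', d')\<in>set Bl. (c mod int N * d' - d mod int N * c') mod int N = 0"
    using bspec[OF bspec[OF all memb[of c]] memb[of d], THEN mp, OF gcd1] .
  then obtain c' d' where c'd': "(c', d') \<in> set Bl" "(c mod int N * d' - d mod int N * c') mod int N = 0"
    by auto
  have "(c mod int N * d' - d mod int N * c') mod int N = (c * d' - d * c') mod int N"
    by (intro mod_diff_cong mod_mult_left_eq)
  hence "(c * d' - d * c') mod int N = 0" using c'd'(2) by (rule trans[OF sym])
  hence "int N dvd c * d' - d * c'" by (rule mod_0_imp_dvd)
  thus ?thesis using c'd'(1) by (intro bexI[of _ "(c', d')"]) simp_all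
qed

text \<open>Two verifications: ts obeys the recursion of \<open>tq_agrees\<close>, and E_4^3 Q_N(t)
  = Delta P_N(t) holds modulo q^M, with P_N given in the factored form A^3 B.\<close>

definition series_check :: "nat \<Rightarrow> (nat \<Rightarrow> int) \<Rightarrow> nat \<Rightarrow> int \<Rightarrow> int list \<Rightarrow> int list \<Rightarrow> int list \<Rightarrow> int list \<Rightarrow> bool" where
  "series_check N r M c ts as bs cs \<longleftrightarrow> length ts = M \<and> ts ! 0 = 0 \<and> ts ! 1 = c \<and>
     map2 (*) (map int [0..<M]) ts = series_mult ts (map (log_coeff N r) [0..<M]) \<and>
     series_mult (series_poly cs ts) (take M E4_cube_list) =
       series_mult (series_mult (series_cube (series_poly as ts)) (series_poly bs ts)) (take M disc_list)"

lemma prod_divisors: "n > 0 \<Longrightarrow> (\<Prod>d | d dvd n. f d) = (\<Prod>d\<leftarrow>divisor_list n. f d)"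
  by (simp add: prod.distinct_set_conv_list[OF distinct_divisor_list] flip: set_divisor_list)

text \<open>This reduces the identification of P and Q at one level to evaluations on integer lists
  and to the absence of common zeros.\<close>

lemma j_in_lowest_terms_unique:
  fixes r :: "nat \<Rightarrow> int"
  assumes PQ: "j_in_lowest_terms N P Q"
    and t: "\<And>\<tau>. hauptmodul N \<tau> = of_int c * (\<Prod>m\<leftarrow>divisor_list N. dedekind_eta (of_nat m * \<tau>) powi r m)"
    and N: "N > 0" and c: "c \<noteq> 0" and r: "(\<Sum>m\<leftarrow>divisor_list N. r m) = 0" "(\<Sum>m\<leftarrow>divisor_list N. int m * r m) = 24"
    and cosets: "coset_check (int N) Bl" and M: "M = 2 * length Bl + 1" "M \<le> 25" "Bl \<noteq> []"
    and series: "series_check N r M c ts as bs cs"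
    and deg: "3 * (length as - 1) + (length bs - 1) \<le> length Bl" "length cs - 1 \<le> length Bl"
    and no_common: "\<And>x. poly (int_poly cs) x = 0 \<Longrightarrow> poly (int_poly as) x \<noteq> 0 \<and> poly (int_poly bs) x \<noteq> 0"
  obtains e where "e \<noteq> 0" "P = smult e (int_poly as ^ 3 * int_poly bs)" "Q = smult e (int_poly cs)"
proof -
  have card: "card (set Bl) = length Bl" using cosets by (simp add: coset_check_def distinct_card)
  interpret eta_quotient N r "of_int c" "set Bl"
  proof
    show "coprime c d" if "(c, d) \<in> set Bl" for c d
      using that cosets unfolding coset_check_def by (auto simp: coprime_iff_gcd_eq_1)
    show "\<exists>(c', d')\<in>set Bl. int N dvd c * d' - d * c'" if "coprime c d" for c d
      using coset_check_imp[OF cosets N that] .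
  qed (use N c r in \<open>simp_all add: sum_divisors\<close>)
  have t': "hauptmodul N \<tau> = t \<tau>" for \<tau> by (simp add: assms(2) t_def prod_divisors[OF N])
  interpret eta_quotient_j N r "of_int c" "set Bl" P Q
    by unfold_locales (use PQ in \<open>auto simp: j_in_lowest_terms_def t'\<close>)
  note s = series[unfolded series_check_def]
  show ?thesis
  proof (rule identify)
    show "agrees M (fps_expansion tq 0) ts" by (rule tq_agrees[OF refl]) (use s M in \<open>auto simp: Suc_le_eq\<close>)
    show "agrees M ((1 + fps_const 240 * sigma_fps 3) ^ 3) (take M E4_cube_list)" by (rule agrees_take[OF agrees_E4_cube M(2)])
    show "agrees M (fps_expansion disc_q 0) (take M disc_list)" by (rule agrees_take[OF agrees_disc M(2)])
    show "poly (int_poly as ^ 3 * int_poly bs) x \<noteq> 0" if "poly (int_poly cs) x = 0" for x using no_common[OF that] by simp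
  qed (use s M deg card that in auto)
qed

lemma poly_ext: "(\<And>x. poly p x = poly q x) \<Longrightarrow> p = (q :: complex poly)"
  using poly_eq_poly_eq_iff by blast

section \<open>The levels 2 to 9\<close>

lemma h_fun_2:
  assumes PQ: "j_in_lowest_terms 2 P Q"
  shows "\<forall>\<^sub>F t in nhds 0. h_fun P Q t = hypergeom_2F1 (1/4) (1/4) 1 (- t / 64)"
proof -
  have divs: "divisor_list 2 = [1, 2]" by code_simp
  \<comment> \<open>At every level j = A^3 B / G and j - 1728 = C^2 D / G. Here D is the elliptic
    point t = -64 of order 2; there is none of order 3, and the only finite cusp is the simple zero
    0 of G.\<close>
  define A B C D S G :: "complex poly"
    where "A = int_poly [16, 1]" and "B = int_poly [1]" and "C = int_poly [-8, 1]"
      and "D = int_poly [64, 1]" and "S = int_poly [1]" and "G = int_poly [0, 1]"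
  note defs = A_def B_def C_def D_def S_def G_def
  have polys: "poly A t = 16 + t"
      "poly (pderiv A) t = 1"
      "poly (pderiv (pderiv A)) t = 0"
      "poly B t = 1"
      "poly (pderiv B) t = 0"
      "poly (pderiv (pderiv B)) t = 0"
      "poly C t = - 8 + t"
      "poly D t = 64 + t"
      "poly (pderiv D) t = 1"
      "poly S t = 1"
      "poly (pderiv S) t = 0"
      "poly G t = t"
      "poly (pderiv G) t = 1" for t
    by (simp_all add: defs pderiv_pCons int_poly_def)
  have t: "hauptmodul 2 \<tau> = of_int 4096 * (\<Prod>m\<leftarrow>divisor_list 2. dedekind_eta (of_nat m * \<tau>) powi
      (\<lambda>m. if m = 2 then 24 else if m = 1 then -24 else 0) m)" for \<tau>
    by (simp add: divs hauptmodul_def Let_def power_int_minus divide_inverse mult_ac)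
  have cosets: "coset_check (int 2) [(0, 1), (1, 0), (1, 1)]" by code_simp
  \<comment> \<open>The 7 = 2 * 3 + 1 first q-coefficients of t_2.\<close>
  have series: "series_check 2 (\<lambda>m. if m = 2 then 24 else if m = 1 then -24 else 0) 7 4096
      [0, 4096, 98304, 1228800, 10747904, 74244096, 432144384]
      [16, 1] [1] [0, 1]" by code_simp
  have GA: "poly A x \<noteq> 0" if "poly G x = 0" for x
    using that by (simp add: polys)
  have GB: "poly B x \<noteq> 0" if "poly G x = 0" for x
    using that by (simp add: polys)
  have "\<exists>e. e \<noteq> 0 \<and> P = smult e (int_poly [16, 1] ^ 3 * int_poly [1]) \<and> Q = smult e (int_poly [0, 1])"
  proof (rule j_in_lowest_terms_unique[OF PQ t _ _ _ _ cosets _ _ _ series])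
    show "poly (int_poly [16, 1]) x \<noteq> 0 \<and> poly (int_poly [1]) x \<noteq> 0" if "poly (int_poly [0, 1]) x = 0" for x
      using GA[unfolded defs, OF that] GB[unfolded defs, OF that] by (rule conjI)
    show ?thesis if "e \<noteq> 0" "P = smult e (int_poly [16, 1] ^ 3 * int_poly [1])" "Q = smult e (int_poly [0, 1])" for e
      using that by blast
  qed (simp_all add: divs)
  then obtain e where e: "e \<noteq> 0" "P = smult e (A ^ 3 * B)" "Q = smult e G" unfolding defs by blast
  \<comment> \<open>All polynomials are monic, so the factor is degree G - degree (A^3 B). At every
    level this is -N, because the point t = infinity is the cusp of width N.\<close>
  interpret hauptmodul_pullback A B C D S G "-2" e
  proof
    show "A ^ 3 * B - smult 1728 G = C ^ 2 * D"
      by (rule poly_ext) (simp only: poly_diff poly_mult poly_power poly_smult polys, algebra)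
    show "pderiv G * A * B - smult 3 (G * pderiv A * B) - G * A * pderiv B = smult (-2) (C * S)"
      by (rule poly_ext) (simp only: poly_diff poly_mult poly_power poly_smult polys, algebra)
    show "e \<noteq> 0" by fact
  qed (simp_all add: defs int_poly_def)
  have h: "h_fun P Q t = h t" for t by (simp only: h_def e(2,3))
  have cert: "ode_certificate (\<lambda>t. t * (t - (-64))) (\<lambda>t. (1/4 + 1/4 + 1) * t - (-64)) (\<lambda>t. (1/4) * (1/4)) (\<lambda>t. 1)"
    unfolding ode_certificate_def polys
    by (intro allI conjI; simp only: diff_minus_eq_add; (algebra | (simp add: field_simps power2_eq_square; fail) | (simp add: field_simps, algebra)))
  have "\<forall>\<^sub>F t in nhds 0. h t = hypergeom_2F1 (1/4) (1/4) 1 (t / (-64))"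
    by (rule eq_hypergeom[OF _ cert]) simp
  thus ?thesis by (simp add: h)
qed

lemma h_fun_3:
  assumes PQ: "j_in_lowest_terms 3 P Q"
  shows "\<forall>\<^sub>F t in nhds 0. h_fun P Q t = hypergeom_2F1 (1/3) (1/3) 1 (- t / 27)"
proof -
  have divs: "divisor_list 3 = [1, 3]" by code_simp
  \<comment> \<open>B is the elliptic point t = -27 of order 3; there is none of order 2, so D =
    1.\<close>
  define A B C D S G :: "complex poly"
    where "A = int_poly [3, 1]" and "B = int_poly [27, 1]" and "C = int_poly [-27, 18, 1]"
      and "D = int_poly [1]" and "S = int_poly [1]" and "G = int_poly [0, 1]"
  note defs = A_def B_def C_def D_def S_def G_def
  have polys: "poly A t = 3 + t"
      "poly (pderiv A) t = 1"
      "poly (pderiv (pderiv A)) t = 0"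
      "poly B t = 27 + t"
      "poly (pderiv B) t = 1"
      "poly (pderiv (pderiv B)) t = 0"
      "poly C t = - 27 + t * (18 + t)"
      "poly D t = 1"
      "poly (pderiv D) t = 0"
      "poly S t = 1"
      "poly (pderiv S) t = 0"
      "poly G t = t"
      "poly (pderiv G) t = 1" for t
    by (simp_all add: defs pderiv_pCons int_poly_def)
  have t: "hauptmodul 3 \<tau> = of_int 729 * (\<Prod>m\<leftarrow>divisor_list 3. dedekind_eta (of_nat m * \<tau>) powi
      (\<lambda>m. if m = 3 then 12 else if m = 1 then -12 else 0) m)" for \<tau>
    by (simp add: divs hauptmodul_def Let_def power_int_minus divide_inverse mult_ac)
  have cosets: "coset_check (int 3) [(0, 1), (1, 0), (1, 1), (1, 2)]" by code_simp
  have series: "series_check 3 (\<lambda>m. if m = 3 then 12 else if m = 1 then -12 else 0) 9 729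
      [0, 729, 8748, 65610, 370332, 1743039, 7164612, 26556012, 90533052]
      [3, 1] [27, 1] [0, 1]" by code_simp
  have GA: "poly A x \<noteq> 0" if "poly G x = 0" for x
    using that by (simp add: polys)
  have GB: "poly B x \<noteq> 0" if "poly G x = 0" for x
    using that by (simp add: polys)
  have "\<exists>e. e \<noteq> 0 \<and> P = smult e (int_poly [3, 1] ^ 3 * int_poly [27, 1]) \<and> Q = smult e (int_poly [0, 1])"
  proof (rule j_in_lowest_terms_unique[OF PQ t _ _ _ _ cosets _ _ _ series])
    show "poly (int_poly [3, 1]) x \<noteq> 0 \<and> poly (int_poly [27, 1]) x \<noteq> 0" if "poly (int_poly [0, 1]) x = 0" for x
      using GA[unfolded defs, OF that] GB[unfolded defs, OF that] by (rule conjI)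
    show ?thesis if "e \<noteq> 0" "P = smult e (int_poly [3, 1] ^ 3 * int_poly [27, 1])" "Q = smult e (int_poly [0, 1])" for e
      using that by blast
  qed (simp_all add: divs)
  then obtain e where e: "e \<noteq> 0" "P = smult e (A ^ 3 * B)" "Q = smult e G" unfolding defs by blast
  interpret hauptmodul_pullback A B C D S G "-3" e
  proof
    show "A ^ 3 * B - smult 1728 G = C ^ 2 * D"
      by (rule poly_ext) (simp only: poly_diff poly_mult poly_power poly_smult polys, algebra)
    show "pderiv G * A * B - smult 3 (G * pderiv A * B) - G * A * pderiv B = smult (-3) (C * S)"
      by (rule poly_ext) (simp only: poly_diff poly_mult poly_power poly_smult polys, algebra)
    show "e \<noteq> 0" by fact
  qed (simp_all add: defs int_poly_def)
  have h: "h_fun P Q t = h t" for t by (simp only: h_def e(2,3))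
  \<comment> \<open>S^2/(Q D) = 1/t is extended by t + 27 to the common denominator t (t +
    27).\<close>
  have cert: "ode_certificate (\<lambda>t. t * (t - (-27))) (\<lambda>t. (1/3 + 1/3 + 1) * t - (-27)) (\<lambda>t. (1/3) * (1/3)) (\<lambda>t. t + 27)"
    unfolding ode_certificate_def polys
    by (intro allI conjI; simp only: diff_minus_eq_add; (algebra | (simp add: field_simps power2_eq_square; fail) | (simp add: field_simps, algebra)))
  have "\<forall>\<^sub>F t in nhds 0. h t = hypergeom_2F1 (1/3) (1/3) 1 (t / (-27))"
    by (rule eq_hypergeom[OF _ cert]) simp
  thus ?thesis by (simp add: h)
qed

lemma h_fun_4:
  assumes PQ: "j_in_lowest_terms 4 P Q"
  shows "\<forall>\<^sub>F t in nhds 0. h_fun P Q t = hypergeom_2F1 (1/2) (1/2) 1 (- t / 16)"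
proof -
  have divs: "divisor_list 4 = [1, 2, 4]" by code_simp
  \<comment> \<open>There are no elliptic points, so B = D = 1; the singular point -16 is a cusp, a
    simple zero of G.\<close>
  define A B C D S G :: "complex poly"
    where "A = int_poly [16, 16, 1]" and "B = int_poly [1]" and "C = int_poly [-64, 120, 24, 1]"
      and "D = int_poly [1]" and "S = int_poly [1]" and "G = int_poly [0, 16, 1]"
  note defs = A_def B_def C_def D_def S_def G_def
  have polys: "poly A t = 16 + t * (16 + t)"
      "poly (pderiv A) t = 16 + t * (2)"
      "poly (pderiv (pderiv A)) t = 2"
      "poly B t = 1"
      "poly (pderiv B) t = 0"
      "poly (pderiv (pderiv B)) t = 0"
      "poly C t = - 64 + t * (120 + t * (24 + t))"
      "poly D t = 1"
      "poly (pderiv D) t = 0"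
      "poly S t = 1"
      "poly (pderiv S) t = 0"
      "poly G t = t * (16 + t)"
      "poly (pderiv G) t = 16 + t * (2)" for t
    by (simp_all add: defs pderiv_pCons int_poly_def)
  have t: "hauptmodul 4 \<tau> = of_int 256 * (\<Prod>m\<leftarrow>divisor_list 4. dedekind_eta (of_nat m * \<tau>) powi
      (\<lambda>m. if m = 4 then 8 else if m = 1 then -8 else 0) m)" for \<tau>
    by (simp add: divs hauptmodul_def Let_def power_int_minus divide_inverse mult_ac)
  have cosets: "coset_check (int 4) [(0, 1), (1, 0), (1, 1), (1, 2), (1, 3), (2, 1)]" by code_simp
  have series: "series_check 4 (\<lambda>m. if m = 4 then 8 else if m = 1 then -8 else 0) 13 256
      [0, 256, 2048, 11264, 49152, 183808, 614400, 1882112, 5373952, 14476544, 37122048, 91235328, 216072192]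
      [16, 16, 1] [1] [0, 16, 1]" by code_simp
  have GA: "poly A x \<noteq> 0" if "poly G x = 0" for x
  proof -
    have "poly A x = poly G x + 16" unfolding polys by algebra
    thus ?thesis using that by simp
  qed
  have GB: "poly B x \<noteq> 0" if "poly G x = 0" for x
    using that by (simp add: polys)
  have "\<exists>e. e \<noteq> 0 \<and> P = smult e (int_poly [16, 16, 1] ^ 3 * int_poly [1]) \<and> Q = smult e (int_poly [0, 16, 1])"
  proof (rule j_in_lowest_terms_unique[OF PQ t _ _ _ _ cosets _ _ _ series])
    show "poly (int_poly [16, 16, 1]) x \<noteq> 0 \<and> poly (int_poly [1]) x \<noteq> 0" if "poly (int_poly [0, 16, 1]) x = 0" for x
      using GA[unfolded defs, OF that] GB[unfolded defs, OF that] by (rule conjI)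
    show ?thesis if "e \<noteq> 0" "P = smult e (int_poly [16, 16, 1] ^ 3 * int_poly [1])" "Q = smult e (int_poly [0, 16, 1])" for e
      using that by blast
  qed (simp_all add: divs)
  then obtain e where e: "e \<noteq> 0" "P = smult e (A ^ 3 * B)" "Q = smult e G" unfolding defs by blast
  interpret hauptmodul_pullback A B C D S G "-4" e
  proof
    show "A ^ 3 * B - smult 1728 G = C ^ 2 * D"
      by (rule poly_ext) (simp only: poly_diff poly_mult poly_power poly_smult polys, algebra)
    show "pderiv G * A * B - smult 3 (G * pderiv A * B) - G * A * pderiv B = smult (-4) (C * S)"
      by (rule poly_ext) (simp only: poly_diff poly_mult poly_power poly_smult polys, algebra)
    show "e \<noteq> 0" by fact
  qed (simp_all add: defs int_poly_def)
  have h: "h_fun P Q t = h t" for t by (simp only: h_def e(2,3))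
  have cert: "ode_certificate (\<lambda>t. t * (t - (-16))) (\<lambda>t. (1/2 + 1/2 + 1) * t - (-16)) (\<lambda>t. (1/2) * (1/2)) (\<lambda>t. 1)"
    unfolding ode_certificate_def polys
    by (intro allI conjI; simp only: diff_minus_eq_add; (algebra | (simp add: field_simps power2_eq_square; fail) | (simp add: field_simps, algebra)))
  have "\<forall>\<^sub>F t in nhds 0. h t = hypergeom_2F1 (1/2) (1/2) 1 (t / (-16))"
    by (rule eq_hypergeom[OF _ cert]) simp
  thus ?thesis by (simp add: h)
qed

lemma h_fun_5:
  assumes PQ: "j_in_lowest_terms 5 P Q" and \<sigma>: "\<sigma> \<in> {1, -1}"
  shows "\<forall>\<^sub>F t in nhds 0. h_fun P Q t =
     local_heun ((-11 - \<sigma> * (2 * \<i>)) / (-11 + \<sigma> * (2 * \<i>))) (- (1/50) * (-11 - \<sigma> * (2 * \<i>))) (1/2) (1/2) 1 (1/2) (t / (-11 + \<sigma> * (2 * \<i>)))"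
proof -
  have divs: "divisor_list 5 = [1, 5]" by code_simp
  \<comment> \<open>The zeros of D are the two elliptic points of order 2, which are the singular
    points -11 + 2 i and -11 - 2 i.\<close>
  define A B C D S G :: "complex poly"
    where "A = int_poly [5, 10, 1]" and "B = int_poly [1]" and "C = int_poly [-1, 4, 1]"
      and "D = int_poly [125, 22, 1]" and "S = int_poly [1]" and "G = int_poly [0, 1]"
  note defs = A_def B_def C_def D_def S_def G_def
  have polys: "poly A t = 5 + t * (10 + t)"
      "poly (pderiv A) t = 10 + t * (2)"
      "poly (pderiv (pderiv A)) t = 2"
      "poly B t = 1"
      "poly (pderiv B) t = 0"
      "poly (pderiv (pderiv B)) t = 0"
      "poly C t = - 1 + t * (4 + t)"
      "poly D t = 125 + t * (22 + t)"
      "poly (pderiv D) t = 22 + t * (2)"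
      "poly S t = 1"
      "poly (pderiv S) t = 0"
      "poly G t = t"
      "poly (pderiv G) t = 1" for t
    by (simp_all add: defs pderiv_pCons int_poly_def)
  have t: "hauptmodul 5 \<tau> = of_int 125 * (\<Prod>m\<leftarrow>divisor_list 5. dedekind_eta (of_nat m * \<tau>) powi
      (\<lambda>m. if m = 5 then 6 else if m = 1 then -6 else 0) m)" for \<tau>
    by (simp add: divs hauptmodul_def Let_def power_int_minus divide_inverse mult_ac)
  have cosets: "coset_check (int 5) [(0, 1), (1, 0), (1, 1), (1, 2), (1, 3), (1, 4)]" by code_simp
  have series: "series_check 5 (\<lambda>m. if m = 5 then 6 else if m = 1 then -6 else 0) 13 125
      [0, 125, 750, 3375, 12250, 39375, 114000, 307000, 776250, 1867125, 4298750, 9539625, 20487000]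
      [5, 10, 1] [1] [0, 1]" by code_simp
  have GA: "poly A x \<noteq> 0" if "poly G x = 0" for x
    using that by (simp add: polys)
  have GB: "poly B x \<noteq> 0" if "poly G x = 0" for x
    using that by (simp add: polys)
  have "\<exists>e. e \<noteq> 0 \<and> P = smult e (int_poly [5, 10, 1] ^ 3 * int_poly [1]) \<and> Q = smult e (int_poly [0, 1])"
  proof (rule j_in_lowest_terms_unique[OF PQ t _ _ _ _ cosets _ _ _ series])
    show "poly (int_poly [5, 10, 1]) x \<noteq> 0 \<and> poly (int_poly [1]) x \<noteq> 0" if "poly (int_poly [0, 1]) x = 0" for x
      using GA[unfolded defs, OF that] GB[unfolded defs, OF that] by (rule conjI)
    show ?thesis if "e \<noteq> 0" "P = smult e (int_poly [5, 10, 1] ^ 3 * int_poly [1])" "Q = smult e (int_poly [0, 1])" for e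
      using that by blast
  qed (simp_all add: divs)
  then obtain e where e: "e \<noteq> 0" "P = smult e (A ^ 3 * B)" "Q = smult e G" unfolding defs by blast
  interpret hauptmodul_pullback A B C D S G "-5" e
  proof
    show "A ^ 3 * B - smult 1728 G = C ^ 2 * D"
      by (rule poly_ext) (simp only: poly_diff poly_mult poly_power poly_smult polys, algebra)
    show "pderiv G * A * B - smult 3 (G * pderiv A * B) - G * A * pderiv B = smult (-5) (C * S)"
      by (rule poly_ext) (simp only: poly_diff poly_mult poly_power poly_smult polys, algebra)
    show "e \<noteq> 0" by fact
  qed (simp_all add: defs int_poly_def)
  have h: "h_fun P Q t = h t" for t by (simp only: h_def e(2,3))
  \<comment> \<open>The product of the two singular points contains \<sigma> only squared, so both
    signs are treated at once.\<close>
  have s: "\<sigma> ^ 2 = 1" using \<sigma> by auto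
  have m: "(-11 + \<sigma> * (2 * \<i>)) * (-11 - \<sigma> * (2 * \<i>)) = 121 - \<sigma> ^ 2 * (4 * \<i> ^ 2)"
    by (algebra | (simp add: field_simps power2_eq_square; fail) | (simp add: field_simps, algebra))
  have prod: "(-11 + \<sigma> * (2 * \<i>)) * (-11 - \<sigma> * (2 * \<i>)) = 125" unfolding m s power2_csqrt by simp
  \<comment> \<open>-22 and 125 are the sum and product of the zeros of D. The value e4 = -5/2 gives
    q = (e4/125) k'' = -(1/50) k''.\<close>
  have cert: "ode_certificate (\<lambda>t. t * (t ^ 2 - (-22) * t + 125)) (\<lambda>t. t ^ 2 - (-22) * t + 125 + t * ((1/2 + 1/2) * t - (1/2) * (-22)))
      (\<lambda>t. (1/2) * (1/2) * t - (- 5/2)) (\<lambda>t. 1)"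
    unfolding ode_certificate_def polys by (intro allI conjI; (algebra | (simp add: field_simps, algebra)))
  have "\<forall>\<^sub>F t in nhds 0. h t =
     local_heun ((-11 - \<sigma> * (2 * \<i>)) / (-11 + \<sigma> * (2 * \<i>))) (- (1/50) * (-11 - \<sigma> * (2 * \<i>))) (1/2) (1/2) 1 (1/2) (t / (-11 + \<sigma> * (2 * \<i>)))"
    by (rule eq_local_heun_conj[OF prod _ _ _ _ cert])
      ((simp; fail) | (simp add: field_simps; fail) | (simp add: divide_simps))+
  thus ?thesis unfolding h .
qed

lemma h_fun_6:
  assumes PQ: "j_in_lowest_terms 6 P Q"
  shows "\<forall>\<^sub>F t in nhds 0. h_fun P Q t = local_heun (9/8) (3/4) 1 1 1 1 (- t / 8)"
    "\<forall>\<^sub>F t in nhds 0. h_fun P Q t = local_heun (8/9) (2/3) 1 1 1 1 (- t / 9)"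
proof -
  have divs: "divisor_list 6 = [1, 2, 3, 6]" by code_simp
  \<comment> \<open>G = t (t + 8)^3 (t + 9)^2, so the finite cusps have widths 1, 3, 2, and S = (t +
    8)^2 (t + 9) takes the surplus multiplicities.\<close>
  define A B C D S G :: "complex poly"
    where "A = int_poly [144, 528, 192, 24, 1]" and "B = int_poly [1]" and "C = int_poly [-1728, 11232, 10584, 3384, 504, 36, 1]"
      and "D = int_poly [1]" and "S = int_poly [576, 208, 25, 1]" and "G = int_poly [0, 41472, 24768, 5912, 705, 42, 1]"
  note defs = A_def B_def C_def D_def S_def G_def
  have polys: "poly A t = 144 + t * (528 + t * (192 + t * (24 + t)))"
      "poly (pderiv A) t = 528 + t * (384 + t * (72 + t * (4)))"
      "poly (pderiv (pderiv A)) t = 384 + t * (144 + t * (12))"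
      "poly B t = 1"
      "poly (pderiv B) t = 0"
      "poly (pderiv (pderiv B)) t = 0"
      "poly C t = - 1728 + t * (11232 + t * (10584 + t * (3384 + t * (504 + t * (36 + t)))))"
      "poly D t = 1"
      "poly (pderiv D) t = 0"
      "poly S t = 576 + t * (208 + t * (25 + t))"
      "poly (pderiv S) t = 208 + t * (50 + t * (3))"
      "poly G t = t * (41472 + t * (24768 + t * (5912 + t * (705 + t * (42 + t)))))"
      "poly (pderiv G) t = 41472 + t * (49536 + t * (17736 + t * (2820 + t * (210 + t * (6)))))" for t
    by (simp_all add: defs pderiv_pCons int_poly_def)
  have t: "hauptmodul 6 \<tau> = of_int 72 * (\<Prod>m\<leftarrow>divisor_list 6. dedekind_eta (of_nat m * \<tau>) powi
      (\<lambda>m. if m = 2 then 1 else if m = 6 then 5 else if m = 1 then -5 else if m = 3 then -1 else 0) m)" for \<tau>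
    by (simp add: divs hauptmodul_def Let_def power_int_minus divide_inverse mult_ac)
  have cosets: "coset_check (int 6) [(0, 1), (1, 0), (1, 1), (1, 2), (1, 3), (1, 4), (1, 5), (2, 1), (2, 3), (2, 5), (3, 1), (3, 2)]" by code_simp
  have series: "series_check 6 (\<lambda>m. if m = 2 then 1 else if m = 6 then 5 else if m = 1 then -5 else if m = 3 then -1 else 0) 25 72
      [0, 72, 360, 1368, 4392, 12528, 32760, 80064, 185256, 409608, 871344, 1792800, 3582648, 6976944, 13277376,
      24747984, 45267624, 81390096, 144048168, 251264736, 432425520, 734953536, 1234648224, 2051576640, 3374317368]
      [144, 528, 192, 24, 1] [1] [0, 41472, 24768, 5912, 705, 42, 1]" by code_simp
  have GA: "poly A x \<noteq> 0" if "poly G x = 0" for x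
  proof -
    have "poly G x = x * (x + 8) ^ 3 * (x + 9) ^ 2" unfolding polys by algebra
    with that have "x = 0 \<or> x = -8 \<or> x = -9" by (auto simp: add_eq_0_iff2)
    thus ?thesis by (auto simp: polys)
  qed
  have GB: "poly B x \<noteq> 0" if "poly G x = 0" for x
    using that by (simp add: polys)
  have "\<exists>e. e \<noteq> 0 \<and> P = smult e (int_poly [144, 528, 192, 24, 1] ^ 3 * int_poly [1]) \<and> Q = smult e (int_poly [0, 41472, 24768, 5912, 705, 42, 1])"
  proof (rule j_in_lowest_terms_unique[OF PQ t _ _ _ _ cosets _ _ _ series])
    show "poly (int_poly [144, 528, 192, 24, 1]) x \<noteq> 0 \<and> poly (int_poly [1]) x \<noteq> 0" if "poly (int_poly [0, 41472, 24768, 5912, 705, 42, 1]) x = 0" for x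
      using GA[unfolded defs, OF that] GB[unfolded defs, OF that] by (rule conjI)
    show ?thesis if "e \<noteq> 0" "P = smult e (int_poly [144, 528, 192, 24, 1] ^ 3 * int_poly [1])" "Q = smult e (int_poly [0, 41472, 24768, 5912, 705, 42, 1])" for e
      using that by blast
  qed (simp_all add: divs)
  then obtain e where e: "e \<noteq> 0" "P = smult e (A ^ 3 * B)" "Q = smult e G" unfolding defs by blast
  interpret hauptmodul_pullback A B C D S G "-6" e
  proof
    show "A ^ 3 * B - smult 1728 G = C ^ 2 * D"
      by (rule poly_ext) (simp only: poly_diff poly_mult poly_power poly_smult polys, algebra)
    show "pderiv G * A * B - smult 3 (G * pderiv A * B) - G * A * pderiv B = smult (-6) (C * S)"
      by (rule poly_ext) (simp only: poly_diff poly_mult poly_power poly_smult polys, algebra)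
    show "e \<noteq> 0" by fact
  qed (simp_all add: defs int_poly_def)
  have h: "h_fun P Q t = h t" for t by (simp only: h_def e(2,3))
  \<comment> \<open>One equation serves two normalisations: k' = -8 and k' = -9 interchange the
    singular points, and the accessory value q k' is -6 in both, from q = 3/4 and q = 2/3.\<close>
  have cert: "ode_certificate (\<lambda>t. t * (t ^ 2 - (-17) * t + 72)) (\<lambda>t. t ^ 2 - (-17) * t + 72 + t * ((1 + 1) * t - (-17)))
      (\<lambda>t. 1 * 1 * t - (-6)) (\<lambda>t. (t + 8) ^ 2 * (t + 9))"
    unfolding ode_certificate_def polys by (intro allI conjI; (algebra | (simp add: field_simps, algebra)))
  have "\<forall>\<^sub>F t in nhds 0. h t = local_heun (9/8) (3/4) 1 1 1 1 (t / (- 8))"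
    by (rule eq_local_heun[OF _ _ _ _ _ _ cert]) simp_all
  thus "\<forall>\<^sub>F t in nhds 0. h_fun P Q t = local_heun (9/8) (3/4) 1 1 1 1 (- t / 8)"
    by (simp add: h)
  have "\<forall>\<^sub>F t in nhds 0. h t = local_heun (8/9) (2/3) 1 1 1 1 (t / (- 9))"
    by (rule eq_local_heun[OF _ _ _ _ _ _ cert]) simp_all
  thus "\<forall>\<^sub>F t in nhds 0. h_fun P Q t = local_heun (8/9) (2/3) 1 1 1 1 (- t / 9)"
    by (simp add: h)
qed

lemma h_fun_7:
  assumes PQ: "j_in_lowest_terms 7 P Q" and \<sigma>: "\<sigma> \<in> {1, -1}"
  shows "\<forall>\<^sub>F t in nhds 0. h_fun P Q t =
     local_heun ((-13 - \<sigma> * (3 * csqrt (-3))) / (-13 + \<sigma> * (3 * csqrt (-3)))) (- (1/21) * ((-13 - \<sigma> * (3 * csqrt (-3))) / 2)) (2/3) (2/3) 1 (2/3) (t / ((-13 + \<sigma> * (3 * csqrt (-3))) / 2))"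
proof -
  have divs: "divisor_list 7 = [1, 7]" by code_simp
  \<comment> \<open>The zeros of B are the two elliptic points of order 3.\<close>
  define A B C D S G :: "complex poly"
    where "A = int_poly [1, 5, 1]" and "B = int_poly [49, 13, 1]" and "C = int_poly [-7, 70, 63, 14, 1]"
      and "D = int_poly [1]" and "S = int_poly [1]" and "G = int_poly [0, 1]"
  note defs = A_def B_def C_def D_def S_def G_def
  have polys: "poly A t = 1 + t * (5 + t)"
      "poly (pderiv A) t = 5 + t * (2)"
      "poly (pderiv (pderiv A)) t = 2"
      "poly B t = 49 + t * (13 + t)"
      "poly (pderiv B) t = 13 + t * (2)"
      "poly (pderiv (pderiv B)) t = 2"
      "poly C t = - 7 + t * (70 + t * (63 + t * (14 + t)))"
      "poly D t = 1"
      "poly (pderiv D) t = 0"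
      "poly S t = 1"
      "poly (pderiv S) t = 0"
      "poly G t = t"
      "poly (pderiv G) t = 1" for t
    by (simp_all add: defs pderiv_pCons int_poly_def)
  have t: "hauptmodul 7 \<tau> = of_int 49 * (\<Prod>m\<leftarrow>divisor_list 7. dedekind_eta (of_nat m * \<tau>) powi
      (\<lambda>m. if m = 7 then 4 else if m = 1 then -4 else 0) m)" for \<tau>
    by (simp add: divs hauptmodul_def Let_def power_int_minus divide_inverse mult_ac)
  have cosets: "coset_check (int 7) [(0, 1), (1, 0), (1, 1), (1, 2), (1, 3), (1, 4), (1, 5), (1, 6)]" by code_simp
  have series: "series_check 7 (\<lambda>m. if m = 7 then 4 else if m = 1 then -4 else 0) 17 49
      [0, 49, 196, 686, 1960, 5145, 12348, 28126, 60564, 125636, 251076, 487452, 920612, 1699565, 3070536, 5445468,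
      9489928]
      [1, 5, 1] [49, 13, 1] [0, 1]" by code_simp
  have GA: "poly A x \<noteq> 0" if "poly G x = 0" for x
    using that by (simp add: polys)
  have GB: "poly B x \<noteq> 0" if "poly G x = 0" for x
    using that by (simp add: polys)
  have "\<exists>e. e \<noteq> 0 \<and> P = smult e (int_poly [1, 5, 1] ^ 3 * int_poly [49, 13, 1]) \<and> Q = smult e (int_poly [0, 1])"
  proof (rule j_in_lowest_terms_unique[OF PQ t _ _ _ _ cosets _ _ _ series])
    show "poly (int_poly [1, 5, 1]) x \<noteq> 0 \<and> poly (int_poly [49, 13, 1]) x \<noteq> 0" if "poly (int_poly [0, 1]) x = 0" for x
      using GA[unfolded defs, OF that] GB[unfolded defs, OF that] by (rule conjI)
    show ?thesis if "e \<noteq> 0" "P = smult e (int_poly [1, 5, 1] ^ 3 * int_poly [49, 13, 1])" "Q = smult e (int_poly [0, 1])" for e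
      using that by blast
  qed (simp_all add: divs)
  then obtain e where e: "e \<noteq> 0" "P = smult e (A ^ 3 * B)" "Q = smult e G" unfolding defs by blast
  interpret hauptmodul_pullback A B C D S G "-7" e
  proof
    show "A ^ 3 * B - smult 1728 G = C ^ 2 * D"
      by (rule poly_ext) (simp only: poly_diff poly_mult poly_power poly_smult polys, algebra)
    show "pderiv G * A * B - smult 3 (G * pderiv A * B) - G * A * pderiv B = smult (-7) (C * S)"
      by (rule poly_ext) (simp only: poly_diff poly_mult poly_power poly_smult polys, algebra)
    show "e \<noteq> 0" by fact
  qed (simp_all add: defs int_poly_def)
  have h: "h_fun P Q t = h t" for t by (simp only: h_def e(2,3))
  have s: "\<sigma> ^ 2 = 1" using \<sigma> by auto
  have m: "((-13 + \<sigma> * (3 * csqrt (-3))) / 2) * ((-13 - \<sigma> * (3 * csqrt (-3))) / 2) = (169 - \<sigma> ^ 2 * (9 * csqrt (-3) ^ 2)) / 4"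
    by (algebra | (simp add: field_simps power2_eq_square; fail) | (simp add: field_simps, algebra))
  have prod: "((-13 + \<sigma> * (3 * csqrt (-3))) / 2) * ((-13 - \<sigma> * (3 * csqrt (-3))) / 2) = 49" unfolding m s power2_csqrt by simp
  have cert: "ode_certificate (\<lambda>t. t * (t ^ 2 - (-13) * t + 49)) (\<lambda>t. t ^ 2 - (-13) * t + 49 + t * ((2/3 + 2/3) * t - (2/3) * (-13)))
      (\<lambda>t. (2/3) * (2/3) * t - (- 7/3)) (\<lambda>t. t ^ 2 + 13 * t + 49)"
    proof -
    \<comment> \<open>Thirds become multiples of w subject to 3 w = 1, which leaves identities with
      integer coefficients.\<close>
    define w :: complex where "w = 1/3"
    have w: "3 * w = 1" and f: "2/3 = 2 * w" "- 7/3 = - 7 * w" by (simp_all add: w_def)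
    show ?thesis unfolding ode_certificate_def polys
      by (intro allI conjI; (algebra | (simp add: field_simps, algebra) | (simp add: field_simps; fail)
          | (simp only: f, insert w, algebra) | (simp add: field_simps power2_eq_square; fail)))
  qed
  have "\<forall>\<^sub>F t in nhds 0. h t =
     local_heun ((-13 - \<sigma> * (3 * csqrt (-3))) / (-13 + \<sigma> * (3 * csqrt (-3)))) (- (1/21) * ((-13 - \<sigma> * (3 * csqrt (-3))) / 2)) (2/3) (2/3) 1 (2/3) (t / ((-13 + \<sigma> * (3 * csqrt (-3))) / 2))"
    by (rule eq_local_heun_conj[OF prod _ _ _ _ cert])
      ((simp; fail) | (simp add: field_simps; fail) | (simp add: divide_simps))+
  thus ?thesis unfolding h .
qed

lemma h_fun_8:
  assumes PQ: "j_in_lowest_terms 8 P Q"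
  shows "\<forall>\<^sub>F t in nhds 0. h_fun P Q t = local_heun 2 1 1 1 1 1 (- t / 4)"
    "\<forall>\<^sub>F t in nhds 0. h_fun P Q t = local_heun (1/2) (1/2) 1 1 1 1 (- t / 8)"
proof -
  have divs: "divisor_list 8 = [1, 2, 4, 8]" by code_simp
  \<comment> \<open>G = t (t + 4)^2 (t + 8): the cusp -4 has width 2, and S = t + 4 takes its
    surplus multiplicity.\<close>
  define A B C D S G :: "complex poly"
    where "A = int_poly [16, 128, 80, 16, 1]" and "B = int_poly [1]" and "C = int_poly [-64, 960, 1656, 896, 216, 24, 1]"
      and "D = int_poly [1]" and "S = int_poly [4, 1]" and "G = int_poly [0, 128, 80, 16, 1]"
  note defs = A_def B_def C_def D_def S_def G_def
  have polys: "poly A t = 16 + t * (128 + t * (80 + t * (16 + t)))"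
      "poly (pderiv A) t = 128 + t * (160 + t * (48 + t * (4)))"
      "poly (pderiv (pderiv A)) t = 160 + t * (96 + t * (12))"
      "poly B t = 1"
      "poly (pderiv B) t = 0"
      "poly (pderiv (pderiv B)) t = 0"
      "poly C t = - 64 + t * (960 + t * (1656 + t * (896 + t * (216 + t * (24 + t)))))"
      "poly D t = 1"
      "poly (pderiv D) t = 0"
      "poly S t = 4 + t"
      "poly (pderiv S) t = 1"
      "poly G t = t * (128 + t * (80 + t * (16 + t)))"
      "poly (pderiv G) t = 128 + t * (160 + t * (48 + t * (4)))" for t
    by (simp_all add: defs pderiv_pCons int_poly_def)
  have t: "hauptmodul 8 \<tau> = of_int 32 * (\<Prod>m\<leftarrow>divisor_list 8. dedekind_eta (of_nat m * \<tau>) powi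
      (\<lambda>m. if m = 2 then 2 else if m = 8 then 4 else if m = 1 then -4 else if m = 4 then -2 else 0) m)" for \<tau>
    by (simp add: divs hauptmodul_def Let_def power_int_minus divide_inverse mult_ac)
  have cosets: "coset_check (int 8) [(0, 1), (1, 0), (1, 1), (1, 2), (1, 3), (1, 4), (1, 5), (1, 6), (1, 7), (2, 1), (2, 3), (4, 1)]" by code_simp
  have series: "series_check 8 (\<lambda>m. if m = 2 then 2 else if m = 8 then 4 else if m = 1 then -4 else if m = 4 then -2 else 0) 25 32
      [0, 32, 128, 384, 1024, 2496, 5632, 12032, 24576, 48288, 91904, 170112, 307200, 542912, 941056, 1602816,
      2686976, 4439616, 7238272, 11657088, 18561024, 29242368, 45617664, 70507776, 108036096]
      [16, 128, 80, 16, 1] [1] [0, 128, 80, 16, 1]" by code_simp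
  have GA: "poly A x \<noteq> 0" if "poly G x = 0" for x
  proof -
    have "poly A x = poly G x + 16" unfolding polys by algebra
    thus ?thesis using that by simp
  qed
  have GB: "poly B x \<noteq> 0" if "poly G x = 0" for x
    using that by (simp add: polys)
  have "\<exists>e. e \<noteq> 0 \<and> P = smult e (int_poly [16, 128, 80, 16, 1] ^ 3 * int_poly [1]) \<and> Q = smult e (int_poly [0, 128, 80, 16, 1])"
  proof (rule j_in_lowest_terms_unique[OF PQ t _ _ _ _ cosets _ _ _ series])
    show "poly (int_poly [16, 128, 80, 16, 1]) x \<noteq> 0 \<and> poly (int_poly [1]) x \<noteq> 0" if "poly (int_poly [0, 128, 80, 16, 1]) x = 0" for x
      using GA[unfolded defs, OF that] GB[unfolded defs, OF that] by (rule conjI)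
    show ?thesis if "e \<noteq> 0" "P = smult e (int_poly [16, 128, 80, 16, 1] ^ 3 * int_poly [1])" "Q = smult e (int_poly [0, 128, 80, 16, 1])" for e
      using that by blast
  qed (simp_all add: divs)
  then obtain e where e: "e \<noteq> 0" "P = smult e (A ^ 3 * B)" "Q = smult e G" unfolding defs by blast
  interpret hauptmodul_pullback A B C D S G "-8" e
  proof
    show "A ^ 3 * B - smult 1728 G = C ^ 2 * D"
      by (rule poly_ext) (simp only: poly_diff poly_mult poly_power poly_smult polys, algebra)
    show "pderiv G * A * B - smult 3 (G * pderiv A * B) - G * A * pderiv B = smult (-8) (C * S)"
      by (rule poly_ext) (simp only: poly_diff poly_mult poly_power poly_smult polys, algebra)
    show "e \<noteq> 0" by fact
  qed (simp_all add: defs int_poly_def)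
  have h: "h_fun P Q t = h t" for t by (simp only: h_def e(2,3))
  \<comment> \<open>The accessory value -4 is q k' for k' = -4, q = 1 as well as for k' = -8, q =
    1/2.\<close>
  have cert: "ode_certificate (\<lambda>t. t * (t ^ 2 - (-12) * t + 32)) (\<lambda>t. t ^ 2 - (-12) * t + 32 + t * ((1 + 1) * t - (-12)))
      (\<lambda>t. 1 * 1 * t - (-4)) (\<lambda>t. t + 4)"
    unfolding ode_certificate_def polys by (intro allI conjI; (algebra | (simp add: field_simps, algebra)))
  have "\<forall>\<^sub>F t in nhds 0. h t = local_heun 2 1 1 1 1 1 (t / (- 4))"
    by (rule eq_local_heun[OF _ _ _ _ _ _ cert]) simp_all
  thus "\<forall>\<^sub>F t in nhds 0. h_fun P Q t = local_heun 2 1 1 1 1 1 (- t / 4)"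
    by (simp add: h)
  have "\<forall>\<^sub>F t in nhds 0. h t = local_heun (1/2) (1/2) 1 1 1 1 (t / (- 8))"
    by (rule eq_local_heun[OF _ _ _ _ _ _ cert]) simp_all
  thus "\<forall>\<^sub>F t in nhds 0. h_fun P Q t = local_heun (1/2) (1/2) 1 1 1 1 (- t / 8)"
    by (simp add: h)
qed

lemma h_fun_9:
  assumes PQ: "j_in_lowest_terms 9 P Q" and \<sigma>: "\<sigma> \<in> {1, -1}"
  shows "\<forall>\<^sub>F t in nhds 0. h_fun P Q t =
     local_heun ((-9 - \<sigma> * (3 * csqrt (-3))) / (-9 + \<sigma> * (3 * csqrt (-3)))) (- (1/9) * ((-9 - \<sigma> * (3 * csqrt (-3))) / 2)) 1 1 1 1 (t / ((-9 + \<sigma> * (3 * csqrt (-3))) / 2))"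
proof -
  have divs: "divisor_list 9 = [1, 3, 9]" by code_simp
  \<comment> \<open>G = (t + 3)^3 - 27 has three simple zeros, the cusps of width 1, so S =
    1.\<close>
  define A B C D S G :: "complex poly"
    where "A = int_poly [9, 84, 54, 12, 1]" and "B = int_poly [1]" and "C = int_poly [-27, 486, 891, 504, 135, 18, 1]"
      and "D = int_poly [1]" and "S = int_poly [1]" and "G = int_poly [0, 27, 9, 1]"
  note defs = A_def B_def C_def D_def S_def G_def
  have polys: "poly A t = 9 + t * (84 + t * (54 + t * (12 + t)))"
      "poly (pderiv A) t = 84 + t * (108 + t * (36 + t * (4)))"
      "poly (pderiv (pderiv A)) t = 108 + t * (72 + t * (12))"
      "poly B t = 1"
      "poly (pderiv B) t = 0"
      "poly (pderiv (pderiv B)) t = 0"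
      "poly C t = - 27 + t * (486 + t * (891 + t * (504 + t * (135 + t * (18 + t)))))"
      "poly D t = 1"
      "poly (pderiv D) t = 0"
      "poly S t = 1"
      "poly (pderiv S) t = 0"
      "poly G t = t * (27 + t * (9 + t))"
      "poly (pderiv G) t = 27 + t * (18 + t * (3))" for t
    by (simp_all add: defs pderiv_pCons int_poly_def)
  have t: "hauptmodul 9 \<tau> = of_int 27 * (\<Prod>m\<leftarrow>divisor_list 9. dedekind_eta (of_nat m * \<tau>) powi
      (\<lambda>m. if m = 9 then 3 else if m = 1 then -3 else 0) m)" for \<tau>
    by (simp add: divs hauptmodul_def Let_def power_int_minus divide_inverse mult_ac)
  have cosets: "coset_check (int 9) [(0, 1), (1, 0), (1, 1), (1, 2), (1, 3), (1, 4), (1, 5), (1, 6), (1, 7), (1, 8), (3, 1), (3, 2)]" by code_simp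
  have series: "series_check 9 (\<lambda>m. if m = 9 then 3 else if m = 1 then -3 else 0) 25 27
      [0, 27, 81, 243, 594, 1377, 2916, 5967, 11583, 21870, 39852, 71037, 123444, 210654, 352512, 581013, 942786,
      1510245, 2388204, 3734964, 5777730, 8852004, 13434984, 20218491, 30177684]
      [9, 84, 54, 12, 1] [1] [0, 27, 9, 1]" by code_simp
  have GA: "poly A x \<noteq> 0" if "poly G x = 0" for x
  proof
    assume "poly A x = 0"
    \<comment> \<open>At a zero of G this factorisation forces x = -3, where G takes the value
      -27.\<close>
    moreover have "poly A x = (x + 3) * (poly G x + 3)" unfolding polys by algebra
    ultimately have "(x + 3) * 3 = 0" using that by simp
    hence x: "x + 3 = 0" by (metis mult_eq_0_iff zero_neq_numeral)
    have "poly G x = (x + 3) ^ 3 - 27" unfolding polys by algebra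
    thus False unfolding x using that by simp
  qed
  have GB: "poly B x \<noteq> 0" if "poly G x = 0" for x
    using that by (simp add: polys)
  have "\<exists>e. e \<noteq> 0 \<and> P = smult e (int_poly [9, 84, 54, 12, 1] ^ 3 * int_poly [1]) \<and> Q = smult e (int_poly [0, 27, 9, 1])"
  proof (rule j_in_lowest_terms_unique[OF PQ t _ _ _ _ cosets _ _ _ series])
    show "poly (int_poly [9, 84, 54, 12, 1]) x \<noteq> 0 \<and> poly (int_poly [1]) x \<noteq> 0" if "poly (int_poly [0, 27, 9, 1]) x = 0" for x
      using GA[unfolded defs, OF that] GB[unfolded defs, OF that] by (rule conjI)
    show ?thesis if "e \<noteq> 0" "P = smult e (int_poly [9, 84, 54, 12, 1] ^ 3 * int_poly [1])" "Q = smult e (int_poly [0, 27, 9, 1])" for e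
      using that by blast
  qed (simp_all add: divs)
  then obtain e where e: "e \<noteq> 0" "P = smult e (A ^ 3 * B)" "Q = smult e G" unfolding defs by blast
  interpret hauptmodul_pullback A B C D S G "-9" e
  proof
    show "A ^ 3 * B - smult 1728 G = C ^ 2 * D"
      by (rule poly_ext) (simp only: poly_diff poly_mult poly_power poly_smult polys, algebra)
    show "pderiv G * A * B - smult 3 (G * pderiv A * B) - G * A * pderiv B = smult (-9) (C * S)"
      by (rule poly_ext) (simp only: poly_diff poly_mult poly_power poly_smult polys, algebra)
    show "e \<noteq> 0" by fact
  qed (simp_all add: defs int_poly_def)
  have h: "h_fun P Q t = h t" for t by (simp only: h_def e(2,3))
  have s: "\<sigma> ^ 2 = 1" using \<sigma> by auto
  have m: "((-9 + \<sigma> * (3 * csqrt (-3))) / 2) * ((-9 - \<sigma> * (3 * csqrt (-3))) / 2) = (81 - \<sigma> ^ 2 * (9 * csqrt (-3) ^ 2)) / 4"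
    by (algebra | (simp add: field_simps power2_eq_square; fail) | (simp add: field_simps, algebra))
  have prod: "((-9 + \<sigma> * (3 * csqrt (-3))) / 2) * ((-9 - \<sigma> * (3 * csqrt (-3))) / 2) = 27" unfolding m s power2_csqrt by simp
  have cert: "ode_certificate (\<lambda>t. t * (t ^ 2 - (-9) * t + 27)) (\<lambda>t. t ^ 2 - (-9) * t + 27 + t * ((1 + 1) * t - 1 * (-9)))
      (\<lambda>t. 1 * 1 * t - (- 3)) (\<lambda>t. 1)"
    unfolding ode_certificate_def polys by (intro allI conjI; (algebra | (simp add: field_simps, algebra)))
  have "\<forall>\<^sub>F t in nhds 0. h t =
     local_heun ((-9 - \<sigma> * (3 * csqrt (-3))) / (-9 + \<sigma> * (3 * csqrt (-3)))) (- (1/9) * ((-9 - \<sigma> * (3 * csqrt (-3))) / 2)) 1 1 1 1 (t / ((-9 + \<sigma> * (3 * csqrt (-3))) / 2))"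
    by (rule eq_local_heun_conj[OF prod _ _ _ _ cert])
      ((simp; fail) | (simp add: field_simps; fail) | (simp add: divide_simps))+
  thus ?thesis unfolding h .
qed

theorem theorem7p4:
  fixes P Q :: "complex poly"
  shows
    "(j_in_lowest_terms 2 P Q \<longrightarrow>
        (\<forall>\<^sub>F t in nhds 0. h_fun P Q t = hypergeom_2F1 (1/4) (1/4) 1 (- t / 64))) \<and>
     (j_in_lowest_terms 3 P Q \<longrightarrow>
        (\<forall>\<^sub>F t in nhds 0. h_fun P Q t = hypergeom_2F1 (1/3) (1/3) 1 (- t / 27))) \<and>
     (j_in_lowest_terms 4 P Q \<longrightarrow>
        (\<forall>\<^sub>F t in nhds 0. h_fun P Q t = hypergeom_2F1 (1/2) (1/2) 1 (- t / 16))) \<and>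
     (j_in_lowest_terms 5 P Q \<longrightarrow>
        (\<forall>\<sigma> \<in> {1, -1}. \<forall>\<^sub>F t in nhds 0. h_fun P Q t =
           local_heun ((-11 - \<sigma> * (2 * \<i>)) / (-11 + \<sigma> * (2 * \<i>)))
             (- (1/50) * (-11 - \<sigma> * (2 * \<i>)))
             (1/2) (1/2) 1 (1/2) (t / (-11 + \<sigma> * (2 * \<i>))))) \<and>
     (j_in_lowest_terms 6 P Q \<longrightarrow>
        (\<forall>\<^sub>F t in nhds 0. h_fun P Q t = local_heun (9/8) (3/4) 1 1 1 1 (- t / 8)) \<and>
        (\<forall>\<^sub>F t in nhds 0. h_fun P Q t = local_heun (8/9) (2/3) 1 1 1 1 (- t / 9))) \<and>
     (j_in_lowest_terms 7 P Q \<longrightarrow>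
        (\<forall>\<sigma> \<in> {1, -1}. \<forall>\<^sub>F t in nhds 0. h_fun P Q t =
           local_heun ((-13 - \<sigma> * (3 * csqrt (-3))) / (-13 + \<sigma> * (3 * csqrt (-3))))
             (- (1/21) * ((-13 - \<sigma> * (3 * csqrt (-3))) / 2))
             (2/3) (2/3) 1 (2/3) (t / ((-13 + \<sigma> * (3 * csqrt (-3))) / 2)))) \<and>
     (j_in_lowest_terms 8 P Q \<longrightarrow>
        (\<forall>\<^sub>F t in nhds 0. h_fun P Q t = local_heun 2 1 1 1 1 1 (- t / 4)) \<and>
        (\<forall>\<^sub>F t in nhds 0. h_fun P Q t = local_heun (1/2) (1/2) 1 1 1 1 (- t / 8))) \<and>
     (j_in_lowest_terms 9 P Q \<longrightarrow>
        (\<forall>\<sigma> \<in> {1, -1}. \<forall>\<^sub>F t in nhds 0. h_fun P Q t =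
           local_heun ((-9 - \<sigma> * (3 * csqrt (-3))) / (-9 + \<sigma> * (3 * csqrt (-3))))
             (- (1/9) * ((-9 - \<sigma> * (3 * csqrt (-3))) / 2))
             1 1 1 1 (t / ((-9 + \<sigma> * (3 * csqrt (-3))) / 2))))"
  by (intro conjI impI ballI; rule h_fun_2 h_fun_3 h_fun_4 h_fun_5 h_fun_6 h_fun_7 h_fun_8 h_fun_9; assumption)

end
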